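(* Let $q_M:P\to M$ be a smooth $K$-principal bundle, $Z_K\hookrightarrow\hat K\to K$ a central extension of Lie groups, $\alpha:\hat{\mathfrak n}=C^\infty(M,\widehat{\mathrm{Ad}}(P))\to\hat{\mathfrak g}=\mathfrak{aut}(P)$ the associated topological crossed module with $\coker\alpha=\mathfrak g=\mathcal V(M)$ and $\ker\alpha=\mathfrak z=C^\infty(M,\mathfrak z_{\mathfrak k})$. Let $\theta$ be a principal connection $1$-form on $P$ with horizontal lift $\sigma:\mathfrak g\to\hat{\mathfrak g}$ and curvature $R_\theta$, let $S:\mathfrak g\to\mathrm{der}\,\hat{\mathfrak n}$, $S(X).\xi=\sigma(X).\xi$, let $\Omega$ be a smooth $\widehat{\mathrm{Ad}}(P)$-valued $2$-form on $M$ with $q_{\mathfrak k}\circ\Omega=R_\theta$, and let $\omega\in C^2(\mathfrak g,\hat{\mathfrak n})$ be the corresponding cochain with $q_{\mathfrak g}^*\omega=\Omega$. Then the characteristic class $\chi_\alpha\in H^3(\mathfrak g,\mathfrak z)$ is represented by the cocycle $d_S\omega\in Z^3(\mathfrak g,\mathfrak z)$, which is a $\mathfrak z_{\mathfrak k}$-valued closed $3$-form on $M$. Moreover, the de Rham cohomology class $[d_S\omega]\in H^3_{\mathrm{dR}}(M,\mathfrak z_{\mathfrak k})$ depends neither on the connection $1$-form $\theta$ nor on the choice of the lift $\Omega$.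
   Context: Setting. $M$ is a finite-dimensional paracompact smooth manifold, $K$ a Lie group with Lie algebra $\mathfrak k$, $q_M:P\to M$ a smooth $K$-principal bundle with right action $\mu$ of $K$, $\dot\mu:\mathfrak k\to\mathcal V(P)$ the associated map to vector fields. $\mathrm{Ad}(P)=P\times_{\mathrm{Ad}}\mathfrak k$. $\hat{\mathfrak g}:=\mathfrak{aut}(P)=\mathcal V(P)^K$ is the Lie algebra of $K$-invariant vector fields, $q_{\mathfrak g}:\hat{\mathfrak g}\to\mathfrak g:=\mathcal V(M)$ the projection, with kernel $\mathfrak{gau}(P)$, the vertical $K$-invariant vector fields. All these carry the topology of local uniform convergence of all derivatives. $\mathfrak n:=C^\infty(M,\mathrm{Ad}(P))=\{\xi\in C^\infty(P,\mathfrak k):\xi(pk)=\mathrm{Ad}(k)^{-1}\xi(p)\}$ with pointwise bracket. Principal connection $1$-form: $\theta\in\Omega^1(P,\mathfrak k)$, invariant under $k.\beta=\mathrm{Ad}(k)\circ\mu_k^*\beta$, with $\theta(\dot\mu(x))=x$ for $x\in\mathfrak k$. Its horizontal lift $\sigma:\mathcal V(M)\to\mathfrak{aut}(P)$ is determined by $q_{\mathfrak g}\circ\sigma=\mathrm{id}$, $\theta\circ\sigma=0$. Restriction of $-\theta$ gives a Lie algebra isomorphism $\mathfrak{gau}(P)\to\mathfrak n$ (independent of $\theta$), by which $\mathfrak n$ is identified with the ideal $\mathfrak{gau}(P)$ of $\hat{\mathfrak g}$. $R_\theta=d\theta+\frac12[\theta,\theta]$ is horizontal and is viewed as an $\mathrm{Ad}(P)$-valued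 $2$-form on $M$; with $R_\sigma(X,Y)=[\sigma(X),\sigma(Y)]-\sigma([X,Y])\in\mathfrak n$ one has $q_{\mathfrak g}^*R_\sigma=R_\theta$. Central extension. $Z_K\hookrightarrow\hat K\xrightarrow{q_K}K$ is a central extension of Lie groups whose Lie algebra extension $\mathfrak z_{\mathfrak k}\hookrightarrow\hat{\mathfrak k}\xrightarrow{q_{\mathfrak k}}\mathfrak k$ is topologically split. Conjugation in $\hat K$ induces a smooth action $\widehat{\mathrm{Ad}}$ of $K$ on $\hat{\mathfrak k}$; $\widehat{\mathrm{Ad}}(P)=P\times_K\hat{\mathfrak k}$, and $\hat{\mathfrak n}:=C^\infty(M,\widehat{\mathrm{Ad}}(P))=\{\xi\in C^\infty(P,\hat{\mathfrak k}):\xi(pk)=\widehat{\mathrm{Ad}}(k)^{-1}\xi(p)\}$ with pointwise bracket. $\hat{\mathfrak g}$ acts on $\hat{\mathfrak n}$ by $(X.\xi)(p)=d\xi(p)X(p)$. The map $\alpha:\hat{\mathfrak n}\to\mathfrak n\cong\mathfrak{gau}(P)\subseteq\hat{\mathfrak g}$, $\xi\mapsto q_{\mathfrak k}\circ\xi$ (i.e. $\alpha(\xi)$ is the vertical field with $\theta(\alpha(\xi))=-q_{\mathfrak k}\circ\xi$), is a topologically split crossed module: $\alpha(X.\xi)=[X,\alpha(\xi)]$, $\alpha(\xi).\eta=[\xi,\eta]$. Its kernel is $\mathfrak z=C^\infty(M,\mathfrak z_{\mathfrak k})$, on which $\mathfrak g=\mathcal V(M)$ acts by $(X.f)(m)=df(m)X(m)$.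 Forms as cochains. Smooth $r$-forms on $M$ with values in $\widehat{\mathrm{Ad}}(P)$ are identified with the alternating $C^\infty(M,\mathbb R)$-multilinear maps $\mathfrak g^r\to\hat{\mathfrak n}$, a subspace of the space $C^r(\mathfrak g,\hat{\mathfrak n})$ of continuous alternating $r$-linear maps, and also (via $q_{\mathfrak g}^*$) with basic forms on $P$; the condition on $\Omega=q_{\mathfrak g}^*\omega$ is equivalent to $q_{\mathfrak k}\circ\omega=R_\sigma$. The $\mathfrak z_{\mathfrak k}$-valued $r$-forms on $M$ form a subspace of $C^r(\mathfrak g,\mathfrak z)$. The covariant differential is $$(d_S\omega)(X_0,X_1,X_2)=\sum_{\mathrm{cyc}}\big(S(X_0).\omega(X_1,X_2)-\omega([X_0,X_1],X_2)\big),$$ summed over cyclic permutations. Characteristic class. $H^p(\mathfrak g,\mathfrak z)$ is continuous Lie algebra cohomology. Write $\hat{\mathfrak n}\cong\mathfrak z\oplus_f\mathfrak n$ with a continuous $f\in Z^2(\mathfrak n,\mathfrak z)$ (i.e. $\mathfrak z\times\mathfrak n$ with bracket $[(z,n),(z',n')]=(f(n,n'),[n,n'])$); the $\hat{\mathfrak g}$-action is $x.(z,n)=(x.z+\vartheta(x,n),[x,n])$ with $\vartheta$ continuous bilinear. For any continuous alternating $\tilde f\in C^2(\hat{\mathfrak g},\mathfrak z)$ extending $\vartheta$, $d_{\hat{\mathfrak g}}\tilde f=q_{\mathfrak g}^*\beta$ with $\beta\in Z^3(\mathfrak g,\mathfrak z)$, and $\chi_\alpha:=[\beta]$. *)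

theory Defs
  imports "HOL-Analysis.Analysis" "HOL-Library.Function_Algebras"
begin

section \<open>Locally convex spaces and smooth maps\<close>

text \<open>Hausdorff locally convex real topological vector spaces.\<close>

class lcs = real_vector + t2_space + topological_ab_group_add +
  assumes tendsto_scaleR_lcs:
    "filterlim (\<lambda>x. fst x *\<^sub>R snd x) (nhds (r *\<^sub>R a)) (nhds r \<times>\<^sub>F nhds a)"
  assumes locally_convex:
    "open U \<Longrightarrow> 0 \<in> U \<Longrightarrow> \<exists>V. open V \<and> 0 \<in> V \<and> V \<subseteq> U \<and>
       (\<forall>x\<in>V. \<forall>y\<in>V. \<forall>s\<ge>0. \<forall>t\<ge>0. s + t = 1 \<longrightarrow> s *\<^sub>R x + t *\<^sub>R y \<in> V)"

lemma locally_convex_iff: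
  fixes U :: "'a::{real_vector, topological_space} set"
  shows "(\<exists>V. open V \<and> 0 \<in> V \<and> V \<subseteq> U \<and>
       (\<forall>x\<in>V. \<forall>y\<in>V. \<forall>s\<ge>0. \<forall>t\<ge>0. s + t = 1 \<longrightarrow> s *\<^sub>R x + t *\<^sub>R y \<in> V)) \<longleftrightarrow>
     (\<exists>V. open V \<and> convex V \<and> 0 \<in> V \<and> V \<subseteq> U)"
  unfolding convex_def by blast

instance real_normed_vector \<subseteq> lcs
proof
  fix r :: real and a :: 'a
  show "filterlim (\<lambda>x. fst x *\<^sub>R snd x) (nhds (r *\<^sub>R a)) (nhds r \<times>\<^sub>F nhds a)"
    by (intro tendsto_scaleR filterlim_fst filterlim_snd)
next
  fix U :: "'a set"
  assume "open U" "0 \<in> U"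
  then obtain e where "e > 0" "ball 0 e \<subseteq> U"
    using open_contains_ball by blast
  then have "\<exists>V. open V \<and> convex V \<and> 0 \<in> V \<and> V \<subseteq> U"
    by (intro exI[of _ "ball 0 e"]) (auto simp: convex_ball)
  then show "\<exists>V. open V \<and> 0 \<in> V \<and> V \<subseteq> U \<and>
       (\<forall>x\<in>V. \<forall>y\<in>V. \<forall>s\<ge>0. \<forall>t\<ge>0. s + t = 1 \<longrightarrow> s *\<^sub>R x + t *\<^sub>R y \<in> V)"
    by (simp only: locally_convex_iff)
qed

instance prod :: (topological_monoid_add, topological_monoid_add) topological_monoid_add
proof
  fix a b :: "'a \<times> 'b"
  have f: "filterlim (\<lambda>x. fst x) (nhds a) (nhds a \<times>\<^sub>F nhds b)"
    and s: "filterlim (\<lambda>x. snd x) (nhds b) (nhds a \<times>\<^sub>F nhds b)"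
    by (rule filterlim_fst filterlim_snd)+
  have "((\<lambda>x. (fst (fst x) + fst (snd x), snd (fst x) + snd (snd x)))
      \<longlongrightarrow> (fst a + fst b, snd a + snd b)) (nhds a \<times>\<^sub>F nhds b)"
    by (intro tendsto_Pair tendsto_add tendsto_fst tendsto_snd f s)
  then show "filterlim (\<lambda>x. fst x + snd x) (nhds (a + b)) (nhds a \<times>\<^sub>F nhds b)"
    by (simp add: plus_prod_def)
qed

instance prod :: (topological_group_add, topological_group_add) topological_group_add
proof
  fix a :: "'a \<times> 'b"
  have i: "filterlim (\<lambda>x. x) (nhds a) (nhds a)"
    by (rule filterlim_ident)
  have "((\<lambda>x. (- fst x, - snd x)) \<longlongrightarrow> (- fst a, - snd a)) (nhds a)"
    by (intro tendsto_Pair tendsto_minus tendsto_fst tendsto_snd i)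
  then show "(uminus \<longlongrightarrow> - a) (nhds a)"
    by (simp add: uminus_prod_def[abs_def])
qed

instance prod :: (topological_ab_group_add, topological_ab_group_add) topological_ab_group_add ..

instance prod :: (lcs, lcs) lcs
proof
  fix r :: real and a :: "'a \<times> 'b"
  have f: "filterlim (\<lambda>x. fst x) (nhds r) (nhds r \<times>\<^sub>F nhds a)"
    and s: "filterlim (\<lambda>x. snd x) (nhds a) (nhds r \<times>\<^sub>F nhds a)"
    by (rule filterlim_fst filterlim_snd)+
  have c1: "filterlim (\<lambda>x. fst x *\<^sub>R fst (snd x)) (nhds (r *\<^sub>R fst a)) (nhds r \<times>\<^sub>F nhds a)"
    using filterlim_compose[OF tendsto_scaleR_lcs filterlim_Pair[OF f tendsto_fst[OF s]]]
    by simp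
  have c2: "filterlim (\<lambda>x. fst x *\<^sub>R snd (snd x)) (nhds (r *\<^sub>R snd a)) (nhds r \<times>\<^sub>F nhds a)"
    using filterlim_compose[OF tendsto_scaleR_lcs filterlim_Pair[OF f tendsto_snd[OF s]]]
    by simp
  show "filterlim (\<lambda>x. fst x *\<^sub>R snd x) (nhds (r *\<^sub>R a)) (nhds r \<times>\<^sub>F nhds a)"
    using tendsto_Pair[OF c1 c2] by (simp add: scaleR_prod_def)
next
  fix U :: "('a \<times> 'b) set"
  assume "open U" "0 \<in> U"
  then obtain A B where AB: "open A" "open B" "0 \<in> A \<times> B" "A \<times> B \<subseteq> U"
    by (metis open_prod_elim)
  have "0 \<in> A" "0 \<in> B" using AB(3) by (auto simp: zero_prod_def)
  then obtain V W where "open V" "convex V" "0 \<in> V" "V \<subseteq> A" "open W" "convex W" "0 \<in> W" "W \<subseteq> B"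
    using locally_convex[OF AB(1)] locally_convex[OF AB(2)] unfolding locally_convex_iff by meson
  then have "\<exists>V. open V \<and> convex V \<and> 0 \<in> V \<and> V \<subseteq> U"
    using AB(4)
    by (intro exI[of _ "V \<times> W"]) (auto simp: open_Times convex_Times zero_prod_def)
  then show "\<exists>V. open V \<and> 0 \<in> V \<and> V \<subseteq> U \<and>
       (\<forall>x\<in>V. \<forall>y\<in>V. \<forall>s\<ge>0. \<forall>t\<ge>0. s + t = 1 \<longrightarrow> s *\<^sub>R x + t *\<^sub>R y \<in> V)"
    by (simp only: locally_convex_iff)
qed

instantiation "fun" :: (type, real_vector) real_vector
begin

definition "scaleR_fun (r::real) (f::'a \<Rightarrow> 'b) = (\<lambda>x. r *\<^sub>R f x)"

instance
  by standard (auto simp: scaleR_fun_def fun_eq_iff scaleR_add_right scaleR_add_left)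

end

text \<open>Smoothness is that of Michal--Bastiani: all iterated directional derivatives
  \<open>d\<^sup>n f(x)(h\<^sub>1, \<dots>, h\<^sub>n)\<close> exist and are jointly continuous in \<open>(x, h\<^sub>1, \<dots>, h\<^sub>n)\<close>.  The
  directions are packed in a sequence \<open>h\<close>, only \<open>h 0, \<dots>, h (n - 1)\<close> being used; continuity
  with respect to the product topology on sequences is then continuity on \<open>E\<^sup>n\<close>.\<close>

definition dquot :: "('a::lcs \<Rightarrow> 'b::lcs) \<Rightarrow> 'a \<Rightarrow> 'a \<Rightarrow> real \<Rightarrow> 'b" where
  "dquot f x v t = (f (x + t *\<^sub>R v) - f x) /\<^sub>R t"

definition ddir :: "('a::lcs \<Rightarrow> 'b::lcs) \<Rightarrow> 'a \<Rightarrow> 'a \<Rightarrow> 'b" where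
  "ddir f x v = Lim (at 0) (dquot f x v)"

primrec iter_deriv :: "nat \<Rightarrow> ('a::lcs \<Rightarrow> 'b::lcs) \<Rightarrow> 'a \<Rightarrow> (nat \<Rightarrow> 'a) \<Rightarrow> 'b" where
  "iter_deriv 0 f x h = f x"
| "iter_deriv (Suc n) f x h = ddir (\<lambda>y. iter_deriv n f y h) x (h n)"

text \<open>Only used for open \<open>U\<close>.\<close>

definition smooth_on :: "'a::lcs set \<Rightarrow> ('a \<Rightarrow> 'b::lcs) \<Rightarrow> bool" where
  "smooth_on U f \<longleftrightarrow> (\<forall>n.
     (\<forall>x\<in>U. \<forall>h v. \<exists>l. (dquot (\<lambda>y. iter_deriv n f y h) x v \<longlongrightarrow> l) (at 0)) \<and>
     continuous_on (U \<times> UNIV) (\<lambda>(x, h). iter_deriv n f x h))"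


section \<open>Manifolds\<close>

type_synonym ('m, 'e) chart = "'m set \<times> ('m \<Rightarrow> 'e)"

abbreviation cdom :: "('m, 'e) chart \<Rightarrow> 'm set" where "cdom \<equiv> fst"
abbreviation cmap :: "('m, 'e) chart \<Rightarrow> 'm \<Rightarrow> 'e" where "cmap \<equiv> snd"

definition cimg :: "('m, 'e) chart \<Rightarrow> 'e set" where
  "cimg c = cmap c ` cdom c"

definition cinv :: "('m, 'e) chart \<Rightarrow> 'e \<Rightarrow> 'm" where
  "cinv c = inv_into (cdom c) (cmap c)"

definition manifold :: "('m::t2_space, 'e::lcs) chart set \<Rightarrow> bool" where
  "manifold A \<longleftrightarrow>
     (\<Union>c\<in>A. cdom c) = UNIV \<and>
     (\<forall>c\<in>A. open (cdom c) \<and> open (cimg c) \<and> inj_on (cmap c) (cdom c) \<and>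
        homeomorphism (cdom c) (cimg c) (cmap c) (cinv c)) \<and>
     (\<forall>c\<in>A. \<forall>d\<in>A. smooth_on (cmap c ` (cdom c \<inter> cdom d)) (\<lambda>x. cmap d (cinv c x)))"

definition lin_atlas :: "('e, 'e) chart set" where
  "lin_atlas = {(UNIV, \<lambda>x. x)}"

definition prod_atlas ::
  "('m, 'e) chart set \<Rightarrow> ('n, 'f) chart set \<Rightarrow> ('m \<times> 'n, 'e \<times> 'f) chart set" where
  "prod_atlas A B = {(cdom c \<times> cdom d, map_prod (cmap c) (cmap d)) | c d. c \<in> A \<and> d \<in> B}"

text \<open>Smoothness of \<open>f\<close> on an open subset \<open>U\<close> of a manifold.\<close>

definition smooth_map_on ::
  "'m::t2_space set \<Rightarrow> ('m, 'e::lcs) chart set \<Rightarrow> ('n::t2_space, 'f::lcs) chart set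
   \<Rightarrow> ('m \<Rightarrow> 'n) \<Rightarrow> bool" where
  "smooth_map_on U A B f \<longleftrightarrow> continuous_on U f \<and>
     (\<forall>c\<in>A. \<forall>d\<in>B. smooth_on (cmap c ` (cdom c \<inter> U \<inter> f -` cdom d))
                             (\<lambda>x. cmap d (f (cinv c x))))"

abbreviation "smooth_map \<equiv> smooth_map_on UNIV"

text \<open>The tangent map of \<open>f\<close> at \<open>p\<close> read in the charts \<open>c\<close> around \<open>p\<close> and \<open>d\<close> around \<open>f p\<close>.\<close>

definition tang ::
  "('m, 'e::lcs) chart \<Rightarrow> ('n, 'f::lcs) chart \<Rightarrow> ('m \<Rightarrow> 'n) \<Rightarrow> 'm \<Rightarrow> 'e \<Rightarrow> 'f" where
  "tang c d f p v = ddir (\<lambda>x. cmap d (f (cinv c x))) (cmap c p) v"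

definition paracompact_space :: "'m topology \<Rightarrow> bool" where
  "paracompact_space X \<longleftrightarrow>
     (\<forall>\<U>. (\<forall>U\<in>\<U>. openin X U) \<and> \<Union>\<U> = topspace X \<longrightarrow>
        (\<exists>\<V>. (\<forall>V\<in>\<V>. openin X V) \<and> \<Union>\<V> = topspace X \<and>
             (\<forall>V\<in>\<V>. \<exists>U\<in>\<U>. V \<subseteq> U) \<and> locally_finite_in X \<V>))"


subsection \<open>Vector fields\<close>

text \<open>A tangent vector at \<open>p\<close> is represented by its components in all charts around \<open>p\<close>, which
  are related by the derivatives of the coordinate changes.  Hence a vector field is a family
  \<open>X c p\<close>, for charts \<open>c\<close> and points \<open>p\<close> of \<open>c\<close>; it is set to \<open>0\<close> elsewhere to make it
  unique.\<close>

type_synonym ('m, 'e) vf = "('m, 'e) chart \<Rightarrow> 'm \<Rightarrow> 'e"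

definition vfields :: "('m::t2_space, 'e::lcs) chart set \<Rightarrow> ('m, 'e) vf set" where
  "vfields A = {X.
     (\<forall>c p. c \<notin> A \<or> p \<notin> cdom c \<longrightarrow> X c p = 0) \<and>
     (\<forall>c\<in>A. \<forall>d\<in>A. \<forall>p\<in>cdom c \<inter> cdom d. X d p = tang c d (\<lambda>q. q) p (X c p)) \<and>
     (\<forall>c\<in>A. smooth_on (cimg c) (\<lambda>x. X c (cinv c x)))}"

definition vf_bracket ::
  "('m, 'e::lcs) chart set \<Rightarrow> ('m, 'e) vf \<Rightarrow> ('m, 'e) vf \<Rightarrow> ('m, 'e) vf" where
  "vf_bracket A X Y = (\<lambda>c p. if c \<in> A \<and> p \<in> cdom c
     then ddir (\<lambda>x. Y c (cinv c x)) (cmap c p) (X c p)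
        - ddir (\<lambda>x. X c (cinv c x)) (cmap c p) (Y c p)
     else 0)"

text \<open>The derivative \<open>(X.f)(p) = df(p)X(p)\<close> of a vector valued function.\<close>

definition vf_deriv ::
  "('m, 'e::lcs) chart set \<Rightarrow> ('m, 'e) vf \<Rightarrow> ('m \<Rightarrow> 'v::lcs) \<Rightarrow> 'm \<Rightarrow> 'v" where
  "vf_deriv A X f p = (let c = (SOME c. c \<in> A \<and> p \<in> cdom c)
     in ddir (\<lambda>x. f (cinv c x)) (cmap c p) (X c p))"

text \<open>The topology of local uniform convergence of all derivatives on a set \<open>S\<close> of functions
  or vector fields: \<open>ev s c\<close> is the representative of \<open>s \<in> S\<close> in the chart \<open>c\<close>, and all
  \<open>d\<^sup>n\<close> of it are to converge uniformly on compact subsets of \<open>cimg c \<times> E\<^sup>n\<close>.  On \<open>\<V>(M)\<close> and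
  functions on \<open>M\<close>, compact sets amount to local uniformity because \<open>M\<close> is locally compact.
  \<open>K\<close>-invariant vector fields and \<open>K\<close>-equivariant functions on \<open>P\<close> are determined by their
  restrictions to local sections, so compact sets in \<open>P\<close> give the same topology as
  compact sets in \<open>M\<close>.\<close>

definition cinf_top ::
  "('m, 'e::lcs) chart set \<Rightarrow> 's set \<Rightarrow> ('s \<Rightarrow> ('m, 'e) chart \<Rightarrow> 'm \<Rightarrow> 'v::lcs) \<Rightarrow> 's topology" where
  "cinf_top A S ev = topology_generated_by
     {{s\<in>S. \<forall>(x, h)\<in>C. iter_deriv n (\<lambda>y. ev s c (cinv c y)) x h
                       - iter_deriv n (\<lambda>y. ev t c (cinv c y)) x h \<in> W} | t c n C W.
       t \<in> S \<and> c \<in> A \<and> compact C \<and> C \<subseteq> cimg c \<times> UNIV \<and> open W \<and> 0 \<in> W}"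


section \<open>Continuous Lie algebra cohomology\<close>

text \<open>Lie algebras and modules are linear subspaces of ambient vector spaces, given together
  with their topology as \<open>topspace\<close>s.  An \<open>r\<close>-cochain is a function on lists, which vanishes
  outside of the lists of length \<open>r\<close> with entries in the Lie algebra.\<close>

definition tuples :: "nat \<Rightarrow> 'g set \<Rightarrow> 'g list set" where
  "tuples r G = {xs. length xs = r \<and> set xs \<subseteq> G}"

definition alt_maps :: "nat \<Rightarrow> 'g::real_vector set \<Rightarrow> 'v::real_vector set \<Rightarrow> ('g list \<Rightarrow> 'v) set" where
  "alt_maps r G V = {w.
     (\<forall>xs. xs \<notin> tuples r G \<longrightarrow> w xs = 0) \<and>
     (\<forall>xs\<in>tuples r G. w xs \<in> V) \<and>
     (\<forall>xs\<in>tuples r G. \<forall>i<r. \<forall>x\<in>G. \<forall>y\<in>G. \<forall>a b.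
        w (xs[i := a *\<^sub>R x + b *\<^sub>R y]) = a *\<^sub>R w (xs[i := x]) + b *\<^sub>R w (xs[i := y])) \<and>
     (\<forall>xs\<in>tuples r G. \<forall>i<r. \<forall>j<r. i \<noteq> j \<and> xs ! i = xs ! j \<longrightarrow> w xs = 0)}"

definition cochains ::
  "nat \<Rightarrow> 'g::real_vector topology \<Rightarrow> 'v::real_vector topology \<Rightarrow> ('g list \<Rightarrow> 'v) set" where
  "cochains r TG TV = {w \<in> alt_maps r (topspace TG) (topspace TV).
     continuous_map (product_topology (\<lambda>_. TG) {..<r}) TV (\<lambda>x. w (map x [0..<r]))}"

definition del :: "nat \<Rightarrow> 'g list \<Rightarrow> 'g list" where
  "del i xs = take i xs @ drop (Suc i) xs"

definition ce_d ::
  "nat \<Rightarrow> 'g set \<Rightarrow> ('g \<Rightarrow> 'g \<Rightarrow> 'g) \<Rightarrow> ('g \<Rightarrow> 'v \<Rightarrow> 'v) \<Rightarrow> ('g list \<Rightarrow> 'v::real_vector)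
   \<Rightarrow> 'g list \<Rightarrow> 'v" where
  "ce_d r G br act w xs = (if xs \<in> tuples (Suc r) G then
       (\<Sum>i\<le>r. (-1) ^ i *\<^sub>R act (xs ! i) (w (del i xs)))
     + (\<Sum>j\<le>r. \<Sum>i<j. (-1) ^ (i + j) *\<^sub>R w (br (xs ! i) (xs ! j) # del i (del j xs)))
     else 0)"

definition cocycles where
  "cocycles r TG br act TV =
     {w \<in> cochains r TG TV. ce_d r (topspace TG) br act w = (\<lambda>_. 0)}"

text \<open>Only used for \<open>r > 0\<close>.\<close>

definition coboundaries where
  "coboundaries r TG br act TV = ce_d (r - 1) (topspace TG) br act ` cochains (r - 1) TG TV"

definition coh_class where
  "coh_class r TG br act TV w =
     {w' \<in> cocycles r TG br act TV. w' - w \<in> coboundaries r TG br act TV}"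


section \<open>The characteristic class of a topologically split crossed module\<close>

text \<open>The data of a crossed module \<open>\<alpha> : \<nn>' \<rightarrow> \<gg>'\<close> with cokernel \<open>qt : \<gg>' \<rightarrow> \<gg>\<close> and kernel
  \<open>inc : \<zz> \<rightarrow> \<nn>'\<close>; here \<open>\<gg>'\<close> (\<open>gh\<close>) acts on \<open>\<nn>'\<close> (\<open>nh\<close>), and \<open>\<gg>\<close> on \<open>\<zz>\<close>.\<close>

record ('gh, 'nh, 'g, 'z) xmod =
  gh_top :: "'gh topology"
  gh_br :: "'gh \<Rightarrow> 'gh \<Rightarrow> 'gh"
  nh_top :: "'nh topology"
  nh_br :: "'nh \<Rightarrow> 'nh \<Rightarrow> 'nh"
  gh_act :: "'gh \<Rightarrow> 'nh \<Rightarrow> 'nh"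
  alpha :: "'nh \<Rightarrow> 'gh"
  g_top :: "'g topology"
  g_br :: "'g \<Rightarrow> 'g \<Rightarrow> 'g"
  qt :: "'gh \<Rightarrow> 'g"
  z_top :: "'z topology"
  inc :: "'z \<Rightarrow> 'nh"
  g_act :: "'g \<Rightarrow> 'z \<Rightarrow> 'z"

text \<open>\<open>\<nn>\<close> is the ideal \<open>\<alpha>(\<nn>')\<close> of \<open>\<gg>'\<close>.\<close>

definition n_top :: "('gh, 'nh, 'g, 'z) xmod \<Rightarrow> 'gh topology" where
  "n_top C = subtopology (gh_top C) (alpha C ` topspace (nh_top C))"

text \<open>\<open>\<beta>\<close> arises from a topological linear isomorphism \<open>\<Phi> : \<zz> \<oplus>\<^sub>f \<nn> \<rightarrow> \<nn>'\<close>, over \<open>\<nn>\<close> and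
  under \<open>\<zz>\<close>, and an alternating extension \<open>ft\<close> of \<open>\<theta>\<close>, where the action of \<open>\<gg>'\<close> on \<open>\<nn>'\<close> is
  \<open>x.(z, n) = (x.z + \<theta>(x, n), [x, n])\<close>.\<close>

definition char_cocycle ::
  "('gh::real_vector, 'nh::real_vector, 'g::real_vector, 'z::real_vector) xmod
   \<Rightarrow> ('g list \<Rightarrow> 'z) \<Rightarrow> bool" where
  "char_cocycle C \<beta> \<longleftrightarrow>
     \<beta> \<in> cocycles 3 (g_top C) (g_br C) (g_act C) (z_top C) \<and>
     (\<exists>\<Phi> f \<theta> ft.
       homeomorphic_map (prod_topology (z_top C) (n_top C)) (nh_top C) \<Phi> \<and>
       (\<forall>z\<in>topspace (z_top C). \<forall>z'\<in>topspace (z_top C).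
        \<forall>n\<in>topspace (n_top C). \<forall>n'\<in>topspace (n_top C). \<forall>a b.
          \<Phi> (a *\<^sub>R z + b *\<^sub>R z', a *\<^sub>R n + b *\<^sub>R n') = a *\<^sub>R \<Phi> (z, n) + b *\<^sub>R \<Phi> (z', n')) \<and>
       (\<forall>z\<in>topspace (z_top C). \<Phi> (z, 0) = inc C z) \<and>
       (\<forall>z\<in>topspace (z_top C). \<forall>n\<in>topspace (n_top C). alpha C (\<Phi> (z, n)) = n) \<and>
       f \<in> cocycles 2 (n_top C) (gh_br C) (\<lambda>_ _. 0) (z_top C) \<and>
       (\<forall>z\<in>topspace (z_top C). \<forall>z'\<in>topspace (z_top C).
        \<forall>n\<in>topspace (n_top C). \<forall>n'\<in>topspace (n_top C).
          nh_br C (\<Phi> (z, n)) (\<Phi> (z', n')) = \<Phi> (f [n, n'], gh_br C n n')) \<and>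
       continuous_map (prod_topology (gh_top C) (n_top C)) (z_top C) (\<lambda>(x, n). \<theta> x n) \<and>
       (\<forall>x\<in>topspace (gh_top C). \<forall>n\<in>topspace (n_top C). \<forall>n'\<in>topspace (n_top C). \<forall>a b.
          \<theta> x (a *\<^sub>R n + b *\<^sub>R n') = a *\<^sub>R \<theta> x n + b *\<^sub>R \<theta> x n') \<and>
       (\<forall>x\<in>topspace (gh_top C). \<forall>x'\<in>topspace (gh_top C). \<forall>n\<in>topspace (n_top C). \<forall>a b.
          \<theta> (a *\<^sub>R x + b *\<^sub>R x') n = a *\<^sub>R \<theta> x n + b *\<^sub>R \<theta> x' n) \<and>
       (\<forall>x\<in>topspace (gh_top C). \<forall>z\<in>topspace (z_top C). \<forall>n\<in>topspace (n_top C).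
          gh_act C x (\<Phi> (z, n)) = \<Phi> (g_act C (qt C x) z + \<theta> x n, gh_br C x n)) \<and>
       ft \<in> cochains 2 (gh_top C) (z_top C) \<and>
       (\<forall>x\<in>topspace (gh_top C). \<forall>n\<in>topspace (n_top C). ft [x, n] = \<theta> x n) \<and>
       (\<forall>xs\<in>tuples 3 (topspace (gh_top C)).
          ce_d 2 (topspace (gh_top C)) (gh_br C) (\<lambda>x. g_act C (qt C x)) ft xs
            = \<beta> (map (qt C) xs)))"

text \<open>The class is the set of all cocycles cohomologous to some \<open>\<beta>\<close> as above.  That it equals
  the class of one cocycle therefore includes that such a \<open>\<beta>\<close> exists, and that its class does
  not depend on the choices.\<close>

definition char_class where
  "char_class C = (\<Union>\<beta>\<in>{\<beta>. char_cocycle C \<beta>}.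
     coh_class 3 (g_top C) (g_br C) (g_act C) (z_top C) \<beta>)"

text \<open>The covariant differential of a \<open>2\<close>-cochain.\<close>

definition cov_d ::
  "('g \<Rightarrow> 'g \<Rightarrow> 'g) \<Rightarrow> ('g \<Rightarrow> 'v \<Rightarrow> 'v) \<Rightarrow> ('g list \<Rightarrow> 'v::ab_group_add) \<Rightarrow> 'g \<Rightarrow> 'g \<Rightarrow> 'g \<Rightarrow> 'v" where
  "cov_d br S w x0 x1 x2 =
     (S x0 (w [x1, x2]) - w [br x0 x1, x2]) +
     (S x1 (w [x2, x0]) - w [br x1 x2, x0]) +
     (S x2 (w [x0, x1]) - w [br x2 x0, x1])"


section \<open>Lie groups\<close>

text \<open>The Lie algebra \<open>T\<^sub>1(G)\<close> is identified with the model space by means of a chart \<open>chart1\<close>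
  around \<open>1\<close>.\<close>

record ('k, 'b) lgrp =
  latlas :: "('k, 'b) chart set"
  chart1 :: "('k, 'b) chart"
  mul :: "'k \<Rightarrow> 'k \<Rightarrow> 'k"
  one :: 'k
  ginv :: "'k \<Rightarrow> 'k"

definition lie_group :: "('k::t2_space, 'b::lcs) lgrp \<Rightarrow> bool" where
  "lie_group G \<longleftrightarrow> manifold (latlas G) \<and> chart1 G \<in> latlas G \<and> one G \<in> cdom (chart1 G) \<and>
     Groups.group (mul G) (one G) (ginv G) \<and>
     smooth_map (prod_atlas (latlas G) (latlas G)) (latlas G) (\<lambda>(g, h). mul G g h) \<and>
     smooth_map (latlas G) (latlas G) (ginv G)"

definition linv_field :: "('k, 'b::lcs) lgrp \<Rightarrow> 'b \<Rightarrow> ('k, 'b) vf" where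
  "linv_field G x c g = (if c \<in> latlas G \<and> g \<in> cdom c
     then tang (chart1 G) c (mul G g) (one G) x else 0)"

definition lie_br :: "('k, 'b::lcs) lgrp \<Rightarrow> 'b \<Rightarrow> 'b \<Rightarrow> 'b" where
  "lie_br G x y = vf_bracket (latlas G) (linv_field G x) (linv_field G y) (chart1 G) (one G)"

definition Ad :: "('k, 'b::lcs) lgrp \<Rightarrow> 'k \<Rightarrow> 'b \<Rightarrow> 'b" where
  "Ad G k = tang (chart1 G) (chart1 G) (\<lambda>g. mul G (mul G k g) (ginv G k)) (one G)"

definition lie_hom :: "('k::t2_space, 'b::lcs) lgrp \<Rightarrow> ('l::t2_space, 'd::lcs) lgrp \<Rightarrow> ('k \<Rightarrow> 'l) \<Rightarrow> bool" where
  "lie_hom G H f \<longleftrightarrow> smooth_map (latlas G) (latlas H) f \<and>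
     (\<forall>x y. f (mul G x y) = mul H (f x) (f y))"

text \<open>The derivative \<open>L(f)\<close> of a homomorphism.\<close>

definition Lhom :: "('k, 'b::lcs) lgrp \<Rightarrow> ('l, 'd::lcs) lgrp \<Rightarrow> ('k \<Rightarrow> 'l) \<Rightarrow> 'b \<Rightarrow> 'd" where
  "Lhom G H f = tang (chart1 G) (chart1 H) f (one G)"


section \<open>Principal bundles\<close>

record ('m, 'a, 'p, 'c, 'k, 'b) pbundle =
  base :: "('m, 'a) chart set"
  total :: "('p, 'c) chart set"
  sgrp :: "('k, 'b) lgrp"
  proj :: "'p \<Rightarrow> 'm"
  ract :: "'p \<Rightarrow> 'k \<Rightarrow> 'p"

definition principal_bundle ::
  "('m::t2_space, 'a::lcs, 'p::t2_space, 'c::lcs, 'k::t2_space, 'b::lcs) pbundle \<Rightarrow> bool" where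
  "principal_bundle B \<longleftrightarrow>
     manifold (base B) \<and> manifold (total B) \<and> lie_group (sgrp B) \<and>
     smooth_map (total B) (base B) (proj B) \<and>
     smooth_map (prod_atlas (total B) (latlas (sgrp B))) (total B) (\<lambda>(p, k). ract B p k) \<and>
     (\<forall>p. ract B p (one (sgrp B)) = p) \<and>
     (\<forall>p k l. ract B (ract B p k) l = ract B p (mul (sgrp B) k l)) \<and>
     (\<forall>m. \<exists>U F. open U \<and> m \<in> U \<and> bij_betw F (U \<times> UNIV) (proj B -` U) \<and>
        (\<forall>u\<in>U. \<forall>k. proj B (F (u, k)) = u) \<and>
        (\<forall>u\<in>U. \<forall>k l. F (u, mul (sgrp B) k l) = ract B (F (u, k)) l) \<and>
        smooth_map_on (U \<times> UNIV) (prod_atlas (base B) (latlas (sgrp B))) (total B) F \<and>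
        smooth_map_on (proj B -` U) (total B) (prod_atlas (base B) (latlas (sgrp B)))
          (inv_into (U \<times> UNIV) F))"

text \<open>The value at \<open>p\<close>, in the chart \<open>c\<close>, of the fundamental vector field of \<open>x\<close>.\<close>

definition fundv ::
  "('m, 'a, 'p, 'c::lcs, 'k, 'b::lcs) pbundle \<Rightarrow> 'b \<Rightarrow> ('p, 'c) chart \<Rightarrow> 'p \<Rightarrow> 'c" where
  "fundv B x c p = tang (chart1 (sgrp B)) c (ract B p) (one (sgrp B)) x"

definition aut ::
  "('m, 'a, 'p::t2_space, 'c::lcs, 'k, 'b) pbundle \<Rightarrow> ('p, 'c) vf set" where
  "aut B = {X \<in> vfields (total B).
     \<forall>k. \<forall>c\<in>total B. \<forall>d\<in>total B. \<forall>p\<in>cdom c. ract B p k \<in> cdom d \<longrightarrow>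
       X d (ract B p k) = tang c d (\<lambda>q. ract B q k) p (X c p)}"

definition qg ::
  "('m::t2_space, 'a::lcs, 'p, 'c::lcs, 'k, 'b) pbundle \<Rightarrow> ('p, 'c) vf \<Rightarrow> ('m, 'a) vf" where
  "qg B X = (THE Y. Y \<in> vfields (base B) \<and>
     (\<forall>c\<in>total B. \<forall>d\<in>base B. \<forall>p\<in>cdom c. proj B p \<in> cdom d \<longrightarrow>
        Y d (proj B p) = tang c d (proj B) p (X c p)))"


subsection \<open>Connections\<close>

text \<open>As for vector fields, forms on \<open>P\<close> are families \<open>\<theta> c p v\<close> resp.\ \<open>\<Omega> c p v w\<close>, with the
  tangent vectors \<open>v\<close>, \<open>w\<close> at \<open>p\<close> given by their components in the chart \<open>c\<close>.\<close>

definition connection ::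
  "('m, 'a, 'p::t2_space, 'c::lcs, 'k, 'b::lcs) pbundle
   \<Rightarrow> (('p, 'c) chart \<Rightarrow> 'p \<Rightarrow> 'c \<Rightarrow> 'b) \<Rightarrow> bool" where
  "connection B \<theta> \<longleftrightarrow>
     (\<forall>c\<in>total B. \<forall>p\<in>cdom c. linear (\<theta> c p)) \<and>
     (\<forall>c\<in>total B. \<forall>d\<in>total B. \<forall>p\<in>cdom c \<inter> cdom d. \<forall>v.
        \<theta> d p (tang c d (\<lambda>q. q) p v) = \<theta> c p v) \<and>
     (\<forall>c\<in>total B. smooth_on (cimg c \<times> UNIV) (\<lambda>(x, v). \<theta> c (cinv c x) v)) \<and>
     (\<forall>k. \<forall>c\<in>total B. \<forall>d\<in>total B. \<forall>p\<in>cdom c. ract B p k \<in> cdom d \<longrightarrow>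
        (\<forall>v. Ad (sgrp B) k (\<theta> d (ract B p k) (tang c d (\<lambda>q. ract B q k) p v)) = \<theta> c p v)) \<and>
     (\<forall>x. \<forall>c\<in>total B. \<forall>p\<in>cdom c. \<theta> c p (fundv B x c p) = x)"

text \<open>\<open>d\<theta> + 1/2 [\<theta>, \<theta>]\<close>, where \<open>[\<theta>, \<theta>](v, w) = [\<theta> v, \<theta> w] - [\<theta> w, \<theta> v]\<close>.\<close>

definition curvature ::
  "('m, 'a, 'p, 'c::lcs, 'k, 'b::lcs) pbundle \<Rightarrow> (('p, 'c) chart \<Rightarrow> 'p \<Rightarrow> 'c \<Rightarrow> 'b)
   \<Rightarrow> ('p, 'c) chart \<Rightarrow> 'p \<Rightarrow> 'c \<Rightarrow> 'c \<Rightarrow> 'b" where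
  "curvature B \<theta> c p v w =
     ddir (\<lambda>x. \<theta> c (cinv c x) w) (cmap c p) v - ddir (\<lambda>x. \<theta> c (cinv c x) v) (cmap c p) w
     + (1 / 2) *\<^sub>R (lie_br (sgrp B) (\<theta> c p v) (\<theta> c p w) - lie_br (sgrp B) (\<theta> c p w) (\<theta> c p v))"

definition hlift ::
  "('m::t2_space, 'a::lcs, 'p::t2_space, 'c::lcs, 'k, 'b::lcs) pbundle
   \<Rightarrow> (('p, 'c) chart \<Rightarrow> 'p \<Rightarrow> 'c \<Rightarrow> 'b) \<Rightarrow> ('m, 'a) vf \<Rightarrow> ('p, 'c) vf" where
  "hlift B \<theta> X = (THE Y. Y \<in> aut B \<and> qg B Y = X \<and>
     (\<forall>c\<in>total B. \<forall>p\<in>cdom c. \<theta> c p (Y c p) = 0))"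


section \<open>Central extensions and the associated crossed module\<close>

record ('z, 'y, 'h, 'd, 'k) cext =
  zgrp :: "('z, 'y) lgrp"
  hgrp :: "('h, 'd) lgrp"
  zincl :: "'z \<Rightarrow> 'h"
  hquot :: "'h \<Rightarrow> 'k"

text \<open>\<open>Z \<rightarrow> H \<rightarrow> K\<close> is a central extension of Lie groups if it is a central extension of groups
  by smooth homomorphisms which makes \<open>H\<close> a smooth \<open>Z\<close>-principal bundle over \<open>K\<close>.\<close>

definition central_extension ::
  "('z::t2_space, 'y::lcs, 'h::t2_space, 'd::lcs, 'k::t2_space) cext
   \<Rightarrow> ('k, 'b::lcs) lgrp \<Rightarrow> bool" where
  "central_extension E K \<longleftrightarrow>
     lie_group (zgrp E) \<and> lie_group (hgrp E) \<and> lie_group K \<and>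
     lie_hom (zgrp E) (hgrp E) (zincl E) \<and> lie_hom (hgrp E) K (hquot E) \<and>
     inj (zincl E) \<and> surj (hquot E) \<and> range (zincl E) = hquot E -` {one K} \<and>
     (\<forall>z h. mul (hgrp E) (zincl E z) h = mul (hgrp E) h (zincl E z)) \<and>
     principal_bundle \<lparr>base = latlas K, total = latlas (hgrp E), sgrp = zgrp E,
        proj = hquot E, ract = (\<lambda>h z. mul (hgrp E) h (zincl E z))\<rparr>"

definition top_split_ext ::
  "('z, 'y, 'h, 'd::lcs, 'k) cext \<Rightarrow> ('k, 'b::lcs) lgrp \<Rightarrow> bool" where
  "top_split_ext E K \<longleftrightarrow>
     (\<exists>s. linear s \<and> continuous_on UNIV s \<and> (\<forall>x. Lhom (hgrp E) K (hquot E) (s x) = x))"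

text \<open>The action of \<open>K\<close> on the Lie algebra of \<open>H\<close> induced by conjugation in \<open>H\<close>.\<close>

definition Adh :: "('z, 'y, 'h, 'd::lcs, 'k) cext \<Rightarrow> 'k \<Rightarrow> 'd \<Rightarrow> 'd" where
  "Adh E k = Ad (hgrp E) (inv (hquot E) k)"

text \<open>Sections of the Lie algebra bundle associated to \<open>Adh\<close>.\<close>

definition hsections ::
  "('m, 'a, 'p::t2_space, 'c::lcs, 'k, 'b) pbundle \<Rightarrow> ('z, 'y, 'h, 'd::lcs, 'k) cext
   \<Rightarrow> ('p \<Rightarrow> 'd) set" where
  "hsections B E = {\<xi>. smooth_map (total B) lin_atlas \<xi> \<and>
     (\<forall>p k. \<xi> (ract B p k) = Adh E (ginv (sgrp B) k) (\<xi> p))}"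

definition zfuns ::
  "('m::t2_space, 'a::lcs, 'p, 'c, 'k, 'b) pbundle \<Rightarrow> ('z, 'y::lcs, 'h, 'd, 'k) cext
   \<Rightarrow> ('m \<Rightarrow> 'y) set" where
  "zfuns B E = {f. smooth_map (base B) lin_atlas f}"

text \<open>\<open>\<alpha>(\<xi>)\<close> is the vertical field with \<open>\<theta>(\<alpha>(\<xi>)) = -q \<circ> \<xi>\<close>; as \<open>\<theta>\<close> is inverse to \<open>x \<mapsto> fundv x\<close> on
  vertical vectors, it does not depend on the connection \<open>\<theta>\<close>.\<close>

definition sec_alpha ::
  "('m, 'a, 'p, 'c::lcs, 'k, 'b::lcs) pbundle \<Rightarrow> ('z, 'y, 'h, 'd::lcs, 'k) cext
   \<Rightarrow> ('p \<Rightarrow> 'd) \<Rightarrow> ('p, 'c) vf" where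
  "sec_alpha B E \<xi> c p = (if c \<in> total B \<and> p \<in> cdom c
     then fundv B (- Lhom (hgrp E) (sgrp B) (hquot E) (\<xi> p)) c p else 0)"

definition assoc_xmod ::
  "('m::t2_space, 'a::lcs, 'p::t2_space, 'c::lcs, 'k, 'b::lcs) pbundle
   \<Rightarrow> ('z, 'y::lcs, 'h, 'd::lcs, 'k) cext
   \<Rightarrow> (('p, 'c) vf, 'p \<Rightarrow> 'd, ('m, 'a) vf, 'm \<Rightarrow> 'y) xmod" where
  "assoc_xmod B E = \<lparr>
     gh_top = cinf_top (total B) (aut B) (\<lambda>X. X),
     gh_br = vf_bracket (total B),
     nh_top = cinf_top (total B) (hsections B E) (\<lambda>\<xi> _. \<xi>),
     nh_br = (\<lambda>\<xi> \<eta> p. lie_br (hgrp E) (\<xi> p) (\<eta> p)),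
     gh_act = vf_deriv (total B),
     alpha = sec_alpha B E,
     g_top = cinf_top (base B) (vfields (base B)) (\<lambda>X. X),
     g_br = vf_bracket (base B),
     qt = qg B,
     z_top = cinf_top (base B) (zfuns B E) (\<lambda>f _. f),
     inc = (\<lambda>f p. Lhom (zgrp E) (hgrp E) (zincl E) (f (proj B p))),
     g_act = vf_deriv (base B)\<rparr>"

text \<open>Smooth \<open>2\<close>-forms on \<open>M\<close> with values in the bundle associated to \<open>Adh\<close>, as basic (horizontal
  and equivariant) forms on \<open>P\<close>.\<close>

definition basic_2form ::
  "('m, 'a::lcs, 'p::t2_space, 'c::lcs, 'k, 'b::lcs) pbundle \<Rightarrow> ('z, 'y, 'h, 'd::lcs, 'k) cext
   \<Rightarrow> (('p, 'c) chart \<Rightarrow> 'p \<Rightarrow> 'c \<Rightarrow> 'c \<Rightarrow> 'd) \<Rightarrow> bool" where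
  "basic_2form B E \<Omega> \<longleftrightarrow>
     (\<forall>c\<in>total B. \<forall>p\<in>cdom c. (\<forall>v. linear (\<Omega> c p v)) \<and> (\<forall>w. linear (\<lambda>v. \<Omega> c p v w)) \<and>
        (\<forall>v. \<Omega> c p v v = 0)) \<and>
     (\<forall>c\<in>total B. \<forall>d\<in>total B. \<forall>p\<in>cdom c \<inter> cdom d. \<forall>v w.
        \<Omega> d p (tang c d (\<lambda>q. q) p v) (tang c d (\<lambda>q. q) p w) = \<Omega> c p v w) \<and>
     (\<forall>c\<in>total B. smooth_on (cimg c \<times> UNIV) (\<lambda>(x, v, w). \<Omega> c (cinv c x) v w)) \<and>
     (\<forall>c\<in>total B. \<forall>d\<in>base B. \<forall>p\<in>cdom c. proj B p \<in> cdom d \<longrightarrow>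
        (\<forall>v w. tang c d (proj B) p v = 0 \<longrightarrow> \<Omega> c p v w = 0)) \<and>
     (\<forall>k. \<forall>c\<in>total B. \<forall>d\<in>total B. \<forall>p\<in>cdom c. ract B p k \<in> cdom d \<longrightarrow>
        (\<forall>v w. \<Omega> d (ract B p k) (tang c d (\<lambda>q. ract B q k) p v) (tang c d (\<lambda>q. ract B q k) p w)
               = Adh E (ginv (sgrp B) k) (\<Omega> c p v w)))"

text \<open>\<open>q \<circ> \<Omega> = R\<^sub>\<theta>\<close>.\<close>

definition lifts_curvature ::
  "('m, 'a, 'p, 'c::lcs, 'k, 'b::lcs) pbundle \<Rightarrow> ('z, 'y, 'h, 'd::lcs, 'k) cext
   \<Rightarrow> (('p, 'c) chart \<Rightarrow> 'p \<Rightarrow> 'c \<Rightarrow> 'b) \<Rightarrow> (('p, 'c) chart \<Rightarrow> 'p \<Rightarrow> 'c \<Rightarrow> 'c \<Rightarrow> 'd) \<Rightarrow> bool" where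
  "lifts_curvature B E \<theta> \<Omega> \<longleftrightarrow> (\<forall>c\<in>total B. \<forall>p\<in>cdom c. \<forall>v w.
     Lhom (hgrp E) (sgrp B) (hquot E) (\<Omega> c p v w) = curvature B \<theta> c p v w)"

text \<open>\<open>\<omega>\<close> is the cochain on \<open>\<V>(M)\<close> with \<open>qg\<^sup>* \<omega> = \<Omega>\<close>.\<close>

definition corresponding_cochain ::
  "('m::t2_space, 'a::lcs, 'p::t2_space, 'c::lcs, 'k, 'b::lcs) pbundle
   \<Rightarrow> ('z, 'y::lcs, 'h, 'd::lcs, 'k) cext
   \<Rightarrow> (('p, 'c) chart \<Rightarrow> 'p \<Rightarrow> 'c \<Rightarrow> 'c \<Rightarrow> 'd) \<Rightarrow> (('m, 'a) vf list \<Rightarrow> 'p \<Rightarrow> 'd) \<Rightarrow> bool" where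
  "corresponding_cochain B E \<Omega> \<omega> \<longleftrightarrow>
     \<omega> \<in> cochains 2 (g_top (assoc_xmod B E)) (nh_top (assoc_xmod B E)) \<and>
     (\<forall>X\<in>aut B. \<forall>Y\<in>aut B. \<forall>c\<in>total B. \<forall>p\<in>cdom c.
        \<omega> [qg B X, qg B Y] p = \<Omega> c p (X c p) (Y c p))"

text \<open>\<open>d\<^sub>S \<omega>\<close> for \<open>S(X).\<xi> = \<sigma>(X).\<xi>\<close>, with values in \<open>nh\<close>, and the same cochain with values in \<open>\<zz>\<close>
  (meaningful if the values of the former are in the image of \<open>\<zz>\<close>).\<close>

definition dS where
  "dS B \<theta> \<omega> X0 X1 X2 =
     cov_d (vf_bracket (base B)) (\<lambda>X. vf_deriv (total B) (hlift B \<theta> X)) \<omega> X0 X1 X2"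

definition dSz ::
  "('m::t2_space, 'a::lcs, 'p::t2_space, 'c::lcs, 'k, 'b::lcs) pbundle
   \<Rightarrow> ('z, 'y::lcs, 'h, 'd::lcs, 'k) cext
   \<Rightarrow> (('p, 'c) chart \<Rightarrow> 'p \<Rightarrow> 'c \<Rightarrow> 'b) \<Rightarrow> (('m, 'a) vf list \<Rightarrow> 'p \<Rightarrow> 'd)
   \<Rightarrow> ('m, 'a) vf list \<Rightarrow> 'm \<Rightarrow> 'y" where
  "dSz B E \<theta> \<omega> xs = (if xs \<in> tuples 3 (vfields (base B))
     then inv_into (zfuns B E) (inc (assoc_xmod B E)) (dS B \<theta> \<omega> (xs ! 0) (xs ! 1) (xs ! 2))
     else 0)"


subsection \<open>De Rham cohomology with values in the Lie algebra of \<open>Z\<close>\<close>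

text \<open>Forms on \<open>M\<close> are identified with the alternating \<open>C\<^sup>\<infinity>(M, \<real>)\<close>-multilinear maps
  on vector fields; the exterior differential is then the Chevalley--Eilenberg differential.\<close>

definition zforms ::
  "nat \<Rightarrow> ('m::t2_space, 'a::lcs, 'p, 'c, 'k, 'b) pbundle \<Rightarrow> ('z, 'y::lcs, 'h, 'd, 'k) cext
   \<Rightarrow> (('m, 'a) vf list \<Rightarrow> 'm \<Rightarrow> 'y) set" where
  "zforms r B E = {\<eta> \<in> alt_maps r (vfields (base B)) (zfuns B E).
     \<forall>g :: 'm \<Rightarrow> real. smooth_map (base B) lin_atlas g \<longrightarrow>
       (\<forall>xs\<in>tuples r (vfields (base B)). \<forall>i<r.
          \<eta> (xs[i := (\<lambda>c m. g m *\<^sub>R (xs ! i) c m)]) = (\<lambda>m. g m *\<^sub>R \<eta> xs m))}"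

definition ext_d ::
  "nat \<Rightarrow> ('m::t2_space, 'a::lcs, 'p, 'c, 'k, 'b) pbundle
   \<Rightarrow> (('m, 'a) vf list \<Rightarrow> 'm \<Rightarrow> 'y::lcs) \<Rightarrow> ('m, 'a) vf list \<Rightarrow> 'm \<Rightarrow> 'y" where
  "ext_d r B = ce_d r (vfields (base B)) (vf_bracket (base B)) (vf_deriv (base B))"

definition closed_zforms where
  "closed_zforms r B E = {\<eta> \<in> zforms r B E. ext_d r B \<eta> = (\<lambda>_. 0)}"

text \<open>Only used for \<open>r > 0\<close>.\<close>

definition derham_class where
  "derham_class r B E \<eta> =
     {\<eta>' \<in> closed_zforms r B E. \<eta>' - \<eta> \<in> ext_d (r - 1) B ` zforms (r - 1) B E}"

end

theory Submission imports Defs "HOL-Computational_Algebra.Polynomial" begin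

text \<open>Replacing \<open>\<sigma>\<close> by \<open>\<sigma> + \<alpha> a\<close> changes \<open>\<omega>\<close> by \<open>d\<^sub>S a + 1/2 [a, a]\<close> plus a central cochain \<open>\<eta>\<close>, and by
  the Jacobi identity \<open>d\<^sub>S \<omega>\<close> changes only by \<open>d \<eta>\<close>.  This is used twice.  For two connections \<open>\<eta>\<close> is
  a two-form, which makes the de Rham class independent of the choices.  Pulled back to \<open>aut(P)\<close>, the
  lift \<open>x \<mapsto> \<sigma>(q x)\<close> differs from the identity, whose curvature is zero, by \<open>\<alpha> n(x)\<close>; so
  \<open>q\<^sup>* d\<^sub>S \<omega>\<close> is the differential of
  \<open>f (x, y) = x.n(y) - y.n(x) - [n(x), n(y)] + \<omega> (q x, q y) - n([x, y])\<close>, which extends \<open>\<vartheta>\<close>.  Two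
  extensions of \<open>\<vartheta>\<close> differ by a cochain on \<open>V(M)\<close>, whence \<open>\<chi>\<^sub>\<alpha> = [d\<^sub>S \<omega>]\<close>.  The section
  \<open>n\<close> of \<open>\<alpha>\<close> must be continuous and \<open>C\<^sup>\<infinity>(M)\<close>-linear; it is patched from local trivializations.\<close>

text \<open>Only M is finite-dimensional. K and its extension are modelled on arbitrary locally
  convex spaces, so P need not be locally compact, and evaluation d\<xi>(X) is in general not
  jointly continuous: a varying direction X can leave every compact set, whereas the derivatives of
  \<xi> are controlled on compact sets only. The remedy is to split X by \<theta>. Its vertical part
  acts on \<xi> through the continuous bracket of the extended Lie algebra, and its horizontal part
  is locally a finite combination of fixed horizontal fields, because TM has finite rank.
  Convergence is formulated along an arbitrary filter. Along the trivial filter it means smoothness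
  of the limit, so one argument yields both smoothness of a construction and its continuity. Neither
  integrals nor an inverse function theorem can be relied on for such model spaces. Convexity takes
  the place of the former in the mean value theorem; explicit formulas from local trivializations
  take the place of the latter.\<close>

section \<open>Locally convex spaces and a mean value theorem\<close>

instance "fun" :: (type, t0_space) t0_space
proof
 fix f g :: "'a=>'b" assume "f \<noteq> g"
 then obtain x where "f x \<noteq> g x" by blast
 from t0_space_class.t0_space[OF this] obtain U where U: "open U" "(f x:U) \<noteq> (g x:U)" by auto
 have "open ((%f. f x) -` U)" using U open_vimage[of U "%f. f x"] by simp
 then show "\<exists>U. open U\<and>\<not> (f:U\<longleftrightarrow>g:U)" using U by (intro exI[of _ "(%f. f x) -` U"]) auto
qed

instance "fun" :: (type, t1_space) t1_space
proof
 fix f g :: "'a=>'b" assume "f \<noteq> g"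
 then obtain x where "f x \<noteq> g x" by blast
 then obtain U where U: "open U" "f x:U" "g x\<notin>U" using t1_space by blast
 have "open ((%f. f x) -` U)" using U open_vimage[of U "%f. f x"] by simp
 then show "\<exists>U. open U\<and>f:U\<and>g\<notin>U" using U by (intro exI[of _ "(%f. f x) -` U"]) auto
qed

text \<open>The directions of iterated derivatives are packed in sequences, so the compact sets that
  define the topologies lie in the product of the model space with \<open>nat => E\<close>;
  localizing on them (\<open>compact_local\<close>) uses that this product is Hausdorff.\<close>

instance "fun" :: (type, t2_space) t2_space
proof
 fix f g :: "'a=>'b" assume "f \<noteq> g"
 then obtain x where "f x \<noteq> g x" by blast
 from hausdorff[OF this] obtain U V
  where UV: "open U" "open V" "f x:U" "g x:V" "U\<inter>V = {}" by blast
 have "open ((%f. f x) -` U)" "open ((%f. f x) -` V)" using UV open_vimage[of U "%f. f x"] open_vimage[of V "%f. f x"] by simp_all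
 then show "\<exists>U V. open U\<and>open V\<and>f:U\<and>g:V\<and>U\<inter>V = {}"
  using UV by (intro exI[of _ "(%f. f x) -` U"] exI[of _ "(%f. f x) -` V"]) auto
qed

lemma tendsto_scaleR' [tendsto_intros]:
 fixes g :: "'i=>'a::lcs"
 assumes "(f\<longlongrightarrow>r) F" "(g\<longlongrightarrow>a) F" shows "((%i. f i*\<^sub>Rg i)\<longlongrightarrow>r*\<^sub>Ra) F"
 using filterlim_compose[OF tendsto_scaleR_lcs filterlim_Pair[OF assms]] by simp

lemma continuous_on_scaleR' [continuous_intros]:
 fixes g :: "'i::topological_space=>'a::lcs"
 assumes "continuous_on S f" "continuous_on S g" shows "continuous_on S (%i. f i*\<^sub>Rg i)"
 using assms unfolding continuous_on_def by (auto intro: tendsto_scaleR')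

lemma continuous_on_diff_lcs:
 fixes g :: "'i::topological_space=>'a::lcs"
 assumes "continuous_on S f" "continuous_on S g" shows "continuous_on S (%i. f i - g i)"
 using assms unfolding continuous_on_def by (auto intro: tendsto_diff)

lemma continuous_on_add_lcs:
 fixes g :: "'i::topological_space=>'a::lcs"
 assumes "continuous_on S f" "continuous_on S g" shows "continuous_on S (%i. f i + g i)"
 using assms unfolding continuous_on_def by (auto intro: tendsto_add)

lemma lcs_nbhdE:
 fixes U :: "'a::lcs set"
 assumes "open U" "0:U"
 obtains V where "open V" "convex V" "0:V" "V\<subseteq>U" using locally_convex[OF assms] unfolding locally_convex_iff by blast

lemma open_vimage_plus: "open U==>open {y. x + y:U}" for x :: "'a::lcs"
 using open_vimage[of U "%y. x + y"] by (simp add: vimage_def continuous_on_add_lcs)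

lemma open_vimage_minus: "open U==>open {y. y - x:U}" for x :: "'a::lcs" using open_vimage_plus[of U "-x"] by (simp add: algebra_simps)

lemma lcs_nbhd_atE:
 fixes U :: "'a::lcs set"
 assumes "open U" "x:U"
 obtains V where "open V" "convex V" "x:V" "V\<subseteq>U"
proof -
 obtain V where V: "open V" "convex V" "0:V" "V\<subseteq>{y. x + y:U}" by (rule lcs_nbhdE[of "{y. x + y:U}"]) (use assms open_vimage_plus in auto)
 have eq: "{y. y - x:V} = (+) x ` V" by (auto simp: image_iff algebra_simps intro!: bexI[of _ "_ - x"])
 show thesis
 proof (rule that[of "{y. y - x:V}"])
  show "open {y. y - x:V}" using V open_vimage_minus by blast
  show "convex {y. y - x:V}" unfolding eq using V by (simp add: convex_translation)
  show "{y. y - x:V}\<subseteq>U" using V(4) by (auto simp: subset_iff)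
 qed (use V in auto)
qed

lemma lcs_nbhd_diffE:
 fixes U :: "'a::lcs set"
 assumes "open U" "0:U"
 obtains V where "open V" "convex V" "0:V" "!!x y. x:V==>y:V==>x - y:U"
proof -
 have "((%z. fst z - snd z)\<longlongrightarrow>0 - (0::'a)) (nhds 0 \<times>\<^sub>F nhds 0)" by (intro tendsto_diff filterlim_fst filterlim_snd)
 then have "eventually (%z. fst z - snd z:U) (nhds 0 \<times>\<^sub>F nhds (0::'a))" using assms by (auto simp: tendsto_def)
 then obtain P Q where PQ: "eventually P (nhds (0::'a))" "eventually Q (nhds (0::'a))"
   "!!x y. P x==>Q y==>x - y:U" unfolding eventually_prod_filter by auto
 then have "eventually (%x. P x\<and>Q x) (nhds (0::'a))" by (simp add: eventually_conj)
 then obtain A where A: "open A" "0:A" "!!x. x:A==>P x\<and>Q x" unfolding eventually_nhds by blast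
 obtain V where "open V" "convex V" "0:V" "V\<subseteq>A" using lcs_nbhdE[OF A(1,2)] .
 then show thesis using that[of V] A(3) PQ(3) by blast
qed

text \<open>The difference quotient over a union of two adjacent intervals is a convex combination
  of the two quotients, so membership in D passes to unions; around each point it follows from
  openness of D. Bolzano's bisection principle then covers [0, 1]. No integral is formed, hence
  completeness of the space is not an issue.\<close>

lemma convex_mean_value:
 fixes \<gamma> :: "real=>'a::lcs"
 assumes D: "open D" "convex D"
  and der: "!!t. 0 \<le> t==>t \<le> 1==>((%s. (\<gamma> s - \<gamma> t)/\<^sub>R(s - t))\<longlongrightarrow>\<gamma>' t) (at t)"
  and mem: "!!t. 0 \<le> t==>t \<le> 1==>\<gamma>' t:D" shows "\<gamma> 1 - \<gamma> 0:D"
proof -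
 define P where "P a b\<longleftrightarrow>(a < b-->(\<gamma> b - \<gamma> a)/\<^sub>R(b - a):D)" for a b :: real
 have trans: "P a c" if "P a b" "P b c" "a \<le> b" "b \<le> c" for a b c
 proof (cases "a < b\<and>b < c")
  case True
  then have 1: "(\<gamma> b - \<gamma> a)/\<^sub>R(b - a):D" and 2: "(\<gamma> c - \<gamma> b)/\<^sub>R(c - b):D" using that by (auto simp: P_def)
  have "(b - a) / (c - a) + (c - b) / (c - a) = 1" using True by (simp add: add_divide_distrib[symmetric])
  then have "((b - a) / (c - a))*\<^sub>R((\<gamma> b - \<gamma> a)/\<^sub>R(b - a)) +
     ((c - b) / (c - a))*\<^sub>R((\<gamma> c - \<gamma> b)/\<^sub>R(c - b)):D" using True by (intro convexD[OF D(2) 1 2]) auto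
  also have "((b - a) / (c - a))*\<^sub>R((\<gamma> b - \<gamma> a)/\<^sub>R(b - a)) +
     ((c - b) / (c - a))*\<^sub>R((\<gamma> c - \<gamma> b)/\<^sub>R(c - b)) = (\<gamma> c - \<gamma> a)/\<^sub>R(c - a)"
  proof -
   have "((b - a) / (c - a))*\<^sub>R((\<gamma> b - \<gamma> a)/\<^sub>R(b - a)) = (\<gamma> b - \<gamma> a)/\<^sub>R(c - a)"
    "((c - b) / (c - a))*\<^sub>R((\<gamma> c - \<gamma> b)/\<^sub>R(c - b)) = (\<gamma> c - \<gamma> b)/\<^sub>R(c - a)"
    using True by (simp_all add: divide_inverse)
   then show ?thesis by (simp only: scaleR_add_right[symmetric]) (simp add: algebra_simps)
  qed
  finally show ?thesis by (simp add: P_def)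
 next
  case False
  then show ?thesis using that by (auto simp: P_def)
 qed
 have loc: "\<exists>d>0. \<forall>a b. a \<le> x\<and>x \<le> b\<and>b - a < d-->P a b" if x: "0 \<le> x" "x \<le> 1" for x
 proof -
  have "eventually (%s. (\<gamma> s - \<gamma> x)/\<^sub>R(s - x):D) (at x)" using der[OF x] mem[OF x] D(1) by (auto simp: tendsto_def)
  then obtain d where d: "d > 0" "!!s. s \<noteq> x==>dist s x < d==>(\<gamma> s - \<gamma> x)/\<^sub>R(s - x):D" unfolding eventually_at by auto
  have "P a b" if "a \<le> x\<and>x \<le> b\<and>b - a < d" for a b
  proof -
   have "P a x" unfolding P_def
   proof
    assume "a < x"
    then have "(\<gamma> a - \<gamma> x)/\<^sub>R(a - x):D" using d(2)[of a] that by (auto simp: dist_real_def)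
    moreover have "(\<gamma> a - \<gamma> x)/\<^sub>R(a - x) = (\<gamma> x - \<gamma> a)/\<^sub>R(x - a)"
     using scaleR_minus_left[of "inverse (a - x)" "\<gamma> x - \<gamma> a"]
     by (metis (no_types, lifting) inverse_minus_eq minus_diff_eq scaleR_minus_left scaleR_minus_right)
    ultimately show "(\<gamma> x - \<gamma> a)/\<^sub>R(x - a):D" by simp
   qed
   moreover have "P x b" unfolding P_def using d(2)[of b] that by (auto simp: dist_real_def)
   ultimately show "P a b" using trans that by blast
  qed
  then show ?thesis using d(1) by blast
 qed
 have "P 0 1" using Bolzano[of 0 1 P] trans loc by simp
 then show ?thesis by (simp add: P_def)
qed

text \<open>Both end points and a parameter move with i, so the directional derivative at x alone
  says nothing. Joint continuity of \<open>D\<close> keeps the derivatives along the whole segment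
  from b i to a i in a convex neighbourhood of \<open>D x l0 v0\<close>, and the mean value theorem
  puts the quotient there as well.\<close>

lemma tendsto_dquot_curve:
 fixes G :: "'e::lcs=>'l::topological_space=>'f::lcs"
 assumes U: "open U" "x:U" and der: "!!y l v. y:U==>(dquot (%y. G y l) y v\<longlongrightarrow>D y l v) (at 0)"
  and cont: "((%(y, l, v). D y l v)\<longlongrightarrow>D x l0 v0) (nhds (x, l0, v0))"
  and a: "(a\<longlongrightarrow>x) F" and b: "(b\<longlongrightarrow>x) F" and l: "(l\<longlongrightarrow>l0) F"
  and r: "eventually (%i. r i \<noteq> 0) F" and v: "((%i. (a i - b i)/\<^sub>Rr i)\<longlongrightarrow>v0) F"
 shows "((%i. (G (a i) (l i) - G (b i) (l i))/\<^sub>Rr i)\<longlongrightarrow>D x l0 v0) F"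
proof (rule topological_tendstoI)
 fix W assume W: "open W" "D x l0 v0:W"
 obtain W' where W': "open W'" "convex W'" "D x l0 v0:W'" "W'\<subseteq>W" using lcs_nbhd_atE[OF W] .
 have "eventually (%z. (case z of (y, l, v)=>D y l v):W') (nhds (x, l0, v0))" using cont W' by (auto simp: tendsto_def)
 then obtain S where S0: "open S" "(x, l0, v0):S" "\<forall>z\<in>S. (case z of (y, l, v)=>D y l v):W'" unfolding eventually_nhds by blast
 have S: "open S" "(x, l0, v0):S" "!!y l v. (y, l, v):S==>D y l v:W'" using S0 by auto
 obtain N S' where N: "open N" "open S'" "(x, l0, v0):N\<times>S'" "N\<times>S'\<subseteq>S" by (rule open_prod_elim[OF S(1,2)])
 obtain M Q where M: "open M" "open Q" "(l0, v0):M\<times>Q" "M\<times>Q\<subseteq>S'"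
  by (rule open_prod_elim[OF N(2), of "(l0, v0)"]) (use N in auto)
 obtain N' where N': "open N'" "convex N'" "x:N'" "N'\<subseteq>N\<inter>U" using lcs_nbhd_atE[of "N\<inter>U" x] N U by auto
 have "eventually (%i. a i:N') F" "eventually (%i. b i:N') F" "eventually (%i. l i:M) F"
  "eventually (%i. (a i - b i)/\<^sub>Rr i:Q) F" using a b l v N' M unfolding tendsto_def by auto
 with r show "eventually (%i. (G (a i) (l i) - G (b i) (l i))/\<^sub>Rr i:W) F"
 proof eventually_elim
  case (elim i)
  define w where "w = (a i - b i)/\<^sub>Rr i"
  have ab: "a i = b i + r i*\<^sub>Rw" using elim by (simp add: w_def)
  define \<gamma> where "\<gamma> s = G (b i + (s * r i)*\<^sub>Rw) (l i)/\<^sub>Rr i" for s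
  have seg: "b i + (s * r i)*\<^sub>Rw:N'" if "0 \<le> s" "s \<le> 1" for s
  proof -
   have "(1 - s)*\<^sub>Rb i + s*\<^sub>Ra i:N'" using N'(2) elim that by (intro convexD) auto
   then show ?thesis by (simp add: ab algebra_simps)
  qed
  have "\<gamma> 1 - \<gamma> 0:W'"
  proof (rule convex_mean_value[where \<gamma>' = "%s. D (b i + (s * r i)*\<^sub>Rw) (l i) w"])
   fix s :: real assume s: "0 \<le> s" "s \<le> 1"
   let ?y = "b i + (s * r i)*\<^sub>Rw"
   have "?y:U" using seg[OF s] N' by auto
   from der[OF this]
   have d: "(dquot (%y. G y (l i)) ?y w\<longlongrightarrow>D ?y (l i) w) (at 0)" .
   have f: "filterlim (%u. (u - s) * r i) (at 0) (at s)"
   proof (rule filterlim_atI)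
    show "((%u. (u - s) * r i)\<longlongrightarrow>0) (at s)" by (auto intro!: tendsto_eq_intros)
    show "\<forall>\<^sub>F u in at s. (u - s) * r i \<noteq> 0" using elim by (auto simp: eventually_at_filter)
   qed
   have eq: "dquot (%y. G y (l i)) ?y w ((u - s) * r i) = (\<gamma> u - \<gamma> s)/\<^sub>R(u - s)" for u unfolding dquot_def \<gamma>_def
   proof -
    have "b i + (u * r i)*\<^sub>Rw = ?y + ((u - s) * r i)*\<^sub>Rw" by (simp add: algebra_simps)
    then show "(G (?y + ((u - s) * r i)*\<^sub>Rw) (l i) - G ?y (l i))/\<^sub>R((u - s) * r i) =
     (G (b i + (u * r i)*\<^sub>Rw) (l i)/\<^sub>Rr i - G ?y (l i)/\<^sub>Rr i)/\<^sub>R(u - s)"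
     by (metis scaleR_diff_right scaleR_scaleR inverse_mult_distrib)
   qed
   show "((%u. (\<gamma> u - \<gamma> s)/\<^sub>R(u - s))\<longlongrightarrow>D ?y (l i) w) (at s)"
    using filterlim_compose[OF d f] by (simp add: eq)
   have "(?y, l i, w):S" using seg[OF s] elim N N' M w_def by auto
   then show "D ?y (l i) w:W'" using S by blast
  qed (use W' in auto)
  then show ?case using W' by (auto simp: \<gamma>_def ab scaleR_diff_right[symmetric])
 qed
qed

section \<open>Iterated derivatives\<close>

lemma ddirI: "(dquot f x v\<longlongrightarrow>l) (at 0)==>ddir f x v = l" unfolding ddir_def by (rule tendsto_Lim) auto

lemma tendsto_line: "((%t. x + t*\<^sub>Rv)\<longlongrightarrow>x) (at 0)" for x :: "'a::lcs"
proof -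
 have "((%t. x + t*\<^sub>Rv)\<longlongrightarrow>x + 0*\<^sub>Rv) (at 0)" by (intro tendsto_intros)
 then show ?thesis by simp
qed

lemma eventually_line: "open U==>x:U==>eventually (%t. x + t*\<^sub>Rv:U) (at 0)" for x :: "'a::lcs"
 using tendsto_line[of x v] by (auto simp: tendsto_def)

lemma dquot_cong_ev:
 assumes "open U" "x:U" "!!y. y:U==>f y = g y" shows "eventually (%t. dquot f x v t = dquot g x v t) (at 0)"
 using eventually_line[OF assms(1,2), of v] by eventually_elim (auto simp: dquot_def assms)

lemma tendsto_dquot_cong:
 assumes "open U" "x:U" "!!y. y:U==>f y = g y"
 shows "(dquot f x v\<longlongrightarrow>l) (at 0)\<longleftrightarrow>(dquot g x v\<longlongrightarrow>l) (at 0)"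
 by (rule tendsto_cong) (rule dquot_cong_ev[OF assms])

lemma ddir_cong:
 assumes "open U" "x:U" "!!y. y:U==>f y = g y" shows "ddir f x v = ddir g x v"
 unfolding ddir_def t2_space_class.Lim_def using tendsto_dquot_cong[OF assms(1,2), of f g v, OF assms(3)] by simp

lemma iter_deriv_cong:
 assumes "open U" "!!y. y:U==>f y = g y" "x:U" shows "iter_deriv n f x h = iter_deriv n g x h" using assms(3)
proof (induction n arbitrary: x)
 case (Suc n)
 then show ?case using ddir_cong[OF assms(1), of x "%y. iter_deriv n f y h" "%y. iter_deriv n g y h"] by simp
qed (use assms in auto)

lemma iter_deriv_indep:
 "(!!i. i < n==>h i = h' i)==>iter_deriv n f x h = iter_deriv n f x h'"
proof (induction n arbitrary: x)
 case (Suc n)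
 have "(%y. iter_deriv n f y h) = (%y. iter_deriv n f y h')" using Suc by auto
 then show ?case using Suc.prems by simp
qed auto

lemma iter_deriv_ddir:
 "iter_deriv n (%x. ddir f x w) x h = iter_deriv (Suc n) f x (case_nat w h)" by (induction n arbitrary: x) simp_all

lemma smooth_on_dquot:
 assumes "smooth_on U f" "x:U" shows "(dquot (%y. iter_deriv n f y h) x v\<longlongrightarrow>iter_deriv (Suc n) f x (h(n := v))) (at 0)"
proof -
 obtain l where l: "(dquot (%y. iter_deriv n f y h) x v\<longlongrightarrow>l) (at 0)" using assms unfolding smooth_on_def by blast
 have "(%y. iter_deriv n f y (h(n := v))) = (%y. iter_deriv n f y h)" by (intro ext iter_deriv_indep) auto
 then show ?thesis using l ddirI[OF l] by simp
qed

lemma smooth_on_dquot0: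
 assumes "smooth_on U f" "x:U" shows "(dquot f x v\<longlongrightarrow>ddir f x v) (at 0)" using smooth_on_dquot[OF assms, of 0 undefined v] by simp

lemma smooth_on_continuous_iter:
 "smooth_on U f==>continuous_on (U\<times>UNIV) (%(x, h). iter_deriv n f x h)" unfolding smooth_on_def by blast

text \<open>\<open>iter_deriv\<close> is a nested limit and hard to compute directly. It is enough
  to guess all derivatives \<open>G n\<close> and to check that each differentiates to the next; the
  new direction v is then taken from \<open>h n\<close>.\<close>

lemma smooth_onI:
 assumes U: "open U" and G0: "!!x h. x:U==>G 0 x h = f x" and der: "!!n x h v. x:U==>(dquot (%y. G n y h) x v\<longlongrightarrow>G' n x h v) (at 0)"
  and GS: "!!n x h. x:U==>G (Suc n) x h = G' n x h (h n)" and cont: "!!n. continuous_on (U\<times>UNIV) (%(x, h). G n x h)"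
 shows "smooth_on U f" "!!n x h. x:U==>iter_deriv n f x h = G n x h"
proof -
 show *: "iter_deriv n f x h = G n x h" if "x:U" for n x h using that
 proof (induction n arbitrary: x)
  case (Suc n)
  have "(dquot (%y. iter_deriv n f y h) x (h n)\<longlongrightarrow>G' n x h (h n)) (at 0)"
   using tendsto_dquot_cong[OF U Suc.prems, of "%y. iter_deriv n f y h" "%y. G n y h"]
    Suc.IH der[OF Suc.prems] by simp
  then show ?case using GS[OF Suc.prems] by (simp add: ddirI)
 qed (simp add: G0)
 show "smooth_on U f" unfolding smooth_on_def
 proof (intro allI conjI ballI)
  fix n x h v assume x: "x:U"
  show "\<exists>l. (dquot (%y. iter_deriv n f y h) x v\<longlongrightarrow>l) (at 0)"
   using tendsto_dquot_cong[OF U x, of "%y. iter_deriv n f y h" "%y. G n y h" v] * der[OF x] by blast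
 next
  fix n
  show "continuous_on (U\<times>UNIV) (%(x, h). iter_deriv n f x h)" using cont[of n] by (rule continuous_on_eq) (auto simp: *)
 qed
qed

lemma smooth_on_cong:
 assumes "smooth_on U f" "open U" "!!x. x:U==>f x = g x" shows "smooth_on U g"
proof (rule smooth_onI(1)[of U "%n x h. iter_deriv n f x h" g "%n x h v. iter_deriv (Suc n) f x (h(n := v))"])
 fix n x h assume "x:U"
 show "iter_deriv (Suc n) f x h = iter_deriv (Suc n) f x (h(n := h n))" by simp
qed (use assms smooth_on_dquot smooth_on_continuous_iter in auto)

lemma smooth_on_subset: "smooth_on U f==>V\<subseteq>U==>smooth_on V f"
 unfolding smooth_on_def by (meson continuous_on_subset subsetD Sigma_mono order_refl)

lemma smooth_on_local:
 assumes "!!x. x:U==>\<exists>V. open V\<and>x:V\<and>smooth_on V f" shows "smooth_on U f" unfolding smooth_on_def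
proof (intro allI conjI ballI)
 fix n x h v assume "x:U"
 with assms show "\<exists>l. (dquot (%y. iter_deriv n f y h) x v\<longlongrightarrow>l) (at 0)" unfolding smooth_on_def by meson
next
 fix n
 show "continuous_on (U\<times>UNIV) (%(x, h). iter_deriv n f x h)" unfolding continuous_on_def
 proof
  fix z :: "'a\<times>(nat=>'a)" assume "z:U\<times>UNIV"
  then obtain V where V: "open V" "fst z:V" "smooth_on V f" using assms by (auto simp: mem_Times_iff)
  have "continuous_on (V\<times>UNIV) (%(x, h). iter_deriv n f x h)" using V smooth_on_continuous_iter by blast
  moreover have "open (V\<times>(UNIV :: (nat=>'a) set))" "z:V\<times>UNIV" using V by (auto simp: open_Times mem_Times_iff)
  ultimately have "isCont (%(x, h). iter_deriv n f x h) z" using continuous_on_eq_continuous_at by blast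
  then show "((%(x, h). iter_deriv n f x h)\<longlongrightarrow>(case z of (x, h)=>iter_deriv n f x h)) (at z within U\<times>UNIV)"
   unfolding isCont_def by (rule tendsto_within_subset) auto
 qed
qed

lemma smooth_on_continuous:
 assumes "smooth_on U f" shows "continuous_on U f"
proof -
 have "continuous_on U ((%(x, h). iter_deriv 0 f x h)\<circ>(%x. (x, %_. 0)))"
  by (intro continuous_on_compose continuous_on_subset[OF smooth_on_continuous_iter[OF assms]]
    continuous_intros) auto
 then show ?thesis by (simp add: comp_def)
qed

lemma smooth_on_ddir:
 assumes "smooth_on U f" shows "smooth_on U (%x. ddir f x w)" unfolding smooth_on_def
proof (intro allI conjI ballI)
 fix n x h v assume "x:U"
 then show "\<exists>l. (dquot (%y. iter_deriv n (%x. ddir f x w) y h) x v\<longlongrightarrow>l) (at 0)"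
  using assms unfolding iter_deriv_ddir smooth_on_def by blast
next
 fix n
 have c: "continuous_on (U\<times>UNIV) (%z. (fst z, case_nat w (snd z)))"
 proof (intro continuous_on_Pair continuous_on_fst continuous_on_id continuous_on_coordinatewise_then_product)
  fix i show "continuous_on (U\<times>UNIV) (%z. case_nat w (snd z) i)"
   by (cases i) (auto intro!: continuous_on_product_then_coordinatewise continuous_on_snd continuous_on_id)
 qed
 have "continuous_on (U\<times>UNIV) ((%(x, h). iter_deriv (Suc n) f x h)\<circ>(%z. (fst z, case_nat w (snd z))))"
  by (intro continuous_on_compose c continuous_on_subset[OF smooth_on_continuous_iter[OF assms]]) auto
 then show "continuous_on (U\<times>UNIV) (%(x, h). iter_deriv n (%x. ddir f x w) x h)"
  unfolding iter_deriv_ddir by (simp add: comp_def case_prod_unfold)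
qed

lemma tendsto_coordinatewiseI:
 fixes l :: "'i=>'k=>'a::topological_space"
 assumes "!!k. ((%i. l i k)\<longlongrightarrow>l0 k) F" shows "(l\<longlongrightarrow>l0) F"
proof -
 have "limitin (product_topology (%_. euclidean) UNIV) l l0 F" unfolding limitin_componentwise using assms by auto
 then show ?thesis by (simp add: euclidean_product_topology)
qed

lemma tendsto_coordinatewiseD:
 fixes l :: "'i=>'k=>'a::topological_space"
 assumes "(l\<longlongrightarrow>l0) F" shows "((%i. l i k)\<longlongrightarrow>l0 k) F"
proof -
 have "limitin (product_topology (%_. euclidean) UNIV) l l0 F" using assms by (simp add: euclidean_product_topology)
 then show ?thesis unfolding limitin_componentwise by auto
qed

lemma tendsto_fun_upd:
 fixes l :: "'i=>'k=>'a::topological_space"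
 assumes "(l\<longlongrightarrow>l0) F" "(v\<longlongrightarrow>v0) F" shows "((%i. (l i)(n := v i))\<longlongrightarrow>l0(n := v0)) F"
proof (rule tendsto_coordinatewiseI)
 fix k show "((%i. ((l i)(n := v i)) k)\<longlongrightarrow>(l0(n := v0)) k) F"
  using assms tendsto_coordinatewiseD[OF assms(1)] by (cases "k = n") auto
qed

lemma tendsto_iter_deriv:
 assumes "smooth_on U f" "open U" "x:U" "(a\<longlongrightarrow>x) F" "(l\<longlongrightarrow>l0) F"
 shows "((%i. iter_deriv n f (a i) (l i))\<longlongrightarrow>iter_deriv n f x l0) F"
proof -
 have "open (U\<times>(UNIV :: (nat=>'a) set))" using assms by (simp add: open_Times)
 moreover have "(x, l0):U\<times>UNIV" using assms by auto
 ultimately have "isCont (%(x, h). iter_deriv n f x h) (x, l0)"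
  using smooth_on_continuous_iter[OF assms(1), of n] continuous_on_eq_continuous_at by blast
 then show ?thesis using isCont_tendsto_compose[OF _ tendsto_Pair[OF assms(4,5)]] by fastforce
qed

lemma tendsto_iter_deriv_curve:
 assumes "smooth_on U f" "open U" "x:U" "(a\<longlongrightarrow>x) F" "(b\<longlongrightarrow>x) F" "(l\<longlongrightarrow>l0) F"
  "eventually (%i. r i \<noteq> 0) F" "((%i. (a i - b i)/\<^sub>Rr i)\<longlongrightarrow>v0) F"
 shows "((%i. (iter_deriv n f (a i) (l i) - iter_deriv n f (b i) (l i))/\<^sub>Rr i)
 \<longlongrightarrow>iter_deriv (Suc n) f x (l0(n := v0))) F"
proof (rule tendsto_dquot_curve[OF assms(2,3) _ _ assms(4-8), where D = "%y l v. iter_deriv (Suc n) f y (l(n := v))"])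
 show "(dquot (%y. iter_deriv n f y l) y v\<longlongrightarrow>iter_deriv (Suc n) f y (l(n := v))) (at 0)" if "y:U" for y l v
  using smooth_on_dquot[OF assms(1) that] .
 have "((%z. iter_deriv (Suc n) f (fst z) ((fst (snd z))(n := snd (snd z))))\<longlongrightarrow>iter_deriv (Suc n) f x (l0(n := v0)))
  (nhds (x, l0, v0))"
 proof (rule tendsto_iter_deriv[OF assms(1-3)])
  have i: "((%z. z)\<longlongrightarrow>(x, l0, v0)) (nhds (x, l0, v0))" by (rule filterlim_ident)
  show "(fst\<longlongrightarrow>x) (nhds (x, l0, v0))" using tendsto_fst[OF i] by simp
  show "((%z. (fst (snd z))(n := snd (snd z)))\<longlongrightarrow>l0(n := v0)) (nhds (x, l0, v0))"
   using tendsto_fun_upd[OF tendsto_fst[OF tendsto_snd[OF i]] tendsto_snd[OF tendsto_snd[OF i]]] by simp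
 qed
 then show "((%(y, l, v). iter_deriv (Suc n) f y (l(n := v)))\<longlongrightarrow>iter_deriv (Suc n) f x (l0(n := v0)))
  (nhds (x, l0, v0))" by (simp only: case_prod_unfold)
qed

text \<open>For additivity the step t (v + w) is a step t w followed by a step t v from the moving
  point x + t w; by \<open>tendsto_iter_deriv_curve\<close> the second quotient has the same limit
  as if it started at x. Homogeneity is a rescaling of t.\<close>

lemma iter_deriv_last_linear:
 assumes "smooth_on U f" "open U" "x:U" shows "linear (%v. iter_deriv (Suc n) f x (h(n := v)))"
proof (rule linearI)
 let ?D = "%v. iter_deriv (Suc n) f x (h(n := v))" and ?g = "%y. iter_deriv n f y h"
 have d: "(dquot ?g x v\<longlongrightarrow>?D v) (at 0)" for v using smooth_on_dquot[OF assms(1,3)] .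
 fix v w
 have "((%t. (?g ((x + t*\<^sub>Rw) + t*\<^sub>Rv) - ?g (x + t*\<^sub>Rw))/\<^sub>Rt)\<longlongrightarrow>?D v) (at 0)"
 proof (rule tendsto_iter_deriv_curve[OF assms, where l = "%_. h"])
  have "((%t. x + t*\<^sub>Rw + t*\<^sub>Rv)\<longlongrightarrow>x + 0*\<^sub>Rw + 0*\<^sub>Rv) (at 0)" by (intro tendsto_intros)
  then show "((%t. x + t*\<^sub>Rw + t*\<^sub>Rv)\<longlongrightarrow>x) (at 0)" by simp
  show "((%i. (x + i*\<^sub>Rw + i*\<^sub>Rv - (x + i*\<^sub>Rw))/\<^sub>Ri)\<longlongrightarrow>v) (at 0)"
   by (rule tendsto_eventually) (auto simp: eventually_at_filter)
 qed (auto simp: tendsto_line eventually_at_filter)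
 from tendsto_add[OF this d[of w]]
 have "(dquot ?g x (v + w)\<longlongrightarrow>?D v + ?D w) (at 0)" by (simp add: dquot_def[abs_def] algebra_simps)
 then show "?D (v + w) = ?D v + ?D w" using tendsto_unique[OF _ d[of "v + w"]] by auto
next
 let ?D = "%v. iter_deriv (Suc n) f x (h(n := v))" and ?g = "%y. iter_deriv n f y h"
 have d: "(dquot ?g x v\<longlongrightarrow>?D v) (at 0)" for v using smooth_on_dquot[OF assms(1,3)] .
 fix r v
 have "(dquot ?g x (r*\<^sub>Rv)\<longlongrightarrow>r*\<^sub>R?D v) (at 0)"
 proof (cases "r = 0")
  case True
  then show ?thesis by (simp add: dquot_def[abs_def])
 next
  case False
  have f: "filterlim (%t. t * r) (at 0) (at 0)"
   by (rule filterlim_atI) (use False in \<open>auto intro!: tendsto_eq_intros simp: eventually_at_filter\<close>)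
  have "((%t. r*\<^sub>Rdquot ?g x v (t * r))\<longlongrightarrow>r*\<^sub>R?D v) (at 0)" by (intro tendsto_intros filterlim_compose[OF d f])
  moreover have "r*\<^sub>Rdquot ?g x v (t * r) = dquot ?g x (r*\<^sub>Rv) t" for t using False by (simp add: dquot_def)
  ultimately show ?thesis by simp
 qed
 then show "?D (r*\<^sub>Rv) = r*\<^sub>R?D v" using tendsto_unique[OF _ d[of "r*\<^sub>Rv"]] by auto
qed

lemma linear_limit:
 fixes D :: "'a::lcs=>'b::lcs"
 assumes g: "!!v. ((%t. g t v)\<longlongrightarrow>D v) F" and lin: "eventually (%t. linear (g t)) F" and F: "F \<noteq> bot" shows "linear D"
proof (rule linearI)
 fix v w and r :: real
 have "((%t. g t (v + w))\<longlongrightarrow>D v + D w) F"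
  by (rule tendsto_cong[THEN iffD2, OF _ tendsto_add[OF g g]]) (rule eventually_mono[OF lin linear_add])
 then show "D (v + w) = D v + D w" by (rule tendsto_unique[OF F g])
 have "((%t. g t (r*\<^sub>Rv))\<longlongrightarrow>r*\<^sub>RD v) F"
  by (rule tendsto_cong[THEN iffD2, OF _ tendsto_scaleR'[OF tendsto_const g]]) (rule eventually_mono[OF lin linear_scale])
 then show "D (r*\<^sub>Rv) = r*\<^sub>RD v" by (rule tendsto_unique[OF F g])
qed

text \<open>The last slot is linear as the direction of a derivative. In an earlier slot every
  difference quotient is linear by induction, and limits of linear maps are linear.\<close>

lemma iter_deriv_linear:
 assumes "smooth_on U f" "open U" "x:U" "j < n" shows "linear (%v. iter_deriv n f x (h(j := v)))" using assms(3,4)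
proof (induction n arbitrary: x)
 case (Suc n)
 show ?case
 proof (cases "j = n")
  case True
  show ?thesis unfolding True by (rule iter_deriv_last_linear[OF assms(1,2) Suc.prems(1)])
 next
  case False
  then have lin: "linear (%v. iter_deriv n f y (h(j := v)))" if "y:U" for y by (intro Suc.IH that) (use Suc.prems in auto)
  show ?thesis
  proof (rule linear_limit)
   show "((%t. dquot (%y. iter_deriv n f y (h(j := v))) x (h n) t)\<longlongrightarrow>iter_deriv (Suc n) f x (h(j := v))) (at 0)" for v
    using smooth_on_dquot[OF assms(1) Suc.prems(1), of n "h(j := v)" "h n"] False by (simp add: fun_upd_twist fun_upd_idem)
   show "eventually (%t. linear (%v. dquot (%y. iter_deriv n f y (h(j := v))) x (h n) t)) (at 0)"
    using eventually_line[OF assms(2) Suc.prems(1), of "h n"] by eventually_elim (intro linearI,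
     auto simp: dquot_def linear_add[OF lin] linear_scale[OF lin] Suc.prems algebra_simps)
  qed simp
 qed
qed auto

lemma ddir_linear:
 assumes "smooth_on U f" "open U" "x:U" shows "linear (ddir f x)" using iter_deriv_last_linear[OF assms, of 0 "%_. 0"] by simp

lemma tendsto_iter_deriv_slots:
 assumes f: "smooth_on U f" "open U" "x:U" and a: "(a\<longlongrightarrow>x) F" and l: "(l\<longlongrightarrow>l0) F"
  and r: "eventually (%i. r i \<noteq> 0) F" and v: "((%i. (a i - x)/\<^sub>Rr i)\<longlongrightarrow>v) F"
  and d: "!!j. j < k==>((%i. (l i j - l0 j)/\<^sub>Rr i)\<longlongrightarrow>d j) F"
 shows "((%i. (iter_deriv k f (a i) (l i) - iter_deriv k f x l0)/\<^sub>Rr i) \<longlongrightarrow>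
  iter_deriv (Suc k) f x (l0(k := v)) + (\<Sum>j<k. iter_deriv k f x (l0(j := d j)))) F"
proof -
 \<comment> \<open>Telescoping over the slots: in \<open>?l m\<close> the arguments below m have
   moved and the others are still at their limits, so consecutive terms differ in one slot, where
   linearity applies.\<close>
 let ?l = "%m i j. if j < m then l i j else l0 j"
 have lm: "((%i. ?l m i)\<longlongrightarrow>l0) F" for m
 proof (rule tendsto_coordinatewiseI)
  fix k show "((%i. ?l m i k)\<longlongrightarrow>l0 k) F" using tendsto_coordinatewiseD[OF l] by (cases "k < m") auto
 qed
 have "m \<le> k==>((%i. (iter_deriv k f x (?l m i) - iter_deriv k f x l0)/\<^sub>Rr i) \<longlongrightarrow>
   (\<Sum>j<m. iter_deriv k f x (l0(j := d j)))) F" for m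
 proof (induction m)
  case (Suc m)
  then have m: "m < k" by simp
  have eq: "?l (Suc m) i = (?l m i)(m := l i m)" "?l m i = (?l m i)(m := l0 m)" for i by (auto simp: fun_eq_iff less_Suc_eq)
  have lin: "linear (%v. iter_deriv k f x ((?l m i)(m := v)))" for i using iter_deriv_linear[OF f m] .
  have "(iter_deriv k f x (?l (Suc m) i) - iter_deriv k f x (?l m i))/\<^sub>Rr i =
   iter_deriv k f x ((?l m i)(m := (l i m - l0 m)/\<^sub>Rr i))" for i
   unfolding linear_scale[OF lin] linear_diff[OF lin] eq(1)[of i] using eq(2)[of i] by simp
  then have "((%i. (iter_deriv k f x (?l (Suc m) i) - iter_deriv k f x (?l m i))/\<^sub>Rr i)
   \<longlongrightarrow>iter_deriv k f x (l0(m := d m))) F" using tendsto_iter_deriv[OF f tendsto_const tendsto_fun_upd[OF lm d[OF m]], of k m m]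
   by simp
  from tendsto_add[OF this Suc.IH] m show ?case
   unfolding sum.lessThan_Suc scaleR_add_right[symmetric] add.commute[of _ "iter_deriv k f x (l0(m := d m))"] by (simp del: fun_upd_apply)
 qed simp
 from this[of k] have *: "((%i. (iter_deriv k f x (l i) - iter_deriv k f x l0)/\<^sub>Rr i) \<longlongrightarrow>
   (\<Sum>j<k. iter_deriv k f x (l0(j := d j)))) F" using iter_deriv_indep[of k "?l k _" "l _" f x] by simp
 have "((%i. (iter_deriv k f (a i) (l i) - iter_deriv k f x (l i))/\<^sub>Rr i) \<longlongrightarrow>
  iter_deriv (Suc k) f x (l0(k := v))) F" by (rule tendsto_iter_deriv_curve[OF f a tendsto_const l r v])
 from tendsto_add[OF this *] show ?thesis by (simp add: scaleR_add_right[symmetric])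
qed

section \<open>The chain rule\<close>

text \<open>The \<open>n\<close>-th derivative of \<open>f \<circ> \<phi>\<close> is the sum over \<open>(k, m, r)\<close> in \<open>faa n\<close> of the terms
  \<open>d\<^sup>k f (\<phi> x) (w\<^sub>0, \<dots>, w\<^bsub>k-1\<^esub>)\<close> with \<open>w\<^sub>j = d\<^bsup>m j\<^esup> \<phi> x (h (r j 0), h (r j 1), \<dots>)\<close>.\<close>

primrec faa :: "nat=>(nat\<times>(nat=>nat)\<times>(nat=>nat=>nat)) list" where
 "faa 0 = [(0, %_. 0, %_ _. 0)]"
| "faa (Suc n) = concat (map (%(k, m, r). (Suc k, m(k := Suc 0), r(k := %_. n)) #
  map (%j. (k, m(j := Suc (m j)), r(j := (r j)(m j := n)))) [0..<k]) (faa n))"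

definition faa_arg :: "('e::lcs=>'f::lcs)=>(nat=>nat)=>(nat=>nat=>nat)=>'e=>(nat=>'e)=>nat=>'f" where
 "faa_arg \<phi> m r x h j = iter_deriv (m j) \<phi> x (%i. h (r j i))"

definition faa_term where
 "faa_term f \<phi> t x h = (case t of (k, m, r)=>iter_deriv k f (\<phi> x) (faa_arg \<phi> m r x h))"

lemma tendsto_sum_list:
 fixes g :: "'t=>'i=>'b::lcs"
 assumes "!!t. t:set ts==>(g t\<longlongrightarrow>l t) F"
 shows "((%i. \<Sum>t\<leftarrow>ts. g t i)\<longlongrightarrow>(\<Sum>t\<leftarrow>ts. l t)) F"
 using assms by (induction ts) (auto intro: tendsto_add)

lemma sum_list_concat_map:
 "sum_list (map f (concat (map g xs))) = (\<Sum>x\<leftarrow>xs. sum_list (map f (g x)))" for f :: "_=>'b::comm_monoid_add" by (induction xs) auto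

lemma tendsto_faa_arg:
 assumes "smooth_on U \<phi>" "open U" "x:U" "(a\<longlongrightarrow>x) F" "(l\<longlongrightarrow>h) F"
 shows "((%i. faa_arg \<phi> m r (a i) (l i))\<longlongrightarrow>faa_arg \<phi> m r x h) F" unfolding faa_arg_def
 by (intro tendsto_coordinatewiseI tendsto_iter_deriv[OF assms(1-4)] tendsto_coordinatewiseD[OF assms(5)])

text \<open>Differentiating a term either differentiates f, which adds a slot filled by d\<phi>(h
  n), or one of the inner factors, which raises its order; this is the recursion of
  \<open>faa\<close>. The explicit sum, and not only smoothness, is what later carries convergence
  of all derivatives through compositions.\<close>

theorem smooth_on_faa:
 assumes f: "smooth_on V f" "open V" and \<phi>: "smooth_on U \<phi>" "open U" "!!x. x:U==>\<phi> x:V"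
 shows smooth_on_compose: "smooth_on U (%x. f (\<phi> x))"
  and iter_deriv_compose: "!!n x h. x:U==>iter_deriv n (%x. f (\<phi> x)) x h = (\<Sum>t\<leftarrow>faa n. faa_term f \<phi> t x h)"
proof -
 define dt where "dt t x h v = (case t of (k, m, r) =>
  iter_deriv (Suc k) f (\<phi> x) ((faa_arg \<phi> m r x h)(k := ddir \<phi> x v)) +
  (\<Sum>j<k. iter_deriv k f (\<phi> x) ((faa_arg \<phi> m r x h)(j := iter_deriv (Suc (m j)) \<phi> x ((%i. h (r j i))(m j := v))))))"
  for t :: "nat\<times>(nat=>nat)\<times>(nat=>nat=>nat)" and x h v
 define G where "G n x h = (\<Sum>t\<leftarrow>faa n. faa_term f \<phi> t x h)" for n x h
 have phit: "((%i. \<phi> (a i))\<longlongrightarrow>\<phi> x) F" if "x:U" "(a\<longlongrightarrow>x) F" for a x and F :: "'i filter"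
  using tendsto_iter_deriv[OF \<phi>(1,2) that tendsto_const, of 0] by simp
 have lin1: "((%t. x + t*\<^sub>Rv)\<longlongrightarrow>x) (at 0)" for x v :: 'c by (rule tendsto_line)
 have der: "(dquot (%y. faa_term f \<phi> t y h) x v\<longlongrightarrow>dt t x h v) (at 0)" if x: "x:U" for t :: "nat\<times>(nat=>nat)\<times>(nat=>nat=>nat)" and x h v
 proof -
  obtain k m r where t: "t = (k, m, r)" by (cases t)
  have "((%s. (iter_deriv k f (\<phi> (x + s*\<^sub>Rv)) (faa_arg \<phi> m r (x + s*\<^sub>Rv) h) - iter_deriv k f (\<phi> x) (faa_arg \<phi> m r x h))/\<^sub>Rs)
  \<longlongrightarrow>dt t x h v) (at 0)" unfolding dt_def t prod.case
  proof (rule tendsto_iter_deriv_slots[OF f \<phi>(3)[OF x] phit[OF x lin1] tendsto_faa_arg[OF \<phi>(1,2) x lin1 tendsto_const]])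
   show "\<forall>\<^sub>F i in at (0::real). i \<noteq> 0" by (simp add: eventually_at_filter)
   show "((%i. (\<phi> (x + i*\<^sub>Rv) - \<phi> x)/\<^sub>Ri)\<longlongrightarrow>ddir \<phi> x v) (at 0)"
    using smooth_on_dquot0[OF \<phi>(1) x] by (simp add: dquot_def[abs_def])
   show "((%i. (faa_arg \<phi> m r (x + i*\<^sub>Rv) h j - faa_arg \<phi> m r x h j)/\<^sub>Ri) \<longlongrightarrow>
     iter_deriv (Suc (m j)) \<phi> x ((%i. h (r j i))(m j := v))) (at 0)" for j
    using smooth_on_dquot[OF \<phi>(1) x, of "m j" "%i. h (r j i)" v] by (simp add: dquot_def[abs_def] faa_arg_def del: iter_deriv.simps)
  qed
  then show ?thesis by (simp add: dquot_def[abs_def] faa_term_def t)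
 qed
 have dsum: "dquot (%y. \<Sum>t\<leftarrow>ts. faa_term f \<phi> t y h) x v = (%s. \<Sum>t\<leftarrow>ts. dquot (%y. faa_term f \<phi> t y h) x v s)" for ts h x v
  by (induction ts) (auto simp: dquot_def fun_eq_iff add_diff_add scaleR_add_right)
 have 1: "(dquot (%y. G n y h) x v\<longlongrightarrow>(\<Sum>t\<leftarrow>faa n. dt t x h v)) (at 0)" if "x:U" for n x h v
  unfolding G_def dsum by (rule tendsto_sum_list) (rule der[OF that])
 have 2: "G (Suc n) x h = (\<Sum>t\<leftarrow>faa n. dt t x h (h n))" for n x h
 proof -
  have "(\<Sum>u\<leftarrow>(case t of (k, m, r)=>(Suc k, m(k := Suc 0), r(k := %_. n)) #
   map (%j. (k, m(j := Suc (m j)), r(j := (r j)(m j := n)))) [0..<k]). faa_term f \<phi> u x h) = dt t x h (h n)" for t :: "nat\<times>(nat=>nat)\<times>(nat=>nat=>nat)"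
  proof -
   obtain k m r where t: "t = (k, m, r)" by (cases t)
   have 1: "faa_arg \<phi> (m(k := Suc 0)) (r(k := %_. n)) x h = (faa_arg \<phi> m r x h)(k := ddir \<phi> x (h n))"
    by (auto simp: faa_arg_def fun_eq_iff)
   have 2: "faa_arg \<phi> (m(j := Suc (m j))) (r(j := (r j)(m j := n))) x h =
     (faa_arg \<phi> m r x h)(j := iter_deriv (Suc (m j)) \<phi> x ((%i. h (r j i))(m j := h n)))" for j
   proof -
    have "(%i. h (if i = m j then n else r j i)) = (%i. h (r j i))(m j := h n)" by auto
    then show ?thesis by (auto simp add: faa_arg_def simp del: iter_deriv.simps fun_upd_apply intro!: ext) (simp_all add: fun_upd_apply faa_arg_def del: iter_deriv.simps)
   qed
   show ?thesis by (simp add: t dt_def faa_term_def 1 2 comp_def interv_sum_list_conv_sum_set_nat lessThan_atLeast0 del: iter_deriv.simps)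
  qed
  then show ?thesis by (simp add: G_def sum_list_concat_map)
 qed
 have 3: "continuous_on (U\<times>UNIV) (%(x, h). G n x h)" for n unfolding continuous_on_def
 proof -
  have "((%(x, h). G n x h)\<longlongrightarrow>G n x h) (at (x, h) within U\<times>UNIV)" if x: "x:U" for x and h :: "nat=>'c"
  proof -
   let ?F = "at (x, h) within U\<times>UNIV"
   have i: "((%z. z)\<longlongrightarrow>(x, h)) ?F" by (rule tendsto_ident_at)
   have fs: "(fst\<longlongrightarrow>x) ?F" "(snd\<longlongrightarrow>h) ?F" using tendsto_fst[OF i] tendsto_snd[OF i] by auto
   have "((%z. G n (fst z) (snd z))\<longlongrightarrow>G n x h) ?F" unfolding G_def
   proof (rule tendsto_sum_list)
    fix t :: "nat\<times>(nat=>nat)\<times>(nat=>nat=>nat)"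
    obtain k m r where t: "t = (k, m, r)" by (cases t)
    show "((%z. faa_term f \<phi> t (fst z) (snd z))\<longlongrightarrow>faa_term f \<phi> t x h) ?F" unfolding t faa_term_def prod.case
     by (intro tendsto_iter_deriv[OF f] tendsto_faa_arg[OF \<phi>(1,2)] phit x fs \<phi>(3))
   qed
   then show ?thesis by (simp add: case_prod_unfold)
  qed
  then show "\<forall>x\<in>U\<times>UNIV. ((%(x, h). G n x h)\<longlongrightarrow>(case x of (x, h)=>G n x h)) (at x within U\<times>UNIV)" by auto
 qed
 have 0: "G 0 x h = f (\<phi> x)" for x h by (simp add: G_def faa_term_def)
 note * = smooth_onI[of U G "%x. f (\<phi> x)" "%n x h v. \<Sum>t\<leftarrow>faa n. dt t x h v", OF \<phi>(2) 0 1 2 3]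
 show "smooth_on U (%x. f (\<phi> x))"
  "!!n x h. x:U==>iter_deriv n (%x. f (\<phi> x)) x h = (\<Sum>t\<leftarrow>faa n. faa_term f \<phi> t x h)" using * by (simp_all add: G_def)
qed

lemma ddir_compose:
 assumes "smooth_on V f" "open V" "smooth_on U \<phi>" "open U" "!!x. x:U==>\<phi> x:V" "x:U"
 shows "ddir (%x. f (\<phi> x)) x v = ddir f (\<phi> x) (ddir \<phi> x v)"
 using iter_deriv_compose[OF assms, of "Suc 0" "%_. v"] by (simp add: faa_term_def faa_arg_def)

section \<open>Basic smooth maps\<close>

lemma smooth_on_Pair_aux:
 assumes "smooth_on U f" "smooth_on U g" "open U" shows smooth_on_Pair: "smooth_on U (%x. (f x, g x))"
  and iter_deriv_Pair: "!!x n h. x:U==>iter_deriv n (%x. (f x, g x)) x h = (iter_deriv n f x h, iter_deriv n g x h)"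
proof -
 let ?G = "%n x h. (iter_deriv n f x h, iter_deriv n g x h)"
 let ?G' = "%n x h v. (iter_deriv (Suc n) f x (h(n := v)), iter_deriv (Suc n) g x (h(n := v)))"
 have der: "(dquot (%y. ?G n y h) x v\<longlongrightarrow>?G' n x h v) (at 0)" if "x:U" for n x h v
 proof -
  have "((%t. (dquot (%y. iter_deriv n f y h) x v t, dquot (%y. iter_deriv n g y h) x v t))\<longlongrightarrow>?G' n x h v) (at 0)"
   by (intro tendsto_Pair smooth_on_dquot[OF assms(1)] smooth_on_dquot[OF assms(2)] that)
  then show ?thesis by (simp add: dquot_def[abs_def] del: iter_deriv.simps)
 qed
 have cont: "continuous_on (U\<times>UNIV) (%(x, h). ?G n x h)" for n
  using continuous_on_Pair[OF smooth_on_continuous_iter[OF assms(1)] smooth_on_continuous_iter[OF assms(2)]] by (simp add: case_prod_unfold)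
 note * = smooth_onI[of U ?G "%x. (f x, g x)" ?G', OF assms(3) _ der _ cont]
 show "smooth_on U (%x. (f x, g x))"
  "!!x n h. x:U==>iter_deriv n (%x. (f x, g x)) x h = ?G n x h" by (rule *; simp)+
qed

lemma ddir_Pair:
 assumes "smooth_on U f" "smooth_on U g" "open U" "x:U" shows "ddir (%x. (f x, g x)) x v = (ddir f x v, ddir g x v)"
 using iter_deriv_Pair[OF assms, of "Suc 0" "%_. v"] by simp

lemma dquot_linear: "linear L==>t \<noteq> 0==>dquot L x v t = L v" by (simp add: dquot_def linear_add linear_scale)

lemma tendsto_dquot_linear: "linear L==>(dquot L x v\<longlongrightarrow>L v) (at 0)"
 by (rule tendsto_eventually) (auto simp: eventually_at_filter dquot_linear)

lemma ddir_linear_eq: "linear L==>ddir L x v = L v" by (rule ddirI) (rule tendsto_dquot_linear)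

lemma tendsto_dquot_const: "(dquot (%_. c) x v\<longlongrightarrow>0) (at 0)" by (simp add: dquot_def[abs_def])

lemma ddir_const: "ddir (%_. c) x v = 0" by (rule ddirI) (rule tendsto_dquot_const)

lemma continuous_on_proj_snd: "continuous_on (U\<times>UNIV) (%z. snd z (i::nat))"
 by (rule continuous_on_product_then_coordinatewise) (intro continuous_intros)

lemma smooth_on_linear:
 assumes L: "linear L" "continuous_on UNIV L" shows "smooth_on UNIV L"
proof (rule smooth_onI(1)[where G = "%n x h. if n = 0 then L x else if n = Suc 0 then L (h 0) else 0" and G' = "%n x h v. if n = 0 then L v else 0"])
 fix n show "continuous_on (UNIV\<times>UNIV) (%(x, h :: nat=>'a). if n = 0 then L x else if n = Suc 0 then L (h 0) else 0)"
 proof -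
  have "continuous_on (UNIV\<times>UNIV) (%z :: 'a\<times>(nat=>'a). L (fst z))"
   by (rule continuous_on_compose2[OF L(2)]) (auto intro!: continuous_intros)
  moreover have "continuous_on (UNIV\<times>UNIV) (%z :: 'a\<times>(nat=>'a). L (snd z 0))"
   by (rule continuous_on_compose2[OF L(2) continuous_on_proj_snd]) auto
  ultimately show ?thesis by (cases "n = 0"; cases "n = Suc 0") (auto simp: case_prod_unfold)
 qed
qed (auto simp: tendsto_dquot_linear[OF L(1)] tendsto_dquot_const)

lemma smooth_on_const: "smooth_on U (%_. c)"
proof (rule smooth_on_subset)
 show "smooth_on UNIV (%_. c)" by (rule smooth_onI(1)[where G = "%n x h. if n = 0 then c else 0" and G' = "%n x h v. 0"])
   (auto simp: tendsto_dquot_const)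
qed auto

lemma smooth_on_id: "smooth_on U (%x. x)" by (rule smooth_on_subset[OF smooth_on_linear]) (auto intro: linearI)

lemma smooth_on_fst: "smooth_on U fst" and smooth_on_snd: "smooth_on U snd"
 by (rule smooth_on_subset[OF smooth_on_linear]; auto intro: linearI continuous_intros)+

lemma smooth_on_linear_compose:
 assumes "linear L" "continuous_on UNIV L" "smooth_on U f" "open U" shows "smooth_on U (%x. L (f x))"
 by (rule smooth_on_compose[OF smooth_on_linear[OF assms(1,2)] _ assms(3,4)]) auto

lemma smooth_on_add:
 assumes "smooth_on U f" "smooth_on U g" "open U" shows "smooth_on U (%x. f x + g x)"
proof -
 have "smooth_on U (%x. (%z. fst z + snd z) (f x, g x))" by (rule smooth_on_linear_compose[OF _ _ smooth_on_Pair[OF assms] assms(3)])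
   (auto intro!: linearI continuous_on_add_lcs continuous_intros simp: algebra_simps)
 then show ?thesis by simp
qed

lemma smooth_on_minus:
 assumes "smooth_on U f" "open U" shows "smooth_on U (%x. - f x)"
proof (rule smooth_on_linear_compose[OF _ _ assms])
 have "continuous_on UNIV (%x::'b. 0 - x)" by (intro continuous_on_diff_lcs continuous_intros)
 then show "continuous_on UNIV (uminus :: 'b=>'b)" by simp
qed (auto intro: linearI)

lemma smooth_on_diff:
 assumes "smooth_on U f" "smooth_on U g" "open U" shows "smooth_on U (%x. f x - g x)"
 using smooth_on_add[OF assms(1) smooth_on_minus[OF assms(2,3)] assms(3)] by simp

lemma smooth_on_sum:
 "(!!i. i:I==>smooth_on U (f i))==>open U==>smooth_on U (%x. \<Sum>i\<in>I. f i x)"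
 by (induction I rule: infinite_finite_induct) (auto intro!: smooth_on_add smooth_on_const)

lemma tendsto_dquot_bilinear:
 fixes b :: "'e::lcs=>'f::lcs=>'g::lcs"
 assumes b: "bilinear b" "continuous_on UNIV (%z. b (fst z) (snd z))"
 shows "(dquot (%z. b (fst z) (snd z)) x v\<longlongrightarrow>b (fst v) (snd x) + b (fst x) (snd v)) (at 0)"
proof -
 have "((%t. b (fst v) (snd x) + (b (fst x) (snd v) + t*\<^sub>Rb (fst v) (snd v))) \<longlongrightarrow>
    b (fst v) (snd x) + (b (fst x) (snd v) + 0*\<^sub>Rb (fst v) (snd v))) (at 0)" by (intro tendsto_intros)
 moreover have "eventually (%t. b (fst v) (snd x) + (b (fst x) (snd v) + t*\<^sub>Rb (fst v) (snd v)) =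
   dquot (%z. b (fst z) (snd z)) x v t) (at 0)" by (auto simp: eventually_at_filter dquot_def bilinear_ladd[OF b(1)] bilinear_radd[OF b(1)]
   bilinear_lmul[OF b(1)] bilinear_rmul[OF b(1)] scaleR_add_right)
 ultimately show ?thesis by (simp add: tendsto_cong)
qed

lemma continuous_on_bilinear_compose:
 assumes "continuous_on UNIV (%z. b (fst z) (snd z))" "continuous_on S f" "continuous_on S g" shows "continuous_on S (%x. b (f x) (g x))"
 using continuous_on_compose2[OF assms(1) continuous_on_Pair[OF assms(2,3)]] by simp

text \<open>A bilinear map has no derivatives beyond the second, so the candidates for
  \<open>smooth_onI\<close> can be listed.\<close>

lemma smooth_on_bilinear:
 fixes b :: "'e::lcs=>'f::lcs=>'g::lcs"
 assumes b: "bilinear b" "continuous_on UNIV (%z. b (fst z) (snd z))" shows "smooth_on UNIV (%z. b (fst z) (snd z))"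
proof (rule smooth_onI(1)[where G = "%n x h. if n = 0 then b (fst x) (snd x) else if n = Suc 0 then b (fst (h 0)) (snd x) + b (fst x) (snd (h 0)) else
   if n = Suc (Suc 0) then b (fst (h 0)) (snd (h 1)) + b (fst (h 1)) (snd (h 0)) else 0"
   and G' = "%n x h v. if n = 0 then b (fst v) (snd x) + b (fst x) (snd v) else
    if n = Suc 0 then b (fst (h 0)) (snd v) + b (fst v) (snd (h 0)) else 0"])
 fix n
 show "continuous_on (UNIV\<times>UNIV) (%(x, h :: nat=>'e\<times>'f). if n = 0 then b (fst x) (snd x) else
   if n = Suc 0 then b (fst (h 0)) (snd x) + b (fst x) (snd (h 0)) else
   if n = Suc (Suc 0) then b (fst (h 0)) (snd (h 1)) + b (fst (h 1)) (snd (h 0)) else 0)"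
 proof -
  have c: "continuous_on (UNIV\<times>UNIV) (%z :: ('e\<times>'f)\<times>(nat=>'e\<times>'f). fst (fst z))"
   "continuous_on (UNIV\<times>UNIV) (%z :: ('e\<times>'f)\<times>(nat=>'e\<times>'f). snd (fst z))" by (intro continuous_intros)+
  have d: "continuous_on (UNIV\<times>UNIV) (%z :: ('e\<times>'f)\<times>(nat=>'e\<times>'f). fst (snd z i))"
   "continuous_on (UNIV\<times>UNIV) (%z :: ('e\<times>'f)\<times>(nat=>'e\<times>'f). snd (snd z i))" for i
   by (rule continuous_on_fst continuous_on_snd, rule continuous_on_proj_snd)+
  note bc = continuous_on_bilinear_compose[OF b(2)]
  have "continuous_on (UNIV\<times>UNIV) (%z :: ('e\<times>'f)\<times>(nat=>'e\<times>'f). b (fst (fst z)) (snd (fst z)))" by (rule bc[OF c])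
  moreover have "continuous_on (UNIV\<times>UNIV) (%z :: ('e\<times>'f)\<times>(nat=>'e\<times>'f). b (fst (snd z 0)) (snd (fst z)) + b (fst (fst z)) (snd (snd z 0)))"
   by (rule continuous_on_add_lcs[OF bc[OF d(1) c(2)] bc[OF c(1) d(2)]])
  moreover have "continuous_on (UNIV\<times>UNIV) (%z :: ('e\<times>'f)\<times>(nat=>'e\<times>'f). b (fst (snd z 0)) (snd (snd z 1)) + b (fst (snd z 1)) (snd (snd z 0)))"
   by (rule continuous_on_add_lcs[OF bc[OF d(1) d(2)] bc[OF d(1) d(2)]])
  ultimately show ?thesis by (cases "n = 0"; cases "n = Suc 0"; cases "n = Suc (Suc 0)") (auto simp: case_prod_unfold)
 qed
next
 fix n x v and h :: "nat=>'e\<times>'f"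
 have l: "linear (%x. b (fst (h 0)) (snd x) + b (fst x) (snd (h 0)))" by (rule linearI) (auto simp: bilinear_ladd[OF b(1)] bilinear_radd[OF b(1)]
   bilinear_lmul[OF b(1)] bilinear_rmul[OF b(1)] scaleR_add_right)
 show "(dquot (%y. if n = 0 then b (fst y) (snd y) else if n = Suc 0 then b (fst (h 0)) (snd y) + b (fst y) (snd (h 0)) else
   if n = Suc (Suc 0) then b (fst (h 0)) (snd (h 1)) + b (fst (h 1)) (snd (h 0)) else 0) x v \<longlongrightarrow>
   (if n = 0 then b (fst v) (snd x) + b (fst x) (snd v) else if n = Suc 0 then b (fst (h 0)) (snd v) + b (fst v) (snd (h 0)) else 0)) (at 0)"
  using tendsto_dquot_bilinear[OF b, of x v] tendsto_dquot_linear[OF l, of x v]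
  by (cases "n = 0"; cases "n = Suc 0") (auto simp: tendsto_dquot_const)
qed auto

lemma smooth_on_bilinear_compose:
 fixes b :: "'e::lcs=>'f::lcs=>'g::lcs"
 assumes b: "bilinear b" "continuous_on UNIV (%z. b (fst z) (snd z))" and "smooth_on U f" "smooth_on U g" "open U"
 shows "smooth_on U (%x. b (f x) (g x))" using smooth_on_compose[OF smooth_on_bilinear[OF b] _ smooth_on_Pair[OF assms(3-5)]] assms by simp

lemma ddir_bilinear_compose:
 fixes b :: "'e::lcs=>'f::lcs=>'g::lcs"
 assumes b: "bilinear b" "continuous_on UNIV (%z. b (fst z) (snd z))" and "smooth_on U f" "smooth_on U g" "open U" "x:U"
 shows "ddir (%x. b (f x) (g x)) x v = b (ddir f x v) (g x) + b (f x) (ddir g x v)"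
 using ddir_compose[OF smooth_on_bilinear[OF b] _ smooth_on_Pair[OF assms(3-5)], of x v] assms
 by (simp add: ddirI[OF tendsto_dquot_bilinear[OF b]] ddir_Pair)

lemma ddir_linear_compose:
 assumes "linear L" "continuous_on UNIV L" "smooth_on U f" "open U" "x:U" shows "ddir (%x. L (f x)) x v = L (ddir f x v)"
 using ddir_compose[OF smooth_on_linear[OF assms(1,2)] _ assms(3,4)] assms by (simp add: ddir_linear_eq)

lemma ddir_add:
 assumes "smooth_on U f" "smooth_on U g" "open U" "x:U" shows "ddir (%x. f x + g x) x v = ddir f x v + ddir g x v"
 using tendsto_add[OF smooth_on_dquot0[OF assms(1,4), of v] smooth_on_dquot0[OF assms(2,4), of v]]
 by (intro ddirI) (simp add: dquot_def[abs_def] algebra_simps)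

lemma ddir_diff:
 assumes "smooth_on U f" "smooth_on U g" "open U" "x:U" shows "ddir (%x. f x - g x) x v = ddir f x v - ddir g x v"
 using tendsto_diff[OF smooth_on_dquot0[OF assms(1,4), of v] smooth_on_dquot0[OF assms(2,4), of v]]
 by (intro ddirI) (simp add: dquot_def[abs_def] algebra_simps)

lemma bilinear_scaleR: "bilinear (%r x. r*\<^sub>R(x :: 'a::real_vector))" unfolding bilinear_def by (auto intro!: linearI simp: algebra_simps)

lemma continuous_on_scaleR_pair: "continuous_on UNIV (%z. fst z*\<^sub>R(snd z :: 'a::lcs))" by (intro continuous_on_scaleR' continuous_intros)

lemmas smooth_on_scaleR = smooth_on_bilinear_compose[OF bilinear_scaleR continuous_on_scaleR_pair]
lemmas ddir_scaleR = ddir_bilinear_compose[OF bilinear_scaleR continuous_on_scaleR_pair]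

text \<open>The derivative of \<open>(x, v, t) \<mapsto> f (x + t v)\<close> in the direction \<open>(0, 0, 1)\<close> at \<open>t = 0\<close>
  is \<open>df x v\<close>, which reduces joint smoothness in \<open>(x, v)\<close> to derivatives in a fixed direction.\<close>

lemma smooth_on_line: "smooth_on U (%z :: 'a::lcs\<times>'a\<times>real. fst z + snd (snd z)*\<^sub>Rfst (snd z))"
proof (rule smooth_on_subset)
 have s: "smooth_on UNIV (%z :: 'a\<times>'a\<times>real. snd z)" "smooth_on UNIV (%z :: 'a\<times>'a\<times>real. fst z)"
  by (simp_all add: smooth_on_fst smooth_on_snd)
 show "smooth_on UNIV (%z :: 'a\<times>'a\<times>real. fst z + snd (snd z)*\<^sub>Rfst (snd z))"
  by (intro smooth_on_add smooth_on_scaleR s smooth_on_compose[OF smooth_on_snd open_UNIV s(1)]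
    smooth_on_compose[OF smooth_on_fst open_UNIV s(1)]) auto
qed auto

lemma open_line_domain:
 assumes "open U" shows "open {z :: 'a::lcs\<times>'a\<times>real. fst z + snd (snd z)*\<^sub>Rfst (snd z):U}"
 using open_vimage[OF assms smooth_on_continuous[OF smooth_on_line]] by (simp add: vimage_def)

lemma ddir_as_line: "ddir f x v = ddir (%z. f (fst z + snd (snd z)*\<^sub>Rfst (snd z))) (x, v, 0) (0, 0, 1)"
 by (simp add: ddir_def dquot_def[abs_def])

lemma linear_Pair0: "linear (%z :: 'a::real_vector\<times>'a. (fst z, snd z, 0::real))" by (auto intro: linearI)

lemma smooth_on_Pair0: "smooth_on U (%z :: 'a::lcs\<times>'a. (fst z, snd z, 0::real))"
 by (rule smooth_on_subset[OF smooth_on_linear[OF linear_Pair0]]) (auto intro!: continuous_intros)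

lemma smooth_on_tangent:
 assumes "smooth_on U f" "open U" shows "smooth_on (U\<times>UNIV) (%z. ddir f (fst z) (snd z))"
proof -
 let ?O = "{z :: 'a\<times>'a\<times>real. fst z + snd (snd z)*\<^sub>Rfst (snd z):U}"
 have "smooth_on ?O (%z. f (fst z + snd (snd z)*\<^sub>Rfst (snd z)))"
  by (rule smooth_on_compose[OF assms smooth_on_line open_line_domain[OF assms(2)]]) simp
 from smooth_on_ddir[OF this, of "(0, 0, 1)"]
 have s: "smooth_on ?O (%z. ddir (%z. f (fst z + snd (snd z)*\<^sub>Rfst (snd z))) z (0, 0, 1))" .
 have "smooth_on (U\<times>UNIV) (%z. ddir (%z. f (fst z + snd (snd z)*\<^sub>Rfst (snd z))) (fst z, snd z, 0) (0, 0, 1))"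
  by (rule smooth_on_compose[OF s open_line_domain[OF assms(2)] smooth_on_Pair0])
   (use assms in \<open>auto simp: open_Times\<close>)
 then show ?thesis by (simp add: ddir_as_line[symmetric])
qed

lemma smooth_on_ddir_compose:
 assumes "smooth_on V f" "open V" "smooth_on U g" "smooth_on U w" "open U" "!!x. x:U==>g x:V" shows "smooth_on U (%x. ddir f (g x) (w x))"
 using smooth_on_compose[OF smooth_on_tangent[OF assms(1,2)] _ smooth_on_Pair[OF assms(3-5)]] assms by (simp add: open_Times)

section \<open>Symmetry of the second derivative\<close>

lemma line_derivative:
 assumes "(dquot g (b + (s * r)*\<^sub>Rw) w\<longlongrightarrow>D) (at 0)" "r \<noteq> 0"
 shows "((%u. (g (b + (u * r)*\<^sub>Rw)/\<^sub>Rr - g (b + (s * r)*\<^sub>Rw)/\<^sub>Rr)/\<^sub>R(u - s))\<longlongrightarrow>D) (at s)"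
proof -
 let ?y = "b + (s * r)*\<^sub>Rw"
 have f: "filterlim (%u. (u - s) * r) (at 0) (at s)"
 proof (rule filterlim_atI)
  show "((%u. (u - s) * r)\<longlongrightarrow>0) (at s)" by (auto intro!: tendsto_eq_intros)
  show "\<forall>\<^sub>F u in at s. (u - s) * r \<noteq> 0" using assms(2) by (auto simp: eventually_at_filter)
 qed
 have eq: "dquot g ?y w ((u - s) * r) = (g (b + (u * r)*\<^sub>Rw)/\<^sub>Rr - g ?y/\<^sub>Rr)/\<^sub>R(u - s)" for u
 proof -
  have "b + (u * r)*\<^sub>Rw = ?y + ((u - s) * r)*\<^sub>Rw" by (simp add: algebra_simps)
  then show ?thesis unfolding dquot_def by (metis scaleR_diff_right scaleR_scaleR inverse_mult_distrib)
 qed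
 show ?thesis using filterlim_compose[OF assms(1) f] by (simp add: eq)
qed

text \<open>The mean value theorem is applied twice. Along v the second difference becomes a
  difference of \<open>ddir f _ v\<close> at points t w apart; along w that becomes a second
  derivative at a point of the small convex set N, where continuity keeps it in W'. The order of the
  two applications decides which mixed derivative appears.\<close>

lemma tendsto_second_difference:
 assumes f: "smooth_on U f" "open U" "x:U"
 shows "((%t. ((f (x + t*\<^sub>Rw + t*\<^sub>Rv) - f (x + t*\<^sub>Rv)) - (f (x + t*\<^sub>Rw) - f x))/\<^sub>Rt/\<^sub>Rt)
 \<longlongrightarrow>ddir (%y. ddir f y v) x w) (at 0)"
proof (rule topological_tendstoI)
 let ?D = "%y. ddir (%y. ddir f y v) y w"
 fix W assume "open W" "?D x:W"
 then obtain W' where W: "open W'" "convex W'" "?D x:W'" "W'\<subseteq>W" by (rule lcs_nbhd_atE)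
 have g: "smooth_on U (%y. ddir f y v)" using smooth_on_ddir[OF f(1)] .
 have "continuous_on U ?D" using smooth_on_continuous[OF smooth_on_ddir[OF g]] .
 then have "open (U\<inter>?D -` W')" using continuous_on_open_vimage[OF f(2)] W(1) by (metis inf_commute)
 moreover have "x:U\<inter>?D -` W'" using f W by auto
 ultimately obtain N where N: "open N" "convex N" "x:N" "N\<subseteq>U\<inter>?D -` W'" by (rule lcs_nbhd_atE)
 have t: "((%t. x + t*\<^sub>Rw + t*\<^sub>Rv)\<longlongrightarrow>x + 0*\<^sub>Rw + 0*\<^sub>Rv) (at 0)" by (intro tendsto_intros)
 have "eventually (%t. x + t*\<^sub>Rw + t*\<^sub>Rv:N) (at 0)" using t N by (auto simp: tendsto_def)
 moreover have "eventually (%t. x + t*\<^sub>Rw:N) (at 0)" "eventually (%t. x + t*\<^sub>Rv:N) (at 0)" using eventually_line N by auto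
 moreover have "eventually (%t::real. t \<noteq> 0) (at 0)" by (simp add: eventually_at_filter)
 ultimately show "eventually (%t. ((f (x + t*\<^sub>Rw + t*\<^sub>Rv) - f (x + t*\<^sub>Rv)) - (f (x + t*\<^sub>Rw) - f x))/\<^sub>Rt/\<^sub>Rt:W) (at 0)"
 proof eventually_elim
  case (elim t)
  have seg: "(1 - s)*\<^sub>Ra + s*\<^sub>Rb:N" if "0 \<le> s" "s \<le> 1" "a:N" "b:N" for s a b using that by (intro convexD[OF N(2)]) auto
  have mem0: "x + (s * t)*\<^sub>Rv:N" if "0 \<le> s" "s \<le> 1" for s using seg[OF that N(3) elim(3)] by (simp add: algebra_simps)
  have mem1: "x + t*\<^sub>Rw + (s * t)*\<^sub>Rv:N" if "0 \<le> s" "s \<le> 1" for s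
   using seg[OF that elim(2) elim(1)] by (simp add: algebra_simps)
  have mem: "x + (s * t)*\<^sub>Rv + (u * t)*\<^sub>Rw:N" if "0 \<le> s" "s \<le> 1" "0 \<le> u" "u \<le> 1" for s u
   using seg[OF that(3,4) mem0[OF that(1,2)] mem1[OF that(1,2)]] by (simp add: algebra_simps)
  let ?\<gamma> = "%s. (f (x + t*\<^sub>Rw + (s * t)*\<^sub>Rv)/\<^sub>Rt - f (x + (s * t)*\<^sub>Rv)/\<^sub>Rt)/\<^sub>Rt"
  have "?\<gamma> 1 - ?\<gamma> 0:W'"
  proof (rule convex_mean_value[where \<gamma>' = "%s. (ddir f (x + t*\<^sub>Rw + (s * t)*\<^sub>Rv) v - ddir f (x + (s * t)*\<^sub>Rv) v)/\<^sub>Rt"])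
   fix s :: real assume s: "0 \<le> s" "s \<le> 1"
   have 1: "x + t*\<^sub>Rw + (s * t)*\<^sub>Rv:U" "x + (s * t)*\<^sub>Rv:U" using mem0[OF s] mem1[OF s] N by auto
   have "((%u. ((f (x + t*\<^sub>Rw + (u * t)*\<^sub>Rv)/\<^sub>Rt - f (x + t*\<^sub>Rw + (s * t)*\<^sub>Rv)/\<^sub>Rt)/\<^sub>R(u - s) -
    (f (x + (u * t)*\<^sub>Rv)/\<^sub>Rt - f (x + (s * t)*\<^sub>Rv)/\<^sub>Rt)/\<^sub>R(u - s))/\<^sub>Rt) \<longlongrightarrow>
    (ddir f (x + t*\<^sub>Rw + (s * t)*\<^sub>Rv) v - ddir f (x + (s * t)*\<^sub>Rv) v)/\<^sub>Rt) (at s)"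
    by (intro tendsto_scaleR' tendsto_const tendsto_diff line_derivative smooth_on_dquot0[OF f(1)] 1 elim)
   then show "((%u. (?\<gamma> u - ?\<gamma> s)/\<^sub>R(u - s))\<longlongrightarrow>(ddir f (x + t*\<^sub>Rw + (s * t)*\<^sub>Rv) v - ddir f (x + (s * t)*\<^sub>Rv) v)/\<^sub>Rt) (at s)"
    by (rule back_subst[of "%g. (g\<longlongrightarrow>_) _"]) (simp add: fun_eq_iff algebra_simps)
   let ?\<delta> = "%u. ddir f (x + (s * t)*\<^sub>Rv + (u * t)*\<^sub>Rw) v/\<^sub>Rt"
   have "?\<delta> 1 - ?\<delta> 0:W'"
   proof (rule convex_mean_value[where \<gamma>' = "%u. ?D (x + (s * t)*\<^sub>Rv + (u * t)*\<^sub>Rw)"])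
    fix u :: real assume u: "0 \<le> u" "u \<le> 1"
    have 2: "x + (s * t)*\<^sub>Rv + (u * t)*\<^sub>Rw:U" using mem[OF s u] N by auto
    show "((%s'. (?\<delta> s' - ?\<delta> u)/\<^sub>R(s' - u))\<longlongrightarrow>?D (x + (s * t)*\<^sub>Rv + (u * t)*\<^sub>Rw)) (at u)"
     by (intro line_derivative smooth_on_dquot0[OF g] 2 elim)
    show "?D (x + (s * t)*\<^sub>Rv + (u * t)*\<^sub>Rw):W'" using mem[OF s u] N by auto
   qed (use W in auto)
   then show "(ddir f (x + t*\<^sub>Rw + (s * t)*\<^sub>Rv) v - ddir f (x + (s * t)*\<^sub>Rv) v)/\<^sub>Rt:W'" by (simp add: algebra_simps)
  qed (use W in auto)
  then show ?case using W(4) by (auto simp: scaleR_diff_right algebra_simps)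
 qed
qed

text \<open>The second difference quotient is symmetric in v and w, whereas its limit was computed
  with the derivatives in a fixed order.\<close>

lemma ddir_ddir_commute:
 assumes f: "smooth_on U f" "open U" "x:U" shows "ddir (%y. ddir f y v) x w = ddir (%y. ddir f y w) x v"
proof -
 have "(%t. ((f (x + t*\<^sub>Rw + t*\<^sub>Rv) - f (x + t*\<^sub>Rv)) - (f (x + t*\<^sub>Rw) - f x))/\<^sub>Rt/\<^sub>Rt) =
  (%t. ((f (x + t*\<^sub>Rv + t*\<^sub>Rw) - f (x + t*\<^sub>Rw)) - (f (x + t*\<^sub>Rv) - f x))/\<^sub>Rt/\<^sub>Rt)"
  by (simp add: fun_eq_iff algebra_simps)
 then show ?thesis using tendsto_unique[OF _ tendsto_second_difference[OF f, of w v]] tendsto_second_difference[OF f, of v w] by simp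
qed

section \<open>Convergence of all derivatives on compact sets\<close>

text \<open>On a compact set \<open>C\<close>, uniform convergence to a continuous limit is the same as continuous
  convergence \<open>a i y \<longlongrightarrow> l z\<close> for \<open>y \<longlongrightarrow> z\<close> in \<open>C\<close>; the latter is compatible with compositions.\<close>

definition uconv :: "'i filter=>'y::topological_space set=>('i=>'y=>'v::topological_space)=>('y=>'v)=>bool" where
 "uconv F C a l\<longleftrightarrow>(\<forall>z\<in>C. ((%p. a (fst p) (snd p))\<longlongrightarrow>l z) (F \<times>\<^sub>F inf (nhds z) (principal C)))"

lemma eventually_prod_nhds:
 "eventually P (F \<times>\<^sub>F inf (nhds z) (principal C)) \<longleftrightarrow>
  (\<exists>Q N. eventually Q F\<and>open N\<and>z:N\<and>(\<forall>i y. Q i-->y:N\<inter>C-->P (i, y)))"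
proof
 assume "eventually P (F \<times>\<^sub>F inf (nhds z) (principal C))"
 then obtain Q R where QR: "eventually Q F" "eventually R (inf (nhds z) (principal C))"
  "\<forall>i y. Q i-->R y-->P (i, y)" unfolding eventually_prod_filter by blast
 then obtain N where "open N" "z:N" "\<forall>y\<in>N. y:C-->R y" unfolding eventually_inf_principal eventually_nhds by blast
 then show "\<exists>Q N. eventually Q F\<and>open N\<and>z:N\<and>(\<forall>i y. Q i-->y:N\<inter>C-->P (i, y))" using QR by blast
next
 assume "\<exists>Q N. eventually Q F\<and>open N\<and>z:N\<and>(\<forall>i y. Q i-->y:N\<inter>C-->P (i, y))"
 then obtain Q N where "eventually Q F" "open N" "z:N" "\<forall>i y. Q i-->y:N\<inter>C-->P (i, y)" by blast
 then show "eventually P (F \<times>\<^sub>F inf (nhds z) (principal C))" unfolding eventually_prod_filter eventually_inf_principal eventually_nhds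
  by (intro exI[of _ Q] exI[of _ "%y. y:N\<inter>C"]) auto
qed

text \<open>Finitely many of the neighbourhoods on which P holds eventually cover C, and finitely
  many eventual properties hold jointly.\<close>

lemma uconv_prod_eventually:
 assumes "compact C" and "!!z. z:C==>eventually (%p. P (fst p) (snd p)) (F \<times>\<^sub>F inf (nhds z) (principal C))"
 shows "eventually (%i. \<forall>z\<in>C. P i z) F"
proof -
 have "\<forall>z\<in>C. \<exists>Q N. eventually Q F\<and>open N\<and>z:N\<and>(\<forall>i y. Q i-->y:N\<inter>C-->P i y)"
  using assms(2) unfolding eventually_prod_nhds by simp
 then obtain Q N where QN: "!!z. z:C==>eventually (Q z) F" "!!z. z:C==>open (N z)" "!!z. z:C==>z:N z"
  "!!z i y. z:C==>Q z i==>y:N z==>y:C==>P i y" by (metis IntI)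
 obtain D where D: "D\<subseteq>C" "finite D" "C\<subseteq>(\<Union>z\<in>D. N z)" by (rule compactE_image[OF assms(1), of C N]) (use QN in auto)
 have "eventually (%i. \<forall>z\<in>D. Q z i) F" using D QN(1) by (intro eventually_ball_finite) auto
 then show ?thesis by eventually_elim (use D QN(4) in blast)
qed

lemma uconvI_uniform:
 fixes l :: "'y::topological_space=>'v::lcs"
 assumes "continuous_on C l" "!!W. open W==>0:W==>eventually (%i. \<forall>z\<in>C. a i z - l z:W) F" shows "uconv F C a l" unfolding uconv_def
proof
 fix z assume z: "z:C"
 let ?F = "F \<times>\<^sub>F inf (nhds z) (principal C)"
 have "((%p. a (fst p) (snd p) - l (snd p))\<longlongrightarrow>0) ?F"
 proof (rule topological_tendstoI)
  fix W :: "'v set" assume "open W" "0:W"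
  from assms(2)[OF this] show "eventually (%p. a (fst p) (snd p) - l (snd p):W) ?F"
   unfolding eventually_prod_nhds by (intro exI[of _ "%i. \<forall>z\<in>C. a i z - l z:W"] exI[of _ UNIV]) auto
 qed
 moreover have "((%p. l (snd p))\<longlongrightarrow>l z) ?F"
 proof (rule filterlim_compose[OF _ filterlim_snd])
  have "(l\<longlongrightarrow>l z) (inf (nhds z) (principal C))"
  proof (rule topological_tendstoI)
   fix W assume "open W" "l z:W"
   then have "\<exists>A. open A\<and>z:A\<and>(\<forall>y\<in>C. y:A-->l y:W)" using assms(1) z unfolding continuous_on_topological by blast
   then show "eventually (%x. l x:W) (inf (nhds z) (principal C))" unfolding eventually_inf_principal eventually_nhds by blast
  qed
  then show "(l\<longlongrightarrow>l z) (inf (nhds z) (principal C))" .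
 qed
 ultimately show "((%p. a (fst p) (snd p))\<longlongrightarrow>l z) ?F" using tendsto_add by fastforce
qed

text \<open>For continuous convergence this is plain composition of limits; no uniform continuity is
  involved.\<close>

lemma uconv_pullback:
 assumes "uconv F D a l" "continuous_on C \<psi>" "\<psi> ` C\<subseteq>D" shows "uconv F C (%i z. a i (\<psi> z)) (%z. l (\<psi> z))"
 unfolding uconv_def
proof
 fix z assume z: "z:C"
 have *: "((%p. a (fst p) (snd p))\<longlongrightarrow>l (\<psi> z)) (F \<times>\<^sub>F inf (nhds (\<psi> z)) (principal D))"
  using assms z unfolding uconv_def by auto
 have "filterlim (%p. (fst p, \<psi> (snd p))) (F \<times>\<^sub>F inf (nhds (\<psi> z)) (principal D)) (F \<times>\<^sub>F inf (nhds z) (principal C))"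
  unfolding filterlim_iff
 proof (intro allI impI)
  fix P assume "eventually P (F \<times>\<^sub>F inf (nhds (\<psi> z)) (principal D))"
  then obtain Q N where QN: "eventually Q F" "open N" "\<psi> z:N" "\<forall>i y. Q i-->y:N\<inter>D-->P (i, y)"
   unfolding eventually_prod_nhds by blast
  obtain A where "open A" "z:A" "\<forall>y\<in>C. y:A-->\<psi> y:N" using assms(2) z QN(2,3) unfolding continuous_on_topological by blast
  then show "eventually (%p. P (fst p, \<psi> (snd p))) (F \<times>\<^sub>F inf (nhds z) (principal C))"
   unfolding eventually_prod_nhds using QN assms(3) by (intro exI[of _ Q] exI[of _ A]) auto
 qed
 from filterlim_compose[OF * this]
 show "((%p. a (fst p) (\<psi> (snd p)))\<longlongrightarrow>l (\<psi> z)) (F \<times>\<^sub>F inf (nhds z) (principal C))" by simp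
qed

lemma uconv_cong:
 assumes "eventually (%i. \<forall>z\<in>C. a i z = b i z) F" "!!z. z:C==>l z = m z" shows "uconv F C a l\<longleftrightarrow>uconv F C b m"
proof -
 have "((%p. a (fst p) (snd p))\<longlongrightarrow>l z) (F \<times>\<^sub>F inf (nhds z) (principal C)) \<longleftrightarrow>
  ((%p. b (fst p) (snd p))\<longlongrightarrow>m z) (F \<times>\<^sub>F inf (nhds z) (principal C))" if "z:C" for z
 proof -
  have "eventually (%p. a (fst p) (snd p) = b (fst p) (snd p)) (F \<times>\<^sub>F inf (nhds z) (principal C))"
   unfolding eventually_prod_nhds using assms(1) by (intro exI[of _ "%i. \<forall>z\<in>C. a i z = b i z"] exI[of _ UNIV]) auto
  then show ?thesis using assms(2)[OF that] by (simp add: tendsto_cong)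
 qed
 then show ?thesis by (simp add: uconv_def)
qed

text \<open>The compact sets z and C - U can be separated in a Hausdorff space. As the ambient space
  need not be locally compact, D is a neighbourhood of z only relative to C, which is all that
  limits along C can see.\<close>

lemma compact_local:
 fixes C :: "'a::t2_space set"
 assumes "compact C" "z:C" "open U" "z:U"
 obtains N D where "open N" "z:N" "compact D" "D\<subseteq>C\<inter>U" "C\<inter>N\<subseteq>D"
proof -
 have K: "compact (C - U)" using assms by (simp add: compact_diff)
 have "\<forall>y\<in>C - U. \<exists>A B. open A\<and>open B\<and>z:A\<and>y:B\<and>A\<inter>B = {}" using assms(4) by (intro ballI hausdorff) auto
 then obtain A B where AB: "!!y. y:C - U==>open (A y)" "!!y. y:C - U==>open (B y)"
  "!!y. y:C - U==>z:A y" "!!y. y:C - U==>y:B y" "!!y. y:C - U==>A y\<inter>B y = {}" by metis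
 obtain D where D: "D\<subseteq>C - U" "finite D" "C - U\<subseteq>(\<Union>y\<in>D. B y)"
  by (rule compactE_image[OF K, of "C - U" B]) (use AB in auto)
 show thesis
 proof (rule that[of "\<Inter>y\<in>D. A y" "C - (\<Union>y\<in>D. B y)"])
  show "open (\<Inter>y\<in>D. A y)" using D AB by (intro open_INT) auto
  show "compact (C - (\<Union>y\<in>D. B y))" using D AB assms(1) by (intro compact_diff open_UN) auto
  show "C\<inter>(\<Inter>y\<in>D. A y)\<subseteq>C - (\<Union>y\<in>D. B y)" using AB(5) D(1) by blast
 qed (use D AB in auto)
qed

lemma uconv_local:
 fixes C :: "'a::t2_space set"
 assumes "compact C" and "!!z. z:C==>\<exists>U. open U\<and>z:U\<and>(\<forall>D. compact D-->D\<subseteq>C\<inter>U-->uconv F D a l)"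
 shows "uconv F C a l" unfolding uconv_def
proof
 fix z assume z: "z:C"
 then obtain U where U: "open U" "z:U" "\<forall>D. compact D-->D\<subseteq>C\<inter>U-->uconv F D a l" using assms(2) by blast
 obtain N D where ND: "open N" "z:N" "compact D" "D\<subseteq>C\<inter>U" "C\<inter>N\<subseteq>D" using compact_local[OF assms(1) z U(1,2)] .
 have "z:D" using ND z by auto
 have "uconv F D a l" using U ND by blast
 with \<open>z:D\<close> have t: "((%p. a (fst p) (snd p))\<longlongrightarrow>l z) (F \<times>\<^sub>F inf (nhds z) (principal D))"
  unfolding uconv_def by blast
 have "F \<times>\<^sub>F inf (nhds z) (principal C) \<le> F \<times>\<^sub>F inf (nhds z) (principal D)"
  unfolding le_filter_def eventually_prod_nhds
 proof (intro allI impI)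
  fix P assume "\<exists>Q M. eventually Q F\<and>open M\<and>z:M\<and>(\<forall>i y. Q i-->y:M\<inter>D-->P (i, y))"
  then obtain Q M where "eventually Q F" "open M" "z:M" "\<forall>i y. Q i-->y:M\<inter>D-->P (i, y)" by blast
  then show "\<exists>Q M. eventually Q F\<and>open M\<and>z:M\<and>(\<forall>i y. Q i-->y:M\<inter>C-->P (i, y))"
   using ND by (intro exI[of _ Q] exI[of _ "M\<inter>N"]) auto
 qed
 then show "((%p. a (fst p) (snd p))\<longlongrightarrow>l z) (F \<times>\<^sub>F inf (nhds z) (principal C))" using t by (rule tendsto_mono)
qed

section \<open>Convergence of smooth maps in a chart, along an arbitrary filter\<close>

definition cconv :: "'i filter=>'e::lcs set=>('i=>'e=>'v::lcs)=>('e=>'v)=>bool" where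
 "cconv F U g l\<longleftrightarrow>smooth_on U l\<and>eventually (%i. smooth_on U (g i)) F \<and>
  (\<forall>n C. compact C-->C\<subseteq>U\<times>UNIV -->
    uconv F C (%i z. iter_deriv n (g i) (fst z) (snd z)) (%z. iter_deriv n l (fst z) (snd z)))"

lemma cconv_smooth: "cconv F U g l==>smooth_on U l" and cconv_ev_smooth: "cconv F U g l==>eventually (%i. smooth_on U (g i)) F"
 and cconv_uconv: "cconv F U g l==>compact C==>C\<subseteq>U\<times>UNIV ==>
    uconv F C (%i z. iter_deriv n (g i) (fst z) (snd z)) (%z. iter_deriv n l (fst z) (snd z))" unfolding cconv_def by blast+

text \<open>Along the trivial filter only the condition on the limit survives. Hence each
  convergence lemma below is a smoothness lemma at the same time.\<close>

lemma cconv_bot: "cconv bot U (g :: 'b=>'c::lcs=>'d::lcs) l\<longleftrightarrow>smooth_on U l"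
proof -
 have "uconv bot C a l" for C :: "('c\<times>(nat=>'c)) set" and a :: "'b=>_=>'d" and l
  unfolding uconv_def tendsto_def eventually_prod_nhds by (auto intro!: exI[of _ "%_. False"])
 then show ?thesis by (simp add: cconv_def)
qed

lemma uconv_const:
 assumes "continuous_on C l" shows "uconv F C (%_. l) l"
proof -
 show ?thesis unfolding uconv_def
 proof
  fix z assume z: "z:C"
  have "(l\<longlongrightarrow>l z) (inf (nhds z) (principal C))"
  proof (rule topological_tendstoI)
   fix W assume "open W" "l z:W"
   then have "\<exists>A. open A\<and>z:A\<and>(\<forall>y\<in>C. y:A-->l y:W)" using assms(1) z unfolding continuous_on_topological by blast
   then show "eventually (%x. l x:W) (inf (nhds z) (principal C))" unfolding eventually_inf_principal eventually_nhds by blast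
  qed
  then show "((%p. l (snd p))\<longlongrightarrow>l z) (F \<times>\<^sub>F inf (nhds z) (principal C))"
   by (rule filterlim_compose[OF _ filterlim_snd])
 qed
qed

lemma continuous_on_iter_deriv:
 "smooth_on U l==>C\<subseteq>U\<times>UNIV==>continuous_on C (%z. iter_deriv n l (fst z) (snd z))"
 using continuous_on_subset[OF smooth_on_continuous_iter[of U l n]] by (simp add: case_prod_unfold)

lemma cconv_const: "smooth_on U l==>cconv F U (%_. l) l" unfolding cconv_def by (auto intro!: uconv_const continuous_on_iter_deriv)

lemma cconv_cong:
 assumes "cconv F U g l" "open U" "eventually (%i. \<forall>x\<in>U. g i x = g' i x) F" "!!x. x:U==>l x = l' x" shows "cconv F U g' l'"
 unfolding cconv_def
proof (intro conjI allI impI)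
 show "smooth_on U l'" using smooth_on_cong[OF cconv_smooth[OF assms(1)] assms(2)] assms(4) by auto
 show "eventually (%i. smooth_on U (g' i)) F"
  using assms(3) cconv_ev_smooth[OF assms(1)] by eventually_elim (rule smooth_on_cong[OF _ assms(2)], assumption, auto)
 fix n and C :: "('b\<times>(nat=>'b)) set" assume C: "compact C" "C\<subseteq>U\<times>UNIV"
 have "uconv F C (%i z. iter_deriv n (g i) (fst z) (snd z)) (%z. iter_deriv n l (fst z) (snd z)) \<longleftrightarrow>
  uconv F C (%i z. iter_deriv n (g' i) (fst z) (snd z)) (%z. iter_deriv n l' (fst z) (snd z))"
 proof (rule uconv_cong)
  show "eventually (%i. \<forall>z\<in>C. iter_deriv n (g i) (fst z) (snd z) = iter_deriv n (g' i) (fst z) (snd z)) F"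
   using assms(3) by eventually_elim (use C iter_deriv_cong[OF assms(2)] in fastforce)
  show "iter_deriv n l (fst z) (snd z) = iter_deriv n l' (fst z) (snd z)" if "z:C" for z using that C iter_deriv_cong[OF assms(2,4)] by fastforce
 qed
 then show "uconv F C (%i z. iter_deriv n (g' i) (fst z) (snd z)) (%z. iter_deriv n l' (fst z) (snd z))" using cconv_uconv[OF assms(1) C] by blast
qed

lemma cconv_subset: "cconv F U g l==>V\<subseteq>U==>cconv F V g l" unfolding cconv_def using Sigma_mono[of V U "%_. UNIV" "%_. UNIV"]
 by (auto elim!: eventually_mono intro: smooth_on_subset simp: subset_iff)

text \<open>Smoothness of the g i on all of U does not follow from the local statements, whose tails
  of the filter may change from point to point; hence the first hypothesis.\<close>

lemma cconv_local:
 assumes "eventually (%i. smooth_on U (g i)) F" and "!!x. x:U==>\<exists>V. open V\<and>x:V\<and>cconv F V g l" shows "cconv F U g l"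
 unfolding cconv_def
proof (intro conjI allI impI assms(1))
 show "smooth_on U l"
 proof (rule smooth_on_local)
  fix x assume "x:U"
  from assms(2)[OF this] show "\<exists>V. open V\<and>x:V\<and>smooth_on V l" by (auto dest: cconv_smooth)
 qed
 fix n and C :: "('b\<times>(nat=>'b)) set" assume C: "compact C" "C\<subseteq>U\<times>UNIV"
 show "uconv F C (%i z. iter_deriv n (g i) (fst z) (snd z)) (%z. iter_deriv n l (fst z) (snd z))"
 proof (rule uconv_local[OF C(1)])
  fix z assume "z:C"
  then have "fst z:U" using C by auto
  then obtain V where V: "open V" "fst z:V" "cconv F V g l" using assms(2) by blast
  show "\<exists>W. open W\<and>z:W\<and>(\<forall>D. compact D-->D\<subseteq>C\<inter>W -->
   uconv F D (%i z. iter_deriv n (g i) (fst z) (snd z)) (%z. iter_deriv n l (fst z) (snd z)))" using V cconv_uconv[OF V(3)]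
   by (intro exI[of _ "V\<times>UNIV"]) (auto simp: open_Times mem_Times_iff)
 qed
qed

lemma cconv_Pair:
 assumes "cconv F U f l" "cconv F U g m" "open U" shows "cconv F U (%i x. (f i x, g i x)) (%x. (l x, m x))" unfolding cconv_def
proof (intro conjI allI impI)
 note s = cconv_smooth[OF assms(1)] cconv_smooth[OF assms(2)]
 show "smooth_on U (%x. (l x, m x))" using s assms(3) by (rule smooth_on_Pair)
 have ev: "eventually (%i. smooth_on U (f i)\<and>smooth_on U (g i)) F"
  using cconv_ev_smooth[OF assms(1)] cconv_ev_smooth[OF assms(2)] by eventually_elim auto
 then show "eventually (%i. smooth_on U (%x. (f i x, g i x))) F" by eventually_elim (auto intro: smooth_on_Pair assms)
 fix n and C :: "('b\<times>(nat=>'b)) set" assume C: "compact C" "C\<subseteq>U\<times>UNIV"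
 have "uconv F C (%i z. (iter_deriv n (f i) (fst z) (snd z), iter_deriv n (g i) (fst z) (snd z)))
  (%z. (iter_deriv n l (fst z) (snd z), iter_deriv n m (fst z) (snd z)))" using cconv_uconv[OF assms(1) C, of n] cconv_uconv[OF assms(2) C, of n]
  unfolding uconv_def by (auto intro: tendsto_Pair)
 moreover have "eventually (%i. \<forall>z\<in>C. (iter_deriv n (f i) (fst z) (snd z), iter_deriv n (g i) (fst z) (snd z)) =
   iter_deriv n (%x. (f i x, g i x)) (fst z) (snd z)) F" using ev by eventually_elim (use C iter_deriv_Pair assms(3) in fastforce)
 moreover have "(iter_deriv n l (fst z) (snd z), iter_deriv n m (fst z) (snd z)) = iter_deriv n (%x. (l x, m x)) (fst z) (snd z)"
  if "z:C" for z using that C iter_deriv_Pair[OF s assms(3)] by fastforce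
 ultimately show "uconv F C (%i z. iter_deriv n (%x. (f i x, g i x)) (fst z) (snd z)) (%z. iter_deriv n (%x. (l x, m x)) (fst z) (snd z))"
  by (subst (asm) uconv_cong) auto
qed

lemma uconv_sum_list:
 fixes l :: "'t=>'y::topological_space=>'v::lcs"
 assumes "!!t. t:set ts==>uconv F C (a t) (l t)" shows "uconv F C (%i z. \<Sum>t\<leftarrow>ts. a t i z) (%z. \<Sum>t\<leftarrow>ts. l t z)"
 using assms unfolding uconv_def by (auto intro!: tendsto_sum_list)

lemma compact_image_reindex:
 assumes "compact C" "C\<subseteq>U\<times>UNIV"
 shows "compact ((%z. (fst z, %i. snd z (r i :: nat))) ` C)" "(%z. (fst z, %i. snd z (r i))) ` C\<subseteq>U\<times>UNIV"
  "continuous_on C (%z. (fst z, %i. snd z (r i)))"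
proof -
 show c: "continuous_on C (%z. (fst z, %i. snd z (r i)))"
  by (rule continuous_on_Pair[OF continuous_on_fst[OF continuous_on_id]], rule continuous_on_coordinatewise_then_product)
   (rule continuous_on_product_then_coordinatewise[OF continuous_on_snd[OF continuous_on_id]])
 show "compact ((%z. (fst z, %i. snd z (r i))) ` C)" by (rule compact_continuous_image[OF c assms(1)])
 show "(%z. (fst z, %i. snd z (r i))) ` C\<subseteq>U\<times>UNIV" using assms(2) by auto
qed

text \<open>Each derivative of the composite is a finite Faa di Bruno sum. Its arguments converge
  continuously, and the derivatives of the fixed map G are jointly continuous.\<close>

lemma cconv_outer:
 assumes \<phi>: "cconv F U \<phi> l" "open U" and G: "smooth_on V G" "open V"
  and lV: "!!x. x:U==>l x:V" and ev: "eventually (%i. \<forall>x\<in>U. \<phi> i x:V) F" shows "cconv F U (%i x. G (\<phi> i x)) (%x. G (l x))"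
 unfolding cconv_def
proof (intro conjI allI impI)
 note s = cconv_smooth[OF \<phi>(1)]
 show "smooth_on U (%x. G (l x))" by (rule smooth_on_compose[OF G s \<phi>(2) lV])
 have ev2: "eventually (%i. smooth_on U (\<phi> i)\<and>(\<forall>x\<in>U. \<phi> i x:V)) F"
  using cconv_ev_smooth[OF \<phi>(1)] ev by eventually_elim auto
 then show "eventually (%i. smooth_on U (%x. G (\<phi> i x))) F" by eventually_elim (use smooth_on_compose[OF G _ \<phi>(2)] in blast)
 fix n and C :: "('b\<times>(nat=>'b)) set" assume C: "compact C" "C\<subseteq>U\<times>UNIV"
 have "uconv F C (%i z. \<Sum>t\<leftarrow>faa n. faa_term G (\<phi> i) t (fst z) (snd z)) (%z. \<Sum>t\<leftarrow>faa n. faa_term G l t (fst z) (snd z))"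
 proof (rule uconv_sum_list)
  fix t :: "nat\<times>(nat=>nat)\<times>(nat=>nat=>nat)"
  obtain k m r where t: "t = (k, m, r)" by (cases t)
  show "uconv F C (%i z. faa_term G (\<phi> i) t (fst z) (snd z)) (%z. faa_term G l t (fst z) (snd z))" unfolding uconv_def
  proof
   fix z assume z: "z:C"
   let ?F = "F \<times>\<^sub>F inf (nhds z) (principal C)"
   show "((%p. faa_term G (\<phi> (fst p)) t (fst (snd p)) (snd (snd p)))\<longlongrightarrow>faa_term G l t (fst z) (snd z)) ?F"
    unfolding t faa_term_def prod.case
   proof (rule tendsto_iter_deriv[OF G])
    show "l (fst z):V" using z C lV by auto
    show "((%p. \<phi> (fst p) (fst (snd p)))\<longlongrightarrow>l (fst z)) ?F"
     using cconv_uconv[OF \<phi>(1) C, of 0] z by (simp add: uconv_def)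
    show "((%p. faa_arg (\<phi> (fst p)) m r (fst (snd p)) (snd (snd p)))\<longlongrightarrow>faa_arg l m r (fst z) (snd z)) ?F"
    proof (rule tendsto_coordinatewiseI)
     fix j
     note ci = compact_image_reindex[OF C, of "r j"]
     show "((%p. faa_arg (\<phi> (fst p)) m r (fst (snd p)) (snd (snd p)) j)\<longlongrightarrow>faa_arg l m r (fst z) (snd z) j) ?F"
      using uconv_pullback[OF cconv_uconv[OF \<phi>(1) ci(1,2), of "m j"] ci(3) order_refl] z by (simp add: uconv_def faa_arg_def)
    qed
   qed
  qed
 qed
 moreover have "eventually (%i. \<forall>z\<in>C. (\<Sum>t\<leftarrow>faa n. faa_term G (\<phi> i) t (fst z) (snd z)) =
  iter_deriv n (%x. G (\<phi> i x)) (fst z) (snd z)) F" using ev2 by eventually_elim (use C iter_deriv_compose[OF G _ \<phi>(2)] in fastforce)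
 moreover have "(\<Sum>t\<leftarrow>faa n. faa_term G l t (fst z) (snd z)) = iter_deriv n (%x. G (l x)) (fst z) (snd z)" if "z:C" for z
  using that C iter_deriv_compose[OF G s \<phi>(2) lV] by fastforce
 ultimately show "uconv F C (%i z. iter_deriv n (%x. G (\<phi> i x)) (fst z) (snd z)) (%z. iter_deriv n (%x. G (l x)) (fst z) (snd z))"
  by (subst (asm) uconv_cong) auto
qed

text \<open>The inner map is fixed, so the points and directions at which a Faa di Bruno term
  evaluates g range over a compact set again, namely a continuous image of C.\<close>

lemma cconv_inner:
 fixes \<phi> :: "'c::lcs=>'e::lcs"
 assumes g: "cconv F V g l" "open V" and \<phi>: "smooth_on U \<phi>" "open U" "!!x. x:U==>\<phi> x:V"
 shows "cconv F U (%i x. g i (\<phi> x)) (%x. l (\<phi> x))" unfolding cconv_def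
proof (intro conjI allI impI)
 note s = cconv_smooth[OF g(1)]
 show "smooth_on U (%x. l (\<phi> x))" by (rule smooth_on_compose[OF s g(2) \<phi>])
 show "eventually (%i. smooth_on U (%x. g i (\<phi> x))) F"
  using cconv_ev_smooth[OF g(1)] by eventually_elim (use smooth_on_compose[OF _ g(2) \<phi>] in blast)
 fix n and C :: "('c\<times>(nat=>'c)) set" assume C: "compact C" "C\<subseteq>U\<times>UNIV"
 have "uconv F C (%i z. \<Sum>t\<leftarrow>faa n. faa_term (g i) \<phi> t (fst z) (snd z)) (%z. \<Sum>t\<leftarrow>faa n. faa_term l \<phi> t (fst z) (snd z))"
 proof (rule uconv_sum_list)
  fix t :: "nat\<times>(nat=>nat)\<times>(nat=>nat=>nat)"
  obtain k m r where t: "t = (k, m, r)" by (cases t)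
  have c: "continuous_on C (%z. (\<phi> (fst z), faa_arg \<phi> m r (fst z) (snd z)))" unfolding continuous_on_def
  proof
   fix z assume z: "z:C"
   have f: "fst z:U" using z C by auto
   have i: "((%z. z)\<longlongrightarrow>z) (at z within C)" by (rule tendsto_ident_at)
   show "((%z. (\<phi> (fst z), faa_arg \<phi> m r (fst z) (snd z)))\<longlongrightarrow>(\<phi> (fst z), faa_arg \<phi> m r (fst z) (snd z))) (at z within C)"
    using tendsto_iter_deriv[OF \<phi>(1,2) f tendsto_fst[OF i] tendsto_const, of 0]
    by (intro tendsto_Pair tendsto_faa_arg[OF \<phi>(1,2) f tendsto_fst[OF i] tendsto_snd[OF i]]) simp
  qed
  have c2: "compact ((%z. (\<phi> (fst z), faa_arg \<phi> m r (fst z) (snd z))) ` C)" by (rule compact_continuous_image[OF c C(1)])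
  have c3: "(%z. (\<phi> (fst z), faa_arg \<phi> m r (fst z) (snd z))) ` C\<subseteq>V\<times>UNIV" using C \<phi>(3) by auto
  show "uconv F C (%i z. faa_term (g i) \<phi> t (fst z) (snd z)) (%z. faa_term l \<phi> t (fst z) (snd z))"
   using uconv_pullback[OF cconv_uconv[OF g(1) c2 c3, of k] c order_refl] by (simp add: t faa_term_def)
 qed
 moreover have "eventually (%i. \<forall>z\<in>C. (\<Sum>t\<leftarrow>faa n. faa_term (g i) \<phi> t (fst z) (snd z)) =
  iter_deriv n (%x. g i (\<phi> x)) (fst z) (snd z)) F"
  using cconv_ev_smooth[OF g(1)] by eventually_elim (use C iter_deriv_compose[OF _ g(2) \<phi>] in fastforce)
 moreover have "(\<Sum>t\<leftarrow>faa n. faa_term l \<phi> t (fst z) (snd z)) = iter_deriv n (%x. l (\<phi> x)) (fst z) (snd z)" if "z:C" for z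
  using that C iter_deriv_compose[OF s g(2) \<phi>] by fastforce
 ultimately show "uconv F C (%i z. iter_deriv n (%x. g i (\<phi> x)) (fst z) (snd z)) (%z. iter_deriv n (%x. l (\<phi> x)) (fst z) (snd z))"
  by (subst (asm) uconv_cong) auto
qed

lemma cconv_ddir:
 assumes "cconv F U g l" shows "cconv F U (%i x. ddir (g i) x w) (%x. ddir l x w)" unfolding cconv_def
proof (intro conjI allI impI)
 show "smooth_on U (%x. ddir l x w)" using smooth_on_ddir[OF cconv_smooth[OF assms]] .
 show "eventually (%i. smooth_on U (%x. ddir (g i) x w)) F" using cconv_ev_smooth[OF assms] by eventually_elim (rule smooth_on_ddir)
 fix n and C :: "('b\<times>(nat=>'b)) set" assume C: "compact C" "C\<subseteq>U\<times>UNIV"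
 have c: "continuous_on C (%z. (fst z, case_nat w (snd z)))"
 proof (intro continuous_on_Pair continuous_on_fst continuous_on_id continuous_on_coordinatewise_then_product)
  fix i show "continuous_on C (%z. case_nat w (snd z) i)"
   by (cases i) (auto intro!: continuous_on_product_then_coordinatewise continuous_on_snd continuous_on_id)
 qed
 have c2: "compact ((%z. (fst z, case_nat w (snd z))) ` C)" by (rule compact_continuous_image[OF c C(1)])
 have c3: "(%z. (fst z, case_nat w (snd z))) ` C\<subseteq>U\<times>UNIV" using C by auto
 show "uconv F C (%i z. iter_deriv n (%x. ddir (g i) x w) (fst z) (snd z)) (%z. iter_deriv n (%x. ddir l x w) (fst z) (snd z))"
  using uconv_pullback[OF cconv_uconv[OF assms c2 c3, of "Suc n"] c order_refl] unfolding iter_deriv_ddir by simp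
qed

lemma cconv_tangent:
 assumes "cconv F U g l" "open U" shows "cconv F (U\<times>UNIV) (%i z. ddir (g i) (fst z) (snd z)) (%z. ddir l (fst z) (snd z))"
proof -
 let ?O = "{z :: 'b\<times>'b\<times>real. fst z + snd (snd z)*\<^sub>Rfst (snd z):U}"
 have "cconv F ?O (%i z. g i (fst z + snd (snd z)*\<^sub>Rfst (snd z))) (%z. l (fst z + snd (snd z)*\<^sub>Rfst (snd z)))"
  by (rule cconv_inner[OF assms smooth_on_line open_line_domain[OF assms(2)]]) simp
 note s = cconv_ddir[OF this, of "(0, 0, 1)"]
 have "cconv F (U\<times>UNIV) (%i z. ddir (%z. g i (fst z + snd (snd z)*\<^sub>Rfst (snd z))) (fst z, snd z, 0) (0, 0, 1))
  (%z. ddir (%z. l (fst z + snd (snd z)*\<^sub>Rfst (snd z))) (fst z, snd z, 0) (0, 0, 1))"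
  by (rule cconv_inner[OF s open_line_domain[OF assms(2)] smooth_on_Pair0])
   (use assms in \<open>auto simp: open_Times\<close>)
 then show ?thesis by (simp add: ddir_as_line[symmetric])
qed

section \<open>The topology of uniform convergence of all derivatives on compact sets\<close>

lemma topspace_cinf_top:
 assumes "A \<noteq> {}" shows "topspace (cinf_top A S ev) = S"
proof -
 obtain c where "c:A" using assms by blast
 have "s:topspace (cinf_top A S ev)" if "s:S" for s
 proof -
  \<comment> \<open>The empty compact set exhibits all of S as a subbasic open set.\<close>
  have "S = {s':S. \<forall>(x, h)\<in>{}. iter_deriv 0 (%y. ev s' c (cinv c y)) x h
   - iter_deriv 0 (%y. ev s c (cinv c y)) x h:UNIV}" by auto
  then show ?thesis unfolding cinf_top_def topology_generated_by_topspace using that \<open>c:A\<close> compact_empty open_UNIV by blast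
 qed
 then show ?thesis unfolding cinf_top_def topology_generated_by_topspace by auto
qed

lemma continuous_map_cinf_topD:
 fixes ev :: "'s=>('m, 'e::lcs) chart=>'m=>'v::lcs"
 assumes f: "continuous_map T (cinf_top A S ev) f" and t: "t:topspace T" and c: "c:A" and sm: "!!s. s:S==>smooth_on (cimg c) (%y. ev s c (cinv c y))"
 shows "cconv (atin T t) (cimg c) (%t y. ev (f t) c (cinv c y)) (%y. ev (f t) c (cinv c y))"
proof -
 have A: "A \<noteq> {}" using c by blast
 have S: "f t':S" if "t':topspace T" for t' using f that topspace_cinf_top[OF A, of S ev] unfolding continuous_map_def by auto
 show ?thesis unfolding cconv_def
 proof (intro conjI allI impI)
  show "smooth_on (cimg c) (%y. ev (f t) c (cinv c y))" using sm S t by blast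
  show "eventually (%t. smooth_on (cimg c) (%y. ev (f t) c (cinv c y))) (atin T t)"
   unfolding eventually_atin using sm S t by (auto intro!: exI[of _ "topspace T"])
  fix n and C :: "('e\<times>(nat=>'e)) set" assume C: "compact C" "C\<subseteq>cimg c\<times>UNIV"
  show "uconv (atin T t) C (%t z. iter_deriv n (%y. ev (f t) c (cinv c y)) (fst z) (snd z))
   (%z. iter_deriv n (%y. ev (f t) c (cinv c y)) (fst z) (snd z))"
  proof (rule uconvI_uniform)
   show "continuous_on C (%z. iter_deriv n (%y. ev (f t) c (cinv c y)) (fst z) (snd z))"
    by (rule continuous_on_iter_deriv[OF sm C(2)]) (use S t in blast)
   fix W :: "'v set" assume W: "open W" "0:W"
   let ?X = "{s:S. \<forall>(x, h)\<in>C. iter_deriv n (%y. ev s c (cinv c y)) x h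
           - iter_deriv n (%y. ev (f t) c (cinv c y)) x h:W}"
   have "openin (cinf_top A S ev) ?X" unfolding cinf_top_def by (rule topology_generated_by_Basis) (use S t c C W in blast)
   then have "openin T {t':topspace T. f t':?X}" using f unfolding continuous_map_def by blast
   moreover have "t:{t':topspace T. f t':?X}" using t S W by auto
   ultimately show "eventually (%i. \<forall>z\<in>C. iter_deriv n (%y. ev (f i) c (cinv c y)) (fst z) (snd z) -
     iter_deriv n (%y. ev (f t) c (cinv c y)) (fst z) (snd z):W) (atin T t)"
    unfolding eventually_atin by (intro disjI2 exI[of _ "{t':topspace T. f t':?X}"]) auto
  qed
 qed
qed

text \<open>A subbasic set is centred at some s and not at f t. In place of a triangle inequality,
  the differences to s converge continuously to the difference of f t and s, which lies in the open
  set W; compactness makes this uniform.\<close>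

lemma continuous_map_cinf_topI:
 assumes S: "!!t. t:topspace T==>f t:S" and sm: "!!s c. s:S==>c:A==>smooth_on (cimg c) (%y. ev s c (cinv c y))" and A: "A \<noteq> {}"
  and cc: "!!t c. t:topspace T==>c:A ==>
   cconv (atin T t) (cimg c) (%t y. ev (f t) c (cinv c y)) (%y. ev (f t) c (cinv c y))" shows "continuous_map T (cinf_top A S ev) f"
 unfolding cinf_top_def continuous_on_generated_topo_iff
proof (intro conjI allI impI)
 let ?B = "{{s:S. \<forall>(x, h)\<in>C. iter_deriv n (%y. ev s c (cinv c y)) x h
           - iter_deriv n (%y. ev t c (cinv c y)) x h:W} | t c n C W.
   t:S\<and>c:A\<and>compact C\<and>C\<subseteq>cimg c\<times>UNIV\<and>open W\<and>0:W}"
 show "f ` topspace T\<subseteq>\<Union>?B" using topspace_cinf_top[OF A, of S ev] S unfolding cinf_top_def topology_generated_by_topspace by auto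
 fix U assume "U:?B"
 then obtain s c n C W where U: "U = {s':S. \<forall>(x, h)\<in>C. iter_deriv n (%y. ev s' c (cinv c y)) x h
   - iter_deriv n (%y. ev s c (cinv c y)) x h:W}" and *: "s:S" "c:A" "compact C" "C\<subseteq>cimg c\<times>UNIV" "open W" "0:W" by blast
 show "openin T (f -` U\<inter>topspace T)"
 proof (subst openin_subopen, intro ballI)
  fix t assume t: "t:f -` U\<inter>topspace T"
  let ?d = "%s z. iter_deriv n (%y. ev s c (cinv c y)) (fst z) (snd z)"
  have uc: "uconv (atin T t) C (%t. ?d (f t)) (?d (f t))" using cconv_uconv[OF cc *(3,4)] t * by auto
  have us: "uconv (atin T t) C (%_. ?d s) (?d s)" by (rule uconv_const[OF continuous_on_iter_deriv[OF sm[OF *(1,2)] *(4)]])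
  have "eventually (%t'. \<forall>z\<in>C. ?d (f t') z - ?d s z:W) (atin T t)"
  proof (rule uconv_prod_eventually[OF *(3)])
   fix z assume z: "z:C"
   have "((%p. ?d (f (fst p)) (snd p) - ?d s (snd p))\<longlongrightarrow>?d (f t) z - ?d s z) (atin T t \<times>\<^sub>F inf (nhds z) (principal C))"
    using uc us z unfolding uconv_def by (intro tendsto_diff) auto
   moreover have "?d (f t) z - ?d s z:W" using t z unfolding U by auto
   ultimately show "eventually (%p. ?d (f (fst p)) (snd p) - ?d s (snd p):W) (atin T t \<times>\<^sub>F inf (nhds z) (principal C))"
    using *(5) by (auto simp: tendsto_def)
  qed
  then obtain V where V: "openin T V" "t:V" "\<forall>t'\<in>V - {t}. \<forall>z\<in>C. ?d (f t') z - ?d s z:W"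
   using t unfolding eventually_atin by auto
  have "V\<subseteq>f -` U\<inter>topspace T"
  proof
   fix t' assume t': "t':V"
   then have "t':topspace T" using V(1) openin_subset by blast
   moreover have "f t':U"
   proof (cases "t' = t")
    case False
    then have "\<forall>z\<in>C. ?d (f t') z - ?d s z:W" using V(3) t' by blast
    then show ?thesis using S[OF \<open>t':topspace T\<close>] by (simp add: U case_prod_unfold)
   qed (use t in auto)
   ultimately show "t':f -` U\<inter>topspace T" by simp
  qed
  then show "\<exists>V. openin T V\<and>t:V\<and>V\<subseteq>f -` U\<inter>topspace T" using V by blast
 qed
qed

section \<open>Second order calculus in coordinates\<close>

lemma ddir_split:
 assumes "smooth_on V T" "open V" "(x, w):V" shows "ddir T (x, w) (v, u) = ddir (%y. T (y, w)) x v + ddir (%s. T (x, s)) w u"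
proof -
 have "ddir T (x, w) ((v, 0) + (0, u)) = ddir T (x, w) (v, 0) + ddir T (x, w) (0, u)" by (rule linear_add[OF ddir_linear[OF assms]])
 moreover have "ddir T (x, w) (v, 0) = ddir (%y. T (y, w)) x v" by (simp add: ddir_def dquot_def[abs_def])
 moreover have "ddir T (x, w) (0, u) = ddir (%s. T (x, s)) w u" by (simp add: ddir_def dquot_def[abs_def])
 ultimately show ?thesis by simp
qed

text \<open>The tangent map of f is differentiated separately in the point and in the direction, and
  in the direction it is linear.\<close>

lemma ddir_of_ddir:
 assumes f: "smooth_on V f" "open V" and g: "smooth_on U g" and w: "smooth_on U w" and U: "open U" and gV: "!!x. x:U==>g x:V" and x: "x:U"
 shows "ddir (%x. ddir f (g x) (w x)) x v
  = ddir (%y. ddir f y (w x)) (g x) (ddir g x v) + ddir f (g x) (ddir w x v)"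
proof -
 have V: "open (V\<times>(UNIV :: 'a set))" using f by (simp add: open_Times)
 have "ddir (%x. (%z. ddir f (fst z) (snd z)) (g x, w x)) x v =
  ddir (%z. ddir f (fst z) (snd z)) (g x, w x) (ddir (%x. (g x, w x)) x v)"
  by (rule ddir_compose[OF smooth_on_tangent[OF f] V smooth_on_Pair[OF g w U] U]) (use gV x in auto)
 also have "\<dots> = ddir (%z. ddir f (fst z) (snd z)) (g x, w x) (ddir g x v, ddir w x v)" by (simp add: ddir_Pair[OF g w U x])
 also have "\<dots> = ddir (%y. ddir f y (w x)) (g x) (ddir g x v) + ddir (%s. ddir f (g x) s) (w x) (ddir w x v)"
  using ddir_split[OF smooth_on_tangent[OF f] V, of "g x" "w x"] gV x by simp
 also have "ddir (%s. ddir f (g x) s) (w x) (ddir w x v) = ddir f (g x) (ddir w x v)" by (rule ddir_linear_eq[OF ddir_linear[OF f gV[OF x]]])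
 finally show ?thesis by simp
qed

lemma ddir_of_ddir_id:
 assumes f: "smooth_on U f" and w: "smooth_on U w" and U: "open U" and x: "x:U"
 shows "ddir (%x. ddir f x (w x)) x v = ddir (%y. ddir f y (w x)) x v + ddir f x (ddir w x v)"
 using ddir_of_ddir[OF f U smooth_on_id w U _ x] ddir_linear_eq[of "%x. x" x v] by (simp add: linear_iff)

section \<open>Brackets of vector fields in coordinates\<close>

definition lbr :: "('e::lcs=>'e)=>('e=>'e)=>'e=>'e" where
 "lbr X Y x = ddir Y x (X x) - ddir X x (Y x)"

lemma smooth_on_lbr:
 assumes "smooth_on U X" "smooth_on U Y" "open U" shows "smooth_on U (lbr X Y)" unfolding lbr_def[abs_def]
 by (rule smooth_on_diff[OF smooth_on_ddir_compose[OF assms(2,3) smooth_on_id assms(1,3)]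
    smooth_on_ddir_compose[OF assms(1,3) smooth_on_id assms(2,3)] assms(3)]) auto

text \<open>Differentiating the relation between X' and X produces a second derivative of \<phi> on
  X and Y. It is symmetric and cancels in the commutator.\<close>

lemma lbr_related:
 assumes \<phi>: "smooth_on U \<phi>" "open U" "!!x. x:U==>\<phi> x:V" and V: "open V"
  and s: "smooth_on U X" "smooth_on U Y" "smooth_on V X'" "smooth_on V Y'" and X: "!!x. x:U==>X' (\<phi> x) = ddir \<phi> x (X x)"
  and Y: "!!x. x:U==>Y' (\<phi> x) = ddir \<phi> x (Y x)" and x: "x:U" shows "lbr X' Y' (\<phi> x) = ddir \<phi> x (lbr X Y x)"
proof -
 have *: "ddir Z' (\<phi> x) (ddir \<phi> x v) = ddir (%y. ddir \<phi> y (Z x)) x v + ddir \<phi> x (ddir Z x v)"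
  if "smooth_on U Z" "smooth_on V Z'" "!!x. x:U==>Z' (\<phi> x) = ddir \<phi> x (Z x)" for Z Z' v
 proof -
  have "ddir Z' (\<phi> x) (ddir \<phi> x v) = ddir (%x. Z' (\<phi> x)) x v" by (rule ddir_compose[OF that(2) V \<phi> x, symmetric])
  also have "\<dots> = ddir (%x. ddir \<phi> x (Z x)) x v" by (rule ddir_cong[OF \<phi>(2) x that(3)])
  finally show ?thesis using ddir_of_ddir_id[OF \<phi>(1) that(1) \<phi>(2) x] by simp
 qed
 have "lbr X' Y' (\<phi> x) = ddir Y' (\<phi> x) (ddir \<phi> x (X x)) - ddir X' (\<phi> x) (ddir \<phi> x (Y x))" by (simp add: lbr_def X Y x)
 also have "\<dots> = ddir \<phi> x (ddir Y x (X x)) - ddir \<phi> x (ddir X x (Y x))"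
  using *[OF s(1,3) X, of "Y x"] *[OF s(2,4) Y, of "X x"] ddir_ddir_commute[OF \<phi>(1,2) x, of "X x" "Y x"] by simp
 finally show ?thesis using linear_diff[OF ddir_linear[OF \<phi>(1,2) x]] by (simp add: lbr_def)
qed

lemma ddir_lbr:
 assumes "smooth_on U X" "smooth_on U Y" "smooth_on U f" "open U" "x:U"
 shows "ddir f x (lbr X Y x) = ddir (%x. ddir f x (Y x)) x (X x) - ddir (%x. ddir f x (X x)) x (Y x)"
 unfolding lbr_def linear_diff[OF ddir_linear[OF assms(3-5)]]
  ddir_of_ddir_id[OF assms(3,1,4,5)] ddir_of_ddir_id[OF assms(3,2,4,5)]
  ddir_ddir_commute[OF assms(3-5), of "X x" "Y x"] by simp

lemma lbr_jacobi:
 assumes s: "smooth_on U X" "smooth_on U Y" "smooth_on U Z" and U: "open U" "x:U"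
 shows "lbr X (lbr Y Z) x + lbr Y (lbr Z X) x + lbr Z (lbr X Y) x = 0"
proof -
 have d: "ddir (lbr P Q) x v = ddir (%y. ddir Q y (P x)) x v + ddir Q x (ddir P x v)
  - ddir (%y. ddir P y (Q x)) x v - ddir P x (ddir Q x v)" if "smooth_on U P" "smooth_on U Q" for P Q v
 proof -
  have "smooth_on U (%x. ddir Q x (P x))" "smooth_on U (%x. ddir P x (Q x))"
   by (rule smooth_on_ddir_compose[OF that(2) U(1) smooth_on_id that(1) U(1)], assumption)
    (rule smooth_on_ddir_compose[OF that(1) U(1) smooth_on_id that(2) U(1)], assumption)
  then have "ddir (lbr P Q) x v = ddir (%x. ddir Q x (P x)) x v - ddir (%x. ddir P x (Q x)) x v"
   unfolding lbr_def[abs_def] by (rule ddir_diff[OF _ _ U])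
  then show ?thesis using ddir_of_ddir_id[OF that(2,1) U] ddir_of_ddir_id[OF that U] by (simp add: algebra_simps)
 qed
 note l = linear_diff[OF ddir_linear[OF s(1) U]] linear_diff[OF ddir_linear[OF s(2) U]] linear_diff[OF ddir_linear[OF s(3) U]]
 show ?thesis unfolding lbr_def[of _ "lbr _ _"] d[OF s(1,2)] d[OF s(2,3)] d[OF s(3,1)] unfolding lbr_def l
  using ddir_ddir_commute[OF s(1) U, of "Y x" "Z x"] ddir_ddir_commute[OF s(2) U, of "X x" "Z x"]
   ddir_ddir_commute[OF s(3) U, of "X x" "Y x"] by (simp add: algebra_simps)
qed

section \<open>Manifolds\<close>

lemma cmap_cinv: "y:cimg c==>cmap c (cinv c y) = y" unfolding cimg_def cinv_def by (rule f_inv_into_f)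

lemma cinv_cdom: "y:cimg c==>cinv c y:cdom c" unfolding cimg_def cinv_def by (rule inv_into_into)

lemma cmap_cimg: "p:cdom c==>cmap c p:cimg c" unfolding cimg_def by simp

context
 fixes A :: "('m::t2_space, 'e::lcs) chart set"
 assumes A: "manifold A"
begin

lemma ex_chart: "\<exists>c\<in>A. p:cdom c" using A unfolding manifold_def by blast

lemma atlas_nonempty: "A \<noteq> {}" using ex_chart by blast

lemma open_cdom: "c:A==>open (cdom c)" and open_cimg: "c:A==>open (cimg c)" and cmap_inj: "c:A==>inj_on (cmap c) (cdom c)"
 and continuous_cmap: "c:A==>continuous_on (cdom c) (cmap c)" and continuous_cinv: "c:A==>continuous_on (cimg c) (cinv c)"
 using A unfolding manifold_def homeomorphism_def by blast+

lemma cinv_cmap: "c:A==>p:cdom c==>cinv c (cmap c p) = p" unfolding cinv_def using cmap_inj by (rule inv_into_f_f)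

lemma mem_cmap_image: "c:A==>y:cmap c ` (cdom c\<inter>W)\<longleftrightarrow>y:cimg c\<and>cinv c y:W"
proof
 assume c: "c:A" and "y:cmap c ` (cdom c\<inter>W)"
 then obtain p where "y = cmap c p" "p:cdom c" "p:W" by blast
 then show "y:cimg c\<and>cinv c y:W" using cinv_cmap[OF c, of p] cmap_cimg[of p c] by simp
next
 assume "y:cimg c\<and>cinv c y:W"
 then show "y:cmap c ` (cdom c\<inter>W)" by (intro image_eqI[of _ _ "cinv c y"]) (simp_all add: cmap_cinv cinv_cdom)
qed

lemma cmap_image_eq: "c:A==>cmap c ` (cdom c\<inter>W) = {y:cimg c. cinv c y:W}" using mem_cmap_image by blast

lemma open_cmap_image: "c:A==>open W==>open (cmap c ` (cdom c\<inter>W))" unfolding cmap_image_eq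
 using continuous_on_open_vimage[OF open_cimg, of c "cinv c"] continuous_cinv by (simp add: vimage_def Int_def conj_commute)

lemma transition_smooth:
 "c:A==>d:A==>smooth_on (cmap c ` (cdom c\<inter>cdom d)) (%x. cmap d (cinv c x))" using A unfolding manifold_def by blast

end

lemma lin_chart [simp]: "cinv (UNIV, %x. x) = (%x. x)" "cimg (UNIV, %x. x) = UNIV" unfolding cinv_def cimg_def by (auto simp: fun_eq_iff inv_into_def)

lemma manifold_lin: "manifold (lin_atlas :: ('e::lcs, 'e) chart set)" unfolding manifold_def lin_atlas_def
 by (auto simp: homeomorphism_def smooth_on_id intro!: continuous_intros)

lemma smooth_map_onD:
 assumes "smooth_map_on U A B f" shows smooth_map_continuous: "continuous_on U f" and smooth_map_rep: "c:A==>d:B ==>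
   smooth_on (cmap c ` (cdom c\<inter>(U\<inter>f -` cdom d))) (%x. cmap d (f (cinv c x)))"
 using assms unfolding smooth_map_on_def by (auto simp: Int_assoc)

lemma smooth_map_preimage_open:
 assumes "smooth_map_on U A B f" "open U" "open V" shows "open (U\<inter>f -` V)"
 using continuous_open_preimage[OF smooth_map_continuous[OF assms(1)] assms(2,3)] .

lemma smooth_map_on_subset: "smooth_map_on U A B f==>V\<subseteq>U==>smooth_map_on V A B f" unfolding smooth_map_on_def
proof (intro conjI ballI)
 fix c d assume *: "continuous_on U f\<and>(\<forall>c\<in>A. \<forall>d\<in>B. smooth_on (cmap c ` (cdom c\<inter>U\<inter>f -` cdom d))
              (%x. cmap d (f (cinv c x))))" "V\<subseteq>U" "c:A" "d:B"
 then have "smooth_on (cmap c ` (cdom c\<inter>U\<inter>f -` cdom d)) (%x. cmap d (f (cinv c x)))" by blast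
 then show "smooth_on (cmap c ` (cdom c\<inter>V\<inter>f -` cdom d)) (%x. cmap d (f (cinv c x)))" by (rule smooth_on_subset) (use *(2) in blast)
qed (blast intro: continuous_on_subset)

lemma smooth_map_on_comp:
 assumes A: "manifold A" and B: "manifold B" and f: "smooth_map_on U A B f" "open U"
  and g: "smooth_map_on V B C g" "open V" and fV: "f ` U\<subseteq>V" and C: "manifold C" shows "smooth_map_on U A C (%x. g (f x))"
 unfolding smooth_map_on_def
proof (intro conjI ballI)
 show "continuous_on U (%x. g (f x))" by (rule continuous_on_compose2[OF smooth_map_continuous[OF g(1)] smooth_map_continuous[OF f(1)] fV])
 fix c e assume c: "c:A" and e: "e:C"
 show "smooth_on (cmap c ` (cdom c\<inter>U\<inter>(%x. g (f x)) -` cdom e)) (%x. cmap e (g (f (cinv c x))))"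
 proof (rule smooth_on_local)
  fix x assume "x:cmap c ` (cdom c\<inter>U\<inter>(%x. g (f x)) -` cdom e)"
  then obtain p where p: "x = cmap c p" "p:cdom c" "p:U" "g (f p):cdom e" by auto
  obtain d where d: "d:B" "f p:cdom d" using ex_chart[OF B] by blast
  let ?W2 = "V\<inter>g -` cdom e"
  have W2: "open (cdom d\<inter>?W2)" using smooth_map_preimage_open[OF g open_cdom[OF C e]] open_cdom[OF B d(1)] by auto
  let ?W = "U\<inter>f -` (cdom d\<inter>?W2)"
  have W: "open ?W" using smooth_map_preimage_open[OF f W2] .
  let ?V = "cmap c ` (cdom c\<inter>?W)"
  have V: "open ?V" using open_cmap_image[OF A c W] .
  have "smooth_on ?V (%x. (%y. cmap e (g (cinv d y))) (cmap d (f (cinv c x))))"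
  proof (rule smooth_on_compose[OF smooth_map_rep[OF g(1) d(1) e] open_cmap_image[OF B d(1)]])
   show "open ?W2" using smooth_map_preimage_open[OF g open_cdom[OF C e]] .
   show "smooth_on ?V (%x. cmap d (f (cinv c x)))" by (rule smooth_on_subset[OF smooth_map_rep[OF f(1) c d(1)]]) auto
   fix x assume "x:?V"
   then have "cinv c x:?W" using mem_cmap_image[OF A c] by blast
   then show "cmap d (f (cinv c x)):cmap d ` (cdom d\<inter>?W2)" by auto
  qed (rule V)
  then have "smooth_on ?V (%x. cmap e (g (f (cinv c x))))"
  proof (rule smooth_on_cong[OF _ V])
   fix x assume "x:?V"
   then have "cinv c x:?W" using mem_cmap_image[OF A c] by blast
   then show "cmap e (g (cinv d (cmap d (f (cinv c x))))) = cmap e (g (f (cinv c x)))" using cinv_cmap[OF B d(1)] by auto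
  qed
  moreover have "x:?V" using p d fV by auto
  ultimately show "\<exists>V. open V\<and>x:V\<and>smooth_on V (%x. cmap e (g (f (cinv c x))))" using V by blast
 qed
qed

lemma smooth_map_on_cmap:
 assumes "manifold A" "c:A" shows "smooth_map_on (cdom c) A lin_atlas (cmap c)" unfolding smooth_map_on_def lin_atlas_def
 using transition_smooth[OF assms(1) _ assms(2)] continuous_cmap[OF assms] by auto

lemma smooth_map_on_lin_iff:
 "smooth_map_on U lin_atlas lin_atlas f\<longleftrightarrow>smooth_on U f"
 unfolding smooth_map_on_def lin_atlas_def by (auto dest: smooth_on_continuous)

lemma smooth_map_on_const: "smooth_map_on U A B (%_. b)" unfolding smooth_map_on_def by (auto intro: smooth_on_const)

lemma smooth_map_on_id: "manifold A==>smooth_map_on U A A (%x. x)" unfolding smooth_map_on_def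
 by (auto intro!: continuous_intros smooth_on_subset[OF transition_smooth])

lemma smooth_map_on_cong:
 assumes "manifold A" "smooth_map_on U A B f" "open U" "!!x. x:U==>f x = g x" "manifold B" shows "smooth_map_on U A B g" unfolding smooth_map_on_def
proof (intro conjI ballI)
 show "continuous_on U g" using smooth_map_continuous[OF assms(2)] assms(4) by (rule continuous_on_eq)
 fix c d assume c: "c:A" and d: "d:B"
 have *: "cdom c\<inter>U\<inter>g -` cdom d = cdom c\<inter>(U\<inter>f -` cdom d)" using assms(4) by auto
 have o: "open (cmap c ` (cdom c\<inter>(U\<inter>f -` cdom d)))"
  by (rule open_cmap_image[OF assms(1) c smooth_map_preimage_open[OF assms(2,3) open_cdom[OF assms(5) d]]])
 show "smooth_on (cmap c ` (cdom c\<inter>U\<inter>g -` cdom d)) (%x. cmap d (g (cinv c x)))" unfolding *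
 proof (rule smooth_on_cong[OF smooth_map_rep[OF assms(2) c d] o])
  fix x assume "x:cmap c ` (cdom c\<inter>(U\<inter>f -` cdom d))"
  then show "cmap d (f (cinv c x)) = cmap d (g (cinv c x))" using mem_cmap_image[OF assms(1) c] assms(4) by auto
 qed
qed

lemma smooth_map_on_local:
 assumes A: "manifold A" and B: "manifold B" and l: "!!p. p:U==>\<exists>V. open V\<and>p:V\<and>smooth_map_on V A B f" shows "smooth_map_on U A B f"
 unfolding smooth_map_on_def
proof (intro conjI ballI)
 show "continuous_on U f" unfolding continuous_on_def
 proof
  fix p assume "p:U"
  then obtain V where "open V" "p:V" "smooth_map_on V A B f" using l by blast
  then have "isCont f p" using smooth_map_continuous continuous_on_eq_continuous_at by blast
  then show "(f\<longlongrightarrow>f p) (at p within U)" unfolding isCont_def by (rule tendsto_within_subset) auto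
 qed
 fix c d assume c: "c:A" and d: "d:B"
 show "smooth_on (cmap c ` (cdom c\<inter>U\<inter>f -` cdom d)) (%x. cmap d (f (cinv c x)))"
 proof (rule smooth_on_local)
  fix x assume "x:cmap c ` (cdom c\<inter>U\<inter>f -` cdom d)"
  then obtain p where p: "x = cmap c p" "p:cdom c" "p:U" "f p:cdom d" by auto
  obtain V where V: "open V" "p:V" "smooth_map_on V A B f" using l p by blast
  show "\<exists>V. open V\<and>x:V\<and>smooth_on V (%x. cmap d (f (cinv c x)))" using smooth_map_rep[OF V(3) c d] p V
    open_cmap_image[OF A c smooth_map_preimage_open[OF V(3,1) open_cdom[OF B d]]]
   by (intro exI[of _ "cmap c ` (cdom c\<inter>(V\<inter>f -` cdom d))"]) auto
 qed
qed

section \<open>Products of manifolds\<close>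

abbreviation pchart :: "('m, 'e) chart=>('n, 'f) chart=>('m\<times>'n, 'e\<times>'f) chart" where
 "pchart c d \<equiv> (cdom c\<times>cdom d, map_prod (cmap c) (cmap d))"

lemma pchart_in: "c:A==>d:B==>pchart c d:prod_atlas A B" unfolding prod_atlas_def by blast

lemma cimg_pchart: "cimg (pchart c d) = cimg c\<times>cimg d" by (auto simp: cimg_def)

lemma cinv_pchart:
 assumes "manifold A" "c:A" "manifold B" "d:B" "z:cimg c\<times>cimg d" shows "cinv (pchart c d) z = (cinv c (fst z), cinv d (snd z))"
proof -
 have "inj_on (map_prod (cmap c) (cmap d)) (cdom c\<times>cdom d)" using map_prod_inj_on cmap_inj[OF assms(1,2)] cmap_inj[OF assms(3,4)] by blast
 moreover have "(cinv c (fst z), cinv d (snd z)):cdom c\<times>cdom d"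
  "map_prod (cmap c) (cmap d) (cinv c (fst z), cinv d (snd z)) = z" using assms(5) by (auto simp: cinv_cdom cmap_cinv)
 ultimately show ?thesis unfolding cinv_def fst_conv snd_conv by (rule inv_into_f_eq)
qed

lemma manifold_prod:
 assumes A: "manifold A" and B: "manifold B" shows "manifold (prod_atlas A B)" unfolding manifold_def
proof (intro conjI ballI)
 show "(\<Union>c\<in>prod_atlas A B. cdom c) = UNIV"
 proof -
  have "z:(\<Union>c\<in>prod_atlas A B. cdom c)" for z
  proof -
   obtain c d where "c:A" "fst z:cdom c" "d:B" "snd z:cdom d" using ex_chart[OF A] ex_chart[OF B] by blast
   then show ?thesis by (intro UN_I[OF pchart_in, of c A d B]) (auto simp: mem_Times_iff)
  qed
  then show ?thesis by auto
 qed
 fix c assume "c:prod_atlas A B"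
 then obtain c1 c2 where c: "c = pchart c1 c2" "c1:A" "c2:B" unfolding prod_atlas_def by blast
 note ci = cinv_pchart[OF A c(2) B c(3)]
 show o: "open (cdom c)" "open (cimg c)" using open_cdom[OF A c(2)] open_cdom[OF B c(3)] open_cimg[OF A c(2)] open_cimg[OF B c(3)]
  by (simp_all only: c cimg_pchart) (auto simp: open_Times)
 show "inj_on (cmap c) (cdom c)" using map_prod_inj_on cmap_inj[OF A c(2)] cmap_inj[OF B c(3)] c by (simp only: fst_conv snd_conv) blast
 have c1: "continuous_on (cdom c) (%z. (cmap c1 (fst z), cmap c2 (snd z)))"
  by (intro continuous_on_Pair continuous_on_compose2[OF continuous_cmap[OF A c(2)]]
   continuous_on_compose2[OF continuous_cmap[OF B c(3)]] continuous_intros) (auto simp: c)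
 have c2: "continuous_on (cimg c1\<times>cimg c2) (%z. (cinv c1 (fst z), cinv c2 (snd z)))"
  by (intro continuous_on_Pair continuous_on_compose2[OF continuous_cinv[OF A c(2)]]
   continuous_on_compose2[OF continuous_cinv[OF B c(3)]] continuous_intros) auto
 show "homeomorphism (cdom c) (cimg c) (cmap c) (cinv c)" unfolding homeomorphism_def
 proof (intro conjI ballI)
  show "continuous_on (cdom c) (cmap c)" using c1 by (simp add: c map_prod_def case_prod_unfold)
  show "continuous_on (cimg c) (cinv c)" unfolding c cimg_pchart by (rule continuous_on_eq[OF c2]) (simp only: ci)
  show 1: "cinv c (cmap c x) = x" if "x:cdom c" for x using that ci[of "cmap c x"] cinv_cmap[OF A c(2)] cinv_cmap[OF B c(3)]
   by (auto simp: c cmap_cimg)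
  show "cmap c (cinv c y) = y" if "y:cimg c" for y using that by (rule cmap_cinv)
  show "cmap c ` cdom c = cimg c" by (simp add: cimg_def)
  show "cinv c ` cimg c = cdom c"
  proof
   show "cinv c ` cimg c\<subseteq>cdom c" using cinv_cdom[of _ c] by blast
   show "cdom c\<subseteq>cinv c ` cimg c"
   proof
    fix x assume "x:cdom c"
    then show "x:cinv c ` cimg c" using 1[of x] cmap_cimg[of x c] by (intro image_eqI[of _ _ "cmap c x"]) simp_all
   qed
  qed
 qed
 fix d assume "d:prod_atlas A B"
 then obtain d1 d2 where d: "d = pchart d1 d2" "d1:A" "d2:B" unfolding prod_atlas_def by blast
 let ?U1 = "cmap c1 ` (cdom c1\<inter>cdom d1)" and ?U2 = "cmap c2 ` (cdom c2\<inter>cdom d2)"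
 have U: "cmap c ` (cdom c\<inter>cdom d) = ?U1\<times>?U2" unfolding c d by auto
 have oU: "open ?U1" "open ?U2" using open_cmap_image[OF A c(2) open_cdom[OF A d(2)]] open_cmap_image[OF B c(3) open_cdom[OF B d(3)]] by auto
 then have oU': "open (?U1\<times>?U2)" by (simp add: open_Times)
 have "smooth_on (?U1\<times>?U2) (%z. (cmap d1 (cinv c1 (fst z)), cmap d2 (cinv c2 (snd z))))"
  by (intro smooth_on_Pair oU' smooth_on_compose[OF transition_smooth[OF A c(2) d(2)] oU(1) smooth_on_fst oU']
   smooth_on_compose[OF transition_smooth[OF B c(3) d(3)] oU(2) smooth_on_snd oU']) auto
 then show "smooth_on (cmap c ` (cdom c\<inter>cdom d)) (%x. cmap d (cinv c x))" unfolding U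
 proof (rule smooth_on_cong[OF _ oU'])
  fix z assume "z:?U1\<times>?U2"
  then have "z:cimg c1\<times>cimg c2" by (auto simp: cmap_cimg)
  then show "(cmap d1 (cinv c1 (fst z)), cmap d2 (cinv c2 (snd z))) = cmap d (cinv c z)" using ci by (simp only: c(1) d(1) snd_conv) simp
 qed
qed

lemma smooth_map_on_Pair:
 assumes A: "manifold A" and U: "open U" and f: "smooth_map_on U A B f" and g: "smooth_map_on U A C g" and B: "manifold B" and C: "manifold C"
 shows "smooth_map_on U A (prod_atlas B C) (%x. (f x, g x))" unfolding smooth_map_on_def
proof (intro conjI ballI)
 show "continuous_on U (%x. (f x, g x))" by (intro continuous_on_Pair smooth_map_continuous[OF f] smooth_map_continuous[OF g])
 fix c d assume c: "c:A" and "d:prod_atlas B C"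
 then obtain d1 d2 where d: "d = pchart d1 d2" "d1:B" "d2:C" unfolding prod_atlas_def by blast
 let ?W = "(U\<inter>f -` cdom d1)\<inter>(U\<inter>g -` cdom d2)"
 have W: "open ?W" using smooth_map_preimage_open[OF f U open_cdom[OF B d(2)]] smooth_map_preimage_open[OF g U open_cdom[OF C d(3)]] by auto
 have eq: "cdom c\<inter>U\<inter>(%x. (f x, g x)) -` cdom d = cdom c\<inter>?W" unfolding d by auto
 have "smooth_on (cmap c ` (cdom c\<inter>?W)) (%x. (cmap d1 (f (cinv c x)), cmap d2 (g (cinv c x))))"
  by (intro smooth_on_Pair open_cmap_image[OF A c W] smooth_on_subset[OF smooth_map_rep[OF f c d(2)]]
   smooth_on_subset[OF smooth_map_rep[OF g c d(3)]]) auto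
 then show "smooth_on (cmap c ` (cdom c\<inter>U\<inter>(%x. (f x, g x)) -` cdom d)) (%x. cmap d (f (cinv c x), g (cinv c x)))"
  unfolding eq by (simp add: d)
qed

lemma smooth_map_on_fst:
 assumes A: "manifold A" and B: "manifold B" and U: "open U" shows "smooth_map_on U (prod_atlas A B) A fst" unfolding smooth_map_on_def
proof (intro conjI ballI)
 show "continuous_on U fst" by (intro continuous_intros)
 fix c e assume e: "e:A" and "c:prod_atlas A B"
 then obtain c1 c2 where c: "c = pchart c1 c2" "c1:A" "c2:B" unfolding prod_atlas_def by blast
 let ?V = "cmap c1 ` (cdom c1\<inter>cdom e)\<times>cimg c2"
 have oV: "open ?V" using open_cmap_image[OF A c(2) open_cdom[OF A e]] open_cimg[OF B c(3)] by (simp add: open_Times)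
 have "smooth_on ?V (%z. cmap e (cinv c1 (fst z)))"
  by (rule smooth_on_compose[OF transition_smooth[OF A c(2) e] open_cmap_image[OF A c(2) open_cdom[OF A e]] smooth_on_fst oV]) auto
 then have "smooth_on ?V (%z. cmap e (fst (cinv c z)))"
 proof (rule smooth_on_cong[OF _ oV])
  fix z assume "z:?V"
  then have "z:cimg c1\<times>cimg c2" by (auto simp: cmap_cimg)
  then show "cmap e (cinv c1 (fst z)) = cmap e (fst (cinv c z))" using cinv_pchart[OF A c(2) B c(3)] by (simp only: c(1)) simp
 qed
 then show "smooth_on (cmap c ` (cdom c\<inter>U\<inter>fst -` cdom e)) (%x. cmap e (fst (cinv c x)))"
  by (rule smooth_on_subset) (auto simp: c cmap_cimg)
qed

lemma smooth_map_on_snd: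
 assumes A: "manifold A" and B: "manifold B" and U: "open U" shows "smooth_map_on U (prod_atlas A B) B snd" unfolding smooth_map_on_def
proof (intro conjI ballI)
 show "continuous_on U snd" by (intro continuous_intros)
 fix c e assume e: "e:B" and "c:prod_atlas A B"
 then obtain c1 c2 where c: "c = pchart c1 c2" "c1:A" "c2:B" unfolding prod_atlas_def by blast
 let ?V = "cimg c1\<times>cmap c2 ` (cdom c2\<inter>cdom e)"
 have oV: "open ?V" using open_cmap_image[OF B c(3) open_cdom[OF B e]] open_cimg[OF A c(2)] by (simp add: open_Times)
 have "smooth_on ?V (%z. cmap e (cinv c2 (snd z)))"
  by (rule smooth_on_compose[OF transition_smooth[OF B c(3) e] open_cmap_image[OF B c(3) open_cdom[OF B e]] smooth_on_snd oV]) auto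
 then have "smooth_on ?V (%z. cmap e (snd (cinv c z)))"
 proof (rule smooth_on_cong[OF _ oV])
  fix z assume "z:?V"
  then have "z:cimg c1\<times>cimg c2" by (auto simp: cmap_cimg)
  then show "cmap e (cinv c2 (snd z)) = cmap e (snd (cinv c z))" using cinv_pchart[OF A c(2) B c(3)] by (simp only: c(1)) simp
 qed
 then show "smooth_on (cmap c ` (cdom c\<inter>U\<inter>snd -` cdom e)) (%x. cmap e (snd (cinv c x)))"
  by (rule smooth_on_subset) (auto simp: c cmap_cimg)
qed

section \<open>Tangent maps\<close>

definition smooth_at :: "('m::t2_space, 'e::lcs) chart set=>('n::t2_space, 'f::lcs) chart set=>('m=>'n)=>'m=>bool" where
 "smooth_at A B f p\<longleftrightarrow>(\<exists>U. open U\<and>p:U\<and>smooth_map_on U A B f)"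

lemma smooth_atI: "smooth_map_on U A B f==>open U==>p:U==>smooth_at A B f p" unfolding smooth_at_def by blast

lemma smooth_at_const: "smooth_at A B (%_. b) p" by (rule smooth_atI[OF smooth_map_on_const[of UNIV]]) auto

lemma smooth_at_id: "manifold A==>smooth_at A A (%x. x) p" by (rule smooth_atI[OF smooth_map_on_id[of _ UNIV]]) auto

lemma smooth_at_comp:
 assumes "manifold A" "manifold B" "manifold C" "smooth_at A B f p" "smooth_at B C g (f p)" shows "smooth_at A C (%x. g (f x)) p"
proof -
 obtain U V where U: "open U" "p:U" "smooth_map_on U A B f" and V: "open V" "f p:V" "smooth_map_on V B C g"
  using assms unfolding smooth_at_def by blast
 have o: "open (U\<inter>f -` V)" by (rule smooth_map_preimage_open[OF U(3,1) V(1)])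
 have "smooth_map_on (U\<inter>f -` V) A C (%x. g (f x))"
  by (rule smooth_map_on_comp[OF assms(1,2) smooth_map_on_subset[OF U(3)] o V(3,1) _ assms(3)]) auto
 then show ?thesis by (rule smooth_atI[OF _ o]) (use U V in auto)
qed

lemma smooth_at_Pair:
 assumes "manifold A" "manifold B" "manifold C" "smooth_at A B f p" "smooth_at A C g p" shows "smooth_at A (prod_atlas B C) (%x. (f x, g x)) p"
proof -
 obtain U V where U: "open U" "p:U" "smooth_map_on U A B f" and V: "open V" "p:V" "smooth_map_on V A C g"
  using assms unfolding smooth_at_def by blast
 have "smooth_map_on (U\<inter>V) A (prod_atlas B C) (%x. (f x, g x))"
  by (rule smooth_map_on_Pair[OF assms(1) _ smooth_map_on_subset[OF U(3)] smooth_map_on_subset[OF V(3)] assms(2,3)]) (use U V in auto)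
 then show ?thesis by (rule smooth_atI) (use U V in auto)
qed

lemma smooth_at_repE:
 assumes "manifold A" "manifold B" "smooth_at A B f p" "c:A" "d:B" "p:cdom c" "f p:cdom d"
 obtains W where "open W" "p:W" "W\<subseteq>cdom c\<inter>f -` cdom d" "open (cmap c ` W)"
  "smooth_on (cmap c ` W) (%x. cmap d (f (cinv c x)))" "smooth_map_on W A B f"
proof -
 obtain U where U: "open U" "p:U" "smooth_map_on U A B f" using assms unfolding smooth_at_def by blast
 let ?W = "cdom c\<inter>(U\<inter>f -` cdom d)"
 have o: "open (U\<inter>f -` cdom d)" by (rule smooth_map_preimage_open[OF U(3,1) open_cdom[OF assms(2,5)]])
 show thesis
 proof (rule that[of ?W])
  show "open ?W" using o open_cdom[OF assms(1,4)] by blast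
  show "open (cmap c ` ?W)" using open_cmap_image[OF assms(1,4) o] .
  show "smooth_on (cmap c ` ?W) (%x. cmap d (f (cinv c x)))" by (rule smooth_map_rep[OF U(3) assms(4,5)])
  show "smooth_map_on ?W A B f" by (rule smooth_map_on_subset[OF U(3)]) auto
 qed (use U assms in auto)
qed

lemma tang_cong:
 assumes "manifold A" "c:A" "p:cdom c" "open U" "p:U" "!!q. q:U==>f q = g q" shows "tang c d f p v = tang c d g p v" unfolding tang_def
 by (rule ddir_cong[OF open_cmap_image[OF assms(1,2,4)]])
  (use assms mem_cmap_image[OF assms(1,2)] in auto)

lemma tang_linear:
 assumes "manifold A" "manifold B" "smooth_at A B f p" "c:A" "d:B" "p:cdom c" "f p:cdom d" shows "linear (tang c d f p)"
proof -
 obtain W where "open W" "p:W" "W\<subseteq>cdom c\<inter>f -` cdom d" "open (cmap c ` W)"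
  "smooth_on (cmap c ` W) (%x. cmap d (f (cinv c x)))" using smooth_at_repE[OF assms] .
 then show ?thesis unfolding tang_def[abs_def] by (intro ddir_linear) auto
qed

lemma tang_comp:
 assumes A: "manifold A" and B: "manifold B" and C: "manifold C" and f: "smooth_at A B f p" and g: "smooth_at B C g (f p)"
  and c: "c:A" "p:cdom c" and d: "d:B" "f p:cdom d" and e: "e:C" "g (f p):cdom e"
 shows "tang c e (%x. g (f x)) p v = tang d e g (f p) (tang c d f p v)"
proof -
 obtain V where V: "open V" "f p:V" "V\<subseteq>cdom d\<inter>g -` cdom e" "open (cmap d ` V)"
  "smooth_on (cmap d ` V) (%x. cmap e (g (cinv d x)))" "smooth_map_on V B C g" using smooth_at_repE[OF B C g d(1) e(1) d(2) e(2)] .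
 obtain W where W: "open W" "p:W" "W\<subseteq>cdom c\<inter>f -` cdom d" "open (cmap c ` W)"
  "smooth_on (cmap c ` W) (%x. cmap d (f (cinv c x)))" "smooth_map_on W A B f" using smooth_at_repE[OF A B f c(1) d(1) c(2) d(2)] .
 let ?W = "W\<inter>f -` V"
 have o: "open ?W" by (rule smooth_map_preimage_open[OF W(6,1) V(1)])
 have "cdom c\<inter>?W = ?W" using W(3) by auto
 then have oi: "open (cmap c ` ?W)" using open_cmap_image[OF A c(1) o] by simp
 have mem: "cinv c x:?W" if "x:cmap c ` ?W" for x using that W(3) cinv_cmap[OF A c(1)] by auto
 have p: "cmap c p:cmap c ` ?W" using W V by auto
 have "tang c e (%x. g (f x)) p v = ddir (%x. (%y. cmap e (g (cinv d y))) (cmap d (f (cinv c x)))) (cmap c p) v" unfolding tang_def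
 proof (rule ddir_cong[OF oi p])
  fix x assume "x:cmap c ` ?W"
  then show "cmap e (g (f (cinv c x))) = cmap e (g (cinv d (cmap d (f (cinv c x)))))" using mem W(3) cinv_cmap[OF B d(1)] by fastforce
 qed
 also have "\<dots> = ddir (%y. cmap e (g (cinv d y))) (cmap d (f (cinv c (cmap c p)))) (ddir (%x. cmap d (f (cinv c x))) (cmap c p) v)"
 proof (rule ddir_compose[OF V(5,4) smooth_on_subset[OF W(5)] oi _ p])
  fix x assume "x:cmap c ` ?W"
  then show "cmap d (f (cinv c x)):cmap d ` V" using mem by auto
 qed auto
 finally show ?thesis by (simp add: tang_def cinv_cmap[OF A c])
qed

lemma tang_id:
 assumes "manifold A" "c:A" "p:cdom c" shows "tang c c (%x. x) p v = v"
proof -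
 have "tang c c (%x. x) p v = ddir (%x. x) (cmap c p) v"
  unfolding tang_def by (rule ddir_cong[OF open_cimg[OF assms(1,2)]]) (use assms in \<open>auto simp: cmap_cimg cmap_cinv\<close>)
 then show ?thesis using ddir_linear_eq[of "%x. x"] by (simp add: linear_iff)
qed

lemma tang_const: "tang c d (%_. b) p v = 0" by (simp add: tang_def ddir_const)

lemma tang_Pair:
 assumes A: "manifold A" and B: "manifold B" and C: "manifold C" and f: "smooth_at A B f p" and g: "smooth_at A C g p"
  and c: "c:A" "p:cdom c" and d: "d:B" "f p:cdom d" and e: "e:C" "g p:cdom e"
 shows "tang c (pchart d e) (%x. (f x, g x)) p v = (tang c d f p v, tang c e g p v)"
proof -
 obtain V where V: "open V" "p:V" "V\<subseteq>cdom c\<inter>g -` cdom e" "open (cmap c ` V)"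
  "smooth_on (cmap c ` V) (%x. cmap e (g (cinv c x)))" "smooth_map_on V A C g" using smooth_at_repE[OF A C g c(1) e(1) c(2) e(2)] .
 obtain W where W: "open W" "p:W" "W\<subseteq>cdom c\<inter>f -` cdom d" "open (cmap c ` W)"
  "smooth_on (cmap c ` W) (%x. cmap d (f (cinv c x)))" "smooth_map_on W A B f" using smooth_at_repE[OF A B f c(1) d(1) c(2) d(2)] .
 show ?thesis unfolding tang_def
  using ddir_Pair[OF smooth_on_subset[OF W(5), of "cmap c ` W\<inter>cmap c ` V"] smooth_on_subset[OF V(5)], of "cmap c p" v] W V by auto
qed

text \<open>The tangent map of \<mu> at (f p, g p) is linear, hence the sum of its restrictions to
  the two factors, and each restriction is the tangent map of \<mu> with one argument
  frozen.\<close>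

lemma tang_product_rule:
 assumes A: "manifold A" and B: "manifold B" and C: "manifold C" and D: "manifold D"
  and f: "smooth_at A B f p" and g: "smooth_at A C g p" and \<mu>: "smooth_at (prod_atlas B C) D \<mu> (f p, g p)"
  and c: "c:A" "p:cdom c" and d: "d:B" "f p:cdom d" and e: "e:C" "g p:cdom e" and k: "k:D" "\<mu> (f p, g p):cdom k"
 shows "tang c k (%x. \<mu> (f x, g x)) p v =
  tang d k (%y. \<mu> (y, g p)) (f p) (tang c d f p v) + tang e k (%z. \<mu> (f p, z)) (g p) (tang c e g p v)"
proof -
 note P = manifold_prod[OF B C]
 have de: "pchart d e:prod_atlas B C" "(f p, g p):cdom (pchart d e)" using d e by (auto simp: pchart_in)
 let ?T = "tang (pchart d e) k \<mu> (f p, g p)"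
 have 1: "tang c k (%x. \<mu> (f x, g x)) p v = ?T (tang c d f p v, tang c e g p v)"
  using tang_comp[OF A P D smooth_at_Pair[OF A B C f g] \<mu> c de k] tang_Pair[OF A B C f g c d e] by simp
 have lin: "linear ?T" by (rule tang_linear[OF P D \<mu> de(1) k(1) de(2) k(2)])
 have 2: "?T (u, 0) = tang d k (%y. \<mu> (y, g p)) (f p) u" for u
  using tang_comp[OF B P D smooth_at_Pair[OF B B C smooth_at_id[OF B] smooth_at_const] \<mu> d de k, of u]
   tang_Pair[OF B B C smooth_at_id[OF B, of "f p"] smooth_at_const[of _ _ "g p"] d d e, of u] tang_id[OF B d] by (simp add: tang_const)
 have 3: "?T (0, u) = tang e k (%z. \<mu> (f p, z)) (g p) u" for u
  using tang_comp[OF C P D smooth_at_Pair[OF C B C smooth_at_const smooth_at_id[OF C]] \<mu> e de k, of u]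
   tang_Pair[OF C B C smooth_at_const[of _ _ "f p"] smooth_at_id[OF C, of "g p"] e d e, of u] tang_id[OF C e] by (simp add: tang_const)
 show ?thesis using linear_add[OF lin, of "(tang c d f p v, 0)" "(0, tang c e g p v)"] by (simp add: 1 2 3)
qed

section \<open>Convergence of vector valued functions on manifolds\<close>

abbreviation lchart :: "('v, 'v) chart" where "lchart \<equiv> (UNIV, %x. x)"

lemma lchart_in [simp]: "lchart:lin_atlas" by (simp add: lin_atlas_def)

definition msm :: "('m::t2_space, 'e::lcs) chart set=>'m set=>('m=>'v::lcs)=>bool" where
 "msm A W f\<longleftrightarrow>(\<forall>c\<in>A. smooth_on (cmap c ` (cdom c\<inter>W)) (%y. f (cinv c y)))"

text \<open>All charts are quantified over, so that none is preferred; \<open>mcv_chart\<close>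
  shows that one chart containing W is enough.\<close>

definition mcv :: "('m::t2_space, 'e::lcs) chart set=>'i filter=>'m set=>('i=>'m=>'v::lcs)=>('m=>'v)=>bool" where
 "mcv A F W f l\<longleftrightarrow>eventually (%i. msm A W (f i)) F\<and>msm A W l \<and>
  (\<forall>c\<in>A. cconv F (cmap c ` (cdom c\<inter>W)) (%i y. f i (cinv c y)) (%y. l (cinv c y)))"

lemma msm_iff:
 assumes A: "manifold A" and W: "open W" shows "msm A W f\<longleftrightarrow>smooth_map_on W A lin_atlas f"
proof
 assume f: "msm A W f"
 have "continuous_on W f" unfolding continuous_on_def
 proof
  fix p assume p: "p:W"
  obtain c where c: "c:A" "p:cdom c" using ex_chart[OF A] by blast
  have o: "open (cdom c\<inter>W)" using open_cdom[OF A c(1)] W by auto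
  have "continuous_on (cdom c\<inter>W) (%q. f (cinv c (cmap c q)))"
  proof (rule continuous_on_compose2[where g = "%y. f (cinv c y)" and f = "cmap c" and t = "cmap c ` (cdom c\<inter>W)", OF smooth_on_continuous])
   show "smooth_on (cmap c ` (cdom c\<inter>W)) (%y. f (cinv c y))" using f c by (simp add: msm_def)
   show "continuous_on (cdom c\<inter>W) (cmap c)" by (rule continuous_on_subset[OF continuous_cmap[OF A c(1)]]) auto
  qed auto
  then have "continuous_on (cdom c\<inter>W) f" by (rule continuous_on_eq) (use cinv_cmap[OF A c(1)] in auto)
  then have "isCont f p" using o p c continuous_on_eq_continuous_at by blast
  then show "(f\<longlongrightarrow>f p) (at p within W)" unfolding isCont_def by (rule tendsto_within_subset) auto
 qed
 then show "smooth_map_on W A lin_atlas f" using f unfolding smooth_map_on_def msm_def lin_atlas_def by auto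
next
 assume "smooth_map_on W A lin_atlas f"
 from smooth_map_rep[OF this _ lchart_in] show "msm A W f" by (simp add: msm_def)
qed

lemma msm_subset: "msm A W f==>V\<subseteq>W==>msm A V f" unfolding msm_def by (meson image_mono Int_mono order_refl smooth_on_subset)

lemma msm_cong:
 assumes A: "manifold A" and "msm A W f" "open W" "!!p. p:W==>f p = g p" shows "msm A W g" unfolding msm_iff[OF A assms(3)]
 by (rule smooth_map_on_cong[OF A assms(2)[unfolded msm_iff[OF A assms(3)]] assms(3) assms(4) manifold_lin])

lemma msm_local:
 assumes A: "manifold A" and "!!p. p:W==>\<exists>V. open V\<and>p:V\<and>msm A V f" and "open W" shows "msm A W f"
 using smooth_map_on_local[OF A manifold_lin, of W f] assms(2) msm_iff[OF A] assms(3) by blast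

lemma msm_smooth_at: "manifold A==>msm A W f==>open W==>p:W==>smooth_at A lin_atlas f p" using msm_iff by (blast intro: smooth_atI)

lemma mcv_msm: "mcv A F W f l==>msm A W l" and mcv_ev_msm: "mcv A F W f l==>eventually (%i. msm A W (f i)) F"
 and mcv_cconv: "mcv A F W f l==>c:A==>cconv F (cmap c ` (cdom c\<inter>W)) (%i y. f i (cinv c y)) (%y. l (cinv c y))" by (simp_all add: mcv_def)

lemma mcv_bot: "mcv A bot W (f :: 'i=>_) l\<longleftrightarrow>msm A W l" by (auto simp: mcv_def cconv_bot msm_def)

lemma mcv_const: "msm A W l==>mcv A F W (%_. l) l" by (auto simp: mcv_def msm_def intro: cconv_const)

lemma mcv_subset: "mcv A F W f l==>V\<subseteq>W==>mcv A F V f l" unfolding mcv_def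
 by (meson msm_subset eventually_mono cconv_subset image_mono Int_mono order_refl)

lemma mcv_cong:
 assumes A: "manifold A" and f: "mcv A F W f l" "open W" and g: "eventually (%i. \<forall>p\<in>W. f i p = g i p) F" and m: "!!p. p:W==>l p = m p"
 shows "mcv A F W g m" unfolding mcv_def
proof (intro conjI ballI)
 show "eventually (%i. msm A W (g i)) F" using g mcv_ev_msm[OF f(1)] by eventually_elim (use msm_cong[OF A _ f(2)] in blast)
 show "msm A W m" by (rule msm_cong[OF A mcv_msm[OF f(1)] f(2) m])
 fix c assume c: "c:A"
 show "cconv F (cmap c ` (cdom c\<inter>W)) (%i y. g i (cinv c y)) (%y. m (cinv c y))"
 proof (rule cconv_cong[OF mcv_cconv[OF f(1) c] open_cmap_image[OF A c f(2)]])
  show "eventually (%i. \<forall>x\<in>cmap c ` (cdom c\<inter>W). f i (cinv c x) = g i (cinv c x)) F"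
   using g by eventually_elim (use mem_cmap_image[OF A c] in blast)
  show "l (cinv c x) = m (cinv c x)" if "x:cmap c ` (cdom c\<inter>W)" for x using that mem_cmap_image[OF A c] m by blast
 qed
qed

lemma mcv_local:
 assumes A: "manifold A" and W: "open W" and ev: "eventually (%i. msm A W (f i)) F"
  and l: "!!p. p:W==>\<exists>V. open V\<and>p:V\<and>mcv A F V f l" shows "mcv A F W f l" unfolding mcv_def
proof (intro conjI ballI ev)
 show "msm A W l"
 proof (rule msm_local[OF A _ W])
  fix p assume "p:W"
  from l[OF this] show "\<exists>V. open V\<and>p:V\<and>msm A V l" by (auto dest: mcv_msm)
 qed
 fix c assume c: "c:A"
 show "cconv F (cmap c ` (cdom c\<inter>W)) (%i y. f i (cinv c y)) (%y. l (cinv c y))"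
 proof (rule cconv_local)
  show "eventually (%i. smooth_on (cmap c ` (cdom c\<inter>W)) (%y. f i (cinv c y))) F" using ev by eventually_elim (simp add: msm_def c)
  fix x assume "x:cmap c ` (cdom c\<inter>W)"
  then obtain p where p: "x = cmap c p" "p:cdom c" "p:W" by blast
  then obtain V where V: "open V" "p:V" "mcv A F V f l" using l by blast
  show "\<exists>V. open V\<and>x:V\<and>cconv F V (%i y. f i (cinv c y)) (%y. l (cinv c y))"
   using open_cmap_image[OF A c V(1)] mcv_cconv[OF V(3) c] p V by blast
 qed
qed

lemma mcv_pullback:
 fixes f :: "'i=>'n::t2_space=>'v::lcs"
 assumes A: "manifold A" and B: "manifold B" and f: "mcv B F V f l" "open V"
  and \<phi>: "smooth_map_on W A B \<phi>" "open W" "\<phi> ` W\<subseteq>V" shows "mcv A F W (%i p. f i (\<phi> p)) (%p. l (\<phi> p))"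
 unfolding mcv_def
proof (intro conjI ballI)
 have *: "msm A W (%p. g (\<phi> p))" if "msm B V g" for g :: "'n=>'v"
  using smooth_map_on_comp[OF A B \<phi>(1,2) _ f(2) \<phi>(3) manifold_lin] that msm_iff[OF B f(2)] msm_iff[OF A \<phi>(2)] by blast
 show ev: "eventually (%i. msm A W (%p. f i (\<phi> p))) F" using mcv_ev_msm[OF f(1)] by eventually_elim (rule *)
 show "msm A W (%p. l (\<phi> p))" using *[OF mcv_msm[OF f(1)]] .
 fix c assume c: "c:A"
 show "cconv F (cmap c ` (cdom c\<inter>W)) (%i y. f i (\<phi> (cinv c y))) (%y. l (\<phi> (cinv c y)))"
 proof (rule cconv_local)
  show "eventually (%i. smooth_on (cmap c ` (cdom c\<inter>W)) (%y. f i (\<phi> (cinv c y)))) F" using ev by eventually_elim (simp add: msm_def c)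
  fix x assume "x:cmap c ` (cdom c\<inter>W)"
  then obtain p where p: "x = cmap c p" "p:cdom c" "p:W" by blast
  obtain d where d: "d:B" "\<phi> p:cdom d" using ex_chart[OF B] by blast
  let ?O = "W\<inter>\<phi> -` cdom d"
  have O: "open ?O" by (rule smooth_map_preimage_open[OF \<phi>(1,2) open_cdom[OF B d(1)]])
  let ?V = "cmap c ` (cdom c\<inter>?O)"
  have mem: "cinv c y:?O" if "y:?V" for y using that mem_cmap_image[OF A c] by blast
  have "cconv F ?V (%i y. f i (cinv d (cmap d (\<phi> (cinv c y))))) (%y. l (cinv d (cmap d (\<phi> (cinv c y)))))"
  proof (rule cconv_inner[OF mcv_cconv[OF f(1) d(1)] open_cmap_image[OF B d(1) f(2)] smooth_map_rep[OF \<phi>(1) c d(1)] open_cmap_image[OF A c O]])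
   fix y assume "y:?V"
   from mem[OF this] show "cmap d (\<phi> (cinv c y)):cmap d ` (cdom d\<inter>V)" using \<phi>(3) by auto
  qed
  then have "cconv F ?V (%i y. f i (\<phi> (cinv c y))) (%y. l (\<phi> (cinv c y)))"
   by (rule cconv_cong[OF _ open_cmap_image[OF A c O]]) (use mem cinv_cmap[OF B d(1)] in auto)
  moreover have "x:?V" using p d by auto
  ultimately show "\<exists>V. open V\<and>x:V\<and>cconv F V (%i y. f i (\<phi> (cinv c y))) (%y. l (\<phi> (cinv c y)))"
   using open_cmap_image[OF A c O] by blast
 qed
qed

lemma mcv_lin: "mcv lin_atlas F V g l\<longleftrightarrow>cconv F V g l" unfolding mcv_def msm_def by (auto simp: lin_atlas_def cconv_def)

text \<open>A chart is a smooth map into its model space, where this convergence is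
  \<open>cconv\<close>; pulling back along the chart returns the statement on W and hence in every
  other chart.\<close>

lemma mcv_chart:
 assumes A: "manifold A" and c: "c:A" and W: "open W" "W\<subseteq>cdom c" and f: "cconv F (cmap c ` W) (%i y. f i (cinv c y)) (%y. l (cinv c y))"
 shows "mcv A F W f l"
proof -
 have eq: "cdom c\<inter>W = W" using W by auto
 have o: "open (cmap c ` W)" using open_cmap_image[OF A c W(1)] by (simp add: eq)
 have "mcv A F W (%i p. f i (cinv c (cmap c p))) (%p. l (cinv c (cmap c p)))"
  by (rule mcv_pullback[OF A manifold_lin _ o smooth_map_on_subset[OF smooth_map_on_cmap[OF A c] W(2)] W(1)])
   (use f in \<open>auto simp: mcv_lin\<close>)
 then show ?thesis by (rule mcv_cong[OF A _ W(1)]) (use W cinv_cmap[OF A c] in \<open>auto intro!: always_eventually\<close>)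
qed

lemma mcv_chartD:
 assumes A: "manifold A" and c: "c:A" and W: "W\<subseteq>cdom c" and f: "mcv A F W f l"
 shows "cconv F (cmap c ` W) (%i y. f i (cinv c y)) (%y. l (cinv c y))" using mcv_cconv[OF f c] W by (simp add: Int_absorb1)

lemma msm_chart:
 assumes "manifold A" "c:A" "open W" "W\<subseteq>cdom c" "smooth_on (cmap c ` W) (%y. l (cinv c y))" shows "msm A W l"
 using mcv_chart[OF assms(1-4), of "bot :: unit filter" "%_. l" l] assms(5) by (simp add: cconv_bot mcv_bot)

lemma msm_cmap: "manifold A==>c:A==>msm A (cdom c) (cmap c)" by (simp add: msm_iff open_cdom smooth_map_on_cmap)

lemma mcv_Pair:
 assumes A: "manifold A" and W: "open W" and f: "mcv A F W f l" and g: "mcv A F W g m" shows "mcv A F W (%i p. (f i p, g i p)) (%p. (l p, m p))"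
proof -
 have *: "msm A W (%p. (a p, b p))" if "msm A W a" "msm A W b" for a :: "_=>'d" and b :: "_=>'e"
  using that unfolding msm_def by (auto intro!: smooth_on_Pair open_cmap_image[OF A _ W])
 show ?thesis unfolding mcv_def
 proof (intro conjI ballI)
  show "eventually (%i. msm A W (%p. (f i p, g i p))) F" using mcv_ev_msm[OF f] mcv_ev_msm[OF g] by eventually_elim (rule *)
  show "msm A W (%p. (l p, m p))" using *[OF mcv_msm[OF f] mcv_msm[OF g]] .
 qed (intro cconv_Pair mcv_cconv[OF f] mcv_cconv[OF g] open_cmap_image[OF A _ W])
qed

lemma msm_Pair: "manifold A==>open W==>msm A W f==>msm A W g==>msm A W (%p. (f p, g p))"
 unfolding msm_def by (auto intro!: smooth_on_Pair open_cmap_image)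

lemma msm_outer:
 assumes A: "manifold A" and W: "open W" and f: "msm A W f" and G: "smooth_on V G" "open V" and V: "!!p. p:W==>f p:V" shows "msm A W (%p. G (f p))"
 unfolding msm_def
proof
 fix c assume c: "c:A"
 show "smooth_on (cmap c ` (cdom c\<inter>W)) (%y. G (f (cinv c y)))" by (rule smooth_on_compose[OF G _ open_cmap_image[OF A c W]])
   (use f c V mem_cmap_image[OF A c] in \<open>auto simp: msm_def\<close>)
qed

lemma mcv_outer:
 assumes A: "manifold A" and W: "open W" and f: "mcv A F W f l" and G: "smooth_on V G" "open V"
  and V: "!!p. p:W==>l p:V" "eventually (%i. \<forall>p\<in>W. f i p:V) F" shows "mcv A F W (%i p. G (f i p)) (%p. G (l p))" unfolding mcv_def
proof (intro conjI ballI)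
 show "eventually (%i. msm A W (%p. G (f i p))) F" using mcv_ev_msm[OF f] V(2) by eventually_elim (use msm_outer[OF A W _ G] in blast)
 show "msm A W (%p. G (l p))" by (rule msm_outer[OF A W mcv_msm[OF f] G V(1)])
 fix c assume c: "c:A"
 show "cconv F (cmap c ` (cdom c\<inter>W)) (%i y. G (f i (cinv c y))) (%y. G (l (cinv c y)))"
 proof (rule cconv_outer[OF mcv_cconv[OF f c] open_cmap_image[OF A c W] G])
  show "l (cinv c x):V" if "x:cmap c ` (cdom c\<inter>W)" for x using that V(1) mem_cmap_image[OF A c] by blast
  show "eventually (%i. \<forall>x\<in>cmap c ` (cdom c\<inter>W). f i (cinv c x):V) F"
   using V(2) by eventually_elim (use mem_cmap_image[OF A c] in blast)
 qed
qed

lemma mcv_outer2: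
 assumes A: "manifold A" and W: "open W" and f: "mcv A F W f l" and a: "msm A W a"
  and G: "smooth_on (V\<times>UNIV) G" "open V" and V: "!!p. p:W==>a p:V" shows "mcv A F W (%i p. G (a p, f i p)) (%p. G (a p, l p))"
 by (rule mcv_outer[OF A W mcv_Pair[OF A W mcv_const[OF a] f] G(1)])
  (use G V in \<open>auto simp: open_Times intro!: always_eventually\<close>)

lemma mcv_linear:
 assumes A: "manifold A" and W: "open W" and f: "mcv A F W f l" and L: "linear L" "continuous_on UNIV L"
 shows "mcv A F W (%i p. L (f i p)) (%p. L (l p))" by (rule mcv_outer[OF A W f smooth_on_linear[OF L]]) auto

lemma linear_plus_pair: "linear (%z. fst z + snd z)" "linear (%z. fst z - snd z)" by (auto intro!: linearI simp: algebra_simps)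

lemma msm_const: "msm A W (%_. b)" by (simp add: msm_def smooth_on_const)

lemma msm_linear: "manifold A==>open W==>msm A W f==>linear L==>continuous_on UNIV L==>msm A W (%p. L (f p))"
 by (rule msm_outer[OF _ _ _ smooth_on_linear]) auto

lemma msm_bilinear: "manifold A==>open W==>msm A W f==>msm A W g==>bilinear b ==>
  continuous_on UNIV (%z. b (fst z) (snd z))==>msm A W (%p. b (f p) (g p))"
 using msm_outer[OF _ _ msm_Pair smooth_on_bilinear, of A W f g b] by simp

lemmas msm_scaleR = msm_bilinear[OF _ _ _ _ bilinear_scaleR continuous_on_scaleR_pair]

lemma msm_add: "manifold A==>open W==>msm A W f==>msm A W g==>msm A W (%p. f p + g p)"
 unfolding msm_def by (auto intro!: smooth_on_add open_cmap_image)

lemma msm_pullback: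
 assumes "manifold A" "manifold B" "msm B V l" "open V" "smooth_map_on W A B \<phi>" "open W" "\<phi> ` W\<subseteq>V"
 shows "msm A W (%p. l (\<phi> p))"
 using mcv_pullback[OF assms(1,2) mcv_const[OF assms(3)] assms(4-7), of "bot :: unit filter"] by (simp add: mcv_bot)

text \<open>The direction field H is fixed. Directions that vary with i could leave every compact
  set, and only on compact sets are the derivatives of f i controlled;
  \<open>deriv_decompose\<close> later reduces to this case.\<close>

lemma mcv_tang:
 assumes A: "manifold A" and c: "c:A" and W: "open W" "W\<subseteq>cdom c" and f: "mcv A F W f l" and H: "msm A W H"
 shows "mcv A F W (%i p. tang c lchart (f i) p (H p)) (%p. tang c lchart l p (H p))"
proof -
 have eq: "cdom c\<inter>W = W" using W by auto
 have o: "open (cmap c ` W)" using open_cmap_image[OF A c W(1)] by (simp add: eq)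
 have "cconv F (cmap c ` W\<times>UNIV) (%i z. ddir (%y. f i (cinv c y)) (fst z) (snd z)) (%z. ddir (%y. l (cinv c y)) (fst z) (snd z))"
  by (rule cconv_tangent[OF mcv_chartD[OF A c W(2) f] o])
 then have "mcv lin_atlas F (cmap c ` W\<times>UNIV) (%i z. ddir (%y. f i (cinv c y)) (fst z) (snd z)) (%z. ddir (%y. l (cinv c y)) (fst z) (snd z))"
  by (simp add: mcv_lin)
 moreover have "smooth_map_on W A lin_atlas (%p. (cmap c p, H p))"
  using msm_Pair[OF A W(1) msm_subset[OF msm_cmap[OF A c] W(2)] H] msm_iff[OF A W(1)] by blast
 ultimately have "mcv A F W (%i p. ddir (%y. f i (cinv c y)) (fst (cmap c p, H p)) (snd (cmap c p, H p)))
  (%p. ddir (%y. l (cinv c y)) (fst (cmap c p, H p)) (snd (cmap c p, H p)))"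
  by (intro mcv_pullback[OF A manifold_lin _ _ _ W(1)]) (use o in \<open>auto simp: open_Times\<close>)
 then show ?thesis by (simp add: tang_def)
qed

lemma tang_map_smooth:
 assumes A: "manifold A" and B: "manifold B" and \<phi>: "smooth_map_on W A B \<phi>" "open W" "W\<subseteq>cdom c" "\<phi> ` W\<subseteq>cdom d"
  and c: "c:A" and d: "d:B" shows "smooth_on (cmap c ` W\<times>UNIV) (%z. tang c d \<phi> (cinv c (fst z)) (snd z))"
proof -
 have eq: "cdom c\<inter>(W\<inter>\<phi> -` cdom d) = W" using \<phi> by auto
 have eq': "cdom c\<inter>W = W" using \<phi> by auto
 have o: "open (cmap c ` W)" using open_cmap_image[OF A c \<phi>(2)] by (simp add: eq')
 have "smooth_on (cmap c ` W) (%x. cmap d (\<phi> (cinv c x)))" using smooth_map_rep[OF \<phi>(1) c d] by (simp add: eq)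
 from smooth_on_tangent[OF this o] show ?thesis
  by (rule smooth_on_cong) (use o \<phi> in \<open>auto simp: open_Times tang_def cmap_cinv cinv_cmap[OF A c] subset_iff\<close>)
qed

lemma cimg_as_image: "cimg c = cmap c ` (cdom c\<inter>UNIV)" by (simp add: cimg_def)

lemma continuous_map_cinf_funD:
 assumes A: "manifold A" and f: "continuous_map T (cinf_top A S (%\<xi> _. \<xi>)) f" and t: "t:topspace T" and S: "!!s. s:S==>msm A UNIV s"
 shows "mcv A (atin T t) UNIV f (f t)" unfolding mcv_def
proof (intro conjI ballI)
 have *: "f t:S" if "t:topspace T" for t
  using f that topspace_cinf_top[OF atlas_nonempty[OF A], of S "%\<xi> _. \<xi>"] unfolding continuous_map_def by auto
 then show "eventually (%i. msm A UNIV (f i)) (atin T t)" unfolding eventually_atin using S t by (auto intro!: exI[of _ "topspace T"])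
 show "msm A UNIV (f t)" using * S t by blast
 fix c assume c: "c:A"
 show "cconv (atin T t) (cmap c ` (cdom c\<inter>UNIV)) (%i y. f i (cinv c y)) (%y. f t (cinv c y))"
  using continuous_map_cinf_topD[OF f t c] S c unfolding cimg_as_image[symmetric] by (auto simp: msm_def cimg_as_image)
qed

lemma continuous_map_cinf_vfD:
 assumes A: "manifold A" and f: "continuous_map T (cinf_top A S (%X. X)) f" and t: "t:topspace T" and S: "S\<subseteq>vfields A" and c: "c:A"
 shows "mcv A (atin T t) (cdom c) (%t. f t c) (f t c)"
proof (rule mcv_chart[OF A c open_cdom[OF A c] order_refl])
 have sm: "smooth_on (cimg c) (%y. s c (cinv c y))" if "s:S" for s using that S c unfolding vfields_def by blast
 show "cconv (atin T t) (cmap c ` cdom c) (%i y. f i c (cinv c y)) (%y. f t c (cinv c y))"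
  unfolding cimg_def[symmetric] by (rule continuous_map_cinf_topD[OF f t c], rule sm)
qed

lemma continuous_map_cinf_funI:
 assumes A: "manifold A" and f: "!!t. t:topspace T==>f t:S" and S: "!!s. s:S==>msm A UNIV s"
  and l: "!!t p. t:topspace T==>\<exists>V. open V\<and>p:V\<and>mcv A (atin T t) V f (f t)"
 shows "continuous_map T (cinf_top A S (%\<xi> _. \<xi>)) f"
proof (rule continuous_map_cinf_topI[OF f _ atlas_nonempty[OF A]])
 show "smooth_on (cimg c) (%y. s (cinv c y))" if "s:S" "c:A" for s c using S[OF that(1)] that(2) by (simp add: msm_def cimg_def)
 fix t c assume t: "t:topspace T" and c: "c:A"
 have ev: "eventually (%i. msm A UNIV (f i)) (atin T t)" unfolding eventually_atin using S f t by (auto intro!: exI[of _ "topspace T"])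
 have "mcv A (atin T t) UNIV f (f t)" by (rule mcv_local[OF A open_UNIV ev]) (use l t in auto)
 from mcv_cconv[OF this c] show "cconv (atin T t) (cimg c) (%t y. f t (cinv c y)) (%y. f t (cinv c y))" by (simp add: cimg_def)
qed

lemma continuous_map_cinf_vfI:
 assumes A: "manifold A" and f: "!!t. t:topspace T==>f t:S" and S: "S\<subseteq>vfields A" and l: "!!t c p. t:topspace T==>c:A==>p:cdom c ==>
   \<exists>V. open V\<and>p:V\<and>mcv A (atin T t) V (%t. f t c) (f t c)" shows "continuous_map T (cinf_top A S (%X. X)) f"
proof (rule continuous_map_cinf_topI[OF f _ atlas_nonempty[OF A]])
 show sm: "smooth_on (cimg c) (%y. s c (cinv c y))" if "s:S" "c:A" for s c using S that by (auto simp: vfields_def)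
 fix t c assume t: "t:topspace T" and c: "c:A"
 have *: "msm A (cdom c) (f t c)" if "t:topspace T" for t
  by (rule msm_chart[OF A c open_cdom[OF A c] order_refl]) (use sm f that c in \<open>auto simp: cimg_def\<close>)
 have ev: "eventually (%i. msm A (cdom c) (f i c)) (atin T t)" unfolding eventually_atin using * t by (auto intro!: exI[of _ "topspace T"])
 have "mcv A (atin T t) (cdom c) (%t. f t c) (f t c)" by (rule mcv_local[OF A open_cdom[OF A c] ev]) (use l t c in auto)
 from mcv_cconv[OF this c] show "cconv (atin T t) (cimg c) (%t y. f t c (cinv c y)) (%y. f t c (cinv c y))" by (simp add: cimg_def)
qed

section \<open>Vector fields\<close>

lemma tang_lchart: "tang c lchart f p v = ddir (%x. f (cinv c x)) (cmap c p) v" by (simp add: tang_def)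

context
 fixes A :: "('m::t2_space, 'e::lcs) chart set"
 assumes A: "manifold A"
begin

lemma vf_outside: "X:vfields A==>c\<notin>A \<or> p\<notin>cdom c==>X c p = 0" unfolding vfields_def by blast

lemma vf_change: "X:vfields A==>c:A==>d:A==>p:cdom c==>p:cdom d ==>
  X d p = tang c d (%q. q) p (X c p)" unfolding vfields_def by blast

lemma vf_smooth: "X:vfields A==>c:A==>smooth_on (cimg c) (%x. X c (cinv c x))" unfolding vfields_def by blast

lemma vf_msm: "X:vfields A==>c:A==>msm A (cdom c) (X c)"
 by (rule msm_chart[OF A _ open_cdom[OF A] order_refl], assumption+, fold cimg_def, rule vf_smooth)

lemma vfieldsI:
 assumes "!!c p. c\<notin>A \<or> p\<notin>cdom c==>X c p = 0"
  "!!c d p. c:A==>d:A==>p:cdom c==>p:cdom d==>X d p = tang c d (%q. q) p (X c p)"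
  "!!c p. c:A==>p:cdom c==>\<exists>V. open V\<and>p:V\<and>msm A V (X c)" shows "X:vfields A" unfolding vfields_def
proof (intro CollectI conjI allI ballI impI)
 fix c assume c: "c:A"
 have "msm A (cdom c) (X c)" by (rule msm_local[OF A _ open_cdom[OF A c]], rule assms(3)[OF c])
 then show "smooth_on (cimg c) (%x. X c (cinv c x))" using c by (auto simp: msm_def cimg_def)
qed (use assms(1,2) in blast)+

lemma vf_eqI:
 assumes "X:vfields A" "Y:vfields A" "!!p. \<exists>c\<in>A. p:cdom c\<and>X c p = Y c p" shows "X = Y"
proof (intro ext)
 fix d p
 show "X d p = Y d p"
 proof (cases "d:A\<and>p:cdom d")
  case True
  obtain c where "c:A" "p:cdom c" "X c p = Y c p" using assms(3) by blast
  then show ?thesis using True vf_change[OF assms(1)] vf_change[OF assms(2)] by metis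
 qed (use vf_outside assms in metis)
qed

lemma tang_id_linear: "c:A==>d:A==>p:cdom c==>p:cdom d==>linear (tang c d (%q. q) p)" by (rule tang_linear[OF A A smooth_at_id[OF A]])

lemma vf_add: "X:vfields A==>Y:vfields A==>X + Y:vfields A"
proof (rule vfieldsI)
 assume X: "X:vfields A" and Y: "Y:vfields A"
 show "(X + Y) c p = 0" if "c\<notin>A \<or> p\<notin>cdom c" for c p using vf_outside[OF X that] vf_outside[OF Y that] by (simp add: plus_fun_def)
 show "(X + Y) d p = tang c d (%q. q) p ((X + Y) c p)" if "c:A" "d:A" "p:cdom c" "p:cdom d" for c d p
  using vf_change[OF X that] vf_change[OF Y that] linear_add[OF tang_id_linear[OF that]] by (simp add: plus_fun_def)
 show "\<exists>V. open V\<and>p:V\<and>msm A V ((X + Y) c)" if "c:A" "p:cdom c" for c p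
  using msm_add[OF A open_cdom[OF A that(1)] vf_msm[OF X that(1)] vf_msm[OF Y that(1)]] that open_cdom[OF A that(1)] by (auto simp: plus_fun_def)
qed

lemma vf_gmult:
 assumes g: "msm A UNIV (g :: _=>real)" and X: "X:vfields A" shows "(%c m. g m*\<^sub>RX c m):vfields A"
proof (rule vfieldsI)
 fix c d p assume *: "c:A" "d:A" "p:cdom c" "p:cdom d"
 show "g p*\<^sub>RX d p = tang c d (%q. q) p (g p*\<^sub>RX c p)" using vf_change[OF X *] linear_scale[OF tang_id_linear[OF *]] by simp
qed (auto simp: vf_outside[OF X] intro!: exI[of _ "cdom _"] open_cdom[OF A] msm_scaleR[OF A] vf_msm X msm_subset[OF g])

lemma vf_scale: "X:vfields A==>a*\<^sub>RX:vfields A" using vf_gmult[OF msm_const[of _ _ a]] by (simp add: scaleR_fun_def)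

lemma vf_zero: "0:vfields A"
proof (rule vfieldsI)
 fix c d p assume *: "c:A" "d:A" "p:cdom c" "p:cdom d"
 show "0 d p = tang c d (%q. q) p (0 c p)" using linear_0[OF tang_id_linear[OF *]] by simp
qed (auto simp: zero_fun_def intro!: exI[of _ UNIV] msm_const)

lemma subspace_vfields: "subspace (vfields A)" unfolding subspace_def using vf_add vf_scale vf_zero by blast

lemma vf_bracket_lbr:
 assumes "c:A" "p:cdom c" shows "vf_bracket A X Y c p = lbr (%x. X c (cinv c x)) (%x. Y c (cinv c x)) (cmap c p)"
 using assms by (simp add: vf_bracket_def lbr_def cinv_cmap[OF A])

lemma vf_bracket_msm:
 assumes X: "X:vfields A" and Y: "Y:vfields A" and c: "c:A" shows "msm A (cdom c) (vf_bracket A X Y c)"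
proof (rule msm_chart[OF A c open_cdom[OF A c] order_refl])
 have "smooth_on (cimg c) (lbr (%x. X c (cinv c x)) (%x. Y c (cinv c x)))" by (intro smooth_on_lbr vf_smooth X Y c open_cimg[OF A])
 then show "smooth_on (cmap c ` cdom c) (%y. vf_bracket A X Y c (cinv c y))" unfolding cimg_def[symmetric]
  by (rule smooth_on_cong[OF _ open_cimg[OF A c]]) (simp add: vf_bracket_lbr c cinv_cdom cmap_cinv)
qed

end

text \<open>In charts this is \<open>lbr_related\<close>. Applied to the identity it gives chart
  independence of the bracket, to right translations its invariance, and to the bundle projection
  the homomorphism property of \<open>qg\<close>.\<close>

lemma vf_bracket_related:
 assumes A: "manifold A" and B: "manifold B" and \<phi>: "smooth_map_on W A B \<phi>" "open W"
  and X: "X:vfields A" "X':vfields B" and Y: "Y:vfields A" "Y':vfields B" and c: "c:A" "p:cdom c" and d: "d:B" "\<phi> p:cdom d" and p: "p:W"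
  and XX: "!!q. q:W==>q:cdom c==>\<phi> q:cdom d==>X' d (\<phi> q) = tang c d \<phi> q (X c q)"
  and YY: "!!q. q:W==>q:cdom c==>\<phi> q:cdom d==>Y' d (\<phi> q) = tang c d \<phi> q (Y c q)"
 shows "vf_bracket B X' Y' d (\<phi> p) = tang c d \<phi> p (vf_bracket A X Y c p)"
proof -
 let ?O = "W\<inter>\<phi> -` cdom d"
 have O: "open ?O" by (rule smooth_map_preimage_open[OF \<phi> open_cdom[OF B d(1)]])
 let ?U = "cmap c ` (cdom c\<inter>?O)"
 have U: "open ?U" by (rule open_cmap_image[OF A c(1) O])
 have mem: "x:cimg c\<and>cinv c x:?O" if "x:?U" for x using that mem_cmap_image[OF A c(1)] by blast
 have "lbr (%x. X' d (cinv d x)) (%x. Y' d (cinv d x)) (cmap d (\<phi> (cinv c (cmap c p)))) =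
  ddir (%x. cmap d (\<phi> (cinv c x))) (cmap c p) (lbr (%x. X c (cinv c x)) (%x. Y c (cinv c x)) (cmap c p))"
 proof (rule lbr_related[OF smooth_map_rep[OF \<phi>(1) c(1) d(1)] U _ open_cimg[OF B d(1)]])
  show "cmap d (\<phi> (cinv c x)):cimg d" if "x:?U" for x using mem[OF that] by (simp add: cmap_cimg)
  show "smooth_on ?U (%x. X c (cinv c x))" by (rule smooth_on_subset[OF vf_smooth[OF A X(1) c(1)]]) (use mem in blast)
  show "smooth_on ?U (%x. Y c (cinv c x))" by (rule smooth_on_subset[OF vf_smooth[OF A Y(1) c(1)]]) (use mem in blast)
  show "smooth_on (cimg d) (%x. X' d (cinv d x))" "smooth_on (cimg d) (%x. Y' d (cinv d x))"
   using vf_smooth[OF B X(2) d(1)] vf_smooth[OF B Y(2) d(1)] by auto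
  fix x assume "x:?U"
  note m = mem[OF this]
  show "X' d (cinv d (cmap d (\<phi> (cinv c x)))) = ddir (%x. cmap d (\<phi> (cinv c x))) x (X c (cinv c x))"
   using m XX[of "cinv c x"] cinv_cdom[of x c] by (simp add: cinv_cmap[OF B d(1)] tang_def cmap_cinv)
  show "Y' d (cinv d (cmap d (\<phi> (cinv c x)))) = ddir (%x. cmap d (\<phi> (cinv c x))) x (Y c (cinv c x))"
   using m YY[of "cinv c x"] cinv_cdom[of x c] by (simp add: cinv_cmap[OF B d(1)] tang_def cmap_cinv)
 qed (use c p d in auto)
 then show ?thesis by (simp add: vf_bracket_lbr[OF A c] vf_bracket_lbr[OF B d] tang_def cinv_cmap[OF A c])
qed

context
 fixes A :: "('m::t2_space, 'e::lcs) chart set"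
 assumes A: "manifold A"
begin

lemma vf_bracket_in:
 assumes X: "X:vfields A" and Y: "Y:vfields A" shows "vf_bracket A X Y:vfields A"
proof (rule vfieldsI[OF A])
 show "vf_bracket A X Y c p = 0" if "c\<notin>A \<or> p\<notin>cdom c" for c p using that by (auto simp: vf_bracket_def)
 show "vf_bracket A X Y d p = tang c d (%q. q) p (vf_bracket A X Y c p)" if "c:A" "d:A" "p:cdom c" "p:cdom d" for c d p
  by (rule vf_bracket_related[OF A A smooth_map_on_id[OF A] open_UNIV X X Y Y that(1,3,2,4)])
   (blast intro: vf_change[OF A X that(1,2)] vf_change[OF A Y that(1,2)])+
 show "\<exists>V. open V\<and>p:V\<and>msm A V (vf_bracket A X Y c)" if "c:A" "p:cdom c" for c p
  using that vf_bracket_msm[OF A X Y] open_cdom[OF A] by blast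
qed

lemma vf_bracket_skew: "vf_bracket A X Y = - vf_bracket A Y X" by (auto simp: vf_bracket_def fun_eq_iff)

lemma vf_bracket_add_right:
 assumes "X:vfields A" "Y:vfields A" "Z:vfields A" shows "vf_bracket A X (Y + Z) = vf_bracket A X Y + vf_bracket A X Z"
proof -
 have "ddir (%x. Y c (cinv c x) + Z c (cinv c x)) (cmap c p) v
  = ddir (%x. Y c (cinv c x)) (cmap c p) v + ddir (%x. Z c (cinv c x)) (cmap c p) v" if "c:A" "p:cdom c" for c p v
  by (rule ddir_add[OF _ _ open_cimg[OF A that(1)]]) (use assms that in \<open>auto intro: vf_smooth[OF A] cmap_cimg\<close>)
 moreover have "ddir (%x. X c (cinv c x)) (cmap c p) (Y c p + Z c p)
  = ddir (%x. X c (cinv c x)) (cmap c p) (Y c p) + ddir (%x. X c (cinv c x)) (cmap c p) (Z c p)" if "c:A" "p:cdom c" for c p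
  by (rule linear_add[OF ddir_linear[OF vf_smooth[OF A assms(1) that(1)] open_cimg[OF A that(1)] cmap_cimg[OF that(2)]]])
 ultimately show ?thesis by (auto simp: vf_bracket_def fun_eq_iff plus_fun_def algebra_simps)
qed

lemma vf_bracket_gmult_left:
 assumes X: "X:vfields A" and Y: "Y:vfields A" and g: "msm A UNIV (g :: _=>real)" and c: "c:A" "p:cdom c"
 shows "vf_bracket A (%c m. g m*\<^sub>RX c m) Y c p = g p*\<^sub>Rvf_bracket A X Y c p - tang c lchart g p (Y c p)*\<^sub>RX c p"
proof -
 note sX = vf_smooth[OF A X c(1)] and sY = vf_smooth[OF A Y c(1)]
 have sg: "smooth_on (cimg c) (%x. g (cinv c x))" using g c by (simp add: msm_def cimg_def)
 note o = open_cimg[OF A c(1)] and m = cmap_cimg[OF c(2)]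
 have "ddir (%x. g (cinv c x)*\<^sub>RX c (cinv c x)) (cmap c p) (Y c p) =
  ddir (%x. g (cinv c x)) (cmap c p) (Y c p)*\<^sub>RX c (cinv c (cmap c p)) + g (cinv c (cmap c p))*\<^sub>Rddir (%x. X c (cinv c x)) (cmap c p) (Y c p)"
  by (rule ddir_scaleR[OF sg sX o m])
 moreover have "ddir (%x. Y c (cinv c x)) (cmap c p) (g p*\<^sub>RX c p) = g p*\<^sub>Rddir (%x. Y c (cinv c x)) (cmap c p) (X c p)"
  by (rule linear_scale[OF ddir_linear[OF sY o m]])
 ultimately show ?thesis using c by (simp add: vf_bracket_def tang_def cinv_cmap[OF A] algebra_simps)
qed

lemma vf_bracket_scale_left:
 assumes "X:vfields A" "Y:vfields A" shows "vf_bracket A (a*\<^sub>RX) Y = a*\<^sub>Rvf_bracket A X Y"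
proof (intro ext)
 fix c p
 show "vf_bracket A (a*\<^sub>RX) Y c p = (a*\<^sub>Rvf_bracket A X Y) c p"
 proof (cases "c:A\<and>p:cdom c")
  case True
  then show ?thesis using vf_bracket_gmult_left[OF assms msm_const[of _ _ a], of c p] by (simp add: scaleR_fun_def tang_const)
 qed (auto simp: vf_bracket_def scaleR_fun_def)
qed

lemma vf_jacobi:
 assumes X: "X:vfields A" and Y: "Y:vfields A" and Z: "Z:vfields A"
 shows "vf_bracket A X (vf_bracket A Y Z) + vf_bracket A Y (vf_bracket A Z X) + vf_bracket A Z (vf_bracket A X Y) = 0"
proof (intro ext)
 fix c p
 show "(vf_bracket A X (vf_bracket A Y Z) + vf_bracket A Y (vf_bracket A Z X) + vf_bracket A Z (vf_bracket A X Y)) c p = 0 c p"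
 proof (cases "c:A\<and>p:cdom c")
  case True
  then have c: "c:A" "p:cdom c" by auto
  note o = open_cimg[OF A c(1)] and m = cmap_cimg[OF c(2)]
  let ?r = "%X x. X c (cinv c x)"
  have *: "lbr (?r P) (?r (vf_bracket A Q R)) (cmap c p) = lbr (?r P) (lbr (?r Q) (?r R)) (cmap c p)" if "Q:vfields A" "R:vfields A" for P Q R
  proof -
   have eq: "?r (vf_bracket A Q R) x = lbr (?r Q) (?r R) x" if "x:cimg c" for x
    using that by (simp add: vf_bracket_lbr[OF A c(1)] cinv_cdom cmap_cinv)
   show ?thesis unfolding lbr_def[of "?r P"] eq[OF m] using ddir_cong[OF o m eq] by simp
  qed
  show ?thesis using lbr_jacobi[OF vf_smooth[OF A X c(1)] vf_smooth[OF A Y c(1)] vf_smooth[OF A Z c(1)] o m]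
   by (simp add: plus_fun_def vf_bracket_lbr[OF A c] *[OF X Y] *[OF Y Z] *[OF Z X])
 qed (auto simp: vf_bracket_def plus_fun_def)
qed

lemma tang_chart_change:
 assumes B: "manifold B" and f: "smooth_at A B f p" and "c:A" "p:cdom c" "d:A" "p:cdom d" "e:B" "f p:cdom e"
 shows "tang c e f p v = tang d e f p (tang c d (%q. q) p v)" using tang_comp[OF A A B smooth_at_id[OF A] f assms(3-8)] by simp

text \<open>The chart picked by \<open>SOME\<close> in \<open>vf_deriv\<close> is exchanged for c:
  the transformation law of the field compensates the coordinate change of f.\<close>

lemma vf_deriv_eq:
 assumes X: "X:vfields A" and f: "smooth_at A lin_atlas f p" and c: "c:A" "p:cdom c" shows "vf_deriv A X f p = tang c lchart f p (X c p)"
proof -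
 define d where "d = (SOME c. c:A\<and>p:cdom c)"
 have d: "d:A" "p:cdom d" unfolding d_def using someI_ex[of "%c. c:A\<and>p:cdom c"] c by blast+
 have "vf_deriv A X f p = tang d lchart f p (X d p)" by (simp add: vf_deriv_def Let_def d_def tang_def)
 also have "X d p = tang c d (%q. q) p (X c p)" by (rule vf_change[OF A X c(1) d(1) c(2) d(2)])
 finally show ?thesis using tang_chart_change[OF manifold_lin f c d, of lchart] by simp
qed

lemma vf_deriv_msm:
 assumes X: "X:vfields A" and f: "msm A UNIV f" shows "msm A UNIV (vf_deriv A X f)"
proof (rule msm_local[OF A _ open_UNIV])
 fix p
 obtain c where c: "c:A" "p:cdom c" using ex_chart[OF A] by blast
 have "msm A (cdom c) (%q. tang c lchart f q (X c q))"
  using mcv_tang[OF A c(1) open_cdom[OF A c(1)] order_refl mcv_const[OF msm_subset[OF f]] vf_msm[OF A X c(1)], of "bot :: unit filter"]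
  by (simp add: mcv_bot)
 then have "msm A (cdom c) (vf_deriv A X f)"
  by (rule msm_cong[OF A _ open_cdom[OF A c(1)]]) (simp add: vf_deriv_eq[OF X msm_smooth_at[OF A f open_UNIV UNIV_I] c(1)])
 then show "\<exists>V. open V\<and>p:V\<and>msm A V (vf_deriv A X f)" using c open_cdom[OF A] by blast
qed

lemma vf_deriv_bracket:
 assumes X: "X:vfields A" and Y: "Y:vfields A" and f: "msm A UNIV f"
 shows "vf_deriv A (vf_bracket A X Y) f p = vf_deriv A X (vf_deriv A Y f) p - vf_deriv A Y (vf_deriv A X f) p"
proof -
 obtain c where c: "c:A" "p:cdom c" using ex_chart[OF A] by blast
 note o = open_cimg[OF A c(1)] and m = cmap_cimg[OF c(2)]
 note sf = msm_smooth_at[OF A f open_UNIV UNIV_I]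
 have f': "smooth_on (cimg c) (%x. f (cinv c x))" using f c by (simp add: msm_def cimg_def)
 have *: "vf_deriv A P (vf_deriv A Q f) p = ddir (%x. ddir (%x. f (cinv c x)) x (Q c (cinv c x))) (cmap c p) (P c p)"
  if "P:vfields A" "Q:vfields A" for P Q
 proof -
  have "vf_deriv A P (vf_deriv A Q f) p = ddir (%x. vf_deriv A Q f (cinv c x)) (cmap c p) (P c p)"
   using vf_deriv_eq[OF that(1) msm_smooth_at[OF A vf_deriv_msm[OF that(2) f] open_UNIV] c] by (simp add: tang_def)
  also have "\<dots> = ddir (%x. ddir (%x. f (cinv c x)) x (Q c (cinv c x))) (cmap c p) (P c p)"
  proof (rule ddir_cong[OF o m])
   fix x assume "x:cimg c"
   then show "vf_deriv A Q f (cinv c x) = ddir (%x. f (cinv c x)) x (Q c (cinv c x))"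
    using vf_deriv_eq[OF that(2) sf c(1) cinv_cdom] by (simp add: tang_def cmap_cinv)
  qed
  finally show ?thesis .
 qed
 have "vf_deriv A (vf_bracket A X Y) f p = ddir (%x. f (cinv c x)) (cmap c p) (lbr (%x. X c (cinv c x)) (%x. Y c (cinv c x)) (cmap c p))"
  by (simp add: vf_deriv_eq[OF vf_bracket_in[OF X Y] sf c] tang_def vf_bracket_lbr[OF A c])
 also have "\<dots> = vf_deriv A X (vf_deriv A Y f) p - vf_deriv A Y (vf_deriv A X f) p"
  using ddir_lbr[OF vf_smooth[OF A X c(1)] vf_smooth[OF A Y c(1)] f' o m] by (simp add: *[OF X Y] *[OF Y X] cinv_cmap[OF A c])
 finally show ?thesis .
qed

lemma tang_lchart_linear:
 assumes "smooth_at A lin_atlas f p" "c:A" "p:cdom c" shows "linear (tang c lchart f p)"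
 using tang_linear[OF A manifold_lin assms(1,2) lchart_in assms(3)] by simp

lemma vf_deriv_add_field:
 assumes "X:vfields A" "Y:vfields A" "msm A UNIV f"
 shows "vf_deriv A (a*\<^sub>RX + b*\<^sub>RY) f p = a*\<^sub>Rvf_deriv A X f p + b*\<^sub>Rvf_deriv A Y f p"
proof -
 obtain c where c: "c:A" "p:cdom c" using ex_chart[OF A] by blast
 note sf = msm_smooth_at[OF A assms(3) open_UNIV UNIV_I]
 note l = tang_lchart_linear[OF sf c]
 show ?thesis using vf_deriv_eq[OF _ sf c] assms vf_add[OF A vf_scale[OF A assms(1), of a] vf_scale[OF A assms(2), of b]]
  by (simp add: plus_fun_def scaleR_fun_def linear_add[OF l] linear_scale[OF l])
qed

lemma vf_deriv_gmult_field:
 assumes "X:vfields A" "msm A UNIV g" "msm A UNIV f" shows "vf_deriv A (%c m. g m*\<^sub>RX c m) f p = g p*\<^sub>Rvf_deriv A X f p"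
proof -
 obtain c where c: "c:A" "p:cdom c" using ex_chart[OF A] by blast
 note sf = msm_smooth_at[OF A assms(3) open_UNIV UNIV_I]
 show ?thesis using vf_deriv_eq[OF vf_gmult[OF A assms(2,1)] sf c] vf_deriv_eq[OF assms(1) sf c] linear_scale[OF tang_lchart_linear[OF sf c]] by simp
qed

lemma vf_deriv_linear_fun:
 assumes X: "X:vfields A" and f: "msm A UNIV f" and L: "linear L" "continuous_on UNIV L" shows "vf_deriv A X (%p. L (f p)) p = L (vf_deriv A X f p)"
proof -
 obtain c where c: "c:A" "p:cdom c" using ex_chart[OF A] by blast
 have f': "smooth_on (cimg c) (%x. f (cinv c x))" using f c by (simp add: msm_def cimg_def)
 show ?thesis using ddir_linear_compose[OF L f' open_cimg[OF A c(1)] cmap_cimg[OF c(2)]]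
   vf_deriv_eq[OF X msm_smooth_at[OF A msm_linear[OF A open_UNIV f L] open_UNIV] c]
   vf_deriv_eq[OF X msm_smooth_at[OF A f open_UNIV] c] by (simp add: tang_def)
qed

lemma vf_deriv_bilinear_fun:
 assumes X: "X:vfields A" and f: "msm A UNIV f" and g: "msm A UNIV g" and b: "bilinear b" "continuous_on UNIV (%z. b (fst z) (snd z))"
 shows "vf_deriv A X (%p. b (f p) (g p)) p = b (vf_deriv A X f p) (g p) + b (f p) (vf_deriv A X g p)"
proof -
 obtain c where c: "c:A" "p:cdom c" using ex_chart[OF A] by blast
 have f': "smooth_on (cimg c) (%x. f (cinv c x))" using f c by (simp add: msm_def cimg_def)
 have g': "smooth_on (cimg c) (%x. g (cinv c x))" using g c by (simp add: msm_def cimg_def)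
 show ?thesis using ddir_bilinear_compose[OF b f' g' open_cimg[OF A c(1)] cmap_cimg[OF c(2)]]
   vf_deriv_eq[OF X msm_smooth_at[OF A msm_bilinear[OF A open_UNIV f g b] open_UNIV] c]
   vf_deriv_eq[OF X msm_smooth_at[OF A f open_UNIV] c] vf_deriv_eq[OF X msm_smooth_at[OF A g open_UNIV] c]
  by (simp add: tang_def cinv_cmap[OF A c])
qed

lemma vf_deriv_add_fun:
 assumes X: "X:vfields A" and f: "msm A UNIV f" and g: "msm A UNIV g" shows "vf_deriv A X (%p. f p + g p) p = vf_deriv A X f p + vf_deriv A X g p"
proof -
 obtain c where c: "c:A" "p:cdom c" using ex_chart[OF A] by blast
 have f': "smooth_on (cimg c) (%x. f (cinv c x))" using f c by (simp add: msm_def cimg_def)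
 have g': "smooth_on (cimg c) (%x. g (cinv c x))" using g c by (simp add: msm_def cimg_def)
 show ?thesis using ddir_add[OF f' g' open_cimg[OF A c(1)] cmap_cimg[OF c(2)]]
   vf_deriv_eq[OF X msm_smooth_at[OF A msm_add[OF A open_UNIV f g] open_UNIV] c]
   vf_deriv_eq[OF X msm_smooth_at[OF A f open_UNIV] c] vf_deriv_eq[OF X msm_smooth_at[OF A g open_UNIV] c] by (simp add: tang_def)
qed

end

section \<open>Local convergence\<close>

text \<open>A notion for germs at p: the neighbourhood may depend on p but not on i. Local sections,
  trivializations and charts exist only near a point, so most computations take this form; the
  global topologies are reached through \<open>continuous_map_cinf_funI\<close> and
  \<open>continuous_map_cinf_vfI\<close>.\<close>

definition lmcv :: "('m::t2_space, 'e::lcs) chart set=>'i filter=>'m=>('i=>'m=>'v::lcs)=>('m=>'v)=>bool" where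
 "lmcv A F p f l\<longleftrightarrow>(\<exists>V. open V\<and>p:V\<and>mcv A F V f l)"

lemma lmcvI: "mcv A F V f l==>open V==>p:V==>lmcv A F p f l" unfolding lmcv_def by blast

lemma lmcvE:
 assumes "lmcv A F p f l"
 obtains V where "open V" "p:V" "mcv A F V f l" using assms unfolding lmcv_def by blast

lemma smooth_at_linE:
 assumes "manifold A" "smooth_at A lin_atlas f p"
 obtains V where "open V" "p:V" "msm A V f" using assms msm_iff unfolding smooth_at_def by blast

lemma lmcv_const: "manifold A==>smooth_at A lin_atlas l p==>lmcv A F p (%_. l) l" by (erule smooth_at_linE) (auto intro: lmcvI mcv_const)

lemma lmcv_bot: "manifold A==>lmcv A bot p f l\<longleftrightarrow>smooth_at A lin_atlas l p" by (auto simp: lmcv_def mcv_bot smooth_at_def msm_iff)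

lemma lmcv_smooth_at: "manifold A==>lmcv A F p f l==>smooth_at A lin_atlas l p" by (meson lmcvE mcv_msm msm_smooth_at)

lemma smooth_at_via_lmcv: "manifold A==>lmcv A (bot :: unit filter) p (%_. l) l==>smooth_at A lin_atlas l p" by (simp add: lmcv_bot)

lemma smooth_at_msm_iff: "manifold A==>(\<forall>p\<in>W. smooth_at A lin_atlas f p)\<longleftrightarrow>msm A W f" if "open W"
proof
 assume A: "manifold A" and f: "\<forall>p\<in>W. smooth_at A lin_atlas f p"
 show "msm A W f" by (rule msm_local[OF A _ that]) (use f smooth_at_linE[OF A] in metis)
qed (use that msm_smooth_at in blast)

lemma lmcv_cong:
 assumes A: "manifold A" and f: "lmcv A F p f l" and W: "open W" "p:W" and g: "!!i q. q:W==>f i q = g i q" and m: "!!q. q:W==>l q = m q"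
 shows "lmcv A F p g m"
proof -
 obtain V where V: "open V" "p:V" "mcv A F V f l" using f by (rule lmcvE)
 have "mcv A F (V\<inter>W) g m" by (rule mcv_cong[OF A mcv_subset[OF V(3)]]) (use V W g m in \<open>auto intro!: always_eventually\<close>)
 then show ?thesis by (rule lmcvI) (use V W in auto)
qed

lemma lmcv_cong_ev:
 assumes A: "manifold A" and f: "lmcv A F p f l" and W: "open W" "p:W"
  and g: "eventually (%i. \<forall>q\<in>W. f i q = g i q) F" and m: "!!q. q:W==>l q = m q" shows "lmcv A F p g m"
proof -
 obtain V where V: "open V" "p:V" "mcv A F V f l" using f by (rule lmcvE)
 have "mcv A F (V\<inter>W) g m" by (rule mcv_cong[OF A mcv_subset[OF V(3)]]) (use V W m in \<open>auto intro: eventually_mono[OF g]\<close>)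
 then show ?thesis by (rule lmcvI) (use V W in auto)
qed

lemma smooth_at_cong:
 assumes A: "manifold A" and B: "manifold B" and f: "smooth_at A B f p" and W: "open W" "p:W" and g: "!!q. q:W==>f q = g q" shows "smooth_at A B g p"
proof -
 obtain V where V: "open V" "p:V" "smooth_map_on V A B f" using f unfolding smooth_at_def by blast
 have "smooth_map_on (V\<inter>W) A B g" by (rule smooth_map_on_cong[OF A smooth_map_on_subset[OF V(3)] _ _ B]) (use V W g in auto)
 then show ?thesis by (rule smooth_atI) (use V W in auto)
qed

lemma lmcv_Pair:
 assumes A: "manifold A" and "lmcv A F p f l" "lmcv A F p g m" shows "lmcv A F p (%i q. (f i q, g i q)) (%q. (l q, m q))"
proof -
 obtain V W where V: "open V" "p:V" "mcv A F V f l" and W: "open W" "p:W" "mcv A F W g m" using assms by (auto elim!: lmcvE)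
 have "mcv A F (V\<inter>W) (%i q. (f i q, g i q)) (%q. (l q, m q))"
  by (rule mcv_Pair[OF A _ mcv_subset[OF V(3)] mcv_subset[OF W(3)]]) (use V W in auto)
 then show ?thesis by (rule lmcvI) (use V W in auto)
qed

lemma lmcv_linear:
 assumes A: "manifold A" and f: "lmcv A F p f l" and L: "linear L" "continuous_on UNIV L" shows "lmcv A F p (%i q. L (f i q)) (%q. L (l q))"
 using f by (rule lmcvE) (auto intro: lmcvI mcv_linear[OF A _ _ L])

lemma lmcv_bilinear:
 assumes A: "manifold A" and f: "lmcv A F p f l" and g: "lmcv A F p g m" and b: "bilinear b" "continuous_on UNIV (%z. b (fst z) (snd z))"
 shows "lmcv A F p (%i q. b (f i q) (g i q)) (%q. b (l q) (m q))"
proof -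
 have "lmcv A F p (%i q. (%z. b (fst z) (snd z)) (f i q, g i q)) (%q. (%z. b (fst z) (snd z)) (l q, m q))"
 proof -
  obtain V where V: "open V" "p:V" "mcv A F V (%i q. (f i q, g i q)) (%q. (l q, m q))" using lmcv_Pair[OF A f g] by (rule lmcvE)
  show ?thesis by (rule lmcvI[OF mcv_outer[OF A V(1,3) smooth_on_bilinear[OF b] open_UNIV] V(1,2)]) auto
 qed
 then show ?thesis by simp
qed

lemmas lmcv_scaleR = lmcv_bilinear[OF _ _ _ bilinear_scaleR continuous_on_scaleR_pair]

lemma lmcv_add:
 assumes A: "manifold A" and "lmcv A F p f l" "lmcv A F p g m" shows "lmcv A F p (%i q. f i q + g i q) (%q. l q + m q)"
 using lmcv_linear[OF A lmcv_Pair[OF assms] linear_plus_pair(1)]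
 by (simp add: continuous_on_add_lcs continuous_on_fst continuous_on_snd continuous_on_id)

lemma lmcv_diff:
 assumes A: "manifold A" and "lmcv A F p f l" "lmcv A F p g m" shows "lmcv A F p (%i q. f i q - g i q) (%q. l q - m q)"
 using lmcv_linear[OF A lmcv_Pair[OF assms] linear_plus_pair(2)]
 by (simp add: continuous_on_diff_lcs continuous_on_fst continuous_on_snd continuous_on_id)

lemma lmcv_sum:
 assumes A: "manifold A" and f: "!!j. j:J==>lmcv A F p (f j) (l j)" shows "lmcv A F p (%i q. \<Sum>j\<in>J. f j i q) (%q. \<Sum>j\<in>J. l j q)"
 using f by (induction J rule: infinite_finite_induct)
  (auto intro!: lmcv_add[OF A] lmcv_const[OF A] smooth_at_const)

lemma lmcv_pullback:
 assumes A: "manifold A" and B: "manifold B" and f: "lmcv B F (\<phi> p) f l" and \<phi>: "smooth_at A B \<phi> p"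
 shows "lmcv A F p (%i q. f i (\<phi> q)) (%q. l (\<phi> q))"
proof -
 obtain V where V: "open V" "\<phi> p:V" "mcv B F V f l" using f by (rule lmcvE)
 obtain W where W: "open W" "p:W" "smooth_map_on W A B \<phi>" using \<phi> unfolding smooth_at_def by blast
 have o: "open (W\<inter>\<phi> -` V)" by (rule smooth_map_preimage_open[OF W(3,1) V(1)])
 have "mcv A F (W\<inter>\<phi> -` V) (%i q. f i (\<phi> q)) (%q. l (\<phi> q))"
  by (rule mcv_pullback[OF A B V(3,1) smooth_map_on_subset[OF W(3)] o]) auto
 then show ?thesis by (rule lmcvI[OF _ o]) (use V W in auto)
qed

lemma smooth_at_preimage:
 assumes A: "manifold A" and f: "smooth_at A B f p" and V: "open V" "f p:V"
 obtains W where "open W" "p:W" "smooth_map_on W A B f" "f ` W\<subseteq>V"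
proof -
 obtain U where U: "open U" "p:U" "smooth_map_on U A B f" using f unfolding smooth_at_def by blast
 have "open (U\<inter>f -` V)" by (rule smooth_map_preimage_open[OF U(3,1) V(1)])
 then show thesis using that[of "U\<inter>f -` V"] U V smooth_map_on_subset[OF U(3)] by auto
qed

lemma lmcv_tang:
 assumes A: "manifold A" and c: "c:A" "p:cdom c" and f: "lmcv A F p f l" and H: "smooth_at A lin_atlas H p"
 shows "lmcv A F p (%i q. tang c lchart (f i) q (H q)) (%q. tang c lchart l q (H q))"
proof -
 obtain V where V: "open V" "p:V" "mcv A F V f l" using f by (rule lmcvE)
 obtain W where W: "open W" "p:W" "msm A W H" using smooth_at_linE[OF A H] .
 have "mcv A F (V\<inter>W\<inter>cdom c) (%i q. tang c lchart (f i) q (H q)) (%q. tang c lchart l q (H q))"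
  by (rule mcv_tang[OF A c(1) _ _ mcv_subset[OF V(3)] msm_subset[OF W(3)]]) (use V W open_cdom[OF A c(1)] in auto)
 then show ?thesis by (rule lmcvI) (use V W c open_cdom[OF A c(1)] in auto)
qed

text \<open>The counterpart of \<open>lmcv_tang\<close>: the map \<psi> is fixed and the tangent
  vectors vary. In charts this is composition with the smooth tangent map of \<psi>.\<close>

lemma lmcv_tang_along:
 assumes A: "manifold A" and N: "manifold N" and Q: "manifold Q" and \<psi>: "smooth_at N Q \<psi> (m p)" and m: "smooth_at A N m p"
  and c: "c:N" "m p:cdom c" and k: "k:Q" "\<psi> (m p):cdom k" and f: "lmcv A F p f l"
 shows "lmcv A F p (%i q. tang c k \<psi> (m q) (f i q)) (%q. tang c k \<psi> (m q) (l q))"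
proof -
 obtain V where V: "open V" "m p:V" "V\<subseteq>cdom c\<inter>\<psi> -` cdom k" "smooth_map_on V N Q \<psi>"
  using smooth_at_repE[OF N Q \<psi> c(1) k(1) c(2) k(2)] .
 have o: "open (cmap c ` V)" using open_cmap_image[OF N c(1) V(1)] V(3) by (simp add: Int_absorb1)
 have sm: "smooth_on (cmap c ` V\<times>UNIV) (%z. tang c k \<psi> (cinv c (fst z)) (snd z))"
  by (rule tang_map_smooth[OF N Q V(4,1) _ _ c(1) k(1)]) (use V in auto)
 obtain W where W: "open W" "p:W" "smooth_map_on W A N m" "m ` W\<subseteq>V" using smooth_at_preimage[OF A m V(1,2)] .
 obtain W' where W': "open W'" "p:W'" "mcv A F W' f l" using f by (rule lmcvE)
 let ?W = "W\<inter>W'"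
 have oW: "open ?W" using W W' by auto
 have "msm A ?W (%q. cmap c (m q))"
  by (rule msm_pullback[OF A N msm_cmap[OF N c(1)] open_cdom[OF N c(1)] smooth_map_on_subset[OF W(3)] oW]) (use W V in auto)
 from mcv_outer2[OF A oW mcv_subset[OF W'(3)] this sm o]
 have "mcv A F ?W (%i q. tang c k \<psi> (cinv c (cmap c (m q))) (f i q)) (%q. tang c k \<psi> (cinv c (cmap c (m q))) (l q))" using W by auto
 then have "mcv A F ?W (%i q. tang c k \<psi> (m q) (f i q)) (%q. tang c k \<psi> (m q) (l q))"
  by (rule mcv_cong[OF A _ oW]) (use W V cinv_cmap[OF N c(1)] in \<open>auto intro!: always_eventually simp: subset_iff image_subset_iff\<close>)
 then show ?thesis by (rule lmcvI[OF _ oW]) (use W W' in auto)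
qed

lemma tang_continuous:
 assumes "manifold A" "manifold B" "smooth_at A B f p" "c:A" "d:B" "p:cdom c" "f p:cdom d" shows "continuous_on UNIV (tang c d f p)"
proof -
 obtain W where W: "open W" "p:W" "W\<subseteq>cdom c\<inter>f -` cdom d" "open (cmap c ` W)"
  "smooth_on (cmap c ` W) (%x. cmap d (f (cinv c x)))" using smooth_at_repE[OF assms] .
 have "continuous_on UNIV (%v. ddir (%x. cmap d (f (cinv c x))) (fst (cmap c p, v)) (snd (cmap c p, v)))"
  by (rule continuous_on_compose2[OF smooth_on_continuous[OF smooth_on_tangent[OF W(5,4)]]])
   (use W in \<open>auto intro!: continuous_intros\<close>)
 then show ?thesis by (simp add: tang_def[abs_def])
qed

section \<open>Smooth binary operations\<close>

text \<open>Multiplication in a Lie group, conjugation and the right action on the bundle are all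
  instances.\<close>

locale smooth_op =
 fixes N :: "('n::t2_space, 'e::lcs) chart set" and L :: "('l::t2_space, 'f::lcs) chart set"
  and Q :: "('q::t2_space, 'g::lcs) chart set" and \<mu> :: "'n=>'l=>'q"
 assumes N: "manifold N" and L: "manifold L" and Q: "manifold Q" and op: "smooth_map (prod_atlas N L) Q (%(x, y). \<mu> x y)"
begin

lemma op_at: "smooth_at (prod_atlas N L) Q (%z. \<mu> (fst z) (snd z)) z" using op by (intro smooth_atI[of UNIV]) (auto simp: case_prod_unfold)

lemma smooth_at_op:
 assumes A: "manifold A" and f: "smooth_at A N f p" and g: "smooth_at A L g p" shows "smooth_at A Q (%x. \<mu> (f x) (g x)) p"
 using smooth_at_comp[OF A manifold_prod[OF N L] Q smooth_at_Pair[OF A N L f g] op_at] by simp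

lemma smooth_at_left: "smooth_at N Q (%x. \<mu> x y) x" by (rule smooth_at_op[OF N smooth_at_id[OF N] smooth_at_const])

lemma smooth_at_right: "smooth_at L Q (\<mu> x) y" by (rule smooth_at_op[OF L smooth_at_const smooth_at_id[OF L]])

lemma tang_op:
 assumes A: "manifold A" and f: "smooth_at A N f p" and g: "smooth_at A L g p"
  and c: "c:A" "p:cdom c" and d: "d:N" "f p:cdom d" and e: "e:L" "g p:cdom e" and k: "k:Q" "\<mu> (f p) (g p):cdom k"
 shows "tang c k (%x. \<mu> (f x) (g x)) p v =
  tang d k (%y. \<mu> y (g p)) (f p) (tang c d f p v) + tang e k (\<mu> (f p)) (g p) (tang c e g p v)"
 using tang_product_rule[OF A N L Q f g op_at c d e k(1)] k(2) by simp

lemma tang_left: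
 assumes d: "d:N" "x:cdom d" and e: "e:L" "y:cdom e" and k: "k:Q" "\<mu> x y:cdom k"
 shows "tang d k (%x. \<mu> x y) x v = tang (pchart d e) k (%z. \<mu> (fst z) (snd z)) (x, y) (v, 0)"
 using tang_comp[OF N manifold_prod[OF N L] Q smooth_at_Pair[OF N N L smooth_at_id[OF N] smooth_at_const] op_at d pchart_in[OF d(1) e(1)] _ k(1), of y v]
  tang_Pair[OF N N L smooth_at_id[OF N, of x] smooth_at_const[of _ _ y] d d e, of v] tang_id[OF N d] d e k by (simp add: tang_const)

lemma tang_right:
 assumes d: "d:N" "x:cdom d" and e: "e:L" "y:cdom e" and k: "k:Q" "\<mu> x y:cdom k"
 shows "tang e k (\<mu> x) y v = tang (pchart d e) k (%z. \<mu> (fst z) (snd z)) (x, y) (0, v)"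
 using tang_comp[OF L manifold_prod[OF N L] Q smooth_at_Pair[OF L N L smooth_at_const smooth_at_id[OF L]] op_at e pchart_in[OF d(1) e(1)] _ k(1), of x v]
  tang_Pair[OF L N L smooth_at_const[of _ _ x] smooth_at_id[OF L, of y] e d e, of v] tang_id[OF L e] d e k by (simp add: tang_const)

lemma op_chart_nbhd:
 assumes A: "manifold A" and m: "smooth_at A N m p" and n: "smooth_at A L n p"
  and d: "d:N" "m p:cdom d" and e: "e:L" "n p:cdom e" and k: "k:Q" "\<mu> (m p) (n p):cdom k"
 obtains W where "open W" "p:W" "!!q. q:W==>m q:cdom d\<and>n q:cdom e\<and>\<mu> (m q) (n q):cdom k"
proof -
 obtain W1 where W1: "open W1" "p:W1" "m ` W1\<subseteq>cdom d" using smooth_at_preimage[OF A m open_cdom[OF N d(1)] d(2)] .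
 obtain W2 where W2: "open W2" "p:W2" "n ` W2\<subseteq>cdom e" using smooth_at_preimage[OF A n open_cdom[OF L e(1)] e(2)] .
 obtain W3 where W3: "open W3" "p:W3" "(%q. \<mu> (m q) (n q)) ` W3\<subseteq>cdom k"
  using smooth_at_preimage[OF A smooth_at_op[OF A m n] open_cdom[OF Q k(1)] k(2)] .
 show thesis by (rule that[of "W1\<inter>W2\<inter>W3"]) (use W1 W2 W3 in auto)
qed

text \<open>The partial map with second argument n q changes with q. Written as the total tangent
  map of \<mu> at (m q, n q), applied to (f i q, 0), it becomes one fixed smooth map along a moving
  point, to which \<open>lmcv_tang_along\<close> applies.\<close>

lemma lmcv_left:
 assumes A: "manifold A" and m: "smooth_at A N m p" and n: "smooth_at A L n p"
  and d: "d:N" "m p:cdom d" and k: "k:Q" "\<mu> (m p) (n p):cdom k" and f: "lmcv A F p f l"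
 shows "lmcv A F p (%i q. tang d k (%x. \<mu> x (n q)) (m q) (f i q)) (%q. tang d k (%x. \<mu> x (n q)) (m q) (l q))"
proof -
 obtain e where e: "e:L" "n p:cdom e" using ex_chart[OF L] by blast
 obtain W where W: "open W" "p:W" "!!q. q:W==>m q:cdom d\<and>n q:cdom e\<and>\<mu> (m q) (n q):cdom k" by (rule op_chart_nbhd[OF A m n d e k]) blast
 have "lmcv A F p (%i q. tang (pchart d e) k (%z. \<mu> (fst z) (snd z)) (m q, n q) (f i q, 0))
   (%q. tang (pchart d e) k (%z. \<mu> (fst z) (snd z)) (m q, n q) (l q, 0))"
  by (rule lmcv_tang_along[OF A manifold_prod[OF N L] Q op_at smooth_at_Pair[OF A N L m n] pchart_in[OF d(1) e(1)] _ k(1)])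
   (use d e k lmcv_Pair[OF A f lmcv_const[OF A smooth_at_const[of _ _ 0]]] in auto)
 then show ?thesis by (rule lmcv_cong[OF A _ W(1,2)]) (use W tang_left d e k in auto)
qed

lemma lmcv_right:
 assumes A: "manifold A" and m: "smooth_at A N m p" and n: "smooth_at A L n p"
  and e: "e:L" "n p:cdom e" and k: "k:Q" "\<mu> (m p) (n p):cdom k" and f: "lmcv A F p f l"
 shows "lmcv A F p (%i q. tang e k (\<mu> (m q)) (n q) (f i q)) (%q. tang e k (\<mu> (m q)) (n q) (l q))"
proof -
 obtain d where d: "d:N" "m p:cdom d" using ex_chart[OF N] by blast
 obtain W where W: "open W" "p:W" "!!q. q:W==>m q:cdom d\<and>n q:cdom e\<and>\<mu> (m q) (n q):cdom k" by (rule op_chart_nbhd[OF A m n d e k]) blast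
 have "lmcv A F p (%i q. tang (pchart d e) k (%z. \<mu> (fst z) (snd z)) (m q, n q) (0, f i q))
   (%q. tang (pchart d e) k (%z. \<mu> (fst z) (snd z)) (m q, n q) (0, l q))"
  by (rule lmcv_tang_along[OF A manifold_prod[OF N L] Q op_at smooth_at_Pair[OF A N L m n] pchart_in[OF d(1) e(1)] _ k(1)])
   (use d e k lmcv_Pair[OF A lmcv_const[OF A smooth_at_const[of _ _ 0]] f] in auto)
 then show ?thesis by (rule lmcv_cong[OF A _ W(1,2)]) (use W tang_right d e k in auto)
qed

end

section \<open>Lie groups\<close>

locale lie_grp =
 fixes G :: "('k::t2_space, 'b::lcs) lgrp"
 assumes lie: "lie_group G"
begin

lemma manG: "manifold (latlas G)" and chart1: "chart1 G:latlas G" and one_chart1: "one G:cdom (chart1 G)"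
 and grp: "Groups.group (mul G) (one G) (ginv G)" and smooth_mul: "smooth_map (prod_atlas (latlas G) (latlas G)) (latlas G) (%(g, h). mul G g h)"
 and smooth_ginv: "smooth_map (latlas G) (latlas G) (ginv G)" using lie unfolding lie_group_def by blast+

sublocale grp: Groups.group "mul G" "one G" "ginv G" by (rule grp)

sublocale mulop: smooth_op "latlas G" "latlas G" "latlas G" "mul G" by unfold_locales (rule manG smooth_mul)+

lemma smooth_at_ginv: "smooth_at (latlas G) (latlas G) (ginv G) g" by (rule smooth_atI[OF smooth_ginv]) auto

lemma smooth_at_conj: "smooth_at (latlas G) (latlas G) (%g. mul G (mul G k g) (ginv G k)) g"
 by (intro mulop.smooth_at_op manG smooth_at_const smooth_at_id)

lemma Ad_linear: "linear (Ad G k)" unfolding Ad_def[abs_def] by (rule tang_linear[OF manG manG smooth_at_conj chart1 chart1]) (auto simp: one_chart1)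

lemma Ad_continuous: "continuous_on UNIV (Ad G k)" unfolding Ad_def[abs_def]
 by (rule tang_continuous[OF manG manG smooth_at_conj chart1 chart1]) (auto simp: one_chart1)

lemma Ad_mul: "Ad G (mul G k l) x = Ad G k (Ad G l x)"
proof -
 have *: "(%g. mul G (mul G (mul G k l) g) (ginv G (mul G k l))) =
  (%g. mul G (mul G k (mul G (mul G l g) (ginv G l))) (ginv G k))" by (simp add: fun_eq_iff grp.assoc grp.inverse_distrib_swap)
 show ?thesis unfolding Ad_def * using tang_comp[OF manG manG manG smooth_at_conj smooth_at_conj chart1 one_chart1 chart1 _ chart1, of l k x]
  by (simp add: one_chart1)
qed

lemma Ad_one: "Ad G (one G) x = x" by (simp add: Ad_def tang_id[OF manG chart1 one_chart1] grp.inverse_neutral)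

text \<open>Ad is the tangent map at 1 of conjugation in its second argument. Treating conjugation
  as a smooth binary operation allows the first argument to move as well.\<close>

lemma lmcv_Ad:
 assumes A: "manifold A" and k: "smooth_at A (latlas G) k p" and f: "lmcv A F p f l"
 shows "lmcv A F p (%i q. Ad G (k q) (f i q)) (%q. Ad G (k q) (l q))"
proof -
 have c: "smooth_map (prod_atlas (latlas G) (latlas G)) (latlas G) (%(k, g). mul G (mul G k g) (ginv G k))"
 proof -
  note P = manifold_prod[OF manG manG]
  have f: "smooth_at (prod_atlas (latlas G) (latlas G)) (latlas G) fst z"
   "smooth_at (prod_atlas (latlas G) (latlas G)) (latlas G) snd z" for z by (rule smooth_atI[OF smooth_map_on_fst[OF manG manG open_UNIV]], auto)
    (rule smooth_atI[OF smooth_map_on_snd[OF manG manG open_UNIV]], auto)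
  have "smooth_at (prod_atlas (latlas G) (latlas G)) (latlas G) (%z. mul G (mul G (fst z) (snd z)) (ginv G (fst z))) z" for z
   by (intro mulop.smooth_at_op P f smooth_at_comp[OF P manG manG _ smooth_at_ginv])
  then show ?thesis unfolding case_prod_unfold by (intro smooth_map_on_local P manG) (auto simp: smooth_at_def)
 qed
 interpret cj: smooth_op "latlas G" "latlas G" "latlas G" "%k g. mul G (mul G k g) (ginv G k)" by unfold_locales (rule manG c)+
 show ?thesis unfolding Ad_def by (rule cj.lmcv_right[OF A k smooth_at_const chart1 one_chart1 chart1 _ f]) (simp add: one_chart1)
qed

section \<open>The Lie bracket from the second derivative of the multiplication\<close>

definition "e1 = cmap (chart1 G) (one G)"
definition m1 :: "'b\<times>'b=>'b" where
 "m1 z = cmap (chart1 G) (mul G (cinv (chart1 G) (fst z)) (cinv (chart1 G) (snd z)))"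

text \<open>The Hessian of the multiplication at the unit. Its mixed part, antisymmetrized, is the
  Lie bracket.\<close>

definition "ddm u v = ddir (%z. ddir m1 z u) (e1, e1) v"

lemma m1_nbhd:
 obtains W where "open W" "(e1, e1):W" "smooth_on W m1" "W\<subseteq>cimg (chart1 G)\<times>cimg (chart1 G)"
  "!!a b. (a, b):W==>mul G (cinv (chart1 G) a) (cinv (chart1 G) b):cdom (chart1 G)"
proof -
 let ?c = "chart1 G"
 note P = manifold_prod[OF manG manG]
 obtain W where W: "open W" "(one G, one G):W" "W\<subseteq>cdom (pchart ?c ?c)\<inter>(%z. mul G (fst z) (snd z)) -` cdom ?c"
  "open (cmap (pchart ?c ?c) ` W)"
  "smooth_on (cmap (pchart ?c ?c) ` W) (%x. cmap ?c (mul G (fst (cinv (pchart ?c ?c) x)) (snd (cinv (pchart ?c ?c) x))))"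
  by (rule smooth_at_repE[OF P manG mulop.op_at pchart_in[OF chart1 chart1] chart1, of "(one G, one G)"])
   (auto simp: one_chart1)
 have mem: "z:cimg ?c\<times>cimg ?c" if "z:cmap (pchart ?c ?c) ` W" for z using that W(3) by (auto simp: cmap_cimg)
 show thesis
 proof (rule that[OF W(4)])
  show "(e1, e1):cmap (pchart ?c ?c) ` W" using W(2) by (auto simp: e1_def intro!: image_eqI[of _ _ "(one G, one G)"])
  show "smooth_on (cmap (pchart ?c ?c) ` W) m1"
   by (rule smooth_on_cong[OF W(5,4)]) (use mem in \<open>simp only: m1_def cinv_pchart[OF manG chart1 manG chart1] fst_conv snd_conv\<close>)
  show "cmap (pchart ?c ?c) ` W\<subseteq>cimg ?c\<times>cimg ?c" using mem by blast
  fix a b assume "(a, b):cmap (pchart ?c ?c) ` W"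
  then obtain g h where "(g, h):W" "a = cmap ?c g" "b = cmap ?c h" by auto
  then show "mul G (cinv ?c a) (cinv ?c b):cdom ?c" proof -
   have "(g, h):cdom ?c\<times>cdom ?c\<inter>(%z. mul G (fst z) (snd z)) -` cdom ?c"
    using W(3) \<open>(g, h):W\<close> unfolding fst_conv by (rule subsetD)
   then show ?thesis
    using \<open>a = cmap ?c g\<close> \<open>b = cmap ?c h\<close> cinv_cmap[OF manG chart1, of g] cinv_cmap[OF manG chart1, of h] by simp
  qed
 qed
qed

lemma cinv_e1: "cinv (chart1 G) e1 = one G" "e1:cimg (chart1 G)" by (simp_all add: e1_def cinv_cmap[OF manG chart1 one_chart1] cmap_cimg one_chart1)

lemma tang_mul_right_m1:
 assumes "a:cimg (chart1 G)" shows "tang (chart1 G) (chart1 G) (mul G (cinv (chart1 G) a)) (one G) y = ddir m1 (a, e1) (0, y)"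
 by (simp add: tang_def ddir_def dquot_def[abs_def] m1_def e1_def)

lemma tang_mul_left_m1:
 assumes "a:cimg (chart1 G)" shows "tang (chart1 G) (chart1 G) (%g. mul G g (cinv (chart1 G) a)) (one G) y = ddir m1 (e1, a) (y, 0)"
 by (simp add: tang_def ddir_def dquot_def[abs_def] m1_def e1_def)

lemma ddir_m1_right: "ddir m1 (e1, e1) (0, y) = y"
proof -
 have "mul G (one G) = (%x. x)" by (simp add: fun_eq_iff)
 then show ?thesis using tang_mul_right_m1[OF cinv_e1(2), of y] tang_id[OF manG chart1 one_chart1, of y] by (simp add: cinv_e1)
qed

lemma linv_field_m1:
 assumes "a:cimg (chart1 G)" shows "linv_field G y (chart1 G) (cinv (chart1 G) a) = ddir m1 (a, e1) (0, y)"
 using assms tang_mul_right_m1[OF assms] by (simp add: linv_field_def chart1 cinv_cdom)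

lemma ddm_smooth: shows ddm_bilinear: "bilinear ddm" and ddm_sym: "ddm u v = ddm v u"
  and ddm_continuous: "continuous_on UNIV (%z. ddm (fst z) (snd z))"
proof -
 obtain W where W: "open W" "(e1, e1):W" "smooth_on W m1" using m1_nbhd by metis
 have eq: "ddm u v = iter_deriv 2 m1 (e1, e1) ((%_. v)(0 := u))" for u v by (simp add: ddm_def numeral_2_eq_2)
 show sym: "ddm u v = ddm v u" for u v unfolding ddm_def by (rule ddir_ddir_commute[OF W(3,1,2)])
 have "linear (%v. ddm u v)" for u unfolding ddm_def by (rule ddir_linear[OF smooth_on_ddir[OF W(3)] W(1,2)])
 moreover from this have "linear (%u. ddm u v)" for v by (simp add: sym[of _ v])
 ultimately show "bilinear ddm" unfolding bilinear_def by blast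
 show "continuous_on UNIV (%z. ddm (fst z) (snd z))" unfolding continuous_on_def eq
 proof
  fix z :: "('b\<times>'b)\<times>('b\<times>'b)"
  have i: "((%z. z)\<longlongrightarrow>z) (at z)" by (rule tendsto_ident_at)
  show "((%z. iter_deriv 2 m1 (e1, e1) ((%_. snd z)(0 := fst z)))\<longlongrightarrow>iter_deriv 2 m1 (e1, e1) ((%_. snd z)(0 := fst z))) (at z)"
   by (rule tendsto_iter_deriv[OF W(3,1,2) tendsto_const tendsto_fun_upd[OF tendsto_coordinatewiseI tendsto_fst[OF i]]])
    (rule tendsto_snd[OF i])
 qed
qed

text \<open>In the chart a left invariant field is the partial derivative of the multiplication in
  its second argument at the unit, so one more differentiation gives a mixed second derivative.
  Bilinearity and continuity of the bracket become evident in this form.\<close>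

lemma lie_br_ddm: "lie_br G x y = ddm (0, y) (x, 0) - ddm (0, x) (y, 0)"
proof -
 obtain W where W: "open W" "(e1, e1):W" "smooth_on W m1" "W\<subseteq>cimg (chart1 G)\<times>cimg (chart1 G)" using m1_nbhd by metis
 have one: "one G:cdom (chart1 G)" by (rule one_chart1)
 have l1: "linv_field G x (chart1 G) (one G) = x" for x using linv_field_m1[OF cinv_e1(2), of x] by (simp add: cinv_e1 ddir_m1_right)
 have d: "ddir (%a. linv_field G y (chart1 G) (cinv (chart1 G) a)) e1 x = ddm (0, y) (x, 0)" for x y
 proof -
  have "ddir (%a. linv_field G y (chart1 G) (cinv (chart1 G) a)) e1 x = ddir (%a. ddir m1 (a, e1) (0, y)) e1 x"
   by (rule ddir_cong[OF open_cimg[OF manG chart1] cinv_e1(2) linv_field_m1])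
  also have "\<dots> = ddm (0, y) (x, 0)" by (simp add: ddm_def ddir_def dquot_def[abs_def])
  finally show ?thesis .
 qed
 show ?thesis using one chart1 by (simp add: lie_br_def vf_bracket_def l1 d[unfolded e1_def] e1_def[symmetric] d)
qed

lemma lie_br_bilinear: "bilinear (lie_br G)"
proof -
 have "linear (%y. lie_br G x y)" "linear (%x. lie_br G x y)" for x y unfolding lie_br_ddm
  by (rule linearI; simp add: bilinear_ladd[OF ddm_bilinear, of "(0, _)" "(0, _)", simplified]
   bilinear_radd[OF ddm_bilinear, of _ "(_, 0)" "(_, 0)", simplified]
   bilinear_lmul[OF ddm_bilinear, of _ "(0, _)", simplified] bilinear_rmul[OF ddm_bilinear, of _ _ "(_, 0)", simplified] algebra_simps)+
 then show ?thesis by (simp add: bilinear_def)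
qed

lemma lie_br_continuous: "continuous_on UNIV (%z. lie_br G (fst z) (snd z))" unfolding lie_br_ddm
 by (intro continuous_on_diff_lcs continuous_on_bilinear_compose[OF ddm_continuous] continuous_intros)

lemma lie_br_skew: "lie_br G x y = - lie_br G y x" by (simp add: lie_br_ddm)

lemma smooth_at_Ad_inv: "smooth_at (latlas G) lin_atlas (%h. Ad G (ginv G h) y) g"
 by (rule smooth_at_via_lmcv[OF manG lmcv_Ad[OF manG smooth_at_ginv lmcv_const[OF manG smooth_at_const]]])

text \<open>By g h = h (h^-1 g h), moving y by right translation with h is the same as moving
  Ad(h^-1) y by left translation with h. Both sides are first derivatives of \<open>m1\<close>;
  differentiating once more in h at the unit leaves the commutator.\<close>

lemma tang_Ad_inv: "tang (chart1 G) lchart (%h. Ad G (ginv G h) y) (one G) x = - lie_br G x y"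
proof -
 let ?c = "chart1 G"
 obtain W where W: "open W" "(e1, e1):W" "smooth_on W m1" "W\<subseteq>cimg ?c\<times>cimg ?c"
  "!!a b. (a, b):W==>mul G (cinv ?c a) (cinv ?c b):cdom ?c" by (rule m1_nbhd) blast
 let ?w = "%a. Ad G (ginv G (cinv ?c a)) y"
 have w1: "?w e1 = y" by (simp add: cinv_e1 grp.inverse_neutral Ad_one)
 have sw: "smooth_on (cimg ?c) ?w"
 proof -
  have "msm (latlas G) UNIV (%h. Ad G (ginv G h) y)" using smooth_at_msm_iff[OF open_UNIV manG] smooth_at_Ad_inv by blast
  then show ?thesis using chart1 by (simp add: msm_def cimg_def)
 qed
 let ?V = "{a:cimg ?c. (e1, a):W\<and>(a, e1):W}"
 have oV: "open ?V"
 proof -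
  have "open ((%a. (e1, a)) -` W)" "open ((%a. (a, e1)) -` W)" by (intro open_vimage W(1) continuous_intros)+
  then show ?thesis using open_cimg[OF manG chart1] by (auto simp: Collect_conj_eq vimage_def)
 qed
 have eV: "e1:?V" using W(2) cinv_e1 by auto
 have id: "ddir m1 (e1, a) (y, 0) = ddir m1 (a, e1) (0, ?w a)" if "a:?V" for a
 proof -
  let ?h = "cinv ?c a"
  have a: "a:cimg ?c" "?h:cdom ?c" using that by (auto simp: cinv_cdom)
  have e: "(%g. mul G g ?h) = (%g. mul G ?h (mul G (mul G (ginv G ?h) g) (ginv G (ginv G ?h))))" by (simp add: fun_eq_iff grp.assoc[symmetric])
  have "tang ?c ?c (%g. mul G g ?h) (one G) y = tang ?c ?c (mul G ?h) (one G) (Ad G (ginv G ?h) y)" unfolding e Ad_def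
   using tang_comp[OF manG manG manG smooth_at_conj mulop.smooth_at_right chart1 one_chart1 chart1 _ chart1, of "ginv G ?h" ?h y] a
   by (simp add: one_chart1)
  then show ?thesis using tang_mul_left_m1[OF a(1)] tang_mul_right_m1[OF a(1)] by simp
 qed
 have sV: "smooth_on ?V (%a. (e1, a))" "smooth_on ?V (%a. (a, e1))" by (intro smooth_on_Pair smooth_on_const smooth_on_id oV)+
 have s1: "smooth_on ?V (%a. (y, 0::'b))" by (rule smooth_on_const)
 have s2: "smooth_on ?V (%a. (0::'b, ?w a))" by (intro smooth_on_Pair smooth_on_const oV smooth_on_subset[OF sw]) auto
 have dl: "ddir (%x. x) a v = v" for a v :: 'b by (rule ddir_linear_eq) (simp add: linear_iff)
 have "ddir (%a. ddir m1 (e1, a) (y, 0)) e1 x = ddir (%a. ddir m1 (a, e1) (0, ?w a)) e1 x" by (rule ddir_cong[OF oV eV id])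
 moreover have "ddir (%a. ddir m1 (e1, a) (y, 0)) e1 x = ddm (y, 0) (0, x)" by (simp add: ddm_def ddir_def dquot_def[abs_def])
 moreover have "ddir (%a. ddir m1 (a, e1) (0, ?w a)) e1 x = ddm (0, y) (x, 0) + ddir ?w e1 x"
 proof -
  have "ddir (%a. ddir m1 (a, e1) (0, ?w a)) e1 x =
   ddir (%z. ddir m1 z (0, ?w e1)) (e1, e1) (ddir (%a. (a, e1)) e1 x) + ddir m1 (e1, e1) (ddir (%a. (0, ?w a)) e1 x)"
   by (rule ddir_of_ddir[OF W(3,1) sV(2) s2 oV _ eV]) auto
  also have "ddir (%a. (a, e1)) e1 x = (x, 0)" by (subst ddir_Pair[OF smooth_on_id smooth_on_const oV eV]) (simp add: ddir_const dl)
  also have "ddir (%a. (0, ?w a)) e1 x = (0, ddir ?w e1 x)"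
   by (subst ddir_Pair[OF smooth_on_const smooth_on_subset[OF sw] oV eV]) (auto simp: ddir_const)
  finally show ?thesis by (simp add: w1 ddm_def ddir_m1_right)
 qed
 ultimately have "ddir ?w e1 x = ddm (y, 0) (0, x) - ddm (0, y) (x, 0)" by simp
 then show ?thesis by (simp add: tang_def e1_def[symmetric] lie_br_ddm ddm_sym[of "(y, 0)"])
qed

end

lemma smooth_map_at: "smooth_map A B f==>smooth_at A B f p" by (rule smooth_atI[of UNIV]) auto

locale lie_morph = G: lie_grp G + H: lie_grp H for G :: "('k::t2_space, 'b::lcs) lgrp" and H :: "('l::t2_space, 'd::lcs) lgrp" +
 fixes f :: "'k=>'l"
 assumes hom: "lie_hom G H f"
begin

lemma smooth_f: "smooth_at (latlas G) (latlas H) f g" using hom smooth_map_at unfolding lie_hom_def by blast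

lemma f_mul: "f (mul G x y) = mul H (f x) (f y)" using hom unfolding lie_hom_def by blast

lemma f_one: "f (one G) = one H" using f_mul[of "one G" "one G"] by (metis G.grp.left_neutral H.grp.group_left_neutral H.grp.right_cancel)

lemma f_ginv: "f (ginv G x) = ginv H (f x)"
 using f_mul[of "ginv G x" x] f_one by (simp add: H.grp.inverse_unique[symmetric]) (metis H.grp.inverse_unique H.grp.inverse_inverse)

lemma Lhom_linear: "linear (Lhom G H f)" unfolding Lhom_def[abs_def]
 by (rule tang_linear[OF G.manG H.manG smooth_f G.chart1 H.chart1 G.one_chart1]) (simp add: f_one H.one_chart1)

lemma Lhom_continuous: "continuous_on UNIV (Lhom G H f)" unfolding Lhom_def[abs_def]
 by (rule tang_continuous[OF G.manG H.manG smooth_f G.chart1 H.chart1 G.one_chart1]) (simp add: f_one H.one_chart1)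

lemma Lhom_Ad: "Lhom G H f (Ad G k x) = Ad H (f k) (Lhom G H f x)"
proof -
 have e: "(%g. f (mul G (mul G k g) (ginv G k))) = (%g. mul H (mul H (f k) (f g)) (ginv H (f k)))" by (simp add: fun_eq_iff f_mul f_ginv)
 have "Lhom G H f (Ad G k x) = tang (chart1 G) (chart1 H) (%g. f (mul G (mul G k g) (ginv G k))) (one G) x" unfolding Lhom_def Ad_def
  using tang_comp[OF G.manG G.manG H.manG G.smooth_at_conj smooth_f G.chart1 G.one_chart1 G.chart1 _ H.chart1, of k x]
  by (simp add: f_one G.one_chart1 H.one_chart1)
 also have "\<dots> = Ad H (f k) (Lhom G H f x)" unfolding e Lhom_def Ad_def
  using tang_comp[OF G.manG H.manG H.manG smooth_f H.smooth_at_conj G.chart1 G.one_chart1 H.chart1 _ H.chart1, of "f k" x]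
  by (simp add: f_one H.one_chart1)
 finally show ?thesis .
qed

end

section \<open>Principal bundles\<close>

locale pbun =
 fixes B :: "('m::t2_space, 'a::lcs, 'p::t2_space, 'c::lcs, 'k::t2_space, 'b::lcs) pbundle"
 assumes pb: "principal_bundle B"
begin

abbreviation "MM \<equiv> base B"
abbreviation "PP \<equiv> total B"
abbreviation "KK \<equiv> sgrp B"
abbreviation "KA \<equiv> latlas (sgrp B)"
abbreviation "k1 \<equiv> chart1 (sgrp B)"
abbreviation "ee \<equiv> one (sgrp B)"
abbreviation "pr \<equiv> proj B"
abbreviation "ra \<equiv> ract B"

lemma manM: "manifold MM" and manP: "manifold PP" and lieK: "lie_group KK" and smooth_proj: "smooth_map PP MM pr"
 and smooth_ract: "smooth_map (prod_atlas PP KA) PP (%(p, k). ra p k)" and ract_one [simp]: "ra p ee = p"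
 and ract_mul: "ra (ra p k) l = ra p (mul KK k l)" using pb unfolding principal_bundle_def by blast+

sublocale K: lie_grp "sgrp B" by unfold_locales (rule lieK)

sublocale act: smooth_op "total B" "latlas (sgrp B)" "total B" "ract B" by unfold_locales (rule manP K.manG smooth_ract)+

lemma proj_at: "smooth_at PP MM pr p" by (rule smooth_map_at[OF smooth_proj])

lemma triviality:
 obtains U F where "open U" "m:U" "bij_betw F (U\<times>UNIV) (pr -` U)" "!!u k. u:U==>pr (F (u, k)) = u"
  "!!u k l. u:U==>F (u, mul KK k l) = ra (F (u, k)) l"
  "smooth_map_on (U\<times>UNIV) (prod_atlas MM KA) PP F"
  "smooth_map_on (pr -` U) PP (prod_atlas MM KA) (inv_into (U\<times>UNIV) F)"
proof -
 have "\<exists>U F. open U\<and>m:U\<and>bij_betw F (U\<times>UNIV) (pr -` U) \<and>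
    (\<forall>u\<in>U. \<forall>k. pr (F (u, k)) = u) \<and>
    (\<forall>u\<in>U. \<forall>k l. F (u, mul KK k l) = ra (F (u, k)) l) \<and>
    smooth_map_on (U\<times>UNIV) (prod_atlas MM KA) PP F \<and>
    smooth_map_on (pr -` U) PP (prod_atlas MM KA) (inv_into (U\<times>UNIV) F)" using pb unfolding principal_bundle_def by blast
 then show thesis using that by blast
qed

lemma proj_ract [simp]: "pr (ra p k) = pr p"
proof -
 obtain U F where U: "open U" "pr p:U" "bij_betw F (U\<times>UNIV) (pr -` U)" "!!u k. u:U==>pr (F (u, k)) = u"
  "!!u k l. u:U==>F (u, mul KK k l) = ra (F (u, k)) l" by (rule triviality) blast
 have "p:F ` (U\<times>UNIV)" using U by (simp add: bij_betw_def)
 then obtain u k0 where "p = F (u, k0)" "u:U" by auto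
 then show ?thesis using U(4,5) by metis
qed

lemma open_over: "open U==>open (pr -` U)" using smooth_map_preimage_open[OF smooth_proj open_UNIV] by simp

lemma local_section:
 obtains U \<tau> \<kappa> where "open U" "m:U" "smooth_map_on U MM PP \<tau>" "smooth_map_on (pr -` U) PP KA \<kappa>"
  "!!u. u:U==>pr (\<tau> u) = u" "!!p. pr p:U==>ra (\<tau> (pr p)) (\<kappa> p) = p"
  "!!u k. u:U==>\<kappa> (ra (\<tau> u) k) = k"
proof -
 obtain U F where U: "open U" "m:U" "bij_betw F (U\<times>UNIV) (pr -` U)" "!!u k. u:U==>pr (F (u, k)) = u"
  "!!u k l. u:U==>F (u, mul KK k l) = ra (F (u, k)) l"
  "smooth_map_on (U\<times>UNIV) (prod_atlas MM KA) PP F"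
  "smooth_map_on (pr -` U) PP (prod_atlas MM KA) (inv_into (U\<times>UNIV) F)" by (rule triviality) blast
 note PK = manifold_prod[OF manM K.manG]
 let ?\<tau> = "%u. F (u, ee)" and ?\<kappa> = "%p. snd (inv_into (U\<times>UNIV) F p)"
 have F1: "F (u, k) = ra (?\<tau> u) k" if "u:U" for u k using U(5)[OF that, of ee k] by simp
 have inj: "inj_on F (U\<times>UNIV)" and im: "F ` (U\<times>UNIV) = pr -` U" using U(3) by (auto simp: bij_betw_def)
 show thesis
 proof (rule that[OF U(1,2)])
  show "smooth_map_on U MM PP ?\<tau>"
   by (rule smooth_map_on_comp[OF manM PK smooth_map_on_Pair[OF manM U(1) smooth_map_on_id[OF manM] smooth_map_on_const manM K.manG] U(1) U(6) _ _ manP])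
    (use U(1) in \<open>auto simp: open_Times\<close>)
  show "smooth_map_on (pr -` U) PP KA ?\<kappa>"
   by (rule smooth_map_on_comp[OF manP PK U(7) open_over[OF U(1)] smooth_map_on_snd[OF manM K.manG open_UNIV] open_UNIV _ K.manG]) auto
  show "pr (?\<tau> u) = u" if "u:U" for u using U(4)[OF that] .
  show "ra (?\<tau> (pr p)) (?\<kappa> p) = p" if "pr p:U" for p
  proof -
   have "p:F ` (U\<times>UNIV)" using im that by auto
   then obtain u k where uk: "p = F (u, k)" "u:U" by auto
   then have "?\<kappa> p = k" using inv_into_f_f[OF inj, of "(u, k)"] by simp
   moreover have "pr p = u" using uk U(4) by simp
   ultimately show ?thesis using uk F1[OF uk(2), of k] by simp
  qed
  show "?\<kappa> (ra (?\<tau> u) k) = k" if "u:U" for u k using inv_into_f_f[OF inj, of "(u, k)"] that by (simp add: F1[symmetric])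
 qed
qed

lemma fibre_transitive:
 assumes "pr p = pr q"
 obtains k where "q = ra p k"
proof -
 obtain U \<tau> \<kappa> where U: "open U" "pr p:U" "!!p. pr p:U==>ra (\<tau> (pr p)) (\<kappa> p) = p" by (rule local_section[of "pr p"]) blast
 have "q = ra (\<tau> (pr p)) (\<kappa> q)" using U(3)[of q] U(2) assms by simp
 also have "\<dots> = ra (ra (\<tau> (pr p)) (\<kappa> p)) (mul KK (ginv KK (\<kappa> p)) (\<kappa> q))"
  by (simp add: ract_mul K.grp.assoc[symmetric])
 also have "\<dots> = ra p (mul KK (ginv KK (\<kappa> p)) (\<kappa> q))" using U by simp
 finally show thesis using that by blast
qed

lemma proj_surj: "\<exists>p. pr p = m"
proof -
 obtain U \<tau> where "open U" "m:U" "!!u. u:U==>pr (\<tau> u) = u" by (rule local_section[of m]) blast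
 then show ?thesis by blast
qed

lemma smooth_at_ract: "smooth_at PP PP (%q. ra q k) p" by (rule act.smooth_at_left)

lemma tang_proj_linear: "c:PP==>p:cdom c==>d:MM==>pr p:cdom d==>linear (tang c d pr p)" by (rule tang_linear[OF manP manM proj_at])

lemma tang_proj_ract:
 assumes "c:PP" "p:cdom c" "c':PP" "ra p k:cdom c'" "d:MM" "pr p:cdom d" shows "tang c' d pr (ra p k) (tang c c' (%q. ra q k) p v) = tang c d pr p v"
 using tang_comp[OF manP manP manM smooth_at_ract proj_at assms(1-5), of v] assms(6) by simp

section \<open>Fundamental vector fields\<close>

lemma fundv_linear: "c:PP==>p:cdom c==>linear (%x. fundv B x c p)" unfolding fundv_def
 by (rule tang_linear[OF K.manG manP act.smooth_at_right K.chart1 _ K.one_chart1]) auto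

lemma fundv_change:
 assumes "c:PP" "p:cdom c" "d:PP" "p:cdom d" shows "fundv B x d p = tang c d (%q. q) p (fundv B x c p)" unfolding fundv_def
 using tang_comp[OF K.manG manP manP act.smooth_at_right smooth_at_id[OF manP] K.chart1 K.one_chart1 assms(1) _ assms(3), of p x] assms by simp

lemma tang_proj_fundv:
 assumes "c:PP" "p:cdom c" "d:MM" "pr p:cdom d" shows "tang c d pr p (fundv B x c p) = 0"
 using tang_comp[OF K.manG manP manM act.smooth_at_right proj_at K.chart1 K.one_chart1 assms(1) _ assms(3), of p x] assms
 by (simp add: fundv_def tang_const)

lemma fundv_ract:
 assumes "c:PP" "p:cdom c" "d:PP" "ra p k:cdom d" shows "tang c d (%q. ra q k) p (fundv B x c p) = fundv B (Ad KK (ginv KK k) x) d (ra p k)"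
proof -
 have e: "(%g. ra (ra p g) k) = (%g. ra (ra p k) (mul KK (mul KK (ginv KK k) g) (ginv KK (ginv KK k))))"
  by (simp add: fun_eq_iff ract_mul K.grp.assoc[symmetric])
 have "tang c d (%q. ra q k) p (fundv B x c p) = tang k1 d (%g. ra (ra p g) k) ee x" unfolding fundv_def
  using tang_comp[OF K.manG manP manP act.smooth_at_right smooth_at_ract K.chart1 K.one_chart1 assms(1) _ assms(3), of p k x] assms by simp
 also have "\<dots> = fundv B (Ad KK (ginv KK k) x) d (ra p k)" unfolding e fundv_def Ad_def
  using tang_comp[OF K.manG K.manG manP K.smooth_at_conj act.smooth_at_right K.chart1 K.one_chart1 K.chart1 _ assms(3), of "ginv KK k" "ra p k" x] assms
  by (simp add: K.one_chart1)
 finally show ?thesis .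
qed

lemma lmcv_fundv:
 assumes "c:PP" "p:cdom c" "lmcv PP F p f l" shows "lmcv PP F p (%i q. fundv B (f i q) c q) (%q. fundv B (l q) c q)" unfolding fundv_def
 by (rule act.lmcv_right[OF manP smooth_at_id[OF manP] smooth_at_const K.chart1 K.one_chart1 assms(1) _ assms(3)])
  (simp add: assms)

text \<open>The inverse is the derivative at p of q to \<kappa>(p)^-1 \<kappa>(q), where \<kappa> is
  the group coordinate of a trivialization. Being explicit, it is continuous, although the inverse
  function theorem fails for general locally convex spaces. Besides P it is applied to the extended
  group as a bundle over K.\<close>

lemma vertical_inverse:
 assumes c: "c:PP" "p:cdom c" and d: "d:MM" "pr p:cdom d"
 obtains \<rho> where "linear \<rho>" "continuous_on UNIV \<rho>" "!!x. \<rho> (fundv B x c p) = x"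
  "!!v. tang c d pr p v = 0==>v = fundv B (\<rho> v) c p"
proof -
 obtain U \<tau> \<kappa> where U: "open U" "pr p:U" "smooth_map_on U MM PP \<tau>" "smooth_map_on (pr -` U) PP KA \<kappa>"
  "!!u. u:U==>pr (\<tau> u) = u" "!!p. pr p:U==>ra (\<tau> (pr p)) (\<kappa> p) = p"
  "!!u k. u:U==>\<kappa> (ra (\<tau> u) k) = k" by (rule local_section[of "pr p"]) blast
 have st: "smooth_at MM PP \<tau> (pr p)" by (rule smooth_atI[OF U(3,1,2)])
 have sk: "smooth_at PP KA \<kappa> p" by (rule smooth_atI[OF U(4) open_over[OF U(1)]]) (use U in auto)
 let ?g = "ginv KK (\<kappa> p)"
 have sL: "smooth_at KA KA (mul KK ?g) k" for k by (rule K.mulop.smooth_at_right)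
 have sr: "smooth_at PP KA (%q. mul KK ?g (\<kappa> q)) p" by (rule smooth_at_comp[OF manP K.manG K.manG sk sL])
 let ?\<rho> = "tang c k1 (%q. mul KK ?g (\<kappa> q)) p"
 have \<kappa>r: "\<kappa> (ra p k) = mul KK (\<kappa> p) k" for k using U(7)[OF U(2), of "mul KK (\<kappa> p) k"] U(6)[OF U(2)] by (metis ract_mul)
 obtain e where e: "e:KA" "\<kappa> p:cdom e" using ex_chart[OF K.manG] by blast
 obtain c0 where c0: "c0:PP" "\<tau> (pr p):cdom c0" using ex_chart[OF manP] by blast
 have p: "ra (\<tau> (pr p)) (\<kappa> p) = p" by (rule U(6)[OF U(2)])
 show thesis
 proof (rule that[of ?\<rho>])
  show "linear ?\<rho>" by (rule tang_linear[OF manP K.manG sr c(1) K.chart1 c(2)]) (simp add: K.one_chart1)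
  show "continuous_on UNIV ?\<rho>" by (rule tang_continuous[OF manP K.manG sr c(1) K.chart1 c(2)]) (simp add: K.one_chart1)
  fix x
  have "?\<rho> (fundv B x c p) = tang k1 k1 (%k. mul KK ?g (\<kappa> (ra p k))) ee x"
  proof -
   have "tang k1 k1 (%k. mul KK ?g (\<kappa> (ra p k))) ee x =
    tang c k1 (%q. mul KK ?g (\<kappa> q)) (ra p ee) (tang k1 c (ra p) ee x)"
    by (rule tang_comp[OF K.manG manP K.manG act.smooth_at_right _ K.chart1 K.one_chart1 c(1) _ K.chart1])
     (simp_all add: sr c K.one_chart1)
   then show ?thesis by (simp add: fundv_def)
  qed
  also have "(%k. mul KK ?g (\<kappa> (ra p k))) = (%k. k)" by (simp add: fun_eq_iff \<kappa>r K.grp.assoc[symmetric])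
  finally show "?\<rho> (fundv B x c p) = x" using tang_id[OF K.manG K.chart1 K.one_chart1] by simp
 next
  fix v assume v: "tang c d pr p v = 0"
  have stp: "smooth_at PP PP (%q. \<tau> (pr q)) p" by (rule smooth_at_comp[OF manP manM manP proj_at st])
  have "v = tang c c (%q. q) p v" using tang_id[OF manP c] by simp
  \<comment> \<open>In the identity q = \<tau>(pr q) \<kappa>(q) only the group factor varies to
    first order along a vertical v.\<close>
  also have "\<dots> = tang c c (%q. ra (\<tau> (pr q)) (\<kappa> q)) p v" by (rule tang_cong[OF manP c open_over[OF U(1)]]) (use U in auto)
  also have "\<dots> = tang c0 c (%y. ra y (\<kappa> p)) (\<tau> (pr p)) (tang c c0 (%q. \<tau> (pr q)) p v)
    + tang e c (ra (\<tau> (pr p))) (\<kappa> p) (tang c e \<kappa> p v)" by (rule act.tang_op[OF manP stp sk c c0 e c(1)]) (simp add: p c)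
  also have "tang c c0 (%q. \<tau> (pr q)) p v = 0" using tang_comp[OF manP manM manP proj_at st c d c0, of v] v
    linear_0[OF tang_linear[OF manM manP st d(1) c0(1) d(2) c0(2)]] by simp
  also have "tang c0 c (%y. ra y (\<kappa> p)) (\<tau> (pr p)) 0 = 0"
   by (rule linear_0[OF tang_linear[OF manP manP smooth_at_ract c0(1) c(1) c0(2)]]) (simp add: p c)
  also have "ra (\<tau> (pr p)) = (%k. ra p (mul KK ?g k))"
  proof
   fix k
   have "ra p (mul KK ?g k) = ra (ra (\<tau> (pr p)) (\<kappa> p)) (mul KK ?g k)" by (simp add: p)
   then show "ra (\<tau> (pr p)) k = ra p (mul KK ?g k)" by (simp add: ract_mul K.grp.assoc[symmetric])
  qed
  also have "tang e c (%k. ra p (mul KK ?g k)) (\<kappa> p) (tang c e \<kappa> p v) =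
   tang k1 c (ra p) (mul KK ?g (\<kappa> p)) (tang e k1 (mul KK ?g) (\<kappa> p) (tang c e \<kappa> p v))"
   by (rule tang_comp[OF K.manG K.manG manP sL act.smooth_at_right e K.chart1 _ c(1)]) (simp_all add: K.one_chart1 c)
  also have "tang e k1 (mul KK ?g) (\<kappa> p) (tang c e \<kappa> p v) = ?\<rho> v"
   by (rule tang_comp[OF manP K.manG K.manG sk sL c e K.chart1, symmetric]) (simp add: K.one_chart1)
  finally show "v = fundv B (?\<rho> v) c p" by (simp add: fundv_def)
 qed
qed

section \<open>Invariant vector fields\<close>

lemma autD: "X:aut B==>X:vfields PP" and aut_inv: "X:aut B==>c:PP==>d:PP==>p:cdom c==>ra p k:cdom d ==>
  X d (ra p k) = tang c d (%q. ra q k) p (X c p)" by (auto simp: aut_def)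

lemma tang_ract_linear: "c:PP==>p:cdom c==>d:PP==>ra p k:cdom d==>linear (tang c d (%q. ra q k) p)" by (rule tang_linear[OF manP manP smooth_at_ract])

lemma autI:
 assumes "X:vfields PP"
  "!!c d p k. c:PP==>d:PP==>p:cdom c==>ra p k:cdom d==>X d (ra p k) = tang c d (%q. ra q k) p (X c p)" shows "X:aut B"
 using assms unfolding aut_def by blast

lemma msm_lift: "msm MM UNIV g==>msm PP UNIV (%p. g (pr p))" by (rule msm_pullback[OF manP manM _ open_UNIV smooth_proj open_UNIV]) auto

lemma aut_gmult:
 assumes "msm MM UNIV (g :: 'm=>real)" "X:aut B" shows "(%c p. g (pr p)*\<^sub>RX c p):aut B"
 by (rule autI[OF vf_gmult[OF manP msm_lift[OF assms(1)] autD[OF assms(2)]]])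
  (simp add: aut_inv[OF assms(2)] linear_scale[OF tang_ract_linear])

lemma aut_add: "X:aut B==>Y:aut B==>X + Y:aut B"
 by (rule autI[OF vf_add[OF manP autD autD]]) (auto simp: aut_inv linear_add[OF tang_ract_linear] plus_fun_def)

lemma aut_scale: "X:aut B==>a*\<^sub>RX:aut B" using aut_gmult[OF msm_const[of _ _ a]] by (simp add: scaleR_fun_def)

lemma aut_zero: "0:aut B" by (rule autI[OF vf_zero[OF manP]]) (simp add: linear_0[OF tang_ract_linear] zero_fun_def)

lemma subspace_aut: "subspace (aut B)" unfolding subspace_def using aut_add aut_scale aut_zero by blast

lemma aut_bracket:
 assumes X: "X:aut B" and Y: "Y:aut B" shows "vf_bracket PP X Y:aut B"
proof (rule autI[OF vf_bracket_in[OF manP autD[OF X] autD[OF Y]]])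
 fix c d p k assume c: "c:PP" "d:PP" "p:cdom c" "ra p k:cdom d"
 have s: "smooth_map PP PP (%q. ra q k)" by (rule smooth_map_on_local[OF manP manP]) (use smooth_at_ract in \<open>auto simp: smooth_at_def\<close>)
 show "vf_bracket PP X Y d (ra p k) = tang c d (%q. ra q k) p (vf_bracket PP X Y c p)"
  by (rule vf_bracket_related[OF manP manP s open_UNIV autD[OF X] autD[OF X] autD[OF Y] autD[OF Y] c(1,3,2,4) UNIV_I])
   (use aut_inv X Y c in auto)
qed

section \<open>The projection to the base\<close>

definition related :: "('p, 'c) vf=>('m, 'a) vf=>bool" where
 "related X Y\<longleftrightarrow>(\<forall>c\<in>PP. \<forall>d\<in>MM. \<forall>p\<in>cdom c. pr p:cdom d-->Y d (pr p) = tang c d pr p (X c p))"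

text \<open>Locally Y i is recovered from X i by pulling back along a section \<tau> and applying
  the tangent map of the projection. This yields continuity of \<open>qg\<close> and, along the
  trivial filter, smoothness of the projected field.\<close>

lemma lmcv_push:
 assumes m: "d:MM" "m:cdom d" and X: "!!p c. pr p = m==>c:PP==>p:cdom c==>lmcv PP F p (%i. X i c) (X' c)"
  and ev: "eventually (%i. related (X i) (Y i)) F" and rel: "related X' Y'" shows "lmcv MM F m (%i. Y i d) (Y' d)"
proof -
 obtain U \<tau> where U: "open U" "m:U" "smooth_map_on U MM PP \<tau>" "!!u. u:U==>pr (\<tau> u) = u" by (rule local_section[of m]) blast
 have st: "smooth_at MM PP \<tau> m" by (rule smooth_atI[OF U(3,1,2)])
 obtain c where c: "c:PP" "\<tau> m:cdom c" using ex_chart[OF manP] by blast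
 have "lmcv MM F m (%i u. X i c (\<tau> u)) (%u. X' c (\<tau> u))" by (rule lmcv_pullback[OF manM manP X[OF U(4)[OF U(2)] c] st])
 then have l: "lmcv MM F m (%i u. tang c d pr (\<tau> u) (X i c (\<tau> u))) (%u. tang c d pr (\<tau> u) (X' c (\<tau> u)))"
  by (intro lmcv_tang_along[OF manM manP manM proj_at st c m(1)]) (simp add: U m)
 obtain W where W: "open W" "m:W" "\<tau> ` W\<subseteq>cdom c" by (rule smooth_at_preimage[OF manM st open_cdom[OF manP c(1)] c(2)]) blast
 let ?W = "W\<inter>U\<inter>cdom d"
 show ?thesis
 proof (rule lmcv_cong_ev[OF manM l, of ?W])
  show "open ?W" "m:?W" using W U m open_cdom[OF manM m(1)] by auto
  have *: "tang c d pr (\<tau> u) (Z c (\<tau> u)) = Z' d u" if "u:?W" "related Z Z'" for u Z Z'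
   using that(2) c m that(1) W(3) U(4)[of u] unfolding related_def by (metis IntD1 IntD2 image_subset_iff)
  show "eventually (%i. \<forall>q\<in>?W. tang c d pr (\<tau> q) (X i c (\<tau> q)) = Y i d q) F" using ev by eventually_elim (intro ballI *)
  show "tang c d pr (\<tau> q) (X' c (\<tau> q)) = Y' d q" if "q:?W" for q using that rel by (rule *)
 qed
qed

lemma related_unique:
 assumes "related X Y" "related X Y'" "Y:vfields MM" "Y':vfields MM" shows "Y = Y'"
proof (rule vf_eqI[OF manM assms(3,4)])
 fix m
 obtain p where p: "pr p = m" using proj_surj by blast
 obtain c where c: "c:PP" "p:cdom c" using ex_chart[OF manP] by blast
 obtain d where d: "d:MM" "m:cdom d" using ex_chart[OF manM] by blast
 show "\<exists>d\<in>MM. m:cdom d\<and>Y d m = Y' d m" using assms(1,2) c d p unfolding related_def by metis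
qed

text \<open>The value at m is pushed down from an arbitrary point over m. K is transitive on fibres
  and the field is invariant, so the choice does not matter.\<close>

lemma related_exists:
 assumes X: "X:aut B" shows "\<exists>Y\<in>vfields MM. related X Y"
proof -
 define lift where "lift m = (SOME p. pr p = m)" for m
 define ch where "ch m = (SOME c. c:PP\<and>lift m:cdom c)" for m
 have lift: "pr (lift m) = m" for m unfolding lift_def using proj_surj by (rule someI_ex)
 have ch: "ch m:PP" "lift m:cdom (ch m)" for m
  unfolding ch_def using someI_ex[of "%c. c:PP\<and>lift m:cdom c"] ex_chart[OF manP, of "lift m"] by blast+
 define Y where "Y d m = (if d:MM\<and>m:cdom d then tang (ch m) d pr (lift m) (X (ch m) (lift m)) else 0)" for d m
 have rel: "related X Y" unfolding related_def
 proof (intro ballI impI)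
  fix c d p assume c: "c:PP" "p:cdom c" and d: "d:MM" "pr p:cdom d"
  obtain k where k: "lift (pr p) = ra p k" using fibre_transitive[of p "lift (pr p)"] lift by metis
  show "Y d (pr p) = tang c d pr p (X c p)"
  proof -
   have r: "ra p k:cdom (ch (pr p))" using ch(2)[of "pr p"] by (simp add: k)
   show ?thesis using tang_proj_ract[OF c ch(1) r d, of "X c p"] aut_inv[OF X c(1) ch(1) c(2) r] d by (simp add: Y_def k)
  qed
 qed
 have "Y:vfields MM"
 proof (rule vfieldsI[OF manM])
  show "Y d m = 0" if "d\<notin>MM \<or> m\<notin>cdom d" for d m using that by (auto simp: Y_def)
  show "Y e m = tang d e (%q. q) m (Y d m)" if *: "d:MM" "e:MM" "m:cdom d" "m:cdom e" for d e m
   using * tang_comp[OF manP manM manM proj_at smooth_at_id[OF manM] ch[of m] *(1) _ *(2), of "X (ch m) (lift m)"] by (simp add: Y_def lift)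
  show "\<exists>V. open V\<and>m:V\<and>msm MM V (Y d)" if d: "d:MM" "m:cdom d" for d m
  proof -
   have "lmcv MM (bot :: unit filter) m (%_. Y d) (Y d)"
   proof (rule lmcv_push[OF d])
    show "lmcv PP bot p (%i :: unit. X c) (X c)" if "c:PP" "p:cdom c" for p c
     by (rule lmcv_const[OF manP msm_smooth_at[OF manP vf_msm[OF manP autD[OF X] that(1)] open_cdom[OF manP that(1)] that(2)]])
   qed (use rel in auto)
   then show ?thesis unfolding lmcv_def mcv_bot .
  qed
 qed
 then show ?thesis using rel by blast
qed

lemma qg_related:
 assumes X: "X:aut B" shows qg_in: "qg B X:vfields MM" and related_qg: "related X (qg B X)"
proof -
 obtain Y where Y: "Y:vfields MM" "related X Y" using related_exists[OF X] by blast
 have "qg B X = Y" unfolding qg_def related_def[symmetric] by (rule the_equality) (use Y related_unique in blast)+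
 then show "qg B X:vfields MM" "related X (qg B X)" using Y by auto
qed

lemma qg_eqI: "X:aut B==>Y:vfields MM==>related X Y==>qg B X = Y" using related_unique qg_related by blast

lemma qg_at: "X:aut B==>c:PP==>p:cdom c==>d:MM==>pr p:cdom d ==>
 qg B X d (pr p) = tang c d pr p (X c p)" using related_qg unfolding related_def by blast

lemma qg_add: "X:aut B==>Y:aut B==>qg B (X + Y) = qg B X + qg B Y" by (rule qg_eqI[OF aut_add vf_add[OF manM qg_in qg_in]])
  (auto simp: related_def plus_fun_def qg_at linear_add[OF tang_proj_linear])

lemma qg_gmult:
 assumes "msm MM UNIV g" "X:aut B" shows "qg B (%c p. g (pr p)*\<^sub>RX c p) = (%c m. g m*\<^sub>Rqg B X c m)"
 by (rule qg_eqI[OF aut_gmult[OF assms] vf_gmult[OF manM assms(1) qg_in[OF assms(2)]]])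
  (auto simp: related_def qg_at[OF assms(2)] linear_scale[OF tang_proj_linear])

lemma qg_scale: "X:aut B==>qg B (a*\<^sub>RX) = a*\<^sub>Rqg B X" using qg_gmult[OF msm_const[of _ _ a]] by (simp add: scaleR_fun_def)

lemma qg_bracket:
 assumes X: "X:aut B" and Y: "Y:aut B" shows "qg B (vf_bracket PP X Y) = vf_bracket MM (qg B X) (qg B Y)"
proof (rule qg_eqI[OF aut_bracket[OF X Y] vf_bracket_in[OF manM qg_in[OF X] qg_in[OF Y]]], unfold related_def, intro ballI impI)
 fix c d p assume c: "c:PP" "p:cdom c" and d: "d:MM" "pr p:cdom d"
 show "vf_bracket MM (qg B X) (qg B Y) d (pr p) = tang c d pr p (vf_bracket PP X Y c p)"
  by (rule vf_bracket_related[OF manP manM smooth_proj open_UNIV autD[OF X] qg_in[OF X] autD[OF Y] qg_in[OF Y] c d UNIV_I])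
   (use qg_at X Y c d in auto)
qed

lemma lmcv_vf: "X:vfields PP==>c:PP==>p:cdom c==>smooth_at PP lin_atlas (X c) p" by (rule msm_smooth_at[OF manP vf_msm[OF manP] open_cdom[OF manP]])

end

section \<open>Connections\<close>

locale pconn = pbun B for B :: "('m::t2_space, 'a::lcs, 'p::t2_space, 'c::lcs, 'k::t2_space, 'b::lcs) pbundle" +
 fixes \<theta> :: "('p, 'c) chart=>'p=>'c=>'b"
 assumes conn: "connection B \<theta>"
begin

lemma th_linear: "c:PP==>p:cdom c==>linear (\<theta> c p)"
 and th_change: "c:PP==>d:PP==>p:cdom c==>p:cdom d==>\<theta> d p (tang c d (%q. q) p v) = \<theta> c p v"
 and th_smooth: "c:PP==>smooth_on (cimg c\<times>UNIV) (%(x, v). \<theta> c (cinv c x) v)" and th_equiv: "c:PP==>d:PP==>p:cdom c==>ra p k:cdom d ==>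
  Ad KK k (\<theta> d (ra p k) (tang c d (%q. ra q k) p v)) = \<theta> c p v" and th_fundv: "c:PP==>p:cdom c==>\<theta> c p (fundv B x c p) = x"
 using conn unfolding connection_def by auto

lemma th_equiv': "c:PP==>d:PP==>p:cdom c==>ra p k:cdom d ==>
  \<theta> d (ra p k) (tang c d (%q. ra q k) p v) = Ad KK (ginv KK k) (\<theta> c p v)"
 using th_equiv[of c d p k v] K.Ad_mul[of "ginv KK k" k] by (metis K.Ad_one K.grp.left_inverse)

lemma lmcv_theta:
 assumes c: "c:PP" "p:cdom c" and f: "lmcv PP F p f l" shows "lmcv PP F p (%i q. \<theta> c q (f i q)) (%q. \<theta> c q (l q))"
proof -
 obtain V where V: "open V" "p:V" "mcv PP F V f l" using f by (rule lmcvE)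
 let ?W = "V\<inter>cdom c"
 have W: "open ?W" using V open_cdom[OF manP c(1)] by auto
 have "mcv PP F ?W (%i q. (%(x, v). \<theta> c (cinv c x) v) (cmap c q, f i q)) (%q. (%(x, v). \<theta> c (cinv c x) v) (cmap c q, l q))"
  by (rule mcv_outer2[OF manP W mcv_subset[OF V(3)] msm_subset[OF msm_cmap[OF manP c(1)]] th_smooth[OF c(1)] open_cimg[OF manP c(1)]])
   (auto simp: cmap_cimg)
 then have "mcv PP F ?W (%i q. \<theta> c q (f i q)) (%q. \<theta> c q (l q))" by (rule mcv_cong[OF manP _ W]) (auto simp: cinv_cmap[OF manP c(1)])
 then show ?thesis by (rule lmcvI[OF _ W]) (use V c in auto)
qed

lemma tangent_eqI:
 assumes c: "c:PP" "p:cdom c" and d: "d:MM" "pr p:cdom d" and "tang c d pr p v = tang c d pr p w" "\<theta> c p v = \<theta> c p w" shows "v = w"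
proof -
 obtain \<rho> where r: "!!v. tang c d pr p v = 0==>v = fundv B (\<rho> v) c p" by (rule vertical_inverse[OF c d]) blast
 have "tang c d pr p (v - w) = 0" using assms(5) linear_diff[OF tang_proj_linear[OF c d]] by simp
 then have 1: "v - w = fundv B (\<rho> (v - w)) c p" by (rule r)
 have "\<theta> c p (v - w) = 0" using assms(6) linear_diff[OF th_linear[OF c]] by simp
 then have "\<rho> (v - w) = 0" using 1 th_fundv[OF c] by metis
 then have "v - w = 0" using 1 linear_0[OF fundv_linear[OF c]] by simp
 then show ?thesis by simp
qed

text \<open>The tangent vector of the base is given by its components \<open>v\<close> in the chart \<open>d\<close>.\<close>

definition hv :: "('p, 'c) chart=>('m, 'a) chart=>'p=>'a=>'c" where
 "hv c d p v = (THE w. tang c d pr p w = v\<and>\<theta> c p w = 0)"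

lemma hv_eqI:
 assumes "c:PP" "p:cdom c" "d:MM" "pr p:cdom d" "tang c d pr p w = v" "\<theta> c p w = 0" shows "hv c d p v = w"
 unfolding hv_def by (rule the_equality) (use assms tangent_eqI[OF assms(1-4)] in auto)

text \<open>A tangent vector at pr q is lifted by the section \<tau>, moved from \<tau>(pr q) to q
  by the group element \<kappa> q, and freed of its vertical part by means of \<theta>. Convergence
  can be checked on this formula, in contrast to \<open>hv\<close>, which is given by a description
  operator.\<close>

lemma hv_local:
 assumes c: "c:PP" "p:cdom c" and d: "d:MM" "pr p:cdom d"
 obtains W G where "open W" "p:W" "!!q v. q:W==>tang c d pr q (G q v) = v\<and>\<theta> c q (G q v) = 0"
  "!!F (f :: 'i=>_) l. lmcv PP F p f l==>lmcv PP F p (%i q. G q (f i q)) (%q. G q (l q))"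
proof -
 obtain U \<tau> \<kappa> where U: "open U" "pr p:U" "smooth_map_on U MM PP \<tau>" "smooth_map_on (pr -` U) PP KA \<kappa>"
  "!!u. u:U==>pr (\<tau> u) = u" "!!p. pr p:U==>ra (\<tau> (pr p)) (\<kappa> p) = p" by (rule local_section[of "pr p"]) blast
 have st: "smooth_at MM PP \<tau> u" if "u:U" for u by (rule smooth_atI[OF U(3,1) that])
 have sk: "smooth_at PP KA \<kappa> p" by (rule smooth_atI[OF U(4) open_over[OF U(1)]]) (use U in auto)
 obtain c0 where c0: "c0:PP" "\<tau> (pr p):cdom c0" using ex_chart[OF manP] by blast
 have stp: "smooth_at PP PP (%q. \<tau> (pr q)) p" by (rule smooth_at_comp[OF manP manM manP proj_at st[OF U(2)]])
 define T where "T q v = tang c0 c (%y. ra y (\<kappa> q)) (\<tau> (pr q)) (tang d c0 \<tau> (pr q) v)" for q v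
 define G where "G q v = T q v - fundv B (\<theta> c q (T q v)) c q" for q v
 obtain W1 where W1: "open W1" "p:W1" "(%q. \<tau> (pr q)) ` W1\<subseteq>cdom c0"
  by (rule smooth_at_preimage[OF manP stp open_cdom[OF manP c0(1)] c0(2)]) blast
 let ?W = "W1\<inter>pr -` (U\<inter>cdom d)\<inter>cdom c"
 have W: "open ?W" using W1 open_over[of "U\<inter>cdom d"] U(1) open_cdom[OF manM d(1)] open_cdom[OF manP c(1)] by auto
 show thesis
 proof (rule that[OF W])
  show "p:?W" using W1 U c d by auto
  fix q v assume "q:?W"
  then have q: "pr q:U" "pr q:cdom d" "q:cdom c" "\<tau> (pr q):cdom c0" using W1(3) by auto
  have r: "ra (\<tau> (pr q)) (\<kappa> q) = q" by (rule U(6)[OF q(1)])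
  have "tang c d pr q (T q v) = tang c0 d (%y. pr (ra y (\<kappa> q))) (\<tau> (pr q)) (tang d c0 \<tau> (pr q) v)" unfolding T_def
   using tang_comp[OF manP manP manM smooth_at_ract proj_at c0(1) q(4) c(1) _ d(1), of "\<kappa> q" "tang d c0 \<tau> (pr q) v"] q r U(5) by simp
  also have "\<dots> = tang d d (%u. pr (\<tau> u)) (pr q) v"
   using tang_comp[OF manM manP manM st[OF q(1)] proj_at d(1) q(2) c0(1) q(4) d(1), of v] q U(5) by simp
  also have "\<dots> = tang d d (%u. u) (pr q) v" by (rule tang_cong[OF manM d(1) q(2) U(1) q(1) U(5)])
  finally have T: "tang c d pr q (T q v) = v" using tang_id[OF manM d(1) q(2)] by simp
  show "tang c d pr q (G q v) = v\<and>\<theta> c q (G q v) = 0"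
   unfolding G_def linear_diff[OF tang_proj_linear[OF c(1) q(3) d(1) q(2)]] linear_diff[OF th_linear[OF c(1) q(3)]]
   by (simp add: T tang_proj_fundv[OF c(1) q(3) d(1) q(2)] th_fundv[OF c(1) q(3)])
 next
  fix F and f :: "'i=>'p=>'a" and l assume f: "lmcv PP F p f l"
  have "lmcv PP F p (%i q. tang d c0 \<tau> (pr q) (f i q)) (%q. tang d c0 \<tau> (pr q) (l q))"
   by (rule lmcv_tang_along[OF manP manM manP st[OF U(2)] proj_at d c0 f])
  then have T: "lmcv PP F p (%i q. T q (f i q)) (%q. T q (l q))" unfolding T_def by (intro act.lmcv_left[OF manP stp sk c0 c(1)]) (simp add: U c)
  show "lmcv PP F p (%i q. G q (f i q)) (%q. G q (l q))" unfolding G_def by (rule lmcv_diff[OF manP T lmcv_fundv[OF c lmcv_theta[OF c T]]])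
 qed
qed

lemma hv_props:
 assumes c: "c:PP" "p:cdom c" and d: "d:MM" "pr p:cdom d" shows tang_hv: "tang c d pr p (hv c d p v) = v" and th_hv: "\<theta> c p (hv c d p v) = 0"
proof -
 obtain W G where G: "open W" "p:W" "!!q v. q:W==>tang c d pr q (G q v) = v\<and>\<theta> c q (G q v) = 0" by (rule hv_local[OF c d]) blast
 show "tang c d pr p (hv c d p v) = v" "\<theta> c p (hv c d p v) = 0" using hv_eqI[OF c d, of "G p v" v] G(3)[OF G(2), of v] by auto
qed

lemma lmcv_hv:
 assumes c: "c:PP" "p:cdom c" and d: "d:MM" "pr p:cdom d" and f: "lmcv PP F p (f :: 'i=>_) l"
 shows "lmcv PP F p (%i q. hv c d q (f i q)) (%q. hv c d q (l q))"
proof -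
 obtain W G where G: "open W" "p:W" "!!q v. q:W==>tang c d pr q (G q v) = v\<and>\<theta> c q (G q v) = 0"
  "!!F (f :: 'i=>_) l. lmcv PP F p f l==>lmcv PP F p (%i q. G q (f i q)) (%q. G q (l q))" by (rule hv_local[OF c d]) blast
 let ?W = "W\<inter>cdom c\<inter>pr -` cdom d"
 have eq: "G q v = hv c d q v" if "q:?W" for q v using hv_eqI[OF c(1) _ d(1), of q "G q v" v] G(3)[of q v] that by auto
 show ?thesis by (rule lmcv_cong[OF manP G(4)[OF f], of ?W])
   (use G open_cdom[OF manP c(1)] open_over[OF open_cdom[OF manM d(1)]] c d eq in auto)
qed

lemma hv_linear:
 assumes c: "c:PP" "p:cdom c" and d: "d:MM" "pr p:cdom d" shows "linear (hv c d p)" by (rule linearI; rule hv_eqI[OF c d])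
  (simp_all add: linear_add[OF tang_proj_linear[OF c d]] linear_add[OF th_linear[OF c]]
   linear_scale[OF tang_proj_linear[OF c d]] linear_scale[OF th_linear[OF c]] tang_hv[OF c d] th_hv[OF c d])

lemma aut_eqI:
 assumes "X:aut B" "Y:aut B" "qg B X = qg B Y"
  "!!c p. c:PP==>p:cdom c==>\<theta> c p (X c p) = \<theta> c p (Y c p)" shows "X = Y"
proof (rule vf_eqI[OF manP autD[OF assms(1)] autD[OF assms(2)]])
 fix p
 obtain c where c: "c:PP" "p:cdom c" using ex_chart[OF manP] by blast
 obtain d where d: "d:MM" "pr p:cdom d" using ex_chart[OF manM] by blast
 have "X c p = Y c p" by (rule tangent_eqI[OF c d]) (use assms(4)[OF c] qg_at[OF assms(1) c d] qg_at[OF assms(2) c d] assms(3) in auto)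
 then show "\<exists>c\<in>PP. p:cdom c\<and>X c p = Y c p" using c by blast
qed

text \<open>A pointwise description of the horizontal lift that makes sense before the lift is known
  to be smooth, invariant or even unique.\<close>

definition is_hlift :: "('m, 'a) vf=>('p, 'c) vf=>bool" where
 "is_hlift X Y\<longleftrightarrow>(\<forall>c\<in>PP. \<forall>p\<in>cdom c. \<forall>d\<in>MM. pr p:cdom d-->Y c p = hv c d p (X d (pr p)))"

lemma lmcv_is_hlift:
 assumes c: "c:PP" "p:cdom c" and X: "!!d. d:MM==>pr p:cdom d==>lmcv MM F (pr p) (%i. X i d) (X' d)"
  and "eventually (%i. is_hlift (X i) (Y i)) F" "is_hlift X' Y'" shows "lmcv PP F p (%i. Y i c) (Y' c)"
proof -
 obtain d where d: "d:MM" "pr p:cdom d" using ex_chart[OF manM] by blast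
 let ?W = "cdom c\<inter>pr -` cdom d"
 have l: "lmcv PP F p (%i q. hv c d q (X i d (pr q))) (%q. hv c d q (X' d (pr q)))"
  by (rule lmcv_hv[OF c d lmcv_pullback[OF manP manM X[OF d] proj_at]])
 show ?thesis
 proof (rule lmcv_cong_ev[OF manP l, of ?W])
  show "open ?W" "p:?W" using open_cdom[OF manP c(1)] open_over[OF open_cdom[OF manM d(1)]] c d by auto
  show "eventually (%i. \<forall>q\<in>?W. hv c d q (X i d (pr q)) = Y i c q) F"
   using assms(4) by eventually_elim (use c(1) d(1) in \<open>auto simp: is_hlift_def\<close>)
  show "hv c d q (X' d (pr q)) = Y' c q" if "q:?W" for q using assms(5) that c(1) d(1) by (auto simp: is_hlift_def)
 qed
qed

text \<open>Independence of the chosen charts, the transformation law and invariance all come from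
  uniqueness of the horizontal vector over a given one; smoothness is \<open>lmcv_is_hlift\<close>
  along the trivial filter.\<close>

lemma is_hlift_exists:
 assumes X: "X:vfields MM" shows "\<exists>Y\<in>aut B. is_hlift X Y"
proof -
 define ch where "ch m = (SOME d. d:MM\<and>m:cdom d)" for m
 have ch: "ch m:MM" "m:cdom (ch m)" for m unfolding ch_def using someI_ex[of "%c. c:MM\<and>m:cdom c"] ex_chart[OF manM, of m] by blast+
 define Y where "Y c p = (if c:PP\<and>p:cdom c then hv c (ch (pr p)) p (X (ch (pr p)) (pr p)) else 0)" for c p
 have l: "is_hlift X Y" unfolding is_hlift_def
 proof (intro ballI impI)
  fix c p d assume c: "c:PP" "p:cdom c" and d: "d:MM" "pr p:cdom d"
  let ?e = "ch (pr p)"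
  have "hv c ?e p (X ?e (pr p)) = hv c d p (X d (pr p))"
  proof (rule hv_eqI[OF c ch])
   have "tang c ?e pr p (hv c d p (X d (pr p))) = tang d ?e (%q. q) (pr p) (tang c d pr p (hv c d p (X d (pr p))))"
    using tang_comp[OF manP manM manM proj_at smooth_at_id[OF manM] c d ch] by simp
   then show "tang c ?e pr p (hv c d p (X d (pr p))) = X ?e (pr p)" using vf_change[OF manM X d(1) ch(1) d(2) ch(2)] by (simp add: tang_hv[OF c d])
  qed (rule th_hv[OF c d])
  then show "Y c p = hv c d p (X d (pr p))" using c by (simp add: Y_def)
 qed
 have Y: "Y:vfields PP"
 proof (rule vfieldsI[OF manP])
  show "Y c p = 0" if "c\<notin>PP \<or> p\<notin>cdom c" for c p using that by (auto simp: Y_def)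
  fix c p assume c: "c:PP" "p:cdom c"
  { fix c' assume c': "c':PP" "p:cdom c'"
   let ?e = "ch (pr p)" and ?v = "X (ch (pr p)) (pr p)"
   have "hv c' ?e p ?v = tang c c' (%q. q) p (hv c ?e p ?v)"
   proof (rule hv_eqI[OF c' ch])
    show "tang c' ?e pr p (tang c c' (%q. q) p (hv c ?e p ?v)) = ?v"
     using tang_chart_change[OF manP manM proj_at c c' ch, of "hv c ?e p ?v"] tang_hv[OF c ch] by simp
    show "\<theta> c' p (tang c c' (%q. q) p (hv c ?e p ?v)) = 0" using th_change[OF c(1) c'(1) c(2) c'(2)] th_hv[OF c ch] by simp
   qed
   then show "Y c' p = tang c c' (%q. q) p (Y c p)" using c c' by (simp add: Y_def) }
  have "lmcv PP (bot :: unit filter) p (%_. Y c) (Y c)"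
  proof (rule lmcv_is_hlift[OF c])
   show "lmcv MM bot (pr p) (%i :: unit. X d) (X d)" if "d:MM" "pr p:cdom d" for d
    by (rule lmcv_const[OF manM msm_smooth_at[OF manM vf_msm[OF manM X that(1)] open_cdom[OF manM that(1)] that(2)]])
  qed (use l in auto)
  then show "\<exists>V. open V\<and>p:V\<and>msm PP V (Y c)" unfolding lmcv_def mcv_bot .
 qed
 have "Y:aut B"
 proof (rule autI[OF Y])
  fix c d p k assume c: "c:PP" "d:PP" "p:cdom c" "ra p k:cdom d"
  let ?e = "ch (pr p)" and ?v = "X (ch (pr p)) (pr p)"
  have "hv d ?e (ra p k) ?v = tang c d (%q. ra q k) p (hv c ?e p ?v)"
  proof (rule hv_eqI[OF c(2,4) ch(1)])
   show "pr (ra p k):cdom ?e" using ch by simp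
   show "tang d ?e pr (ra p k) (tang c d (%q. ra q k) p (hv c ?e p ?v)) = ?v" using tang_proj_ract[OF c(1,3,2,4) ch] tang_hv[OF c(1,3) ch] by simp
   show "\<theta> d (ra p k) (tang c d (%q. ra q k) p (hv c ?e p ?v)) = 0"
    using th_equiv'[OF c] th_hv[OF c(1,3) ch] linear_0[OF K.Ad_linear] by simp
  qed
  then show "Y d (ra p k) = tang c d (%q. ra q k) p (Y c p)" using c by (simp add: Y_def)
 qed
 then show ?thesis using l by blast
qed

lemma is_hlift_props:
 assumes "Y:aut B" "is_hlift X Y" "X:vfields MM" shows "qg B Y = X" "c:PP==>p:cdom c==>\<theta> c p (Y c p) = 0"
proof -
 show "qg B Y = X"
 proof (rule qg_eqI[OF assms(1,3)], unfold related_def, intro ballI impI)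
  fix c d p assume c: "c:PP" "p:cdom c" and d: "d:MM" "pr p:cdom d"
  then have "Y c p = hv c d p (X d (pr p))" using assms(2) unfolding is_hlift_def by blast
  then show "X d (pr p) = tang c d pr p (Y c p)" using tang_hv[OF c d] by simp
 qed
 assume c: "c:PP" "p:cdom c"
 obtain d where d: "d:MM" "pr p:cdom d" using ex_chart[OF manM] by blast
 show "\<theta> c p (Y c p) = 0" using assms(2) c d th_hv[OF c d] unfolding is_hlift_def by simp
qed

abbreviation "sg \<equiv> hlift B \<theta>"

lemma hlift_props:
 assumes X: "X:vfields MM" shows hlift_in: "sg X:aut B" and is_hlift_hlift: "is_hlift X (sg X)" and qg_hlift: "qg B (sg X) = X"
  and th_hlift: "!!c p. c:PP==>p:cdom c==>\<theta> c p (sg X c p) = 0"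
proof -
 obtain Y where Y: "Y:aut B" "is_hlift X Y" using is_hlift_exists[OF X] by blast
 note p = is_hlift_props[OF Y X]
 have "sg X = Y" unfolding hlift_def by (rule the_equality) (use Y p aut_eqI in auto)
 then show "sg X:aut B" "is_hlift X (sg X)" "qg B (sg X) = X"
  "!!c p. c:PP==>p:cdom c==>\<theta> c p (sg X c p) = 0" using Y p by auto
qed

lemma hlift_eqI:
 assumes "X:vfields MM" "Y:aut B" "qg B Y = X" "!!c p. c:PP==>p:cdom c==>\<theta> c p (Y c p) = 0" shows "sg X = Y"
 by (rule aut_eqI[OF hlift_in[OF assms(1)] assms(2)]) (simp_all add: assms qg_hlift th_hlift)

lemma hlift_add:
 assumes "X:vfields MM" "Y:vfields MM" shows "sg (X + Y) = sg X + sg Y"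
 by (rule hlift_eqI[OF vf_add[OF manM assms] aut_add[OF hlift_in[OF assms(1)] hlift_in[OF assms(2)]]])
  (simp add: qg_add hlift_in qg_hlift assms, simp add: plus_fun_def linear_add[OF th_linear] th_hlift assms)

lemma hlift_gmult:
 assumes g: "msm MM UNIV g" and "X:vfields MM" shows "sg (%c m. g m*\<^sub>RX c m) = (%c p. g (pr p)*\<^sub>Rsg X c p)"
 by (rule hlift_eqI[OF vf_gmult[OF manM assms] aut_gmult[OF g hlift_in[OF assms(2)]]])
  (simp_all add: qg_gmult[OF g] hlift_in qg_hlift assms linear_scale[OF th_linear] th_hlift)

lemma hlift_scale: "X:vfields MM==>sg (a*\<^sub>RX) = a*\<^sub>Rsg X" using hlift_gmult[OF msm_const[of _ _ a]] by (simp add: scaleR_fun_def)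

lemma curvature_fields:
 assumes X: "X:vfields PP" and Y: "Y:vfields PP" and c: "c:PP" "p:cdom c"
 shows "curvature B \<theta> c p (X c p) (Y c p) = tang c lchart (%q. \<theta> c q (Y c q)) p (X c p) - tang c lchart (%q. \<theta> c q (X c q)) p (Y c p)
  - \<theta> c p (vf_bracket PP X Y c p) + lie_br KK (\<theta> c p (X c p)) (\<theta> c p (Y c p))"
proof -
 let ?T = "%z. \<theta> c (cinv c (fst z)) (snd z)"
 have sT: "smooth_on (cimg c\<times>UNIV) ?T" using th_smooth[OF c(1)] by (simp add: case_prod_unfold)
 have oT: "open (cimg c\<times>(UNIV :: 'c set))" using open_cimg[OF manP c(1)] by (simp add: open_Times)
 note o = open_cimg[OF manP c(1)] and m = cmap_cimg[OF c(2)] and ci = cinv_cmap[OF manP c]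
 have *: "tang c lchart (%q. \<theta> c q (Z c q)) p v = ddir (%x. \<theta> c (cinv c x) (Z c p)) (cmap c p) v + \<theta> c p (ddir (%x. Z c (cinv c x)) (cmap c p) v)"
  if Z: "Z:vfields PP" for Z v
 proof -
  let ?z = "%x. Z c (cinv c x)"
  have sz: "smooth_on (cimg c) ?z" by (rule vf_smooth[OF manP Z c(1)])
  have "tang c lchart (%q. \<theta> c q (Z c q)) p v = ddir (%x. ?T (x, ?z x)) (cmap c p) v" by (simp add: tang_lchart)
  also have "\<dots> = ddir ?T (cmap c p, ?z (cmap c p)) (ddir (%x. (x, ?z x)) (cmap c p) v)"
   by (rule ddir_compose[OF sT oT smooth_on_Pair[OF smooth_on_id sz o] o _ m]) auto
  also have "ddir (%x. (x, ?z x)) (cmap c p) v = (v, ddir ?z (cmap c p) v)"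
   using ddir_linear_eq[of "%x. x"] by (simp add: ddir_Pair[OF smooth_on_id sz o m] linear_iff)
  also have "ddir ?T (cmap c p, ?z (cmap c p)) (v, ddir ?z (cmap c p) v) =
   ddir (%y. ?T (y, ?z (cmap c p))) (cmap c p) v + ddir (%s. ?T (cmap c p, s)) (?z (cmap c p)) (ddir ?z (cmap c p) v)"
   by (rule ddir_split[OF sT oT]) (simp add: m)
  also have "ddir (%s. ?T (cmap c p, s)) (?z (cmap c p)) (ddir ?z (cmap c p) v) = \<theta> c p (ddir ?z (cmap c p) v)"
   using ddir_linear_eq[OF th_linear[OF c]] by (simp add: ci)
  finally show ?thesis by (simp add: ci)
 qed
 show ?thesis using c K.lie_br_skew[of "\<theta> c p (Y c p)" "\<theta> c p (X c p)"]
  by (simp add: curvature_def *[OF X] *[OF Y] vf_bracket_def linear_diff[OF th_linear[OF c]] flip: scaleR_2)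
qed

lemma curvature_hlift:
 assumes X: "X:vfields MM" and Y: "Y:vfields MM" and c: "c:PP" "p:cdom c"
 shows "curvature B \<theta> c p (sg X c p) (sg Y c p) = - \<theta> c p (vf_bracket PP (sg X) (sg Y) c p)"
proof -
 have *: "tang c lchart (%q. \<theta> c q (sg Z c q)) p v = 0" if "Z:vfields MM" for Z v unfolding tang_lchart
  by (subst ddir_cong[OF open_cimg[OF manP c(1)] cmap_cimg[OF c(2)], of _ "%_. 0"]) (simp_all add: th_hlift[OF that c(1) cinv_cdom] ddir_const)
 show ?thesis using curvature_fields[OF autD[OF hlift_in[OF X]] autD[OF hlift_in[OF Y]] c] K.lie_br_bilinear
  by (simp add: * X Y th_hlift c bilinear_lzero)
qed

text \<open>\<theta>(V) as a function on P without reference to a chart, so that it can be followed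
  along a fibre.\<close>

definition thv :: "('p, 'c) vf=>'p=>'b" where
 "thv V p = (let c = (SOME c. c:PP\<and>p:cdom c) in \<theta> c p (V c p))"

lemma thv_at:
 assumes V: "V:aut B" and c: "c:PP" "p:cdom c" shows "thv V p = \<theta> c p (V c p)"
proof -
 define d where "d = (SOME c. c:PP\<and>p:cdom c)"
 have d: "d:PP" "p:cdom d" unfolding d_def using someI[of "%c. c:PP\<and>p:cdom c" c] c by auto
 show ?thesis unfolding thv_def d_def[symmetric] Let_def vf_change[OF manP autD[OF V] c(1) d(1) c(2) d(2)]
  by (rule th_change[OF c(1) d(1) c(2) d(2)])
qed

lemma thv_ract:
 assumes V: "V:aut B" shows "thv V (ra p k) = Ad KK (ginv KK k) (thv V p)"
proof -
 obtain c where c: "c:PP" "p:cdom c" using ex_chart[OF manP] by blast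
 obtain d where d: "d:PP" "ra p k:cdom d" using ex_chart[OF manP] by blast
 show ?thesis using thv_at[OF V c] thv_at[OF V d] aut_inv[OF V c(1) d(1) c(2) d(2)] th_equiv'[OF c(1) d(1) c(2) d(2)] by simp
qed

lemma thv_lin:
 assumes "V:aut B" "W:aut B" shows "thv (a*\<^sub>RV + b*\<^sub>RW) p = a*\<^sub>Rthv V p + b*\<^sub>Rthv W p"
proof -
 obtain c where c: "c:PP" "p:cdom c" using ex_chart[OF manP] by blast
 have "a*\<^sub>RV + b*\<^sub>RW:aut B" using assms by (simp add: aut_add aut_scale)
 then show ?thesis using thv_at[OF _ c] assms by (simp add: scaleR_fun_def linear_add[OF th_linear[OF c]] linear_scale[OF th_linear[OF c]])
qed

lemma thv_gmult:
 assumes g: "msm MM UNIV (g :: 'm=>real)" and V: "V:aut B" shows "thv (%c p. g (pr p)*\<^sub>RV c p) p = g (pr p)*\<^sub>Rthv V p"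
proof -
 obtain c where c: "c:PP" "p:cdom c" using ex_chart[OF manP] by blast
 show ?thesis using thv_at[OF aut_gmult[OF g V] c] thv_at[OF V c] by (simp add: linear_scale[OF th_linear[OF c]])
qed

text \<open>Infinitesimal equivariance: along the orbit of p the function \<theta>(X) is Ad(k^-1) of
  its value at p, because X is invariant, and this is differentiated at k = 1.\<close>

lemma tang_thv_fundv:
 assumes X: "X:aut B" and c: "c:PP" "p:cdom c"
 shows "tang c lchart (%q. \<theta> c q (X c q)) p (fundv B y c p) = - lie_br KK y (\<theta> c p (X c p))"
proof -
 have "lmcv PP (bot :: unit filter) p (%_ q. \<theta> c q (X c q)) (%q. \<theta> c q (X c q))"
  by (rule lmcv_theta[OF c lmcv_const[OF manP lmcv_vf[OF autD[OF X] c]]])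
 then have "smooth_at PP lin_atlas (%q. \<theta> c q (X c q)) p" by (rule smooth_at_via_lmcv[OF manP])
 then have "smooth_at PP lin_atlas (thv X) p"
  by (rule smooth_at_cong[OF manP manifold_lin _ open_cdom[OF manP c(1)] c(2)]) (simp add: thv_at[OF X c(1)])
 then have s: "smooth_at PP lin_atlas (thv X) (ra p ee)" by simp
 have "tang c lchart (%q. \<theta> c q (X c q)) p (fundv B y c p) = tang c lchart (thv X) p (fundv B y c p)" unfolding tang_lchart
  by (rule ddir_cong[OF open_cimg[OF manP c(1)] cmap_cimg[OF c(2)]]) (simp add: thv_at[OF X c(1)] cinv_cdom)
 also have "\<dots> = tang k1 lchart (%k. thv X (ra p k)) ee y" unfolding fundv_def
  using tang_comp[OF K.manG manP manifold_lin act.smooth_at_right s K.chart1 K.one_chart1 c(1) _ lchart_in, of y] c by simp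
 finally show ?thesis by (simp add: thv_ract[OF X] thv_at[OF X c] K.tang_Ad_inv)
qed

end

lemma tang_linear_fun:
 assumes A: "manifold A" and f: "smooth_at A lin_atlas f p" and c: "c:A" "p:cdom c" and L: "linear L" "continuous_on UNIV L"
 shows "tang c lchart (%q. L (f q)) p v = L (tang c lchart f p v)"
proof -
 have sL: "smooth_at lin_atlas lin_atlas L x" for x by (rule smooth_atI[of UNIV]) (auto simp: smooth_map_on_lin_iff smooth_on_linear[OF L])
 have "tang lchart lchart L (f p) w = L w" for w by (simp add: tang_def ddir_linear_eq[OF L(1)])
 then show ?thesis using tang_comp[OF A manifold_lin manifold_lin f sL c lchart_in _ lchart_in, of v] by simp
qed

text \<open>Linear coordinates on the model space of M. Their continuity is part of the notion, as
  the given topology is merely Hausdorff and locally convex; \<open>fin_coords_exist\<close>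
  supplies it.\<close>

locale fin_coords =
 fixes Bs :: "'a::lcs set" and cf :: "'a=>'a=>real"
 assumes fin: "finite Bs" and cf_linear: "b:Bs==>linear (cf b)" and cf_cont: "b:Bs==>continuous_on UNIV (cf b)"
  and cf_sum: "v = (\<Sum>b\<in>Bs. cf b v *\<^sub>R b)"

lemma linear_expand:
 assumes "fin_coords Bs cf" "linear L" shows "L v = (\<Sum>b\<in>Bs. cf b v *\<^sub>R L b)"
proof -
 have "L v = L (\<Sum>b\<in>Bs. cf b v *\<^sub>R b)" using fin_coords.cf_sum[OF assms(1), of v] by simp
 then show ?thesis by (simp add: linear_sum[OF assms(2)] linear_scale[OF assms(2)])
qed

section \<open>Central extensions\<close>

locale pext = pbun B for B :: "('m::t2_space, 'a::lcs, 'p::t2_space, 'c::lcs, 'k::t2_space, 'b::lcs) pbundle" +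
 fixes E :: "('z::t2_space, 'y::lcs, 'h::t2_space, 'd::lcs, 'k) cext"
 assumes cext: "central_extension E (sgrp B)"
begin

abbreviation "HH \<equiv> hgrp E"
abbreviation "HA \<equiv> latlas (hgrp E)"
abbreviation "h1 \<equiv> chart1 (hgrp E)"
abbreviation "qq \<equiv> hquot E"
abbreviation "Lq \<equiv> Lhom (hgrp E) (sgrp B) (hquot E)"
abbreviation "Lz \<equiv> Lhom (zgrp E) (hgrp E) (zincl E)"
abbreviation "brH \<equiv> lie_br (hgrp E)"
abbreviation "HS \<equiv> hsections B E"
abbreviation "al \<equiv> sec_alpha B E"
abbreviation "ZF \<equiv> zfuns B E"

lemma lieZ: "lie_group (zgrp E)" and lieH: "lie_group HH" and homz: "lie_hom (zgrp E) HH (zincl E)" and homq: "lie_hom HH KK qq"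
 and surjq: "surj qq" and rangez: "range (zincl E) = qq -` {ee}" and central: "mul HH (zincl E z) h = mul HH h (zincl E z)"
 and hbundle: "principal_bundle \<lparr>base = KA, total = HA, sgrp = zgrp E,
    proj = qq, ract = (%h z. mul HH h (zincl E z))\<rparr>" using cext unfolding central_extension_def by blast+

sublocale H: lie_grp "hgrp E" by unfold_locales (rule lieH)
sublocale Z: lie_grp "zgrp E" by unfold_locales (rule lieZ)
sublocale q: lie_morph "hgrp E" "sgrp B" "hquot E" by unfold_locales (rule homq)
sublocale z: lie_morph "zgrp E" "hgrp E" "zincl E" by unfold_locales (rule homz)

lemma hq_section:
 obtains U \<eta> where "open U" "k:U" "smooth_map_on U KA HA \<eta>" "!!u. u:U==>qq (\<eta> u) = u"
proof -
 interpret hb: pbun "\<lparr>base = KA, total = HA, sgrp = zgrp E, proj = qq, ract = (%h z. mul HH h (zincl E z))\<rparr>"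
  by unfold_locales (rule hbundle)
 show thesis by (rule hb.local_section[of k]) (rule that, simp_all)
qed

text \<open>The extended group is a principal bundle over K. At its unit the fundamental vectors
  form the image of \<open>Lz\<close> and the vertical vectors the kernel of \<open>Lq\<close>, so
  \<open>vertical_inverse\<close> applies.\<close>

lemma Lz_inverse:
 obtains \<rho> where "linear \<rho>" "continuous_on UNIV \<rho>" "!!x. \<rho> (Lz x) = x" "!!v. Lq v = 0==>v = Lz (\<rho> v)"
proof -
 let ?hb = "\<lparr>base = KA, total = HA, sgrp = zgrp E, proj = qq, ract = (%h z. mul HH h (zincl E z))\<rparr>"
 interpret hb: pbun ?hb by unfold_locales (rule hbundle)
 have f: "fundv ?hb x h1 (one HH) = Lz x" for x by (simp add: fundv_def Lhom_def)
 show thesis by (rule hb.vertical_inverse[of h1 "one HH" k1])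
   (auto simp: H.chart1 H.one_chart1 K.chart1 K.one_chart1 q.f_one f Lhom_def[symmetric] intro: that)
qed

definition "rz = (SOME \<rho>. linear \<rho>\<and>continuous_on UNIV \<rho>\<and>(\<forall>x. \<rho> (Lz x) = x)\<and>(\<forall>v. Lq v = 0-->v = Lz (\<rho> v)))"

lemma rz: "linear rz" "continuous_on UNIV rz" "rz (Lz x) = x" "Lq v = 0==>Lz (rz v) = v"
proof -
 obtain \<rho> where "linear \<rho>" "continuous_on UNIV \<rho>" "!!x. \<rho> (Lz x) = x" "!!v. Lq v = 0==>v = Lz (\<rho> v)"
  by (rule Lz_inverse) blast
 then have "\<exists>\<rho>. linear \<rho>\<and>continuous_on UNIV \<rho>\<and>(\<forall>x. \<rho> (Lz x) = x)\<and>(\<forall>v. Lq v = 0-->v = Lz (\<rho> v))"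
  by blast
 from someI_ex[OF this] have "linear rz\<and>continuous_on UNIV rz\<and>(\<forall>x. rz (Lz x) = x)\<and>(\<forall>v. Lq v = 0-->v = Lz (rz v))"
  unfolding rz_def .
 then show "linear rz" "continuous_on UNIV rz" "rz (Lz x) = x" "Lq v = 0==>Lz (rz v) = v" by auto
qed

lemma qq_zincl: "qq (zincl E z) = ee" using rangez by auto

lemma Lq_Lz: "Lq (Lz x) = 0" unfolding Lhom_def
 using tang_comp[OF Z.manG H.manG K.manG z.smooth_f q.smooth_f Z.chart1 Z.one_chart1 H.chart1 _ K.chart1, of x]
 by (simp add: z.f_one q.f_one H.one_chart1 K.one_chart1 qq_zincl tang_const)

section \<open>The action of the structure group on the extended Lie algebra\<close>

text \<open>The two elements differ by a central one, which drops out of conjugation. Hence the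
  arbitrary preimage in \<open>Adh\<close> is harmless.\<close>

lemma Ad_cong: 
 assumes "qq h = qq h'" shows "Ad HH h = Ad HH h'"
proof -
 have "qq (mul HH (ginv HH h) h') = ee" using assms by (simp add: q.f_mul q.f_ginv)
 then obtain z where z: "mul HH (ginv HH h) h' = zincl E z" using rangez by auto
 have h': "h' = mul HH h (zincl E z)" by (simp add: z[symmetric] H.grp.assoc[symmetric])
 have "mul HH (mul HH h' g) (ginv HH h') = mul HH (mul HH h g) (ginv HH h)" for g
 proof -
  have "mul HH (mul HH h' g) (ginv HH h') = mul HH h (mul HH (mul HH (zincl E z) g) (mul HH (ginv HH (zincl E z)) (ginv HH h)))"
   unfolding h' by (simp add: H.grp.assoc H.grp.inverse_distrib_swap)
  also have "\<dots> = mul HH (mul HH h g) (ginv HH h)" unfolding central by (simp add: H.grp.assoc) (simp add: H.grp.assoc[symmetric])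
  finally show ?thesis .
 qed
 then show ?thesis unfolding Ad_def by simp
qed

lemma Adh_quot: "qq h = k==>Adh E k = Ad HH h" unfolding Adh_def by (rule Ad_cong) (simp add: surj_f_inv_f[OF surjq])

lemma Adh_linear: "linear (Adh E k)" and Adh_continuous: "continuous_on UNIV (Adh E k)" unfolding Adh_def by (rule H.Ad_linear H.Ad_continuous)+

lemma Adh_mul: "Adh E (mul KK k l) x = Adh E k (Adh E l x)"
proof -
 obtain g h where gh: "qq g = k" "qq h = l" using surjq by (metis surj_def)
 then have "qq (mul HH g h) = mul KK k l" by (simp add: q.f_mul)
 from Adh_quot[OF this] show ?thesis by (simp add: Adh_quot[OF gh(1)] Adh_quot[OF gh(2)] H.Ad_mul)
qed

lemma Lq_Adh: "Lq (Adh E k x) = Ad KK k (Lq x)"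
proof -
 obtain g where "qq g = k" using surjq by (metis surj_def)
 then show ?thesis using q.Lhom_Ad by (auto simp: Adh_quot)
qed

lemma Adh_Lz: "Adh E k (Lz y) = Lz y"
proof -
 obtain h where h: "qq h = k" using surjq by (metis surj_def)
 have "(%z. mul HH (mul HH h (zincl E z)) (ginv HH h)) = zincl E" by (simp add: fun_eq_iff central[symmetric] H.grp.assoc)
 then have "Ad HH h (Lz y) = Lz y" unfolding Lhom_def Ad_def
  using tang_comp[OF Z.manG H.manG H.manG z.smooth_f H.smooth_at_conj Z.chart1 Z.one_chart1 H.chart1 _ H.chart1, of h y]
  by (simp add: z.f_one H.one_chart1)
 then show ?thesis using Adh_quot[OF h] by simp
qed

text \<open>\<open>Adh\<close> chooses preimages without any regularity. Near \<open>k p\<close>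
  they are exchanged for the values of a smooth local section of the extension, which by
  \<open>Adh_quot\<close> leaves the operator unchanged.\<close>

lemma lmcv_Adh:
 assumes A: "manifold A" and k: "smooth_at A KA k p" and f: "lmcv A F p f l" shows "lmcv A F p (%i q. Adh E (k q) (f i q)) (%q. Adh E (k q) (l q))"
proof -
 obtain U \<eta> where U: "open U" "k p:U" "smooth_map_on U KA HA \<eta>" "!!u. u:U==>qq (\<eta> u) = u" by (rule hq_section[of "k p"]) blast
 obtain W where W: "open W" "p:W" "k ` W\<subseteq>U" by (rule smooth_at_preimage[OF A k U(1,2)]) blast
 have s: "smooth_at A HA (%q. \<eta> (k q)) p" by (rule smooth_at_comp[OF A K.manG H.manG k smooth_atI[OF U(3,1,2)]])
 have eq: "Adh E (k q) = Ad HH (\<eta> (k q))" if "q:W" for q by (rule Adh_quot[OF U(4)]) (use that W in auto)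
 show ?thesis by (rule lmcv_cong[OF A H.lmcv_Ad[OF A s f] W(1,2)]) (simp_all add: eq)
qed

text \<open>Pulled back along the quotient homomorphism the map becomes h to Ad(h^-1) y on the
  extended group, whose derivative is known.\<close>

lemma tang_Adh_inv: "tang k1 lchart (%k. Adh E (ginv KK k) y) ee (Lq x) = - brH x y"
proof -
 have s: "smooth_at KA lin_atlas (%k. Adh E (ginv KK k) y) k" for k
  by (rule smooth_at_via_lmcv[OF K.manG lmcv_Adh[OF K.manG K.smooth_at_ginv lmcv_const[OF K.manG smooth_at_const]]])
 have e: "(%h. Ad HH (ginv HH h) y) = (%h. Adh E (ginv KK (qq h)) y)" by (simp add: Adh_quot[OF q.f_ginv])
 have "- brH x y = tang h1 lchart (%h. Adh E (ginv KK (qq h)) y) (one HH) x" using H.tang_Ad_inv[of y x] by (simp add: e)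
 also have "\<dots> = tang k1 lchart (%k. Adh E (ginv KK k) y) ee (Lq x)" unfolding Lhom_def
  using tang_comp[OF H.manG K.manG manifold_lin q.smooth_f s H.chart1 H.one_chart1 K.chart1 _ lchart_in, of x] by (simp add: q.f_one K.one_chart1)
 finally show ?thesis by simp
qed

section \<open>Sections\<close>

lemma HS_iff: "\<xi>:HS\<longleftrightarrow>msm PP UNIV \<xi>\<and>(\<forall>p k. \<xi> (ra p k) = Adh E (ginv KK k) (\<xi> p))"
 unfolding hsections_def by (simp add: msm_iff[OF manP])

lemma HS_msm: "\<xi>:HS==>msm PP UNIV \<xi>" and HS_equiv: "\<xi>:HS==>\<xi> (ra p k) = Adh E (ginv KK k) (\<xi> p)" by (auto simp: HS_iff)

lemma HS_at: "\<xi>:HS==>smooth_at PP lin_atlas \<xi> p" by (rule msm_smooth_at[OF manP HS_msm open_UNIV UNIV_I])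

lemma HS_gmult: "msm MM UNIV g==>\<xi>:HS==>(%p. g (pr p)*\<^sub>R\<xi> p):HS"
 by (auto simp: HS_iff linear_scale[OF Adh_linear] intro!: msm_scaleR[OF manP open_UNIV] msm_lift)

lemma HS_add: "\<xi>:HS==>\<eta>:HS==>\<xi> + \<eta>:HS"
 by (auto simp: HS_iff plus_fun_def linear_add[OF Adh_linear] intro!: msm_add[OF manP open_UNIV])

lemma HS_scale: "\<xi>:HS==>a*\<^sub>R\<xi>:HS" using HS_gmult[OF msm_const[of _ _ a]] by (simp add: scaleR_fun_def)

lemma HS_zero: "0:HS" by (auto simp: HS_iff zero_fun_def linear_0[OF Adh_linear] msm_const)

lemma subspace_HS: "subspace HS" unfolding subspace_def using HS_add HS_scale HS_zero by blast

lemma vf_deriv_at: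
 "X:vfields PP==>\<xi>:HS==>c:PP==>p:cdom c==>vf_deriv PP X \<xi> p = tang c lchart \<xi> p (X c p)" by (rule vf_deriv_eq[OF manP _ HS_at])

lemma HS_deriv:
 assumes X: "X:aut B" and \<xi>: "\<xi>:HS" shows "vf_deriv PP X \<xi>:HS" unfolding HS_iff
proof (intro conjI allI)
 show "msm PP UNIV (vf_deriv PP X \<xi>)" by (rule vf_deriv_msm[OF manP autD[OF X] HS_msm[OF \<xi>]])
 fix p k
 obtain c where c: "c:PP" "p:cdom c" using ex_chart[OF manP] by blast
 obtain d where d: "d:PP" "ra p k:cdom d" using ex_chart[OF manP] by blast
 have "vf_deriv PP X \<xi> (ra p k) = tang d lchart \<xi> (ra p k) (tang c d (%q. ra q k) p (X c p))"
  by (simp add: vf_deriv_at[OF autD[OF X] \<xi> d] aut_inv[OF X c(1) d(1) c(2) d(2)])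
 also have "\<dots> = tang c lchart (%q. \<xi> (ra q k)) p (X c p)"
  by (rule tang_comp[OF manP manP manifold_lin smooth_at_ract HS_at[OF \<xi>] c d lchart_in, symmetric]) simp
 also have "\<dots> = Adh E (ginv KK k) (tang c lchart \<xi> p (X c p))"
  by (simp add: HS_equiv[OF \<xi>] tang_linear_fun[OF manP HS_at[OF \<xi>] c Adh_linear Adh_continuous])
 finally show "vf_deriv PP X \<xi> (ra p k) = Adh E (ginv KK k) (vf_deriv PP X \<xi> p)" by (simp add: vf_deriv_at[OF autD[OF X] \<xi> c])
qed

lemma tang_HS_fundv:
 assumes \<xi>: "\<xi>:HS" and c: "c:PP" "p:cdom c" shows "tang c lchart \<xi> p (fundv B (Lq y) c p) = - brH y (\<xi> p)"
proof -
 have "tang c lchart \<xi> p (fundv B (Lq y) c p) = tang k1 lchart (%k. \<xi> (ra p k)) ee (Lq y)" unfolding fundv_def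
  using tang_comp[OF K.manG manP manifold_lin act.smooth_at_right HS_at[OF \<xi>] K.chart1 K.one_chart1 c(1) _ lchart_in, of p "Lq y"] c by simp
 then show ?thesis by (simp add: HS_equiv[OF \<xi>] tang_Adh_inv)
qed

lemma al_at: "c:PP==>p:cdom c==>al \<xi> c p = fundv B (- Lq (\<xi> p)) c p" by (simp add: sec_alpha_def)

lemma lmcv_alpha:
 assumes c: "c:PP" "p:cdom c" and f: "lmcv PP F p f l" shows "lmcv PP F p (%i. al (f i) c) (al l c)"
proof -
 have L: "linear (%y. - Lq y)" "continuous_on UNIV (%y. - Lq y)"
  using q.Lhom_linear continuous_on_diff_lcs[OF continuous_on_const q.Lhom_continuous, of 0]
  by (auto intro!: linearI simp: linear_add[OF q.Lhom_linear] linear_scale[OF q.Lhom_linear])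
 show ?thesis by (rule lmcv_cong[OF manP lmcv_fundv[OF c lmcv_linear[OF manP f L]] open_cdom[OF manP c(1)] c(2)])
   (simp_all add: al_at c)
qed

lemma al_in:
 assumes \<xi>: "\<xi>:HS" shows "al \<xi>:aut B"
proof (rule autI[OF vfieldsI[OF manP]])
 show "al \<xi> c p = 0" if "c\<notin>PP \<or> p\<notin>cdom c" for c p using that by (auto simp: sec_alpha_def)
 show "al \<xi> d p = tang c d (%q. q) p (al \<xi> c p)" if "c:PP" "d:PP" "p:cdom c" "p:cdom d" for c d p
  using fundv_change[OF that(1,3,2,4)] that by (simp add: al_at)
 show "\<exists>V. open V\<and>p:V\<and>msm PP V (al \<xi> c)" if c: "c:PP" "p:cdom c" for c p
  using lmcv_alpha[OF c lmcv_const[OF manP HS_at[OF \<xi>], of "bot :: unit filter"]] unfolding lmcv_def mcv_bot .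
 show "al \<xi> d (ra p k) = tang c d (%q. ra q k) p (al \<xi> c p)" if "c:PP" "d:PP" "p:cdom c" "ra p k:cdom d" for c d p k
  using fundv_ract[OF that(1,3,2,4)] that by (simp add: al_at HS_equiv[OF \<xi>] Lq_Adh linear_neg[OF K.Ad_linear])
qed

lemma qg_al: "\<xi>:HS==>qg B (al \<xi>) = 0" by (rule qg_eqI[OF al_in vf_zero[OF manM]]) (auto simp: related_def al_at tang_proj_fundv)

lemma al_lin: "al (a*\<^sub>R\<xi> + b*\<^sub>R\<eta>) = a*\<^sub>Ral \<xi> + b*\<^sub>Ral \<eta>"
proof (intro ext)
 fix c p
 have "fundv B (- Lq (a*\<^sub>R\<xi> p + b*\<^sub>R\<eta> p)) c p = a*\<^sub>Rfundv B (- Lq (\<xi> p)) c p + b*\<^sub>Rfundv B (- Lq (\<eta> p)) c p"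
  if "c:PP" "p:cdom c" by (simp add: linear_add[OF q.Lhom_linear] linear_scale[OF q.Lhom_linear] linear_diff[OF fundv_linear[OF that]]
   linear_neg[OF fundv_linear[OF that]] linear_scale[OF fundv_linear[OF that]] linear_add[OF fundv_linear[OF that]])
 then show "al (a*\<^sub>R\<xi> + b*\<^sub>R\<eta>) c p = (a*\<^sub>Ral \<xi> + b*\<^sub>Ral \<eta>) c p"
  by (auto simp: sec_alpha_def plus_fun_def scaleR_fun_def)
qed

text \<open>Two signs cancel: \<open>al\<close> inserts minus \<open>Lq\<close> of \<xi>, and the
  equivariance of \<eta> produces a minus sign in the derivative along a fundamental field. This
  explains the sign convention for \<alpha>.\<close>

lemma deriv_al:
 assumes "\<xi>:HS" "\<eta>:HS" shows "vf_deriv PP (al \<xi>) \<eta> p = brH (\<xi> p) (\<eta> p)"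
proof -
 obtain c where c: "c:PP" "p:cdom c" using ex_chart[OF manP] by blast
 have "- Lq (\<xi> p) = Lq (- \<xi> p)" by (simp add: linear_neg[OF q.Lhom_linear])
 then show ?thesis by (simp add: vf_deriv_at[OF autD[OF al_in[OF assms(1)]] assms(2) c] al_at[OF c] tang_HS_fundv[OF assms(2) c]
   bilinear_lneg[OF H.lie_br_bilinear])
qed

definition "incl f p = Lz (f (pr p))" for f :: "'m=>'y"

lemma ZF_iff: "f:ZF\<longleftrightarrow>msm MM UNIV f" unfolding zfuns_def by (simp add: msm_iff[OF manM])

lemma subspace_ZF: "subspace ZF" unfolding subspace_def
 by (auto simp: ZF_iff zero_fun_def plus_fun_def scaleR_fun_def intro!: msm_const msm_add[OF manM] msm_scaleR[OF manM])

lemma incl_in: "f:ZF==>incl f:HS" unfolding HS_iff ZF_iff incl_def[abs_def]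
 by (auto simp: Adh_Lz intro!: msm_linear[OF manP open_UNIV msm_lift z.Lhom_linear z.Lhom_continuous])

lemma al_incl: "al (incl f) = 0" by (auto simp: fun_eq_iff sec_alpha_def incl_def Lq_Lz linear_0[OF fundv_linear])

lemma incl_lin: "incl (a*\<^sub>Rf + b*\<^sub>Rg) = a*\<^sub>Rincl f + b*\<^sub>Rincl g"
 by (auto simp: fun_eq_iff incl_def plus_fun_def scaleR_fun_def linear_add[OF z.Lhom_linear] linear_scale[OF z.Lhom_linear])

lemma incl_inj: "incl f = incl g==>f = g"
proof
 fix m assume "incl f = incl g"
 moreover obtain p where "pr p = m" using proj_surj by blast
 ultimately have "Lz (f m) = Lz (g m)" unfolding incl_def by metis
 then show "f m = g m" using rz(3) by metis
qed

lemma lmcv_incl: "lmcv MM F (pr p) f l==>lmcv PP F p (%i. incl (f i)) (incl l)" unfolding incl_def[abs_def]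
 by (rule lmcv_linear[OF manP lmcv_pullback[OF manP manM _ proj_at] z.Lhom_linear z.Lhom_continuous])

text \<open>A local section of P and the continuous left inverse \<open>rz\<close> of
  \<open>Lz\<close> recover f from its pullback.\<close>

lemma lmcv_incl_inverse:
 assumes "!!p. pr p = m==>lmcv PP F p (%i. incl (f i)) (incl l)" shows "lmcv MM F m f l"
proof -
 obtain U \<tau> where U: "open U" "m:U" "smooth_map_on U MM PP \<tau>" "!!u. u:U==>pr (\<tau> u) = u" by (rule local_section[of m]) blast
 have "lmcv MM F m (%i u. rz (incl (f i) (\<tau> u))) (%u. rz (incl l (\<tau> u)))"
  by (rule lmcv_linear[OF manM lmcv_pullback[OF manM manP assms smooth_atI[OF U(3,1,2)]] rz(1,2)]) (use U in auto)
 then show ?thesis by (rule lmcv_cong[OF manM _ U(1,2)]) (simp_all add: incl_def U(4) rz(3))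
qed

text \<open>Values in the kernel of \<open>Lq\<close> come from the Lie algebra of Z, on which
  \<open>Adh\<close> acts trivially, so equivariance makes \<xi> constant on the fibres.\<close>

lemma al_eq_0:
 assumes "\<xi>:HS" "!!p. Lq (\<xi> p) = 0" shows "\<xi>:incl ` ZF"
proof -
 define f where "f m = rz (\<xi> (SOME p. pr p = m))" for m
 have const: "\<xi> q = \<xi> p" if pq: "pr p = pr q" for p q
 proof -
  obtain k where k: "q = ra p k" using fibre_transitive[OF pq] .
  have "\<xi> p = Lz (rz (\<xi> p))" using rz(4)[OF assms(2)] by simp
  then have "Adh E (ginv KK k) (\<xi> p) = \<xi> p" using Adh_Lz by metis
  then show ?thesis using HS_equiv[OF assms(1)] k by simp
 qed
 have some: "pr (SOME p. pr p = m) = m" for m using proj_surj by (rule someI_ex)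
 have eq: "\<xi> = incl f"
 proof
  fix p show "\<xi> p = incl f p" using const[of "SOME q. pr q = pr p" p] some rz(4)[OF assms(2)] by (simp add: incl_def f_def)
 qed
 have "smooth_at MM lin_atlas f m" for m by (rule smooth_at_via_lmcv[OF manM lmcv_incl_inverse])
   (use eq lmcv_const[OF manP HS_at[OF assms(1)]] in simp)
 then have "f:ZF" unfolding ZF_iff using smooth_at_msm_iff[OF open_UNIV manM] by blast
 then show ?thesis using eq by blast
qed

text \<open>Injectivity of x to the fundamental vector enters as a hypothesis because no connection
  is fixed at this stage; a connection form supplies it.\<close>

lemma al_zero_Lq:
 assumes "\<xi>:HS" "al \<xi> = 0" "!!c p x. c:PP==>p:cdom c==>fundv B x c p = 0==>x = 0" shows "\<xi>:incl ` ZF"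
proof (rule al_eq_0[OF assms(1)])
 fix p
 obtain c where c: "c:PP" "p:cdom c" using ex_chart[OF manP] by blast
 have "fundv B (- Lq (\<xi> p)) c p = 0" using al_at[OF c, of \<xi>] assms(2) by simp
 then show "Lq (\<xi> p) = 0" using assms(3)[OF c] by fastforce
qed

lemma deriv_incl:
 assumes X: "X:aut B" and f: "f:ZF" shows "vf_deriv PP X (incl f) = incl (vf_deriv MM (qg B X) f)"
proof
 fix p
 obtain c where c: "c:PP" "p:cdom c" using ex_chart[OF manP] by blast
 obtain d where d: "d:MM" "pr p:cdom d" using ex_chart[OF manM] by blast
 have sf: "smooth_at MM lin_atlas f m" for m using f by (auto simp: ZF_iff intro: msm_smooth_at[OF manM])
 have "vf_deriv PP X (incl f) p = tang c lchart (%q. Lz (f (pr q))) p (X c p)"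
 proof -
  have "incl f = (%q. Lz (f (pr q)))" by (simp add: fun_eq_iff incl_def)
  then show ?thesis using vf_deriv_at[OF autD[OF X] incl_in[OF f] c] by simp
 qed
 also have "\<dots> = Lz (tang c lchart (%q. f (pr q)) p (X c p))"
  by (rule tang_linear_fun[OF manP smooth_at_comp[OF manP manM manifold_lin proj_at sf] c z.Lhom_linear z.Lhom_continuous])
 also have "tang c lchart (%q. f (pr q)) p (X c p) = tang d lchart f (pr p) (tang c d pr p (X c p))"
  by (rule tang_comp[OF manP manM manifold_lin proj_at sf c d lchart_in]) simp
 also have "\<dots> = vf_deriv MM (qg B X) f (pr p)" using vf_deriv_eq[OF manM qg_in[OF X] sf d] qg_at[OF X c d] by simp
 finally have r: "vf_deriv PP X (incl f) p = Lz (vf_deriv MM (qg B X) f (pr p))" .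
 show "vf_deriv PP X (incl f) p = incl (vf_deriv MM (qg B X) f) p" by (subst r) (simp add: incl_def)
qed

end

section \<open>Smooth functions of a real variable\<close>

lemma smooth_on_real:
 fixes f :: "real=>real"
 assumes U: "open U" and D0: "!!x. x:U==>D 0 x = f x" and D: "!!n x. x:U==>(D n has_field_derivative D (Suc n) x) (at x)" shows "smooth_on U f"
proof (rule smooth_onI(1)[OF U, where G = "%n x h. D n x * (\<Prod>i<n. h i)" and G' = "%n x h v. D (Suc n) x * v * (\<Prod>i<n. h i)"])
 fix n x h and v :: real assume x: "x:U"
 have "((%t. D n (x + t * v)) has_field_derivative D (Suc n) x * v) (at 0)"
  by (rule DERIV_chain2[where g = "%t. x + t * v"]) (auto intro!: derivative_eq_intros D x)
 then have l: "((%t. (D n (x + t * v) - D n x) / t)\<longlongrightarrow>D (Suc n) x * v) (at 0)" by (simp add: DERIV_def)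
 have "((%t. (D n (x + t * v) - D n x) / t * (\<Prod>i<n. h i))\<longlongrightarrow>D (Suc n) x * v * (\<Prod>i<n. h i)) (at 0)"
  by (intro tendsto_intros l)
 then show "(dquot (%y. D n y * (\<Prod>i<n. h i)) x v\<longlongrightarrow>D (Suc n) x * v * (\<Prod>i<n. h i)) (at 0)"
  by (simp add: dquot_def[abs_def] divide_inverse algebra_simps)
next
 fix n
 have "continuous_on U (D n)" by (intro continuous_at_imp_continuous_on ballI) (rule DERIV_isCont[OF D])
 then have "continuous_on (U\<times>UNIV) (%z :: real\<times>(nat=>real). D n (fst z))"
  by (rule continuous_on_compose2) (auto intro!: continuous_intros)
 then show "continuous_on (U\<times>UNIV) (%(x, h). D n x * (\<Prod>i<n. h i))" unfolding case_prod_unfold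
  by (rule continuous_on_mult) (intro continuous_on_prod continuous_on_proj_snd)
qed (auto simp: D0)

lemma smooth_on_inverse: "smooth_on {0<..} (%x::real. inverse x)"
proof (rule smooth_on_real[where D = "%n x. (-1) ^ n * fact n / x ^ Suc n"])
 fix n and x :: real assume "x:{0<..}"
 then have x: "x > 0" by simp
 have "((%x::real. (-1) ^ n * fact n / x ^ Suc n) has_field_derivative
   - ((-1) ^ n * fact n * (real (Suc n) * x ^ n)) / (x ^ Suc n * x ^ Suc n)) (at x)" by (rule derivative_eq_intros refl | use x in simp)+
 also have "- ((-1) ^ n * fact n * (real (Suc n) * x ^ n)) / (x ^ Suc n * x ^ Suc n) = (-1) ^ Suc n * fact (Suc n) / x ^ Suc (Suc n)"
  using x by (simp add: field_simps)
 finally show "((%x::real. (-1) ^ n * fact n / x ^ Suc n) has_field_derivative (-1) ^ Suc n * fact (Suc n) / x ^ Suc (Suc n)) (at x)" .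
qed (auto simp: divide_inverse)

text \<open>The derivatives of \<open>exp (-1/x)\<close> have the form \<open>p (1/x) exp (-1/x)\<close> with polynomials \<open>p\<close>.\<close>

definition flat :: "real poly=>real=>real" where
 "flat p x = (if x \<le> 0 then 0 else poly p (inverse x) * exp (- inverse x))"

lemma poly_div_exp_tendsto: "((%y. poly p y / exp y)\<longlongrightarrow>0) at_top" for p :: "real poly"
proof -
 have "((%y. \<Sum>i\<le>degree p. coeff p i * (y ^ i / exp y))\<longlongrightarrow>(\<Sum>i\<le>degree p. coeff p i * 0)) at_top"
  by (intro tendsto_intros tendsto_power_div_exp_0)
 then show ?thesis by (simp add: poly_altdef sum_divide_distrib)
qed

text \<open>With y = 1/x, whose derivative is -y^2, the product rule turns the polynomial p into y^2
  (p - p').\<close>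

lemma flat_deriv: "(flat p has_field_derivative flat ([:0, 0, 1:] * (p - pderiv p)) x) (at x)"
proof (cases x "0 :: real" rule: linorder_cases)
 case less
 have "((%_. 0) has_field_derivative 0) (at x)" by simp
 then show ?thesis by (rule DERIV_cong_ev[THEN iffD1, rotated -1])
   (use less in \<open>auto simp: flat_def eventually_nhds intro!: exI[of _ "{..<0}"]\<close>)
next
 case greater
 have "((%x. poly p (inverse x) * exp (- inverse x)) has_field_derivative
  poly ([:0, 0, 1:] * (p - pderiv p)) (inverse x) * exp (- inverse x)) (at x)"
  using greater by (auto intro!: derivative_eq_intros simp: field_simps power2_eq_square)
 then show ?thesis by (rule DERIV_cong_ev[THEN iffD1, rotated -1])
   (use greater in \<open>auto simp: flat_def eventually_nhds intro!: exI[of _ "{0<..}"]\<close>)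
next
 case equal
 have "((%h. flat p h / h)\<longlongrightarrow>0) (at_right 0)"
 proof -
  \<comment> \<open>The difference quotient at 0 is y p(y) exp(-y) with y = 1/h, which accounts for
    the factor \<open>[:0, 1:]\<close>.\<close>
  have "((%h. poly ([:0, 1:] * p) (inverse h) / exp (inverse h))\<longlongrightarrow>0) (at_right (0::real))"
   by (rule filterlim_compose[OF poly_div_exp_tendsto filterlim_inverse_at_top_right])
  then show ?thesis by (rule tendsto_cong[THEN iffD1, rotated])
    (auto simp: eventually_at_filter flat_def exp_minus divide_inverse mult_ac)
 qed
 moreover have "((%h. flat p h / h)\<longlongrightarrow>0) (at_left 0)" by (rule tendsto_eventually) (auto simp: eventually_at_filter flat_def)
 ultimately have "((%h. flat p h / h)\<longlongrightarrow>0) (at 0)" by (simp add: filterlim_at_split)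
 then show ?thesis using equal by (simp add: DERIV_def flat_def)
qed

lemma smooth_on_flat: "smooth_on UNIV (flat p)"
proof -
 define P where "P = rec_nat p (%_ p. [:0, 0, 1:] * (p - pderiv p))"
 show ?thesis
 proof (rule smooth_on_real[where D = "%n. flat (P n)"])
  show "flat (P 0) x = flat p x" for x by (simp add: P_def)
  have "P (Suc n) = [:0, 0, 1:] * (P n - pderiv (P n))" for n by (simp add: P_def)
  then show "(flat (P n) has_field_derivative flat (P (Suc n)) x) (at x)" for n x using flat_deriv by simp
 qed simp
qed

lemma flat_1: "flat 1 x \<ge> 0" "flat 1 x > 0\<longleftrightarrow>x > 0" "x \<le> 0==>flat 1 x = 0" by (auto simp: flat_def)

section \<open>Finite-dimensional spaces\<close>

lemma continuous_functional:
 fixes f :: "'a::lcs=>real"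
 assumes f: "linear f" and V: "open V" "0:V" "!!v. v:V==>\<bar>f v\<bar> < 1" shows "continuous_on UNIV f" unfolding continuous_on_def
proof
 fix x
 show "(f\<longlongrightarrow>f x) (at x)"
 proof (rule tendstoI)
  fix e :: real assume e: "e > 0"
  have "((%y. (1 / e)*\<^sub>R(y - x))\<longlongrightarrow>(1 / e)*\<^sub>R(x - x)) (at x)" by (intro tendsto_intros tendsto_diff tendsto_ident_at)
  then have "eventually (%y. (1 / e)*\<^sub>R(y - x):V) (at x)" using V by (auto simp: tendsto_def)
  then show "eventually (%y. dist (f y) (f x) < e) (at x)"
  proof eventually_elim
   case (elim y)
   from V(3)[OF this] have "\<bar>(1 / e) * (f y - f x)\<bar> < 1" by (simp add: linear_scale[OF f] linear_diff[OF f])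
   then show ?case using e by (simp add: dist_real_def abs_mult field_simps)
  qed
 qed
qed

text \<open>A compact substitute for a ball, since no norm is given. For a basis it is a coordinate
  cube; allowing any finite S makes the faces cubes as well, up to translation.\<close>

definition cube :: "real=>'a::lcs set=>'a set" where
 "cube r S = {v. \<exists>c. (\<forall>b\<in>S. \<bar>c b\<bar> \<le> r)\<and>v = (\<Sum>b\<in>S. c b*\<^sub>Rb)}"

lemma compact_cube:
 assumes "finite S" shows "compact (cube r S)" using assms
proof (induction S)
 case empty
 have "cube r {} = {0 :: 'a}" by (auto simp: cube_def)
 then show ?case by simp
next
 case (insert a S)
 have eq: "cube r (insert a S) = (%z. fst z*\<^sub>Ra + snd z) ` ({-r..r}\<times>cube r S)"
 proof (intro equalityI subsetI)
  fix v assume "v:cube r (insert a S)"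
  then obtain c where c: "\<forall>b\<in>insert a S. \<bar>c b\<bar> \<le> r" "v = (\<Sum>b\<in>insert a S. c b*\<^sub>Rb)" unfolding cube_def by blast
  then have "v = fst (c a, \<Sum>b\<in>S. c b*\<^sub>Rb)*\<^sub>Ra + snd (c a, \<Sum>b\<in>S. c b*\<^sub>Rb)" using insert.hyps by simp
  moreover have "(c a, \<Sum>b\<in>S. c b*\<^sub>Rb):{-r..r}\<times>cube r S" using c by (auto simp: abs_le_iff minus_le_iff cube_def)
  ultimately show "v:(%z. fst z*\<^sub>Ra + snd z) ` ({-r..r}\<times>cube r S)" by blast
 next
  fix v assume "v:(%z. fst z*\<^sub>Ra + snd z) ` ({-r..r}\<times>cube r S)"
  then obtain z where z: "z:{-r..r}\<times>cube r S" "v = fst z*\<^sub>Ra + snd z" by blast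
  define t where "t = fst z"
  have t: "\<bar>t\<bar> \<le> r" using z(1) by (auto simp: t_def abs_le_iff)
  have "snd z:cube r S" using z(1) by (rule mem_Times_iff[THEN iffD1, THEN conjunct2])
  then obtain c where c: "\<forall>b\<in>S. \<bar>c b\<bar> \<le> r" "snd z = (\<Sum>b\<in>S. c b*\<^sub>Rb)" unfolding cube_def by blast
  have "(\<Sum>b\<in>S. (c(a := t)) b*\<^sub>Rb) = (\<Sum>b\<in>S. c b*\<^sub>Rb)" using insert.hyps by (intro sum.cong) auto
  then have "v = (\<Sum>b\<in>insert a S. (c(a := t)) b*\<^sub>Rb)" using c z(2) insert.hyps by (simp add: t_def)
  moreover have "\<forall>b\<in>insert a S. \<bar>(c(a := t)) b\<bar> \<le> r" using c t by auto
  ultimately show "v:cube r (insert a S)" unfolding cube_def by blast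
 qed
 show ?case unfolding eq by (intro compact_continuous_image compact_Times insert.IH compact_Icc continuous_on_add_lcs continuous_on_scaleR'
    continuous_intros)
qed

text \<open>The boundary of the unit cube is compact, hence closed, and misses 0. On a convex
  neighbourhood V of 0 that avoids it all coordinates are below 1 in absolute value: otherwise
  dividing by the largest of them would stay in V and land on the boundary. Functionals bounded near
  0 are continuous.\<close>

lemma fin_coords_exist:
 assumes "\<exists>F::'a::lcs set. finite F\<and>span F = UNIV"
 obtains Bs and cf :: "'a::lcs=>'a=>real" where "fin_coords Bs cf"
proof -
 obtain F :: "'a set" where F: "finite F" "span F = UNIV" using assms by blast
 obtain Bs where Bs: "Bs\<subseteq>F" "independent Bs" "F\<subseteq>span Bs" by (rule maximal_independent_subset)
 have fin: "finite Bs" using Bs F finite_subset by blast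
 have sp: "span Bs = UNIV" using F Bs by (metis span_mono span_span top.extremum_uniqueI)
 define cf where "cf b v = representation Bs v b" for b v
 have lin: "linear (cf b)" for b by (rule linearI) (simp_all add: cf_def representation_add[OF Bs(2)] representation_scale[OF Bs(2)] sp)
 have sum: "v = (\<Sum>b\<in>Bs. cf b v *\<^sub>R b)" for v using sum_representation_eq[OF Bs(2) _ fin order_refl, of v] sp by (simp add: cf_def)
 have basis: "cf b b' = (if b' = b then 1 else 0)" if "b':Bs" for b b' using representation_basis[OF Bs(2) that] by (simp add: cf_def)
 \<comment> \<open>The boundary of the cube, as the union of the faces whose coordinate at b is
   s.\<close>
 let ?T = "\<Union>b\<in>Bs. \<Union>s\<in>{-1, 1::real}. (%w. s*\<^sub>Rb + w) ` cube 1 (Bs - {b})"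
 have "compact ?T" by (intro compact_UN fin compact_continuous_image continuous_on_add_lcs continuous_intros compact_cube) (use fin in auto)
 then have oT: "open (- ?T)" by (rule open_Compl[OF compact_imp_closed])
 have "0\<notin>?T"
 proof
  assume "0:?T"
  then obtain b s w where w: "b:Bs" "s:{-1, 1::real}" "w:cube 1 (Bs - {b})" "0 = s*\<^sub>Rb + w" by blast
  then obtain r where "w = (\<Sum>b\<in>Bs - {b}. r b*\<^sub>Rb)" unfolding cube_def by blast
  note b = w(1,2) w(4)[unfolded this]
  have "cf b 0 = cf b (s*\<^sub>Rb + (\<Sum>b\<in>Bs - {b}. r b*\<^sub>Rb))" using b(3) by simp
  also have "\<dots> = s * cf b b + (\<Sum>b'\<in>Bs - {b}. r b' * cf b b')"
   by (simp add: linear_add[OF lin] linear_scale[OF lin] linear_sum[OF lin])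
  also have "(\<Sum>b'\<in>Bs - {b}. r b' * cf b b') = 0" by (rule sum.neutral) (simp add: basis)
  finally show False using b linear_0[OF lin] by (auto simp: basis)
 qed
 then obtain V where V: "open V" "convex V" "0:V" "V\<subseteq>- ?T" using lcs_nbhdE[OF oT] by blast
 have small: "\<bar>cf b v\<bar> < 1" if v: "v:V" and b: "b:Bs" for b v
 proof (rule ccontr)
  assume n: "\<not> \<bar>cf b v\<bar> < 1"
  obtain M where M: "M = Max ((%b. \<bar>cf b v\<bar>) ` Bs)" by blast
  have Mb: "!!b. b:Bs==>\<bar>cf b v\<bar> \<le> M" using fin by (simp add: M)
  have M1: "M \<ge> 1" using n Mb[OF b] by simp
  have "M:(%b. \<bar>cf b v\<bar>) ` Bs" unfolding M using fin b by (intro Max_in) auto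
  then obtain a where a: "a:Bs" "\<bar>cf a v\<bar> = M" by blast
  let ?v = "(1 / M)*\<^sub>Rv"
  have "(1 / M)*\<^sub>Rv + (1 - 1 / M)*\<^sub>R0:V" using M1 by (intro convexD[OF V(2) v V(3)]) auto
  then have "?v:V" by simp
  moreover have "?v:?T"
  proof -
   let ?r = "%b. cf b v / M"
   have "?v = (\<Sum>b\<in>Bs. ?r b*\<^sub>Rb)" using sum[of ?v] by (simp add: linear_scale[OF lin])
   also have "\<dots> = ?r a*\<^sub>Ra + (\<Sum>b\<in>Bs - {a}. ?r b*\<^sub>Rb)" by (rule sum.remove[OF fin a(1)])
   finally have e: "?v = ?r a*\<^sub>Ra + (\<Sum>b\<in>Bs - {a}. ?r b*\<^sub>Rb)" .
   have r1: "\<forall>b\<in>Bs - {a}. \<bar>?r b\<bar> \<le> 1"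
   proof
    fix b assume "b:Bs - {a}"
    then have "\<bar>cf b v\<bar> \<le> M" using Mb by blast
    then show "\<bar>?r b\<bar> \<le> 1" using M1 by (simp add: abs_divide)
   qed
   have "\<bar>?r a\<bar> = 1" using a(2) M1 by (simp add: abs_div_pos)
   then have "?r a = 1 \<or> ?r a = -1" by linarith
   then have "?r a:{-1, 1}" by blast
   moreover have "(\<Sum>b\<in>Bs - {a}. ?r b*\<^sub>Rb):cube 1 (Bs - {a})" unfolding cube_def by (intro CollectI exI[of _ ?r] conjI refl r1)
   ultimately show ?thesis using e a(1) by blast
  qed
  ultimately show False using V(4) by blast
 qed
 show thesis by (rule that, rule fin_coords.intro) (rule fin, rule lin, rule continuous_functional[OF lin V(1,3) small], assumption+, rule sum)
qed

context fin_coords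
begin

text \<open>Induction on the number of basis vectors: continuity of scaling handles one vector, and
  continuity of subtraction joins it to the others.\<close>

lemma cube_small:
 assumes "open U" "0:U"
 obtains r where "r > 0" "cube r Bs\<subseteq>U"
proof -
 have *: "\<exists>r>0. \<forall>c. (\<forall>b\<in>S. \<bar>c b\<bar> \<le> r)-->(\<Sum>b\<in>S. c b*\<^sub>Rb):U" if "finite S" "open U" "0:U" for S U :: "'a set"
  using that
 proof (induction S arbitrary: U)
  case (insert a S)
  obtain V where V: "open V" "0:V" "!!x y. x:V==>y:V==>x - y:U" by (rule lcs_nbhd_diffE[OF insert.prems]) blast
  obtain r1 where r1: "r1 > 0" "\<forall>c. (\<forall>b\<in>S. \<bar>c b\<bar> \<le> r1)-->(\<Sum>b\<in>S. c b*\<^sub>Rb):V"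
   using insert.IH[OF V(1,2)] by blast
  have "eventually (%t. 0 + t*\<^sub>Ra:V) (at (0::real))" using eventually_line V by blast
  then obtain d where d: "d > 0" "!!t. t \<noteq> 0==>\<bar>t\<bar> < d==>t*\<^sub>Ra:V" unfolding eventually_at by (auto simp: dist_real_def)
  have d': "t*\<^sub>Ra:V" if "\<bar>t\<bar> < d" for t using d(2)[of t] V(2) that by (cases "t = 0") auto
  show ?case
  proof (intro exI[of _ "min r1 (d / 2)"] conjI allI impI)
   show "min r1 (d / 2) > 0" using r1 d by simp
   fix c assume c: "\<forall>b\<in>insert a S. \<bar>c b\<bar> \<le> min r1 (d / 2)"
   have "(\<Sum>b\<in>S. c b*\<^sub>Rb) - (- c a)*\<^sub>Ra:U" using c r1 d by (intro V(3) d') auto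
   then show "(\<Sum>b\<in>insert a S. c b*\<^sub>Rb):U" using insert.hyps by (simp add: add.commute)
  qed
 qed (auto intro: exI[of _ 1])
 obtain r where r: "r > 0" "\<forall>c. (\<forall>b\<in>Bs. \<bar>c b\<bar> \<le> r)-->(\<Sum>b\<in>Bs. c b*\<^sub>Rb):U"
  using *[OF fin assms] by blast
 then have "cube r Bs\<subseteq>U" by (auto simp: cube_def)
 then show thesis using that r by blast
qed

section \<open>Bump functions and partitions of unity\<close>

definition "sqn v = (\<Sum>b\<in>Bs. cf b v * cf b v)"

lemma smooth_on_sqn: "smooth_on UNIV sqn"
proof -
 have m: "bilinear (%a b :: real. a * b)" unfolding bilinear_def by (auto intro!: linearI simp: algebra_simps)
 have c: "continuous_on UNIV (%z :: real\<times>real. fst z * snd z)" by (intro continuous_intros)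
 show ?thesis unfolding sqn_def[abs_def]
  by (rule smooth_on_sum[OF smooth_on_bilinear_compose[OF m c]]) (auto intro: smooth_on_linear cf_linear cf_cont)
qed

lemma sqn_cube: "r > 0==>sqn v < r * r==>v:cube r Bs" unfolding cube_def
proof (intro CollectI exI[of _ "%b. cf b v"] conjI cf_sum ballI)
 fix b assume r: "r > 0" "sqn v < r * r" and b: "b:Bs"
 have "cf b v * cf b v \<le> sqn v" unfolding sqn_def by (rule member_le_sum[OF b _ fin]) simp
 then have "\<bar>cf b v\<bar>\<^sup>2 \<le> r\<^sup>2" using r by (simp add: power2_eq_square)
 then show "\<bar>cf b v\<bar> \<le> r" using r power2_le_imp_le[of "\<bar>cf b v\<bar>" r] by simp
qed

lemma sqn_zero: "sqn 0 = 0" unfolding sqn_def by (rule sum.neutral) (simp add: linear_0[OF cf_linear])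

text \<open>In a chart the function is \<open>flat 1\<close> of r^2 minus the squared distance from
  the centre, extended by zero. The extension is smooth because C, being compact in a Hausdorff
  space, is closed, and the function vanishes off C.\<close>

lemma bump:
 fixes A :: "('m::t2_space, 'a) chart set"
 assumes A: "manifold A" and N: "open N" "m:N"
 obtains \<beta> :: "'m=>real" and C where "msm A UNIV \<beta>" "!!u. \<beta> u \<ge> 0" "\<beta> m > 0" "compact C" "C\<subseteq>N" "!!u. u\<notin>C==>\<beta> u = 0"
proof -
 obtain d where d: "d:A" "m:cdom d" using ex_chart[OF A] by blast
 let ?x = "cmap d m" and ?U = "cmap d ` (cdom d\<inter>N)"
 have U: "open ?U" by (rule open_cmap_image[OF A d(1) N(1)])
 obtain r where r: "r > 0" "cube r Bs\<subseteq>{y. ?x + y:?U}" by (rule cube_small[of "{y. ?x + y:?U}"]) (use open_vimage_plus[OF U] d N in auto)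
 let ?K = "(%v. ?x + v) ` cube r Bs"
 have K: "compact ?K" by (intro compact_continuous_image compact_cube fin continuous_on_add_lcs continuous_intros)
 have KU: "?K\<subseteq>?U" using r by auto
 then have Kc: "?K\<subseteq>cimg d" by (auto simp: cimg_def)
 let ?C = "cinv d ` ?K"
 have C: "compact ?C" by (rule compact_continuous_image[OF continuous_on_subset[OF continuous_cinv[OF A d(1)] Kc] K])
 let ?f = "%y. flat 1 (r * r - sqn (y - ?x))"
 define \<beta> where "\<beta> u = (if u:cdom d then ?f (cmap d u) else 0)" for u
 have out: "\<beta> u = 0" if "u\<notin>?C" for u
 proof (cases "u:cdom d")
  case True
  have "cmap d u - ?x\<notin>cube r Bs"
  proof
   assume "cmap d u - ?x:cube r Bs"
   then have "cinv d (?x + (cmap d u - ?x)):?C" by blast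
   then show False using that cinv_cmap[OF A d(1) True] by simp
  qed
  then have "\<not> sqn (cmap d u - ?x) < r * r" using sqn_cube r by blast
  then show ?thesis using flat_1(3) by (simp add: \<beta>_def)
 qed (simp add: \<beta>_def)
 show thesis
 proof (rule that[of \<beta> ?C])
  show "\<beta> u \<ge> 0" for u by (simp add: \<beta>_def flat_1)
  show "\<beta> m > 0" using d r by (simp add: \<beta>_def flat_1 sqn_zero)
  show "compact ?C" by (rule C)
  show "?C\<subseteq>N" using KU mem_cmap_image[OF A d(1)] by blast
  show "\<beta> u = 0" if "u\<notin>?C" for u using out[OF that] .
  show "msm A UNIV \<beta>"
  proof (rule msm_local[OF A _ open_UNIV])
   fix u
   show "\<exists>V. open V\<and>u:V\<and>msm A V \<beta>"
   proof (cases "u:cdom d")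
    case True
    have s1: "smooth_on UNIV (%y. sqn (y - ?x))"
     by (rule smooth_on_compose[OF smooth_on_sqn open_UNIV smooth_on_diff[OF smooth_on_id smooth_on_const]]) auto
    have "smooth_on UNIV ?f" by (rule smooth_on_compose[OF smooth_on_flat open_UNIV smooth_on_diff[OF smooth_on_const s1]]) auto
    then have "msm A (cdom d) (%u. ?f (cmap d u))" by (rule msm_outer[OF A open_cdom[OF A d(1)] msm_cmap[OF A d(1)]]) auto
    then have "msm A (cdom d) \<beta>" by (rule msm_cong[OF A _ open_cdom[OF A d(1)]]) (simp add: \<beta>_def)
    then show ?thesis using True open_cdom[OF A d(1)] by blast
   next
    case False
    have o: "open (- ?C)" using C by (simp add: compact_imp_closed open_Compl)
    have "?C\<subseteq>cdom d"
    proof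
     fix u assume "u:?C"
     then obtain y where y: "y:?K" "u = cinv d y" by blast
     show "u:cdom d" unfolding y(2) by (rule cinv_cdom) (use y(1) Kc in blast)
    qed
    then have "u:- ?C" using False by blast
    moreover have "msm A (- ?C) \<beta>" by (rule msm_cong[OF A msm_const[of _ _ 0] o]) (simp add: out)
    ultimately show ?thesis using o by blast
   qed
  qed
 qed
qed

lemma msm_sum:
 assumes "manifold A" "open W" "!!j. j:J==>msm A W (f j)" shows "msm A W (%p. \<Sum>j\<in>J. f j p)"
 using assms(3) by (induction J rule: infinite_finite_induct) (auto intro: msm_const msm_add[OF assms(1,2)])

lemma locally_finite_compact:
 fixes K :: "'n::topological_space set"
 assumes "locally_finite_in euclidean \<W>" "compact K" shows "finite {W:\<W>. W\<inter>K \<noteq> {}}"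
proof -
 have "\<forall>x\<in>K. \<exists>V. open V\<and>x:V\<and>finite {U:\<W>. U\<inter>V \<noteq> {}}"
  using assms(1) unfolding locally_finite_in_def by simp
 from bchoice[OF this] obtain V
  where V: "!!x. x:K==>open (V x)" "!!x. x:K==>x:V x" "!!x. x:K==>finite {U:\<W>. U\<inter>V x \<noteq> {}}" by blast
 obtain D where D: "D\<subseteq>K" "finite D" "K\<subseteq>(\<Union>x\<in>D. V x)" by (rule compactE_image[OF assms(2), of K V]) (use V in auto)
 have "{W:\<W>. W\<inter>K \<noteq> {}}\<subseteq>(\<Union>x\<in>D. {U:\<W>. U\<inter>V x \<noteq> {}})"
 proof
  fix W assume W: "W:{W:\<W>. W\<inter>K \<noteq> {}}"
  then obtain y where y: "y:W" "y:K" by blast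
  then obtain x where "x:D" "y:V x" using D(3) by blast
  then show "W:(\<Union>x\<in>D. {U:\<W>. U\<inter>V x \<noteq> {}})" using W y by (intro UN_I[of x]) auto
 qed
 then show ?thesis by (rule finite_subset) (intro finite_UN_I D V(3) subsetD[OF D(1)])
qed

lemma paracompact_refine:
 fixes N :: "'m::topological_space=>'m set"
 assumes "paracompact_space (euclidean :: 'm topology)" "!!x. open (N x)" "!!x. x:N x"
 obtains \<V> a where "!!V. V:\<V>==>open V" "\<Union>\<V> = UNIV" "!!V. V:\<V>==>V\<subseteq>N (a V)" "locally_finite_in euclidean \<V>"
proof -
 have "(\<forall>U\<in>range N. openin euclidean U)\<and>\<Union>(range N) = topspace euclidean" using assms by auto
 from assms(1)[unfolded paracompact_space_def, THEN spec, THEN mp, OF this]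
 obtain \<V> where V: "\<forall>V\<in>\<V>. openin euclidean V" "\<Union>\<V> = topspace (euclidean :: 'm topology)" "\<forall>V\<in>\<V>. \<exists>U\<in>range N. V\<subseteq>U" "locally_finite_in euclidean \<V>"
  by (elim exE conjE) (rule that)
 have "\<forall>V. \<exists>a. V:\<V>-->V\<subseteq>N a" using V(3) by (metis imageE)
 from choice[OF this] obtain a where a: "!!V. V:\<V>-->V\<subseteq>N (a V)" by (elim exE) (rule that, erule spec)
 show thesis by (rule that[of \<V> a]) (use V a in auto)
qed

text \<open>Paracompactness is used twice, in place of a shrinking lemma. The members of the first
  refinement lie in compact supports; the second refinement is subordinate to bumps supported inside
  members of the first. By compactness only finitely many members of the second belong to a given
  member of the first, so the bumps themselves, and not only the refining sets, form a locally
  finite family.\<close>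

lemma partition_of_unity:
 fixes A :: "('m::t2_space, 'a) chart set"
 assumes A: "manifold A" and par: "paracompact_space (euclidean :: 'm topology)" and N: "!!m. open (N m)" "!!m. m:N m"
 obtains J :: "'m set set" and \<psi> :: "'m set=>'m=>real" and x C where
  "!!j. j:J==>msm A UNIV (\<psi> j)" "!!j. j:J==>closed (C j)" "!!j. j:J==>C j\<subseteq>N (x j)"
  "!!j u. j:J==>u\<notin>C j==>\<psi> j u = 0"
  "!!m. \<exists>U. open U\<and>m:U\<and>finite {j:J. \<exists>u\<in>U. \<psi> j u \<noteq> 0}"
  "!!m. (\<Sum>j | j:J\<and>\<psi> j m \<noteq> 0. \<psi> j m) = 1"
proof -
 have "\<forall>m. \<exists>\<beta> C. msm A UNIV \<beta>\<and>(\<beta> m :: real) > 0\<and>compact C\<and>C\<subseteq>N m\<and>(\<forall>u. u\<notin>C-->\<beta> u = 0)"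
  using bump[OF A N] by metis
 then obtain \<beta> D where b: "!!m. msm A UNIV (\<beta> m)" "!!m. (\<beta> m m :: real) > 0" "!!m. compact (D m)" "!!m. D m\<subseteq>N m"
  "!!m u. u\<notin>D m==>\<beta> m u = 0" by metis
 have opn: "open {u. f u > (0::real)}" if "msm A UNIV f" for f
 proof -
  have "continuous_on UNIV f" using that msm_iff[OF A open_UNIV] smooth_map_continuous by blast
  then show ?thesis by (simp add: open_Collect_less)
 qed
 obtain \<V> a where V: "!!V. V:\<V>==>open V" "\<Union>\<V> = UNIV" "!!V. V:\<V>==>V\<subseteq>{u. \<beta> (a V) u > 0}" "locally_finite_in euclidean \<V>"
  by (rule paracompact_refine[OF par, of "%m. {u. \<beta> m u > 0}"]) (use b opn in auto)
 have VD: "V\<subseteq>D (a V)" if "V:\<V>" for V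
 proof
  fix u assume "u:V"
  then have "\<beta> (a V) u \<noteq> 0" using V(3)[OF that] by force
  then show "u:D (a V)" using b(5) by blast
 qed
 have "\<forall>m. \<exists>W. W:\<V>\<and>m:W"
 proof
  fix m
  have "m:\<Union>\<V>" unfolding V(2) by (rule UNIV_I)
  then show "\<exists>W. W:\<V>\<and>m:W" unfolding Union_iff Bex_def .
 qed
 then obtain v where v: "!!m. v m:\<V>" "!!m. m:v m" by metis
 have "\<forall>m. \<exists>\<beta> C. msm A UNIV \<beta>\<and>(\<beta> m :: real) > 0\<and>(\<forall>u. \<beta> u \<ge> 0)\<and>compact C\<and>C\<subseteq>v m\<and>(\<forall>u. u\<notin>C-->\<beta> u = 0)"
  using bump[OF A V(1)[OF v(1)] v(2)] by metis
 then obtain g D' where g: "!!m. msm A UNIV (g m)" "!!m. (g m m :: real) > 0" "!!m u. g m u \<ge> 0" "!!m. compact (D' m)" "!!m. D' m\<subseteq>v m"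
  "!!m u. u\<notin>D' m==>g m u = 0" by metis
 obtain \<W> y where W: "!!W. W:\<W>==>open W" "\<Union>\<W> = UNIV" "!!W. W:\<W>==>W\<subseteq>{u. g (y W) u > 0}" "locally_finite_in euclidean \<W>"
  by (rule paracompact_refine[OF par, of "%m. {u. g m u > 0}"]) (use g opn in auto)
 have fin1: "finite {W:\<W>. v (y W) = V}" if "V:\<V>" for V
 proof -
  \<comment> \<open>The empty set meets no compact set and is therefore listed separately.\<close>
  have "{W:\<W>. v (y W) = V}\<subseteq>insert {} {W:\<W>. W\<inter>D (a V) \<noteq> {}}"
  proof
   fix W assume "W:{W:\<W>. v (y W) = V}"
   then have *: "W:\<W>" "v (y W) = V" by auto
   have "W\<subseteq>V" using W(3)[OF *(1)] g(5,6) * by force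
   then show "W:insert {} {W:\<W>. W\<inter>D (a V) \<noteq> {}}" using VD[OF that] * by auto
  qed
  then show ?thesis using locally_finite_compact[OF W(4) b(3)] finite_subset by blast
 qed
 let ?g = "%W. g (y W)"
 have lf: "\<exists>U. open U\<and>m:U\<and>finite {W:\<W>. \<exists>u\<in>U. ?g W u \<noteq> 0}" for m
 proof -
  obtain U where U: "open U" "m:U" "finite {V:\<V>. V\<inter>U \<noteq> {}}" using V(4) unfolding locally_finite_in_def by auto
  have "{W:\<W>. \<exists>u\<in>U. ?g W u \<noteq> 0}\<subseteq>(\<Union>V\<in>{V:\<V>. V\<inter>U \<noteq> {}}. {W:\<W>. v (y W) = V})"
  proof
   fix W assume "W:{W:\<W>. \<exists>u\<in>U. ?g W u \<noteq> 0}"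
   then obtain u where u: "W:\<W>" "u:U" "?g W u \<noteq> 0" by blast
   have "u:v (y W)" using u(3) g(6) by (intro subsetD[OF g(5)]) metis
   then show "W:(\<Union>V\<in>{V:\<V>. V\<inter>U \<noteq> {}}. {W:\<W>. v (y W) = V})" using u v(1) by (intro UN_I[of "v (y W)"]) auto
  qed
  then have "finite {W:\<W>. \<exists>u\<in>U. ?g W u \<noteq> 0}" using U(3) fin1 by (rule finite_subset[OF _ finite_UN_I]) auto
  then show ?thesis using U by blast
 qed
 have finm: "finite {W. W:\<W>\<and>?g W m \<noteq> 0}" for m
 proof -
  obtain U where "m:U" "finite {W:\<W>. \<exists>u\<in>U. ?g W u \<noteq> 0}" using lf by blast
  then show ?thesis by (auto intro: finite_subset[rotated])
 qed
 \<comment> \<open>The index set may be infinite, where \<open>sum\<close> is 0 by convention; so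
   only the terms that are nonzero at m are summed.\<close>
 define S where "S m = (\<Sum>W | W:\<W>\<and>?g W m \<noteq> 0. ?g W m)" for m
 have Spos: "S m > 0" for m
 proof -
  have "m:\<Union>\<W>" unfolding W(2) by (rule UNIV_I)
  then obtain W where w: "W:\<W>" "m:W" by (rule UnionE)
  then have "?g W m > 0" using W(3)[OF w(1)] by blast
  then show ?thesis unfolding S_def using w by (intro sum_pos2[OF finm, of W]) (auto simp: g(3))
 qed
 have Ssm: "msm A UNIV S"
 proof (rule msm_local[OF A _ open_UNIV])
  fix m
  obtain U where U: "open U" "m:U" "finite {W:\<W>. \<exists>u\<in>U. ?g W u \<noteq> 0}" using lf by blast
  have "msm A U (%u. \<Sum>W | W:\<W>\<and>(\<exists>u\<in>U. ?g W u \<noteq> 0). ?g W u)"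
   by (rule msm_sum[OF A U(1)]) (rule msm_subset[OF g(1)], simp)
  then have "msm A U S"
  proof (rule msm_cong[OF A _ U(1)])
   fix u assume u: "u:U"
   show "(\<Sum>W | W:\<W>\<and>(\<exists>u\<in>U. ?g W u \<noteq> 0). ?g W u) = S u"
    unfolding S_def by (rule sum.mono_neutral_right[OF U(3)]) (use u in auto)
  qed
  then show "\<exists>V. open V\<and>m:V\<and>msm A V S" using U by blast
 qed
 have Sinv: "msm A UNIV (%m. inverse (S m))" by (rule msm_outer[OF A open_UNIV Ssm smooth_on_inverse]) (auto simp: Spos)
 let ?\<psi> = "%W m. inverse (S m)*\<^sub>R?g W m"
 have nz: "?\<psi> W m \<noteq> 0\<longleftrightarrow>?g W m \<noteq> 0" for W m using Spos[of m] by simp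
 show thesis
 proof (rule that[of \<W> ?\<psi> "%W. D' (y W)" "%W. a (v (y W))"])
  fix j assume "j:\<W>"
  show "msm A UNIV (?\<psi> j)" by (rule msm_scaleR[OF A open_UNIV Sinv g(1)])
  show "closed (D' (y j))" using g(4) by (rule compact_imp_closed)
  show "D' (y j)\<subseteq>N (a (v (y j)))" using g(5) VD[OF v(1)] b(4) by blast
  show "?\<psi> j u = 0" if "u\<notin>D' (y j)" for u using g(6)[OF that] by simp
 next
  fix m
  show "\<exists>U. open U\<and>m:U\<and>finite {j:\<W>. \<exists>u\<in>U. ?\<psi> j u \<noteq> 0}" using lf nz by simp
  have "(\<Sum>j | j:\<W>\<and>?\<psi> j m \<noteq> 0. ?\<psi> j m) = inverse (S m) * S m"
   unfolding nz unfolding S_def by (simp add: sum_distrib_left)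
  then show "(\<Sum>j | j:\<W>\<and>?\<psi> j m \<noteq> 0. ?\<psi> j m) = 1" using Spos[of m] by simp
 qed
qed

end

section \<open>Alternating cochains of low degree\<close>

definition cochain2 :: "'g set=>('g=>'g=>'v::real_vector)=>'g list=>'v" where
 "cochain2 G W xs = (if xs:tuples 2 G then W (xs ! 0) (xs ! 1) else 0)"

definition cochain3 :: "'g set=>('g=>'g=>'g=>'v::real_vector)=>'g list=>'v" where
 "cochain3 G T xs = (if xs:tuples 3 G then T (xs ! 0) (xs ! 1) (xs ! 2) else 0)"

lemma tuples2_iff: "xs:tuples 2 G\<longleftrightarrow>(\<exists>x\<in>G. \<exists>y\<in>G. xs = [x, y])"
 by (auto simp: tuples_def numeral_2_eq_2 length_Suc_conv)

lemma tuples3_iff: "xs:tuples 3 G\<longleftrightarrow>(\<exists>x\<in>G. \<exists>y\<in>G. \<exists>z\<in>G. xs = [x, y, z])"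
 by (auto simp: tuples_def numeral_3_eq_3 length_Suc_conv)

lemma tuples4_iff: "xs:tuples 4 G\<longleftrightarrow>(\<exists>x\<in>G. \<exists>y\<in>G. \<exists>z\<in>G. \<exists>t\<in>G. xs = [x, y, z, t])"
 by (auto simp: tuples_def eval_nat_numeral length_Suc_conv)

lemma cochain2_at [simp]: "x:G==>y:G==>cochain2 G W [x, y] = W x y" and cochain3_at [simp]: "x:G==>y:G==>z:G==>cochain3 G T [x, y, z] = T x y z"
 by (simp_all add: cochain2_def cochain3_def tuples_def)

lemma alt_maps_2:
 assumes "w:alt_maps 2 G V" "x:G" "y:G" shows alt_maps_2_in: "w [x, y]:V" and alt_maps_2_self: "w [x, x] = 0"
  and alt_maps_2_left: "z:G==>w [a*\<^sub>Rx + b*\<^sub>Ry, z] = a*\<^sub>Rw [x, z] + b*\<^sub>Rw [y, z]"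
  and alt_maps_2_right: "z:G==>w [z, a*\<^sub>Rx + b*\<^sub>Ry] = a*\<^sub>Rw [z, x] + b*\<^sub>Rw [z, y]"
proof -
 have w: "!!xs. xs:tuples 2 G==>w xs:V"
  "!!xs i x y a b. xs:tuples 2 G==>i < 2==>x:G==>y:G ==>
   w (xs[i := a*\<^sub>Rx + b*\<^sub>Ry]) = a*\<^sub>Rw (xs[i := x]) + b*\<^sub>Rw (xs[i := y])"
  "!!xs i j. xs:tuples 2 G==>i < 2==>j < 2==>i \<noteq> j==>xs ! i = xs ! j==>w xs = 0" using assms(1) unfolding alt_maps_def by blast+
 have t: "[u, v]:tuples 2 G" if "u:G" "v:G" for u v using that by (simp add: tuples_def)
 show "w [x, y]:V" using w(1) t assms by blast
 show "w [x, x] = 0" using w(3)[OF t[OF assms(2,2)], of 0 1] by simp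
 show "w [a*\<^sub>Rx + b*\<^sub>Ry, z] = a*\<^sub>Rw [x, z] + b*\<^sub>Rw [y, z]" if "z:G"
  using w(2)[OF t[OF that that], of 0 x y a b] assms by simp
 show "w [z, a*\<^sub>Rx + b*\<^sub>Ry] = a*\<^sub>Rw [z, x] + b*\<^sub>Rw [z, y]" if "z:G"
  using w(2)[OF t[OF that that], of 1 x y a b] assms by simp
qed

lemma neg_self_zero: "x = - x==>x = 0" for x :: "'v::real_vector" by (simp add: eq_neg_iff_add_eq_0 flip: scaleR_2)

lemma alt_maps_2_skew:
 assumes w: "w:alt_maps 2 G V" and G: "subspace G" and xy: "x:G" "y:G" shows "w [x, y] = - w [y, x]"
proof -
 have s: "x + y:G" using G xy by (rule subspace_add)
 have "w [x + y, x + y] = w [x, x] + w [x, y] + (w [y, x] + w [y, y])"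
  using alt_maps_2_left[OF w xy s, of 1 1] alt_maps_2_right[OF w xy xy(1), of 1 1] alt_maps_2_right[OF w xy xy(2), of 1 1] by simp
 then show ?thesis using alt_maps_2_self[OF w] s xy by (simp add: eq_neg_iff_add_eq_0)
qed

lemma alt_maps_2I:
 assumes "!!x y. x:G==>y:G==>W x y:V" and lin: "!!x y z a b. x:G==>y:G==>z:G==>W (a*\<^sub>Rx + b*\<^sub>Ry) z = a*\<^sub>RW x z + b*\<^sub>RW y z"
  and skew: "!!x y. x:G==>y:G==>W x y = - W y x" and G: "subspace G" shows "cochain2 G W:alt_maps 2 G V"
proof -
 have G': "a*\<^sub>Rx + b*\<^sub>Ry:G" if "x:G" "y:G" for a b x y using G that by (simp add: subspace_add subspace_scale)
 have r: "W z (a*\<^sub>Rx + b*\<^sub>Ry) = a*\<^sub>RW z x + b*\<^sub>RW z y" if "x:G" "y:G" "z:G" for x y z a b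
  using lin[OF that, of a b] skew[OF that(3) G'[OF that(1,2)]] skew[OF that(3,1)] skew[OF that(3,2)] by simp
 have z: "W x x = 0" if "x:G" for x using skew[OF that that] by (rule neg_self_zero)
 show ?thesis unfolding alt_maps_def mem_Collect_eq
 proof (intro conjI ballI allI impI)
  fix xs and x y a b and i :: nat assume "xs:tuples 2 G" and i: "i < 2" and xy: "x:G" "y:G"
  then obtain u v where u: "u:G" "v:G" "xs = [u, v]" by (auto simp: tuples2_iff)
  have "i = 0 \<or> i = 1" using i by auto
  then show "cochain2 G W (xs[i := a*\<^sub>Rx + b*\<^sub>Ry]) = a*\<^sub>Rcochain2 G W (xs[i := x]) + b*\<^sub>Rcochain2 G W (xs[i := y])"
   using u xy by (elim disjE) (simp_all add: G' lin r)
 next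
  fix xs and i j :: nat assume "xs:tuples 2 G" and i: "i < 2" "j < 2" "i \<noteq> j\<and>xs ! i = xs ! j"
  then obtain u v where u: "u:G" "v:G" "xs = [u, v]" by (auto simp: tuples2_iff)
  have "i = 0\<and>j = 1 \<or> i = 1\<and>j = 0" using i by auto
  then show "cochain2 G W xs = 0" using u i z by auto
 qed (use assms(1) in \<open>auto simp: cochain2_def tuples2_iff\<close>)
qed

text \<open>A cyclic shift and one transposition generate all permutations, so linearity in the
  first slot spreads to the others. The form suits d_S \<omega>, which is a cyclic sum.\<close>

lemma alt_maps_3I:
 assumes V: "!!x y z. x:G==>y:G==>z:G==>T x y z:V"
  and lin: "!!x y z t a b. x:G==>y:G==>z:G==>t:G==>T (a*\<^sub>Rx + b*\<^sub>Ry) z t = a*\<^sub>RT x z t + b*\<^sub>RT y z t"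
  and cyc: "!!x y z. x:G==>y:G==>z:G==>T x y z = T y z x" and skew: "!!x y z. x:G==>y:G==>z:G==>T x y z = - T y x z" and G: "subspace G"
 shows "cochain3 G T:alt_maps 3 G V"
proof -
 have G': "a*\<^sub>Rx + b*\<^sub>Ry:G" if "x:G" "y:G" for a b x y using G that by (simp add: subspace_add subspace_scale)
 have lin3: "T z t (a*\<^sub>Rx + b*\<^sub>Ry) = a*\<^sub>RT z t x + b*\<^sub>RT z t y" if "x:G" "y:G" "z:G" "t:G" for x y z t a b
  using lin[OF that, of a b] cyc[OF G'[OF that(1,2)] that(3,4)] cyc[OF that(1,3,4)] cyc[OF that(2,3,4)] by simp
 have lin2: "T z (a*\<^sub>Rx + b*\<^sub>Ry) t = a*\<^sub>RT z x t + b*\<^sub>RT z y t" if "x:G" "y:G" "z:G" "t:G" for x y z t a b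
  using lin[OF that(1,2,4,3), of a b] cyc[OF that(3) G'[OF that(1,2)] that(4)] cyc[OF that(3,1,4)] cyc[OF that(3,2,4)] by simp
 have z: "T x x y = 0" if "x:G" "y:G" for x y using skew[OF that(1,1,2)] by (rule neg_self_zero)
 have z': "T x y x = 0" "T y x x = 0" if "x:G" "y:G" for x y
  using z[OF that] cyc[OF that(1) that(2) that(1)] cyc[OF that(2) that(1) that(1)] by simp_all
 show ?thesis unfolding alt_maps_def mem_Collect_eq
 proof (intro conjI ballI allI impI)
  fix xs and x y a b and i :: nat assume "xs:tuples 3 G" and i: "i < 3" and xy: "x:G" "y:G"
  then obtain u v w where u: "u:G" "v:G" "w:G" "xs = [u, v, w]" by (auto simp: tuples3_iff)
  have "i = 0 \<or> i = Suc 0 \<or> i = Suc (Suc 0)" using i by auto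
  then show "cochain3 G T (xs[i := a*\<^sub>Rx + b*\<^sub>Ry]) = a*\<^sub>Rcochain3 G T (xs[i := x]) + b*\<^sub>Rcochain3 G T (xs[i := y])"
   using u xy by (elim disjE) (simp_all only: u list_update.simps nat.case cochain3_at G'[OF xy] lin lin2 lin3 xy)
 next
  fix xs and i j :: nat assume "xs:tuples 3 G" and i: "i < 3" "j < 3" "i \<noteq> j\<and>xs ! i = xs ! j"
  then obtain u v w where u: "u:G" "v:G" "w:G" "xs = [u, v, w]" by (auto simp: tuples3_iff)
  have "(i = 0 \<or> i = 1 \<or> i = 2)\<and>(j = 0 \<or> j = 1 \<or> j = 2)" using i by auto
  then have "u = v \<or> v = w \<or> u = w" using u(4) i(3) by auto
  then show "cochain3 G T xs = 0" using u z z' by auto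
 qed (use V in \<open>auto simp: cochain3_def tuples3_iff\<close>)
qed

lemma ce_d_2:
 assumes "x:G" "y:G" "z:G" shows "ce_d 2 G br act w [x, y, z] = act x (w [y, z]) - act y (w [x, z]) + act z (w [x, y])
   - w [br x y, z] + w [br x z, y] - w [br y z, x]" using assms by (simp add: ce_d_def tuples_def del_def numeral_2_eq_2 atMost_Suc lessThan_Suc)

lemma ce_d_3:
 assumes "x:G" "y:G" "z:G" "t:G"
 shows "ce_d 3 G br act w [x, y, z, t] = act x (w [y, z, t]) - act y (w [x, z, t]) + act z (w [x, y, t]) - act t (w [x, y, z])
   - w [br x y, z, t] + w [br x z, y, t] - w [br x t, y, z] - w [br y z, x, t] + w [br y t, x, z] - w [br z t, x, y]"
 using assms by (simp add: ce_d_def tuples_def del_def eval_nat_numeral atMost_Suc lessThan_Suc)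

lemma del_tuples: "xs:tuples (Suc r) G==>i \<le> r==>del i xs:tuples r G" by (auto simp: tuples_def del_def dest: in_set_takeD in_set_dropD)

lemma ce_d_linear:
 assumes w: "!!xs. xs:tuples r G==>w xs:V" "!!xs. xs:tuples r G==>w' xs:V"
  and act: "!!X u v. X:G==>u:V==>v:V==>act X (a*\<^sub>Ru + b*\<^sub>Rv) = a*\<^sub>Ract X u + b*\<^sub>Ract X v"
 shows "ce_d r G br act (a*\<^sub>Rw + b*\<^sub>Rw') = a*\<^sub>Rce_d r G br act w + b*\<^sub>Rce_d r G br act w'"
proof
 fix xs
 show "ce_d r G br act (a*\<^sub>Rw + b*\<^sub>Rw') xs = (a*\<^sub>Rce_d r G br act w + b*\<^sub>Rce_d r G br act w') xs"
 proof (cases "xs:tuples (Suc r) G")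
  case True
  have act': "act (xs ! i) (a*\<^sub>Rw (del i xs) + b*\<^sub>Rw' (del i xs)) = a*\<^sub>Ract (xs ! i) (w (del i xs)) + b*\<^sub>Ract (xs ! i) (w' (del i xs))"
   if "i \<le> r" for i using True that by (intro act w del_tuples) (auto simp: tuples_def)
  have "(\<Sum>i\<le>r. (-1) ^ i*\<^sub>Ract (xs ! i) ((a*\<^sub>Rw + b*\<^sub>Rw') (del i xs))) =
   a*\<^sub>R(\<Sum>i\<le>r. (-1) ^ i*\<^sub>Ract (xs ! i) (w (del i xs))) + b*\<^sub>R(\<Sum>i\<le>r. (-1) ^ i*\<^sub>Ract (xs ! i) (w' (del i xs)))"
   by (simp add: act' scaleR_fun_def scaleR_sum_right scaleR_add_right sum.distrib mult.commute)
  then show ?thesis using True by (simp add: ce_d_def scaleR_fun_def scaleR_sum_right scaleR_add_right sum.distrib mult.commute)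
 qed (simp add: ce_d_def scaleR_fun_def)
qed

text \<open>Square zero by expansion, in the degree where it is applied: d_S \<omega>, pulled back,
  will be the differential of a 2-cochain.\<close>

lemma ce_d_ce_d:
 assumes G: "subspace G" and br: "!!x y. x:G==>y:G==>br x y:G" "!!x y. x:G==>y:G==>br x y = - br y x"
  and jac: "!!x y z. x:G==>y:G==>z:G==>br (br x y) z = br (br x z) y - br (br y z) x"
  and act: "!!x u v. x:G==>u:V==>v:V==>act x (u + v) = act x u + act x v"
   "!!x u. x:G==>u:V==>act x u:V"
   "!!x y u. x:G==>y:G==>u:V==>act (br x y) u = act x (act y u) - act y (act x u)"
  and V: "subspace V" and w: "w:alt_maps 2 G V" and xs: "x:G" "y:G" "z:G" "t:G" shows "ce_d 3 G br act (ce_d 2 G br act w) [x, y, z, t] = 0"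
proof -
 note [simp] = br(1) xs act(2) subspace_add[OF V] subspace_diff[OF V] subspace_neg[OF V] alt_maps_2_in[OF w]
 have act0: "act x 0 = 0" if "x:G" for x using act(1)[OF that subspace_0[OF V] subspace_0[OF V]] by simp
 have actm: "act x (- u) = - act x u" if "x:G" "u:V" for x u
  using act(1)[OF that subspace_neg[OF V that(2)]] act0[OF that(1)] by (simp add: eq_neg_iff_add_eq_0 add.commute)
 have actd: "act x (u - v) = act x u - act x v" if "x:G" "u:V" "v:V" for x u v
  using act(1)[OF that(1,2) subspace_neg[OF V that(3)]] actm[OF that(1,3)] by simp
 have sk: "w [a, b] = - w [b, a]" if "a:G" "b:G" for a b using alt_maps_2_skew[OF w G that] .
 have add: "w [a + b, c] = w [a, c] + w [b, c]" if "a:G" "b:G" "c:G" for a b c using alt_maps_2_left[OF w that, of 1 1] by simp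
 have neg: "w [- a, c] = - w [a, c]" if "a:G" "c:G" for a c using alt_maps_2_left[OF w that(1,1,2), of "-1" 0] by simp
 have sub: "w [a - b, c] = w [a, c] - w [b, c]" if "a:G" "b:G" "c:G" for a b c using alt_maps_2_left[OF w that, of 1 "-1"] by simp
 \<comment> \<open>Jacobi in the shape of a rewrite rule for nested brackets, instantiated below for
   the four triples of arguments.\<close>
 have wj: "w [br (br a b) c, d] = w [br (br a c) b, d] - w [br (br b c) a, d]" if "a:G" "b:G" "c:G" "d:G" for a b c d
  using jac[OF that(1-3)] sub that by simp
 have s1: "w [br z t, br x y] = - w [br x y, br z t]" "w [br y t, br x z] = - w [br x z, br y t]"
  "w [br y z, br x t] = - w [br x t, br y z]" by (rule sk; simp)+
 show ?thesis by (subst ce_d_3[OF xs])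
   (simp add: ce_d_2 act actd actm wj[of x y z t] wj[of x y t z] wj[of x z t y] wj[of y z t x] s1)
qed

section \<open>Crossed modules\<close>

text \<open>The algebra of a crossed module, without topology. Membership hypotheses appear because
  the Lie algebras are subspaces of ambient vector spaces, outside of which the operations need not
  satisfy the laws.\<close>

locale xm =
 fixes C :: "('gh::real_vector, 'nh::real_vector, 'g::real_vector, 'z::real_vector) xmod"
 assumes sub: "subspace (topspace (gh_top C))" "subspace (topspace (nh_top C))" "subspace (topspace (g_top C))" "subspace (topspace (z_top C))"
  and br_in: "x:topspace (gh_top C)==>y:topspace (gh_top C)==>gh_br C x y:topspace (gh_top C)"
  and br_add: "x:topspace (gh_top C)==>y:topspace (gh_top C)==>x':topspace (gh_top C) ==>
   gh_br C x (y + x') = gh_br C x y + gh_br C x x'"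
  and br_scale: "x:topspace (gh_top C)==>y:topspace (gh_top C)==>gh_br C (a*\<^sub>Rx) y = a*\<^sub>Rgh_br C x y"
  and br_skew: "gh_br C x y = - gh_br C y x" and br_jac: "x:topspace (gh_top C)==>y:topspace (gh_top C)==>x':topspace (gh_top C) ==>
   gh_br C x (gh_br C y x') + gh_br C y (gh_br C x' x) + gh_br C x' (gh_br C x y) = 0"
  and act_in: "x:topspace (gh_top C)==>n:topspace (nh_top C)==>gh_act C x n:topspace (nh_top C)"
  and act_lin: "x:topspace (gh_top C)==>n:topspace (nh_top C)==>n':topspace (nh_top C) ==>
   gh_act C x (a*\<^sub>Rn + b*\<^sub>Rn') = a*\<^sub>Rgh_act C x n + b*\<^sub>Rgh_act C x n'"
  and act_lin_left: "x:topspace (gh_top C)==>y:topspace (gh_top C)==>n:topspace (nh_top C) ==>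
   gh_act C (a*\<^sub>Rx + b*\<^sub>Ry) n = a*\<^sub>Rgh_act C x n + b*\<^sub>Rgh_act C y n"
  and act_br: "x:topspace (gh_top C)==>y:topspace (gh_top C)==>n:topspace (nh_top C) ==>
   gh_act C (gh_br C x y) n = gh_act C x (gh_act C y n) - gh_act C y (gh_act C x n)"
  and al_in: "n:topspace (nh_top C)==>alpha C n:topspace (gh_top C)"
  and al_lin: "alpha C (a*\<^sub>Rn + b*\<^sub>Rn') = a*\<^sub>Ralpha C n + b*\<^sub>Ralpha C n'"
  and al_act: "x:topspace (gh_top C)==>n:topspace (nh_top C)==>alpha C (gh_act C x n) = gh_br C x (alpha C n)"
  and act_al: "n:topspace (nh_top C)==>n':topspace (nh_top C)==>gh_act C (alpha C n) n' = nh_br C n n'"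
  and nbr_skew: "nh_br C n n' = - nh_br C n' n" and q_in: "x:topspace (gh_top C)==>qt C x:topspace (g_top C)"
  and q_lin: "x:topspace (gh_top C)==>y:topspace (gh_top C)==>qt C (a*\<^sub>Rx + b*\<^sub>Ry) = a*\<^sub>Rqt C x + b*\<^sub>Rqt C y"
  and q_br: "x:topspace (gh_top C)==>y:topspace (gh_top C)==>qt C (gh_br C x y) = g_br C (qt C x) (qt C y)"
  and q_al: "n:topspace (nh_top C)==>qt C (alpha C n) = 0" and inc_in: "z:topspace (z_top C)==>inc C z:topspace (nh_top C)"
  and inc_lin: "inc C (a*\<^sub>Rz + b*\<^sub>Rz') = a*\<^sub>Rinc C z + b*\<^sub>Rinc C z'" and inc_inj: "inc C z = inc C z'==>z = z'"
  and al_inc: "alpha C (inc C z) = 0" and al_ker: "n:topspace (nh_top C)==>alpha C n = 0==>n:inc C ` topspace (z_top C)"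
  and act_inc: "x:topspace (gh_top C)==>z:topspace (z_top C)==>gh_act C x (inc C z) = inc C (g_act C (qt C x) z)"
begin

abbreviation "Gh \<equiv> topspace (gh_top C)"
abbreviation "Nh \<equiv> topspace (nh_top C)"
abbreviation "Gq \<equiv> topspace (g_top C)"
abbreviation "Zz \<equiv> topspace (z_top C)"
abbreviation "br \<equiv> gh_br C"
abbreviation "act \<equiv> gh_act C"
abbreviation "nb \<equiv> nh_br C"
abbreviation "ac \<equiv> alpha C"
abbreviation "ic \<equiv> inc C"
abbreviation "ga \<equiv> g_act C"

lemmas [simp] = br_in act_in al_in q_in inc_in
lemmas Gh_sub [simp] = subspace_add[OF sub(1)] subspace_diff[OF sub(1)] subspace_neg[OF sub(1)] subspace_scale[OF sub(1)] subspace_0[OF sub(1)]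
lemmas Nh_sub [simp] = subspace_add[OF sub(2)] subspace_diff[OF sub(2)] subspace_neg[OF sub(2)] subspace_scale[OF sub(2)] subspace_0[OF sub(2)]
lemmas Gq_sub [simp] = subspace_add[OF sub(3)] subspace_diff[OF sub(3)] subspace_neg[OF sub(3)] subspace_scale[OF sub(3)] subspace_0[OF sub(3)]
lemmas Zz_sub [simp] = subspace_add[OF sub(4)] subspace_diff[OF sub(4)] subspace_neg[OF sub(4)] subspace_scale[OF sub(4)] subspace_0[OF sub(4)]

lemma al_simps: "ac (u + v) = ac u + ac v" "ac (u - v) = ac u - ac v" "ac (- u) = - ac u" "ac 0 = 0" "ac (a*\<^sub>Ru) = a*\<^sub>Rac u"
 using al_lin[of 1 u 1 v] al_lin[of 1 u "-1" v] al_lin[of "-1" u 0 v] al_lin[of 0 u 0 v] al_lin[of a u 0 v] by simp_all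

lemma inc_simps: "ic (u + v) = ic u + ic v" "ic (u - v) = ic u - ic v" "ic (- u) = - ic u" "ic 0 = 0" "ic (a*\<^sub>Ru) = a*\<^sub>Ric u"
 using inc_lin[of 1 u 1 v] inc_lin[of 1 u "-1" v] inc_lin[of "-1" u 0 v] inc_lin[of 0 u 0 v] inc_lin[of a u 0 v] by simp_all

lemma act_simps:
 assumes "x:Gh" "u:Nh" shows "v:Nh==>act x (u + v) = act x u + act x v" "v:Nh==>act x (u - v) = act x u - act x v"
  "act x (- u) = - act x u" "act x (a*\<^sub>Ru) = a*\<^sub>Ract x u"
 using act_lin[OF assms, of v 1 1] act_lin[OF assms, of v 1 "-1"] act_lin[OF assms assms(2), of "-1" 0] act_lin[OF assms assms(2), of a 0]
 by simp_all

lemma act_zero: "x:Gh==>act x 0 = 0" using act_lin[of x 0 0 0 0] by simp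

lemma act_left_simps:
 assumes "x:Gh" "u:Nh" shows "y:Gh==>act (x + y) u = act x u + act y u" "y:Gh==>act (x - y) u = act x u - act y u"
  "act (- x) u = - act x u" "act (a*\<^sub>Rx) u = a*\<^sub>Ract x u"
 using act_lin_left[of x y u 1 1] act_lin_left[of x y u 1 "-1"] act_lin_left[of x x u "-1" 0] act_lin_left[of x x u a 0] assms by simp_all

lemma act_zero_left: "u:Nh==>act 0 u = 0" using act_lin_left[of 0 0 u 0 0] by simp

lemma q_simps:
 assumes "x:Gh"
 shows "y:Gh==>qt C (x + y) = qt C x + qt C y" "y:Gh==>qt C (x - y) = qt C x - qt C y" "qt C (- x) = - qt C x" "qt C (a*\<^sub>Rx) = a*\<^sub>Rqt C x"
 using q_lin[of x y 1 1] q_lin[of x y 1 "-1"] q_lin[of x x "-1" 0] q_lin[of x x a 0] assms by simp_all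

lemma q_zero: "qt C 0 = 0" using q_lin[of 0 0 0 0] by simp

lemma br_simps:
 assumes "x:Gh" "y:Gh" shows "w:Gh==>br x (y + w) = br x y + br x w" "w:Gh==>br x (y - w) = br x y - br x w"
  "br x (- y) = - br x y" "br x (a*\<^sub>Ry) = a*\<^sub>Rbr x y"
  "w:Gh==>br (x + y) w = br x w + br y w" "w:Gh==>br (x - y) w = br x w - br y w" "br (- x) y = - br x y" "br (a*\<^sub>Rx) y = a*\<^sub>Rbr x y"
proof -
 have n: "br x (- y) = - br x y" if "x:Gh" "y:Gh" for x y using br_scale[OF that(2,1), of "-1"] br_skew[of x y] br_skew[of x "- y"] by simp
 show "br x (y + w) = br x y + br x w" if "w:Gh" by (rule br_add[OF assms that])
 show "br x (y - w) = br x y - br x w" if "w:Gh" using that br_add[of x y "- w"] n assms by simp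
 show "br x (- y) = - br x y" using n assms by simp
 show "br x (a*\<^sub>Ry) = a*\<^sub>Rbr x y" using br_scale[of y x a] br_skew[of x y] br_skew[of x "a*\<^sub>Ry"] assms by simp
 show "br (x + y) w = br x w + br y w" if "w:Gh" using that br_add[of w x y] br_skew[of w x] br_skew[of w y] br_skew[of "x + y" w] assms by simp
 show "br (x - y) w = br x w - br y w" if "w:Gh"
  using that br_add[of w x "- y"] n[of w y] br_skew[of w x] br_skew[of w y] br_skew[of "x - y" w] assms by simp
 show "br (- x) y = - br x y" "br (a*\<^sub>Rx) y = a*\<^sub>Rbr x y" using br_scale[of x y] br_scale[of x y "-1"] assms by simp_all
qed

lemma br_jac': "x:Gh==>y:Gh==>w:Gh==>br (br x y) w = br (br x w) y - br (br y w) x"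
 using br_jac[of x y w] br_skew[of x "br y w"] br_skew[of y "br w x"] br_skew[of w "br x y"] br_skew[of w x] br_simps(7)[of "br x w" y]
 by (simp add: algebra_simps)

lemma nbr_in [simp]: "u:Nh==>v:Nh==>nb u v:Nh" using act_al[of u v] act_in[of "ac u" v] by simp

text \<open>By the Peiffer identity \<open>act_al\<close> the bracket with u is the action of
  \<alpha>(u), so linearity is inherited from the action. The derivation property and Jacobi below
  arise in the same way.\<close>

lemma nbr_simps:
 assumes "u:Nh" "v:Nh" shows "w:Nh==>nb u (v + w) = nb u v + nb u w" "w:Nh==>nb u (v - w) = nb u v - nb u w" "nb u (- v) = - nb u v"
  "w:Nh==>nb (u + v) w = nb u w + nb v w" "w:Nh==>nb (u - v) w = nb u w - nb v w" "nb (- u) v = - nb u v"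
  "nb (a*\<^sub>Ru) v = a*\<^sub>Rnb u v" "nb u (a*\<^sub>Rv) = a*\<^sub>Rnb u v"
 using assms by (simp_all add: act_al[symmetric] act_simps act_left_simps al_simps)

lemma nbr_zero: "u:Nh==>ac u = 0==>v:Nh==>nb u v = 0" "u:Nh==>v:Nh==>ac v = 0==>nb u v = 0"
 using act_al[of u v] act_al[of v u] nbr_skew[of u v] act_zero_left by simp_all

lemma act_nbr:
 assumes "x:Gh" "u:Nh" "v:Nh" shows "act x (nb u v) = nb (act x u) v + nb u (act x v)"
 using assms act_br[of x "ac u" v] by (simp add: act_al[symmetric] al_act)

lemma nbr_jac:
 assumes "u:Nh" "v:Nh" "w:Nh" shows "nb (nb u v) w = nb u (nb v w) - nb v (nb u w)"
 using assms act_nbr[of "ac u" v w] by (simp add: act_al algebra_simps)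

lemma al_nbr: "u:Nh==>v:Nh==>ac (nb u v) = br (ac u) (ac v)" by (simp add: act_al[symmetric] al_act)

text \<open>A change of the lift \<open>\<sigma>\<close> by \<open>a\<close> changes \<open>\<omega>\<close> by \<open>d\<^sub>S a + 1/2 [a, a]\<close> and a central cochain, and
  only the latter contributes to the covariant differential.\<close>

lemma transgression:
 fixes L :: "'l::ab_group_add set"
 assumes L: "!!x y. x:L==>y:L==>bl x y:L" "!!x y. x:L==>y:L==>x - y:L"
  and jac: "!!x y z. x:L==>y:L==>z:L==>bl (bl x y) z = bl (bl x z) y - bl (bl y z) x"
  and skew: "!!x y z. x:L==>y:L==>z:L==>bl (bl x y) z = - bl (bl y x) z" and \<sigma>: "!!x. x:L==>\<sigma> x:Gh" "!!x. x:L==>\<sigma>' x:Gh"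
  and w: "!!x y. x:L==>y:L==>w x y:Nh" "!!x y. x:L==>y:L==>ac (w x y) = br (\<sigma> x) (\<sigma> y) - \<sigma> (bl x y)"
  and w': "!!x y. x:L==>y:L==>w' x y:Nh" "!!x y. x:L==>y:L==>ac (w' x y) = br (\<sigma>' x) (\<sigma>' y) - \<sigma>' (bl x y)"
  and a: "!!x. x:L==>a x:Nh" "!!x. x:L==>ac (a x) = \<sigma>' x - \<sigma> x"
   "!!x y. x:L==>y:L==>a (x - y) = a x - a y"
  and b: "!!x y. b x y = w' x y - w x y - (act (\<sigma> x) (a y) - act (\<sigma> y) (a x) - a (bl x y) + nb (a x) (a y))"
  and xyz: "x:L" "y:L" "z:L" shows transgression_al: "ac (b x y) = 0"
  and transgression_d: "act (\<sigma>' x) (w' y z) - w' (bl x y) z + (act (\<sigma>' y) (w' z x) - w' (bl y z) x) + (act (\<sigma>' z) (w' x y) - w' (bl z x) y)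
   = act (\<sigma> x) (w y z) - w (bl x y) z + (act (\<sigma> y) (w z x) - w (bl y z) x) + (act (\<sigma> z) (w x y) - w (bl z x) y)
   + (act (\<sigma> x) (b y z) - b (bl x y) z + (act (\<sigma> y) (b z x) - b (bl y z) x) + (act (\<sigma> z) (b x y) - b (bl z x) y))"
proof -
 note [simp] = L(1) \<sigma> w(1) w'(1) a(1)
 have bN [simp]: "b x y:Nh" if "x:L" "y:L" for x y using that by (simp add: b)
 have bz: "ac (b x y) = 0" if "x:L" "y:L" for x y using that br_skew[of "\<sigma> y" "\<sigma>' x"] br_skew[of "\<sigma> y" "\<sigma> x"]
  by (simp add: b al_simps w w' a al_act al_nbr br_simps)
 then show "ac (b x y) = 0" using xyz by simp
 have act': "act (\<sigma>' x) u = act (\<sigma> x) u + nb (a x) u" if "x:L" "u:Nh" for x u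
  using that act_left_simps(1)[of "\<sigma> x" u "ac (a x)"] by (simp add: a act_al[symmetric])
 define D where "D x y = act (\<sigma> x) (a y) - act (\<sigma> y) (a x) - a (bl x y)" for x y
 have DN [simp]: "D x y:Nh" if "x:L" "y:L" for x y using that by (simp add: D_def)
 have w'_eq: "w' x y = w x y + D x y + nb (a x) (a y) + b x y" for x y by (simp add: b D_def)
 \<comment> \<open>The curvature of the outer action S is the bracket with \<omega>.\<close>
 have flat: "act (\<sigma> (bl x y)) u = act (\<sigma> x) (act (\<sigma> y) u) - act (\<sigma> y) (act (\<sigma> x) u) - nb (w x y) u" if "x:L" "y:L" "u:Nh" for x y u
  using that act_br[of "\<sigma> x" "\<sigma> y" u] act_left_simps(2)[of "br (\<sigma> x) (\<sigma> y)" u "\<sigma> (bl x y)"]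
  by (simp add: act_al[symmetric] w)
 have a3: "a (bl (bl x y) z) = a (bl (bl x z) y) - a (bl (bl y z) x)" if "x:L" "y:L" "z:L" for x y z using jac[OF that] a(3) that by simp
 have zx: "a (bl (bl z x) y) = - a (bl (bl x z) y)"
 proof -
  have 0: "0:L" "a 0 = 0" using L(2)[OF xyz(1,1)] a(3)[OF xyz(1,1)] by simp_all
  have "a (0 - bl (bl x z) y) = a 0 - a (bl (bl x z) y)" using xyz 0 by (intro a(3)) simp_all
  then show ?thesis using skew[OF xyz(3,1,2)] 0 by simp
 qed
 \<comment> \<open>Applying d_S twice to a gives the bracket of \<omega> with a; the values of a on
   iterated brackets drop out by the Jacobi identity in L.\<close>
 have 1: "act (\<sigma> x) (D y z) - D (bl x y) z + (act (\<sigma> y) (D z x) - D (bl y z) x) + (act (\<sigma> z) (D x y) - D (bl z x) y)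
  = nb (w x y) (a z) + nb (w y z) (a x) + nb (w z x) (a y)" using xyz by (simp add: D_def act_simps flat a3[OF xyz] zx algebra_simps)
 \<comment> \<open>The differential of 1/2 [a, a] is cancelled by the bracket of a with d_S a, since
   S acts by derivations.\<close>
 have 2: "nb (a x) (D y z) + nb (a y) (D z x) + nb (a z) (D x y) + (act (\<sigma> x) (nb (a y) (a z)) - nb (a (bl x y)) (a z)
  + (act (\<sigma> y) (nb (a z) (a x)) - nb (a (bl y z)) (a x)) + (act (\<sigma> z) (nb (a x) (a y)) - nb (a (bl z x)) (a y))) = 0"
  using xyz nbr_skew[of "a (bl x y)" "a z"] nbr_skew[of "a (bl y z)" "a x"] nbr_skew[of "a (bl z x)" "a y"]
   nbr_skew[of "act (\<sigma> x) (a y)" "a z"] nbr_skew[of "act (\<sigma> y) (a z)" "a x"] nbr_skew[of "act (\<sigma> z) (a x)" "a y"]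
  by (simp add: D_def nbr_simps act_nbr algebra_simps)
 have 3: "nb (a x) (nb (a y) (a z)) + nb (a y) (nb (a z) (a x)) + nb (a z) (nb (a x) (a y)) = 0"
  using xyz nbr_jac[of "a x" "a y" "a z"] nbr_skew[of "a z" "nb (a x) (a y)"] nbr_skew[of "a z" "a x"] by (simp add: nbr_simps)
 \<comment> \<open>The change of S, applied to the old \<omega>, is the negative of the right-hand
   side of \<open>1\<close>.\<close>
 have 4: "nb (a x) (w y z) + nb (a y) (w z x) + nb (a z) (w x y) = - (nb (w x y) (a z) + nb (w y z) (a x) + nb (w z x) (a y))"
  using nbr_skew[of "a x" "w y z"] nbr_skew[of "a y" "w z x"] nbr_skew[of "a z" "w x y"] by simp
 have bb: "nb (a x) (b y z) = 0" if "x:L" "y:L" "z:L" for x y z using that bz by (simp add: nbr_zero)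
 have "act (\<sigma>' x) (w' y z) - w' (bl x y) z + (act (\<sigma>' y) (w' z x) - w' (bl y z) x) + (act (\<sigma>' z) (w' x y) - w' (bl z x) y)
  = act (\<sigma> x) (w y z) - w (bl x y) z + (act (\<sigma> y) (w z x) - w (bl y z) x) + (act (\<sigma> z) (w x y) - w (bl z x) y)
   + (act (\<sigma> x) (b y z) - b (bl x y) z + (act (\<sigma> y) (b z x) - b (bl y z) x) + (act (\<sigma> z) (b x y) - b (bl z x) y))
   + (act (\<sigma> x) (D y z) - D (bl x y) z + (act (\<sigma> y) (D z x) - D (bl y z) x) + (act (\<sigma> z) (D x y) - D (bl z x) y))
   + (nb (a x) (w y z) + nb (a y) (w z x) + nb (a z) (w x y))
   + (nb (a x) (D y z) + nb (a y) (D z x) + nb (a z) (D x y) + (act (\<sigma> x) (nb (a y) (a z)) - nb (a (bl x y)) (a z)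
  + (act (\<sigma> y) (nb (a z) (a x)) - nb (a (bl y z)) (a x)) + (act (\<sigma> z) (nb (a x) (a y)) - nb (a (bl z x)) (a y))))
   + (nb (a x) (nb (a y) (a z)) + nb (a y) (nb (a z) (a x)) + nb (a z) (nb (a x) (a y)))"
  using xyz by (simp add: w'_eq act' act_simps nbr_simps bb algebra_simps)
 then show "act (\<sigma>' x) (w' y z) - w' (bl x y) z + (act (\<sigma>' y) (w' z x) - w' (bl y z) x) + (act (\<sigma>' z) (w' x y) - w' (bl z x) y)
   = act (\<sigma> x) (w y z) - w (bl x y) z + (act (\<sigma> y) (w z x) - w (bl y z) x) + (act (\<sigma> z) (w x y) - w (bl z x) y)
   + (act (\<sigma> x) (b y z) - b (bl x y) z + (act (\<sigma> y) (b z x) - b (bl y z) x) + (act (\<sigma> z) (b x y) - b (bl z x) y))"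
  unfolding 1 2 3 4 by simp
qed

end

text \<open>s is a continuous linear section of \<alpha> over the kernel of \<open>qt\<close>, which
  is the image of \<alpha> by \<open>nN_iff\<close>. Continuity is stated for the explicit
  topologies of the record, as these are not the topologies of the ambient types.\<close>

locale xm_top = xm C for C :: "('gh::real_vector, 'nh::real_vector, 'g::real_vector, 'z::real_vector) xmod" +
 fixes s :: "'gh=>'nh"
 assumes s_in: "x:topspace (gh_top C)==>qt C x = 0==>s x:topspace (nh_top C)" and al_s: "x:topspace (gh_top C)==>qt C x = 0==>alpha C (s x) = x"
  and s_lin: "x:topspace (gh_top C)==>qt C x = 0==>y:topspace (gh_top C)==>qt C y = 0 ==>
   s (a*\<^sub>Rx + b*\<^sub>Ry) = a*\<^sub>Rs x + b*\<^sub>Rs y"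
  and c_gh_diff: "continuous_map (prod_topology (gh_top C) (gh_top C)) (gh_top C) (%(x, y). x - y)"
  and c_nh_add: "continuous_map (prod_topology (nh_top C) (nh_top C)) (nh_top C) (%(x, y). x + y)"
  and c_nh_diff: "continuous_map (prod_topology (nh_top C) (nh_top C)) (nh_top C) (%(x, y). x - y)"
  and c_z_add: "continuous_map (prod_topology (z_top C) (z_top C)) (z_top C) (%(x, y). x + y)"
  and c_z_diff: "continuous_map (prod_topology (z_top C) (z_top C)) (z_top C) (%(x, y). x - y)"
  and c_act: "continuous_map (prod_topology (gh_top C) (nh_top C)) (nh_top C) (%(x, u). gh_act C x u)"
  and c_al: "continuous_map (nh_top C) (gh_top C) (alpha C)" and c_q: "continuous_map (gh_top C) (g_top C) (qt C)"
  and c_inc: "continuous_map (z_top C) (nh_top C) (inc C)"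
  and c_inc_inv: "continuous_map (subtopology (nh_top C) (inc C ` topspace (z_top C))) (z_top C) (inv_into (topspace (z_top C)) (inc C))"
  and c_s: "continuous_map (subtopology (gh_top C) (alpha C ` topspace (nh_top C))) (nh_top C) s"
  and c_brg: "continuous_map (prod_topology (g_top C) (g_top C)) (g_top C) (%(x, y). g_br C x y)"
begin

abbreviation "HT \<equiv> gh_top C"
abbreviation "NT \<equiv> nh_top C"
abbreviation "QT \<equiv> g_top C"
abbreviation "ZT \<equiv> z_top C"
abbreviation "brg \<equiv> g_br C"
abbreviation "nN \<equiv> ac ` Nh"

lemmas [simp] = s_in al_s

lemma cm2:
 assumes "continuous_map (prod_topology A B) R (%(x, y). f x y)" "continuous_map T A g" "continuous_map T B h"
 shows "continuous_map T R (%t. f (g t) (h t))" using continuous_map_compose[OF continuous_map_pairedI[OF assms(2,3)] assms(1)] by (simp add: o_def)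

lemma cm1: "continuous_map A R f==>continuous_map T A g==>continuous_map T R (%t. f (g t))"
 using continuous_map_compose[of T A g R f] by (simp add: o_def)

lemmas cm_gh_diff = cm2[OF c_gh_diff] and cm_nh_add = cm2[OF c_nh_add] and cm_nh_diff = cm2[OF c_nh_diff]
 and cm_z_add = cm2[OF c_z_add] and cm_z_diff = cm2[OF c_z_diff] and cm_act = cm2[OF c_act] and cm_brg = cm2[OF c_brg]
 and cm_al = cm1[OF c_al] and cm_q = cm1[OF c_q] and cm_inc = cm1[OF c_inc]

lemma nN_iff: "x:nN\<longleftrightarrow>x:Gh\<and>qt C x = 0" using q_al al_s s_in by (metis al_in image_iff)

lemma topspace_n_top [simp]: "topspace (n_top C) = nN" using al_in by (auto simp: n_top_def)

lemma s_simps: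
 assumes "x:nN" shows "y:nN==>s (x + y) = s x + s y" "y:nN==>s (x - y) = s x - s y" "s (a*\<^sub>Rx) = a*\<^sub>Rs x"
 using s_lin[of x y 1 1] s_lin[of x y 1 "-1"] s_lin[of x x a 0] assms unfolding nN_iff by simp_all

lemma s_zero: "s 0 = 0" using s_lin[of 0 0 0 0] q_zero by simp

lemma cm_nbr:
 assumes f: "continuous_map T NT f" and g: "continuous_map T NT g" shows "continuous_map T NT (%t. nb (f t) (g t))"
proof (rule continuous_map_eq[OF cm_act[OF cm_al[OF f] g]])
 fix t assume "t:topspace T"
 then have "f t:Nh" "g t:Nh" using continuous_map_funspace[OF f] continuous_map_funspace[OF g] by blast+
 then show "act (ac (f t)) (g t) = nb (f t) (g t)" by (rule act_al)
qed

text \<open>The projection of the module onto the kernel of \<alpha> along the image of s. Its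
  continuity (\<open>cm_pz\<close>) is the source of continuity for all cochains with values in
  z.\<close>

definition pz :: "'nh=>'z" where "pz u = inv_into Zz ic (u - s (ac u))"

lemma inc_pz:
 assumes u: "u:Nh" shows "pz u:Zz" "ic (pz u) = u - s (ac u)"
proof -
 have "u - s (ac u):ic ` Zz" using u q_al[OF u] by (intro al_ker) (simp_all add: al_simps)
 then show "pz u:Zz" "ic (pz u) = u - s (ac u)" unfolding pz_def by (rule inv_into_into, rule f_inv_into_f)
qed

lemmas [simp] = inc_pz(1)

lemma pz_lin:
 assumes "u:Nh" "v:Nh" shows "pz (a*\<^sub>Ru + b*\<^sub>Rv) = a*\<^sub>Rpz u + b*\<^sub>Rpz v"
proof -
 have "ic (pz (a*\<^sub>Ru + b*\<^sub>Rv)) = ic (a*\<^sub>Rpz u + b*\<^sub>Rpz v)"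
  using assms s_lin[of "ac u" "ac v" a b] q_al[of u] q_al[of v] by (simp add: inc_pz inc_simps al_simps algebra_simps)
 then show ?thesis by (rule inc_inj)
qed

lemma pz_skew: "u:Nh==>pz (- u) = - pz u" using pz_lin[of u u "-1" 0] by simp

lemma pz_inc: "z:Zz==>pz (ic z) = z" by (rule inc_inj) (simp add: inc_pz al_inc s_zero)

lemma pz_s: "n:nN==>pz (s n) = 0" by (rule inc_inj) (simp add: nN_iff inc_pz inc_simps)

lemma cm_s:
 assumes f: "continuous_map T HT f" and "!!t. t:topspace T==>f t:nN" shows "continuous_map T NT (%t. s (f t))"
 by (rule cm1[OF c_s]) (use assms in \<open>auto simp: continuous_map_in_subtopology\<close>)

lemma cm_pz:
 assumes f: "continuous_map T NT f" shows "continuous_map T ZT (%t. pz (f t))" unfolding pz_def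
proof (rule cm1[OF c_inc_inv])
 have fN: "f t:Nh" if "t:topspace T" for t using continuous_map_funspace[OF f] that by blast
 have "continuous_map T NT (%t. f t - s (ac (f t)))" by (intro cm_nh_diff f cm_s cm_al) (use fN in blast)
 moreover have "f t - s (ac (f t)):ic ` Zz" if "t:topspace T" for t using inc_pz[OF fN[OF that]] by (metis imageI)
 ultimately show "continuous_map T (subtopology NT (ic ` Zz)) (%t. f t - s (ac (f t)))" by (auto simp: continuous_map_in_subtopology)
qed

end

lemma cochain_proj: "i < r==>continuous_map (product_topology (%_. T) {..<r}) T (%x. x i)" by (rule continuous_map_product_projection) simp

lemma cochains_2I:
 assumes w: "cochain2 (topspace TG) W:alt_maps 2 (topspace TG) (topspace TV)" and c: "continuous_map (prod_topology TG TG) TV (%(x, y). W x y)"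
 shows "cochain2 (topspace TG) W:cochains 2 TG TV" unfolding cochains_def
proof (intro CollectI conjI w)
 let ?P = "product_topology (%_. TG) {..<2::nat}"
 have "continuous_map ?P TV ((%(x, y). W x y)\<circ>(%x. (x 0, x 1)))"
  by (intro continuous_map_compose[OF _ c] continuous_map_pairedI cochain_proj) simp_all
 then show "continuous_map ?P TV (%x. cochain2 (topspace TG) W (map x [0..<2]))"
 proof (rule continuous_map_eq)
  fix x assume "x:topspace ?P"
  then have "x 0:topspace TG" "x 1:topspace TG" by (auto simp: PiE_iff)
  then show "((%(x, y). W x y)\<circ>(%x. (x 0, x 1))) x = cochain2 (topspace TG) W (map x [0..<2])" by (simp add: numeral_2_eq_2)
 qed
qed

lemma cochains_2D:
 assumes w: "w:cochains 2 TG TV" and f: "continuous_map T TG f" and g: "continuous_map T TG g" shows "continuous_map T TV (%t. w [f t, g t])"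
proof -
 let ?P = "product_topology (%_. TG) {..<2::nat}"
 have c: "continuous_map ?P TV (%x. w (map x [0..<2]))" using w by (simp add: cochains_def)
 have "continuous_map T ?P (%t. \<lambda>i\<in>{..<2}. if i = 0 then f t else g t)" by (subst continuous_map_componentwise) (auto simp: f g)
 from continuous_map_compose[OF this c] show ?thesis by (simp add: o_def numeral_2_eq_2)
qed

lemma cochains_diff:
 assumes V: "subspace (topspace TV)" and c: "continuous_map (prod_topology TV TV) TV (%(x, y). x - y)"
  and w: "w:cochains r TG TV" "w':cochains r TG TV" shows "w - w':cochains r TG TV" unfolding cochains_def
proof (intro CollectI conjI)
 have w': "w:alt_maps r (topspace TG) (topspace TV)" "w':alt_maps r (topspace TG) (topspace TV)"
  and cw: "continuous_map (product_topology (%_. TG) {..<r}) TV (%x. w (map x [0..<r]))"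
   "continuous_map (product_topology (%_. TG) {..<r}) TV (%x. w' (map x [0..<r]))" using w by (auto simp: cochains_def)
 show "w - w':alt_maps r (topspace TG) (topspace TV)" using w' V unfolding alt_maps_def by (simp add: subspace_diff algebra_simps)
 show "continuous_map (product_topology (%_. TG) {..<r}) TV (%x. (w - w') (map x [0..<r]))"
  using continuous_map_compose[OF continuous_map_pairedI[OF cw] c] by (simp add: o_def)
qed

lemma class_eq:
 assumes "!!u v. u:D==>v:D==>u - v:D" "w - w':(D :: 'a::ab_group_add set)" shows "{v:Z. v - w:D} = {v:Z. v - w':D}"
proof -
 have 0: "0:D" using assms(1)[OF assms(2,2)] by simp
 have "v - w':D" if "v - w:D" for v using assms(1)[OF that assms(1)[OF 0 assms(2)]] by simp
 moreover have "v - w:D" if "v - w':D" for v using assms(1)[OF that assms(2)] by simp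
 ultimately show ?thesis by blast
qed

section \<open>A lift of the outer action, its curvature and the cocycle d_S \<omega>\<close>

locale xm_lift = xm_top C s for C :: "('gh::real_vector, 'nh::real_vector, 'g::real_vector, 'z::real_vector) xmod" and s +
 fixes sg :: "'g=>'gh" and \<omega> :: "'g list=>'nh"
 assumes sg_in: "X:topspace (g_top C)==>sg X:topspace (gh_top C)"
  and sg_lin: "X:topspace (g_top C)==>Y:topspace (g_top C)==>sg (a*\<^sub>RX + b*\<^sub>RY) = a*\<^sub>Rsg X + b*\<^sub>Rsg Y"
  and q_sg: "X:topspace (g_top C)==>qt C (sg X) = X" and c_sg: "continuous_map (g_top C) (gh_top C) sg"
  and \<omega>: "\<omega>:cochains 2 (g_top C) (nh_top C)" and al_\<omega>: "X:topspace (g_top C)==>Y:topspace (g_top C) ==>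
   alpha C (\<omega> [X, Y]) = gh_br C (sg X) (sg Y) - sg (g_br C X Y)"
begin

lemmas [simp] = sg_in q_sg
lemmas cm_sg = cm1[OF c_sg] and cm_\<omega> = cochains_2D[OF \<omega>]

lemma \<omega>_alt: "\<omega>:alt_maps 2 Gq Nh" using \<omega> by (simp add: cochains_def)
lemmas \<omega>_in [simp] = alt_maps_2_in[OF \<omega>_alt] and \<omega>_skew = alt_maps_2_skew[OF \<omega>_alt sub(3)]
 and \<omega>_left = alt_maps_2_left[OF \<omega>_alt] and \<omega>_right = alt_maps_2_right[OF \<omega>_alt]

lemma brg_eq: "X:Gq==>Y:Gq==>brg X Y = qt C (br (sg X) (sg Y))" by (simp add: q_br)
lemma brg_in [simp]: "X:Gq==>Y:Gq==>brg X Y:Gq" by (simp add: brg_eq)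

lemma sg_simps:
 assumes "X:Gq" shows "Y:Gq==>sg (X + Y) = sg X + sg Y" "Y:Gq==>sg (X - Y) = sg X - sg Y" "sg (- X) = - sg X"
 using sg_lin[of X Y 1 1] sg_lin[of X Y 1 "-1"] sg_lin[of X X "-1" 0] assms by simp_all

lemma sg_zero: "sg 0 = 0" using sg_lin[of 0 0 0 0] by simp

lemma brg_lin: "X:Gq==>Y:Gq==>Z:Gq==>brg (a*\<^sub>RX + b*\<^sub>RY) Z = a*\<^sub>Rbrg X Z + b*\<^sub>Rbrg Y Z"
 by (simp add: brg_eq sg_lin br_simps q_simps)

lemma brg_skew: "X:Gq==>Y:Gq==>brg X Y = - brg Y X" using br_skew[of "sg X" "sg Y"] by (simp add: brg_eq q_simps)

lemma brg_lin_right: "X:Gq==>Y:Gq==>Z:Gq==>brg Z (a*\<^sub>RX + b*\<^sub>RY) = a*\<^sub>Rbrg Z X + b*\<^sub>Rbrg Z Y"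
 using brg_lin[of X Y Z a b] brg_skew[of Z "a*\<^sub>RX + b*\<^sub>RY"] brg_skew[of Z X] brg_skew[of Z Y] by simp

lemma brg_jac: "X:Gq==>Y:Gq==>Z:Gq==>brg (brg X Y) Z = brg (brg X Z) Y - brg (brg Y Z) X"
 using arg_cong[OF br_jac'[of "sg X" "sg Y" "sg Z"], of "qt C"] by (simp add: q_simps q_br)

lemma ga_in [simp]:
 assumes "X:Gq" "z:Zz" shows "ga X z:Zz"
proof -
 have e: "act (sg X) (ic z) = ic (ga X z)" using act_inc[of "sg X" z] assms by simp
 have "act (sg X) (ic z):ic ` Zz" using assms br_simps(4)[of "sg X" 0 0] by (intro al_ker) (simp_all add: al_act al_inc)
 then show ?thesis unfolding e using inc_inj by blast
qed

lemma inc_ga: "X:Gq==>z:Zz==>ic (ga X z) = act (sg X) (ic z)" using act_inc[of "sg X" z] by simp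

lemma ga_lin:
 assumes "X:Gq" "z:Zz" "z':Zz" shows "ga X (a*\<^sub>Rz + b*\<^sub>Rz') = a*\<^sub>Rga X z + b*\<^sub>Rga X z'"
 by (rule inc_inj) (use assms in \<open>simp add: inc_ga inc_simps act_simps\<close>)

lemma ga_simps:
 assumes "X:Gq" "z:Zz" shows "z':Zz==>ga X (z + z') = ga X z + ga X z'" "z':Zz==>ga X (z - z') = ga X z - ga X z'" "ga X (- z) = - ga X z"
 using ga_lin[of X z z' 1 1] ga_lin[of X z z' 1 "-1"] ga_lin[of X z z "-1" 0] assms by simp_all

definition D :: "'g=>'g=>'g=>'nh" where "D = cov_d brg (%X. act (sg X)) \<omega>"

definition Dz :: "'g list=>'z" where "Dz = cochain3 Gq (%X Y Z. inv_into Zz ic (D X Y Z))"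

lemma D_N [simp]: "X:Gq==>Y:Gq==>Z:Gq==>D X Y Z:Nh" by (simp add: D_def cov_d_def)

text \<open>Bianchi identity: \<alpha> turns d_S \<omega> into the Jacobi sum of the lifted fields,
  up to \<sigma> of the Jacobi sum in the quotient.\<close>

lemma al_D:
 assumes "X:Gq" "Y:Gq" "Z:Gq" shows "ac (D X Y Z) = 0"
proof -
 have 1: "sg (brg (brg X Y) Z) + sg (brg (brg Y Z) X) + sg (brg (brg Z X) Y) = 0"
 proof -
  have "brg (brg X Y) Z + brg (brg Y Z) X + brg (brg Z X) Y = 0"
   using assms brg_jac[of X Y Z] brg_skew[of Z X] brg_lin[of "brg X Z" "brg X Z" Y "-1" 0] by simp
  then show ?thesis using assms sg_zero by (simp flip: sg_simps)
 qed
 show ?thesis using assms 1 br_jac[of "sg X" "sg Y" "sg Z"] br_skew[of "sg X" "sg (brg Y Z)"] br_skew[of "sg Y" "sg (brg Z X)"]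
   br_skew[of "sg Z" "sg (brg X Y)"] by (simp add: D_def cov_d_def al_simps al_act al_\<omega> br_simps algebra_simps)
qed

lemma D_image: "X:Gq==>Y:Gq==>Z:Gq==>D X Y Z:ic ` Zz" by (rule al_ker) (simp_all add: al_D)

lemma Dz_at:
 assumes "X:Gq" "Y:Gq" "Z:Gq" shows "Dz [X, Y, Z]:Zz" "ic (Dz [X, Y, Z]) = D X Y Z" "Dz [X, Y, Z] = pz (D X Y Z)"
proof -
 have e: "Dz [X, Y, Z] = inv_into Zz ic (D X Y Z)" using assms by (simp add: Dz_def)
 show "Dz [X, Y, Z]:Zz" unfolding e by (rule inv_into_into[OF D_image[OF assms]])
 show "ic (Dz [X, Y, Z]) = D X Y Z" unfolding e by (rule f_inv_into_f[OF D_image[OF assms]])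
 show "Dz [X, Y, Z] = pz (D X Y Z)" using e assms by (simp add: pz_def al_D s_zero)
qed

lemma D_cyc: "D X Y Z = D Y Z X" by (simp add: D_def cov_d_def ac_simps)

lemma D_skew:
 assumes "X:Gq" "Y:Gq" "Z:Gq" shows "D X Y Z = - D Y X Z"
proof -
 have n: "\<omega> [- U, V] = - \<omega> [U, V]" if "U:Gq" "V:Gq" for U V using \<omega>_left[of U U V "-1" 0] that by simp
 show ?thesis using assms by (simp add: D_def cov_d_def \<omega>_skew[of Z Y] \<omega>_skew[of Z X] \<omega>_skew[of X Y] act_simps
    brg_skew[of X Y] brg_skew[of Z Y] brg_skew[of Z X] n)
qed

lemma D_lin:
 assumes "X:Gq" "Y:Gq" "Z:Gq" "T:Gq" shows "D (a*\<^sub>RX + b*\<^sub>RY) Z T = a*\<^sub>RD X Z T + b*\<^sub>RD Y Z T"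
 using assms by (simp add: D_def cov_d_def sg_lin brg_lin brg_lin_right \<omega>_left \<omega>_right act_left_simps act_simps algebra_simps)

lemma Dz_alt: "Dz:alt_maps 3 Gq Zz"
proof -
 have e: "inv_into Zz ic (D X Y Z) = Dz [X, Y, Z]" if "X:Gq" "Y:Gq" "Z:Gq" for X Y Z using that by (simp add: Dz_def)
 show ?thesis unfolding Dz_def
 proof (rule alt_maps_3I[OF _ _ _ _ sub(3)])
  fix x y z assume *: "x:Gq" "y:Gq" "z:Gq"
  show "inv_into Zz ic (D x y z):Zz" using * by (simp add: e Dz_at(1))
  show "inv_into Zz ic (D x y z) = inv_into Zz ic (D y z x)" by (rule arg_cong[OF D_cyc])
  show "inv_into Zz ic (D x y z) = - inv_into Zz ic (D y x z)"
   using * by (simp add: e) (rule inc_inj, simp add: Dz_at(1,2) inc_simps D_skew[of x y z])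
  show "inv_into Zz ic (D (a*\<^sub>Rx + b*\<^sub>Ry) z t) = a*\<^sub>Rinv_into Zz ic (D x z t) + b*\<^sub>Rinv_into Zz ic (D y z t)"
   if "t:Gq" for t a b using * that by (simp add: e) (rule inc_inj, simp add: Dz_at(1,2) inc_simps D_lin)
 qed
qed

lemma Dz_cochain: "Dz:cochains 3 QT ZT" unfolding cochains_def
proof (intro CollectI conjI Dz_alt)
 let ?P = "product_topology (%_. QT) {..<3::nat}"
 \<comment> \<open>Through \<open>pz\<close> the value is composed of maps whose continuity is
   known.\<close>
 have "continuous_map ?P ZT (%x. pz (D (x 0) (x 1) (x 2)))" unfolding D_def cov_d_def
  by (intro cm_pz cm_nh_add cm_nh_diff cm_act cm_sg cm_\<omega> cm_brg cochain_proj) simp_all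
 then show "continuous_map ?P ZT (%x. Dz (map x [0..<3]))"
 proof (rule continuous_map_eq)
  fix x assume "x:topspace ?P"
  then have "x 0:Gq" "x 1:Gq" "x 2:Gq" by (auto simp: PiE_iff)
  moreover have "map x [0..<3] = [x 0, x 1, x 2]" by (simp add: numeral_3_eq_3 numeral_2_eq_2)
  ultimately show "pz (D (x 0) (x 1) (x 2)) = Dz (map x [0..<3])" by (simp add: Dz_at)
 qed
qed

text \<open>The n(x) of the overview: the difference between the identity and the lift \<sigma> o q,
  raised to the module by s.\<close>

definition st :: "'gh=>'nh" where "st x = s (x - sg (qt C x))"

lemma vert: "x:Gh==>x - sg (qt C x):nN" by (simp add: nN_iff q_simps)

lemma st_in [simp]: "x:Gh==>st x:Nh" and al_st: "x:Gh==>ac (st x) = x - sg (qt C x)" using vert[of x] by (simp_all add: st_def nN_iff)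

lemma st_lin: "x:Gh==>y:Gh==>st (a*\<^sub>Rx + b*\<^sub>Ry) = a*\<^sub>Rst x + b*\<^sub>Rst y"
 using s_lin[of "x - sg (qt C x)" "y - sg (qt C y)" a b] vert[of x] vert[of y] by (simp add: st_def q_lin sg_lin nN_iff algebra_simps)

lemma st_diff: "x:Gh==>y:Gh==>st (x - y) = st x - st y" using st_lin[of x y 1 "-1"] by simp

text \<open>\<open>pz\<close> provides the term - n([x, y]): the argument has \<alpha>-image [x, y]
  - \<sigma>(q [x, y]), so exactly \<open>st\<close> of the bracket is subtracted, see
  \<open>inc_ft\<close>. Values in z and continuity are then evident.\<close>

definition ft :: "'gh=>'gh=>'z" where
 "ft x y = pz (act x (st y) - act y (st x) - nb (st x) (st y) + \<omega> [qt C x, qt C y])"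

lemma ft_in [simp]: "x:Gh==>y:Gh==>ft x y:Zz" by (simp add: ft_def)

lemma inc_ft:
 assumes "x:Gh" "y:Gh" shows "ic (ft x y) = act x (st y) - act y (st x) - nb (st x) (st y) + \<omega> [qt C x, qt C y] - st (br x y)"
proof -
 have "ac (act x (st y) - act y (st x) - nb (st x) (st y) + \<omega> [qt C x, qt C y]) = br x y - sg (qt C (br x y))"
  using assms br_skew[of "sg (qt C x)" y] br_skew[of y x] by (simp add: al_simps al_act al_nbr al_st al_\<omega> br_simps q_br)
 then show ?thesis unfolding ft_def by (subst inc_pz(2)) (use assms in \<open>simp_all add: st_def[of "br x y"]\<close>)
qed

lemma ft_skew: "x:Gh==>y:Gh==>ft x y = - ft y x" using nbr_skew[of "st x" "st y"] \<omega>_skew[of "qt C x" "qt C y"]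
 by (simp add: ft_def pz_skew[symmetric] algebra_simps)

lemma ft_lin:
 assumes "x:Gh" "y:Gh" "z:Gh" shows "ft (a*\<^sub>Rx + b*\<^sub>Ry) z = a*\<^sub>Rft x z + b*\<^sub>Rft y z"
 by (rule inc_inj) (use assms in \<open>simp add: inc_simps inc_ft act_left_simps act_simps st_lin nbr_simps q_lin \<omega>_left br_simps algebra_simps\<close>)

text \<open>The transgression runs from the lift \<sigma> o q to the identity. The identity is a
  homomorphism, so w' = 0 and the left-hand side vanishes; the central term b is minus
  \<open>ft\<close>.\<close>

lemma inc_ft_d:
 assumes xyz: "x:Gh" "y:Gh" "z:Gh"
 shows "D (qt C x) (qt C y) (qt C z) = ic (ga (qt C x) (ft y z) - ft (br x y) z + (ga (qt C y) (ft z x) - ft (br y z) x)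
  + (ga (qt C z) (ft x y) - ft (br z x) y))"
proof -
 define b where "b x y = 0 - \<omega> [qt C x, qt C y] - (act (sg (qt C x)) (st y) - act (sg (qt C y)) (st x) - st (br x y) + nb (st x) (st y))" for x y
 have b: "b x y = - ic (ft x y)" if "x:Gh" "y:Gh" for x y
 proof -
  have a: "act (sg (qt C x)) u = act x u - nb (st x) u" if "x:Gh" "u:Nh" for x u
   using that act_left_simps(2)[of x u "sg (qt C x)"] by (simp add: act_al[symmetric] al_st)
  show ?thesis using that nbr_skew[of "st y" "st x"] by (simp add: a inc_ft b_def)
 qed
 have sk: "br (br x y) z = - br (br y x) z" if "x:Gh" "y:Gh" "z:Gh" for x y z using that br_skew[of x y] br_simps(7)[of "br y x" z] by simp
 have "act x 0 - 0 + (act y 0 - 0) + (act z 0 - 0)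
  = act (sg (qt C x)) (\<omega> [qt C y, qt C z]) - \<omega> [qt C (br x y), qt C z] + (act (sg (qt C y)) (\<omega> [qt C z, qt C x]) - \<omega> [qt C (br y z), qt C x])
   + (act (sg (qt C z)) (\<omega> [qt C x, qt C y]) - \<omega> [qt C (br z x), qt C y])
   + (act (sg (qt C x)) (b y z) - b (br x y) z + (act (sg (qt C y)) (b z x) - b (br y z) x) + (act (sg (qt C z)) (b x y) - b (br z x) y))"
  by (rule transgression_d[where L = Gh and \<sigma>' = "%x. x" and bl = br and w' = "%_ _. 0" and a = st, OF _ _ br_jac' sk _ _ _ _ _ _ _ _ _ b_def])
   (use xyz in \<open>simp_all add: al_simps al_\<omega> q_br al_st st_diff\<close>)
 then show ?thesis using xyz by (simp add: b act_zero act_simps D_def cov_d_def q_br inc_simps inc_ga algebra_simps)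
qed

lemma ft_alt: "cochain2 Gh ft:alt_maps 2 Gh Zz" by (rule alt_maps_2I[OF ft_in ft_lin ft_skew sub(1)])

lemma d_ft:
 assumes "x:Gh" "y:Gh" "z:Gh" shows "ce_d 2 Gh br (%x. ga (qt C x)) (cochain2 Gh ft) [x, y, z] = Dz [qt C x, qt C y, qt C z]"
proof (rule inc_inj)
 have n: "ft (br z x) y = - ft (br x z) y" using assms br_skew[of z x] ft_lin[of "br x z" "br x z" y "-1" 0] by simp
 have "ce_d 2 Gh br (%x. ga (qt C x)) (cochain2 Gh ft) [x, y, z] = ga (qt C x) (ft y z) - ft (br x y) z + (ga (qt C y) (ft z x) - ft (br y z) x)
  + (ga (qt C z) (ft x y) - ft (br z x) y)" using assms n ft_skew[of z x] by (simp add: ce_d_2 ga_simps)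
 then show "ic (ce_d 2 Gh br (%x. ga (qt C x)) (cochain2 Gh ft) [x, y, z]) = ic (Dz [qt C x, qt C y, qt C z])"
  using assms inc_ft_d[OF assms] by (simp add: Dz_at(2))
qed

text \<open>On lifts of X, Y, Z, T the differential of \<open>Dz\<close> is that of d
  \<open>ft\<close>, because q carries brackets of lifts to brackets; there d^2 = 0 applies.\<close>

lemma Dz_cocycle: "Dz:cocycles 3 QT brg ga ZT"
proof -
 have ga_br: "ga (qt C (br x y)) z = ga (qt C x) (ga (qt C y) z) - ga (qt C y) (ga (qt C x) z)" if "x:Gh" "y:Gh" "z:Zz" for x y z
  by (rule inc_inj) (use that in \<open>simp add: inc_simps act_inc[symmetric] act_br\<close>)
 have "ce_d 3 Gq brg ga Dz xs = 0" for xs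
 proof (cases "xs:tuples 4 Gq")
  case True
  then obtain X Y Z T where X: "X:Gq" "Y:Gq" "Z:Gq" "T:Gq" "xs = [X, Y, Z, T]" by (auto simp: tuples4_iff)
  have "ce_d 3 Gh br (%x. ga (qt C x)) (ce_d 2 Gh br (%x. ga (qt C x)) (cochain2 Gh ft)) [sg X, sg Y, sg Z, sg T] = 0"
   by (rule ce_d_ce_d[OF sub(1) br_in br_skew br_jac' _ _ ga_br sub(4) ft_alt]) (use X in \<open>simp_all add: ga_simps\<close>)
  then show ?thesis using X by (simp add: ce_d_3 d_ft q_br)
 qed (simp add: ce_d_def)
 then show ?thesis using Dz_cochain by (auto simp: cocycles_def)
qed

end

section \<open>The characteristic class\<close>

lemma (in xm_top) cochains_2_diff:
 "w:cochains 2 QT ZT==>w':cochains 2 QT ZT==>w - w':cochains 2 QT ZT" by (rule cochains_diff[OF sub(4) c_z_diff])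

lemma ce_d_2_eqI:
 assumes "v:alt_maps 3 G V" "!!x y z. x:G==>y:G==>z:G==>v [x, y, z] = ce_d 2 G br act w [x, y, z]" shows "v = ce_d 2 G br act w"
proof
 fix xs show "v xs = ce_d 2 G br act w xs"
 proof (cases "xs:tuples 3 G")
  case True
  then show ?thesis using assms(2) by (auto simp: tuples3_iff)
 next
  case False
  then show ?thesis using assms(1) by (simp add: alt_maps_def ce_d_def eval_nat_numeral)
 qed
qed

lemma alt_maps_diff: "subspace V==>w:alt_maps r G V==>w':alt_maps r G V==>w - w':alt_maps r G V"
 unfolding alt_maps_def by (simp add: subspace_diff algebra_simps)

context xm_lift
begin

lemma ce_d_diff:
 assumes "w:alt_maps 2 Gq Zz" "w':alt_maps 2 Gq Zz" shows "ce_d 2 Gq brg ga (w - w') = ce_d 2 Gq brg ga w - ce_d 2 Gq brg ga w'"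
proof -
 have "ce_d 2 Gq brg ga (1*\<^sub>Rw + (-1)*\<^sub>Rw') = 1*\<^sub>Rce_d 2 Gq brg ga w + (-1)*\<^sub>Rce_d 2 Gq brg ga w'"
  by (rule ce_d_linear[where V = Zz, OF _ _ ga_lin]) (use assms in \<open>auto simp: alt_maps_def\<close>)
 then show ?thesis by simp
qed

lemma coboundaries_diff:
 assumes "u:coboundaries 3 QT brg ga ZT" "v:coboundaries 3 QT brg ga ZT" shows "u - v:coboundaries 3 QT brg ga ZT"
proof -
 obtain w w' where w: "w:cochains 2 QT ZT" "w':cochains 2 QT ZT" "u = ce_d 2 Gq brg ga w" "v = ce_d 2 Gq brg ga w'"
  using assms by (auto simp: coboundaries_def)
 then have "u - v = ce_d 2 Gq brg ga (w - w')" by (simp add: ce_d_diff cochains_def)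
 then show ?thesis using cochains_2_diff[OF w(1,2)] by (simp add: coboundaries_def)
qed

lemma br_nN: "x:Gh==>n:nN==>br x n:nN" by (erule imageE) (auto simp flip: al_act)

lemma ft_cochain: "cochain2 Gh ft:cochains 2 HT ZT"
proof (rule cochains_2I[OF ft_alt])
 have st: "continuous_map T NT (%t. st (h t))" if "continuous_map T HT h" for T :: "('gh\<times>'gh) topology" and h
  unfolding st_def using continuous_map_funspace[OF that] by (intro cm_s cm_gh_diff that cm_sg cm_q vert) blast
 show "continuous_map (prod_topology HT HT) ZT (%(x, y). ft x y)" unfolding case_prod_unfold ft_def
  by (intro cm_pz cm_nh_add cm_nh_diff cm_act cm_nbr st cm_\<omega> cm_q continuous_map_fst continuous_map_snd)
qed

text \<open>A vertical n is \<alpha>(s n) and therefore acts on \<open>st x\<close> as a bracket,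
  which cancels the bracket in \<open>ft\<close>; the curvature term vanishes since q n = 0. What
  remains is the function \<theta> of the splitting by s.\<close>

lemma ft_vert:
 assumes "x:Gh" "n:nN" shows "ft x n = pz (act x (s n))"
proof -
 have n: "n:Gh" "qt C n = 0" using assms nN_iff by blast+
 have st: "st n = s n" using n by (simp add: st_def sg_zero)
 have "act n (st x) = act (ac (s n)) (st x)" using n by simp
 then have "act n (st x) = - nb (st x) (s n)" using assms n nbr_skew[of "s n" "st x"] by (simp add: act_al del: al_s)
 moreover have "\<omega> [qt C x, 0] = 0" using \<omega>_right[of 0 0 "qt C x" 0 0] assms by simp
 ultimately show ?thesis using n st by (simp add: ft_def)
qed

text \<open>The isomorphism \<open>\<Phi>\<close> yields another section \<open>\<Phi> (0, n)\<close> of \<open>\<alpha>\<close>.  The extensions of \<open>\<theta>\<close>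
  by \<open>ft\<close> and by the given cochain differ by a cochain pulled back from \<open>\<gg>\<close>.\<close>

lemma char_coboundary:
 assumes "char_cocycle C \<beta>" shows "\<beta> - Dz:coboundaries 3 QT brg ga ZT"
proof -
 obtain \<Phi> \<theta> t where \<beta>: "\<beta>:cocycles 3 QT brg ga ZT" and \<Phi>: "homeomorphic_map (prod_topology ZT (n_top C)) NT \<Phi>"
   "\<forall>z\<in>Zz. \<forall>z'\<in>Zz. \<forall>n\<in>nN. \<forall>n'\<in>nN. \<forall>a b. \<Phi> (a*\<^sub>Rz + b*\<^sub>Rz', a*\<^sub>Rn + b*\<^sub>Rn') = a*\<^sub>R\<Phi> (z, n) + b*\<^sub>R\<Phi> (z', n')"
   "\<forall>z\<in>Zz. \<Phi> (z, 0) = ic z" "\<forall>z\<in>Zz. \<forall>n\<in>nN. ac (\<Phi> (z, n)) = n"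
  and act\<Phi>: "\<forall>x\<in>Gh. \<forall>z\<in>Zz. \<forall>n\<in>nN. act x (\<Phi> (z, n)) = \<Phi> (ga (qt C x) z + \<theta> x n, br x n)"
  and \<theta>: "continuous_map (prod_topology HT (n_top C)) ZT (%(x, n). \<theta> x n)"
  and t: "t:cochains 2 HT ZT" "\<forall>x\<in>Gh. \<forall>n\<in>nN. t [x, n] = \<theta> x n"
  and dt: "\<forall>xs\<in>tuples 3 Gh. ce_d 2 Gh br (%x. ga (qt C x)) t xs = \<beta> (map (qt C) xs)"
  using assms unfolding char_cocycle_def topspace_n_top by (elim conjE exE) (rule that)
 have c\<Phi>: "continuous_map (prod_topology ZT (n_top C)) NT \<Phi>" by (rule homeomorphic_imp_continuous_map[OF \<Phi>(1)])
 \<comment> \<open>Only the section is exchanged; \<sigma> and \<omega> stay, and as d_S \<omega>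
   does not involve the section, \<open>L.Dz\<close> is \<open>Dz\<close>.\<close>
 interpret L: xm_lift C "%n. \<Phi> (0, n)" sg \<omega>
 proof (rule xm_lift.intro[OF xm_top.intro[OF xm_axioms] xm_lift_axioms[unfolded xm_lift_def, THEN conjunct2]],
   rule xm_top_axioms.intro)
  fix x assume x: "x:Gh" "qt C x = 0"
  show "\<Phi> (0, x):Nh" using funcset_mem[OF continuous_map_funspace[OF c\<Phi>], of "(0, x)"] x by (simp add: nN_iff)
  show "ac (\<Phi> (0, x)) = x" by (rule bspec[OF bspec[OF \<Phi>(4)]]) (use x nN_iff in simp_all)
  show "\<Phi> (0, a*\<^sub>Rx + b*\<^sub>Ry) = a*\<^sub>R\<Phi> (0, x) + b*\<^sub>R\<Phi> (0, y)" if "y:Gh" "qt C y = 0" for y a b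
   using \<Phi>(2)[rule_format, of 0 0 x y a b] x that nN_iff by simp
 next
  show "continuous_map (subtopology HT nN) NT (%n. \<Phi> (0, n))"
   unfolding n_top_def[symmetric] by (rule cm1[OF c\<Phi>]) (intro continuous_map_pairedI; simp)
 qed (rule c_gh_diff c_nh_add c_nh_diff c_z_add c_z_diff c_act c_al c_q c_inc c_inc_inv c_brg)+
 \<comment> \<open>The z-component of x.\<Phi>(0, n) is \<theta>(x, n) by hypothesis and
   \<open>L.ft x n\<close> by \<open>ft_vert\<close>.\<close>
 have t\<theta>: "t [x, n] = L.ft x n" if "x:Gh" "n:nN" for x n
 proof -
  have th: "\<theta> x n:Zz" using funcset_mem[OF continuous_map_funspace[OF \<theta>], of "(x, n)"] that by simp
  have b: "br x n:nN" using that by (rule br_nN)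
  have "act x (\<Phi> (0, n)) = \<Phi> (ga (qt C x) 0 + \<theta> x n, br x n)"
   by (rule bspec[OF bspec[OF bspec[OF act\<Phi>]]]) (use that in simp_all)
  also have "ga (qt C x) 0 = 0" using ga_lin[of "qt C x" 0 0 0 0] that by simp
  also have "\<Phi> (0 + \<theta> x n, br x n) = ic (\<theta> x n) + \<Phi> (0, br x n)"
   using \<Phi>(2)[rule_format, of "\<theta> x n" 0 0 "br x n" 1 1] \<Phi>(3) th b q_zero nN_iff[of 0] by simp
  finally show ?thesis using bspec[OF bspec[OF t(2) that(1)] that(2)] th b
    L.pz_lin[of "ic (\<theta> x n)" "\<Phi> (0, br x n)" 1 1] L.ft_vert[OF that] L.pz_s[OF b] L.pz_inc[OF th] L.s_in[of "br x n"] nN_iff[of "br x n"]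
   by simp
 qed
 define d where "d = t - cochain2 Gh L.ft"
 have d: "d:cochains 2 HT ZT" unfolding d_def by (rule cochains_diff[OF sub(4) c_z_diff t(1) L.ft_cochain])
 then have da: "d:alt_maps 2 Gh Zz" by (simp add: cochains_def)
 note dl = alt_maps_2_left[OF da] and ds = alt_maps_2_skew[OF da sub(1)] and di [simp] = alt_maps_2_in[OF da]
 \<comment> \<open>The bracket of lifts and the lift of the bracket differ by \<alpha>(\<omega>),
   and d vanishes as soon as one argument lies in the ideal. So evaluating d on lifts is compatible
   with the brackets of the quotient.\<close>
 have dd: "d [br (sg X) (sg Y), sg Z] = d [sg (brg X Y), sg Z]" if "X:Gq" "Y:Gq" "Z:Gq" for X Y Z
 proof -
  let ?n = "ac (\<omega> [X, Y])"
  have n: "?n:nN" "?n:Gh" using that by simp_all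
  have "d [?n, sg Z] = 0" using ds[of ?n "sg Z"] t\<theta>[OF sg_in[OF that(3)] n(1)] n(2) that by (simp add: d_def)
  then show ?thesis using dl[of "sg (brg X Y)" ?n "sg Z" 1 1] n(2) that by (simp add: al_\<omega>)
 qed
 define g where "g = cochain2 Gq (%X Y. d [sg X, sg Y])"
 have g: "g:cochains 2 QT ZT" unfolding g_def
 proof (rule cochains_2I[OF alt_maps_2I])
  show "continuous_map (prod_topology QT QT) ZT (%(x, y). d [sg x, sg y])"
   unfolding case_prod_unfold by (intro cochains_2D[OF d] cm_sg continuous_map_fst continuous_map_snd)
  show "d [sg x, sg y] = - d [sg y, sg x]" if "x:Gq" "y:Gq" for x y by (rule ds) (use that in simp_all)
 qed (simp_all add: sg_lin dl sub(3))
 have \<beta>alt: "\<beta>:alt_maps 3 Gq Zz" using \<beta> by (simp add: cocycles_def cochains_def)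
 have "\<beta> - Dz = ce_d 2 Gq brg ga g"
 proof (rule ce_d_2_eqI[OF alt_maps_diff[OF sub(4) \<beta>alt Dz_alt]])
  fix X Y Z assume X: "X:Gq" "Y:Gq" "Z:Gq"
  have tin: "[sg X, sg Y, sg Z]:tuples 3 Gh" using X by (simp add: tuples_def)
  have "t:alt_maps 2 Gh Zz" using t(1) by (simp add: cochains_def)
  then have ti: "t [x, y]:Zz" if "x:Gh" "y:Gh" for x y using that alt_maps_2_in by blast
  have "(\<beta> - Dz) [X, Y, Z] = ce_d 2 Gh br (%x. ga (qt C x)) t [sg X, sg Y, sg Z] - ce_d 2 Gh br (%x. ga (qt C x)) (cochain2 Gh L.ft) [sg X, sg Y, sg Z]"
   using bspec[OF dt tin] L.d_ft[of "sg X" "sg Y" "sg Z"] X by simp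
  also have "\<dots> = ce_d 2 Gh br (%x. ga (qt C x)) d [sg X, sg Y, sg Z]" using X ti by (simp add: ce_d_2 d_def ga_simps)
  also have "\<dots> = ce_d 2 Gq brg ga g [X, Y, Z]" using X by (simp add: ce_d_2 g_def dd)
  finally show "(\<beta> - Dz) [X, Y, Z] = ce_d 2 Gq brg ga g [X, Y, Z]" .
 qed
 then show ?thesis using g by (simp add: coboundaries_def)
qed

text \<open>The data exist: the module is z plus the image of s, f measures the failure of s to be a
  homomorphism, \<theta> its failure to be equivariant, and \<open>ft\<close> extends \<theta>. As
  \<open>char_class\<close> is a union over such cocycles, it would be empty if there were
  none.\<close>

lemma char_Dz: "char_cocycle C Dz"
proof -
 define \<Phi> where "\<Phi> zn = ic (fst zn) + s (snd zn)" for zn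
 define f where "f = cochain2 nN (%n n'. pz (nb (s n) (s n')))"
 define \<theta> where "\<theta> x n = pz (act x (s n))" for x n
 have nG [simp]: "n:Gh" "qt C n = 0" if "n:nN" for n using that nN_iff by blast+
 note [simp] = br_nN
 have nN0: "0:nN" by (simp add: nN_iff q_zero)
 have nlin: "a*\<^sub>Rn + b*\<^sub>Rn':nN" if "n:nN" "n':nN" for a b n n' using that unfolding nN_iff by (simp add: q_lin)
 have dec: "u = ic (pz u) + s (ac u)" if "u:Nh" for u using inc_pz[OF that] by simp
 have act\<Phi>: "act x (ic z + s n) = ic (ga (qt C x) z + \<theta> x n) + s (br x n)" if "x:Gh" "z:Zz" "n:nN" for x z n
  using that dec[of "act x (s n)"] by (simp add: act_simps act_inc inc_simps \<theta>_def al_act)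
 have nb\<Phi>: "nb (ic z + s n) (ic z' + s n') = ic (pz (nb (s n) (s n'))) + s (br n n')" if "z:Zz" "z':Zz" "n:nN" "n':nN" for z z' n n'
  using that dec[of "nb (s n) (s n')"] by (simp add: nbr_simps nbr_zero al_inc al_nbr)
 have cn: "continuous_map (n_top C) HT (%n. n)" unfolding n_top_def by (rule continuous_map_from_subtopology[OF continuous_map_id, unfolded id_def])
 have cs: "continuous_map T NT (%t. s (h t))" if "continuous_map T (n_top C) h" for T :: "'t topology" and h
  using cm1[OF c_s[folded n_top_def] that] .
 have "homeomorphic_maps (prod_topology ZT (n_top C)) NT \<Phi> (%u. (pz u, ac u))" unfolding homeomorphic_maps_def
 proof (intro conjI ballI)
  show "continuous_map (prod_topology ZT (n_top C)) NT \<Phi>" unfolding \<Phi>_def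
   by (intro cm_nh_add cm_inc cs continuous_map_fst continuous_map_snd)
  have "continuous_map NT (n_top C) ac" unfolding n_top_def continuous_map_in_subtopology using c_al by auto
  then show "continuous_map NT (prod_topology ZT (n_top C)) (%u. (pz u, ac u))"
   by (intro continuous_map_pairedI cm_pz[OF continuous_map_id, unfolded id_def])
  show "(pz (\<Phi> zn), ac (\<Phi> zn)) = zn" if "zn:topspace (prod_topology ZT (n_top C))" for zn
   using that pz_lin[of "ic (fst zn)" "s (snd zn)" 1 1] by (auto simp: \<Phi>_def al_simps al_inc pz_inc pz_s)
  show "\<Phi> (pz u, ac u) = u" if "u:topspace NT" for u using dec[OF that] by (simp add: \<Phi>_def)
 qed
 then have 1: "homeomorphic_map (prod_topology ZT (n_top C)) NT \<Phi>" using homeomorphic_map_maps by blast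
 have falt: "f:alt_maps 2 nN Zz" unfolding f_def
 proof (rule alt_maps_2I)
  show "subspace nN" using nN0 nlin[of _ _ 1 1] nlin[of _ 0 _ 0] by (auto simp: subspace_def)
  show "pz (nb (s x) (s y)) = - pz (nb (s y) (s x))" if "x:nN" "y:nN" for x y using that nbr_skew[of "s x" "s y"] pz_skew by simp
 qed (simp_all add: s_lin nbr_simps pz_lin)
 have fc: "f:cochains 2 (n_top C) ZT" unfolding f_def topspace_n_top[symmetric]
 proof (rule cochains_2I)
  show "continuous_map (prod_topology (n_top C) (n_top C)) ZT (%(x, y). pz (nb (s x) (s y)))"
   unfolding case_prod_unfold by (intro cm_pz cm_nbr cs continuous_map_fst continuous_map_snd)
 qed (use falt in \<open>simp add: f_def\<close>)
 have 2: "f:cocycles 2 (n_top C) br (%_ _. 0) ZT"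
 proof -
  have "ce_d 2 nN br (%_ _. 0) f xs = 0" for xs
  proof (cases "xs:tuples 3 nN")
   case True
   then obtain x y z where x: "x:nN" "y:nN" "z:nN" "xs = [x, y, z]" by (auto simp: tuples3_iff)
   \<comment> \<open>The bracket sees its arguments only modulo the kernel of \<alpha>, so s([x, y])
     may be traded for [s x, s y]; the Jacobi identity of the module then gives the cocycle
     identity.\<close>
   have F: "ic (pz (nb (s (br x y)) (s z))) = nb (nb (s x) (s y)) (s z) - s (br (br x y) z)" if "x:nN" "y:nN" "z:nN" for x y z
   proof -
    have "nb (nb (s x) (s y)) (s z) = nb (ic (pz (nb (s x) (s y))) + s (br x y)) (s z)" using dec[of "nb (s x) (s y)"] that by (simp add: al_nbr)
    then have "nb (nb (s x) (s y)) (s z) = nb (s (br x y)) (s z)" using that by (simp add: nbr_simps nbr_zero al_inc)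
    then show ?thesis using inc_pz(2)[of "nb (s (br x y)) (s z)"] that by (simp add: al_nbr)
   qed
   have j1: "nb (nb (s x) (s y)) (s z) = nb (nb (s x) (s z)) (s y) - nb (nb (s y) (s z)) (s x)"
    using x nbr_jac[of "s x" "s y" "s z"] nbr_skew[of "s x" "nb (s y) (s z)"] nbr_skew[of "s y" "nb (s x) (s z)"] by simp
   have j2: "s (br (br x y) z) = s (br (br x z) y) - s (br (br y z) x)" using x br_jac'[of x y z] by (simp add: s_simps)
   have "ic (ce_d 2 nN br (%_ _. 0) f xs) = ic 0" using x by (simp add: ce_d_2 f_def inc_simps F j1 j2)
   then show ?thesis by (rule inc_inj)
  qed (simp add: ce_d_def eval_nat_numeral)
  then show ?thesis using fc by (auto simp: cocycles_def)
 qed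
 have 3: "continuous_map (prod_topology HT (n_top C)) ZT (%(x, n). \<theta> x n)"
  unfolding case_prod_unfold \<theta>_def by (intro cm_pz cm_act cs continuous_map_fst continuous_map_snd)
 note 4 = ft_cochain
 have 5: "ft x n = \<theta> x n" if "x:Gh" "n:nN" for x n using ft_vert[OF that] by (simp add: \<theta>_def)
 have a1: "\<Phi> (a*\<^sub>Rz + b*\<^sub>Rz', a*\<^sub>Rn + b*\<^sub>Rn') = a*\<^sub>R\<Phi> (z, n) + b*\<^sub>R\<Phi> (z', n')" if "n:nN" "n':nN" for a b z z' n n'
  using that by (simp add: \<Phi>_def inc_simps s_lin algebra_simps)
 have a2: "\<theta> x (a*\<^sub>Rn + b*\<^sub>Rn') = a*\<^sub>R\<theta> x n + b*\<^sub>R\<theta> x n'" if "x:Gh" "n:nN" "n':nN" for a b x n n'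
  using that by (simp add: \<theta>_def s_lin act_lin pz_lin)
 have a3: "\<theta> (a*\<^sub>Rx + b*\<^sub>Rx') n = a*\<^sub>R\<theta> x n + b*\<^sub>R\<theta> x' n" if "x:Gh" "x':Gh" "n:nN" for a b x x' n
  using that by (simp add: \<theta>_def act_lin_left pz_lin)
 have a4: "ce_d 2 Gh br (%x. ga (qt C x)) (cochain2 Gh ft) xs = Dz (map (qt C) xs)" if "xs:tuples 3 Gh" for xs
  using that d_ft by (auto simp: tuples3_iff)
 show ?thesis unfolding char_cocycle_def topspace_n_top
 proof (rule conjI[OF Dz_cocycle], rule exI[of _ \<Phi>], rule exI[of _ f], rule exI[of _ \<theta>], rule exI[of _ "cochain2 Gh ft"],
   intro conjI 1 2 3 4 ballI allI)
  fix z n assume *: "z:Zz" "n:nN"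
  show "ac (\<Phi> (z, n)) = n" using * by (simp add: \<Phi>_def al_simps al_inc)
  show "act x (\<Phi> (z, n)) = \<Phi> (ga (qt C x) z + \<theta> x n, br x n)" if "x:Gh" for x using act\<Phi>[OF that *] by (simp add: \<Phi>_def)
  show "nb (\<Phi> (z, n)) (\<Phi> (z', n')) = \<Phi> (f [n, n'], br n n')" if "z':Zz" "n':nN" for z' n'
   using nb\<Phi>[OF *(1) that(1) *(2) that(2)] * that by (simp add: \<Phi>_def f_def)
 qed (simp_all only: a1 a2 a3 a4 5 nG cochain2_at, simp add: \<Phi>_def s_zero)
qed

text \<open>\<open>char_Dz\<close> makes the union nonempty and \<open>char_coboundary\<close> makes
  all its members equal.\<close>

lemma char_class_eq: "char_class C = coh_class 3 QT brg ga ZT Dz"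
proof -
 have "coh_class 3 QT brg ga ZT \<beta> = coh_class 3 QT brg ga ZT Dz" if "char_cocycle C \<beta>" for \<beta>
  unfolding coh_class_def by (rule class_eq[OF coboundaries_diff char_coboundary[OF that]])
 then have "char_class C = (\<Union>\<beta>\<in>{\<beta>. char_cocycle C \<beta>}. coh_class 3 QT brg ga ZT Dz)"
  unfolding char_class_def by (intro SUP_cong refl) simp
 also have "\<dots> = coh_class 3 QT brg ga ZT Dz" using char_Dz by blast
 finally show ?thesis .
qed

text \<open>The central cochain \<eta> of the overview for two lifts, with a = s(\<sigma>' -
  \<sigma>), still with values in the module.\<close>

definition chg :: "('g=>'gh)=>('g list=>'nh)=>'g=>'g=>'nh" where
 "chg sg' \<omega>' X Y = (let a = (%X. s (sg' X - sg X)) in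
  \<omega>' [X, Y] - \<omega> [X, Y] - (act (sg X) (a Y) - act (sg Y) (a X) - a (brg X Y) + nb (a X) (a Y)))"

text \<open>Here the transgression compares two lifts over the quotient algebra itself. The term b
  is killed by \<alpha>, hence is the image of a z-valued cochain.\<close>

lemma chg:
 assumes "xm_lift C s sg' \<omega>'" shows chg_in: "!!X Y. X:Gq==>Y:Gq==>pz (chg sg' \<omega>' X Y):Zz"
  and inc_chg: "!!X Y. X:Gq==>Y:Gq==>ic (pz (chg sg' \<omega>' X Y)) = chg sg' \<omega>' X Y"
  and chg_alt: "cochain2 Gq (%X Y. pz (chg sg' \<omega>' X Y)):alt_maps 2 Gq Zz"
  and Dz_change: "xm_lift.Dz C sg' \<omega>' - Dz = ce_d 2 Gq brg ga (cochain2 Gq (%X Y. pz (chg sg' \<omega>' X Y)))"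
proof -
 interpret L: xm_lift C s sg' \<omega>' by (rule assms)
 define a where "a = (%X. s (sg' X - sg X))"
 have vN: "sg' X - sg X:nN" if "X:Gq" for X using that by (simp add: nN_iff q_simps)
 have aN [simp]: "a X:Nh" and ala: "ac (a X) = sg' X - sg X" if "X:Gq" for X using vN[OF that] by (simp_all add: nN_iff a_def)
 have a_lin: "a (r*\<^sub>RX + t*\<^sub>RY) = r*\<^sub>Ra X + t*\<^sub>Ra Y" if "X:Gq" "Y:Gq" for r t X Y
  using s_lin[of "sg' X - sg X" "sg' Y - sg Y" r t] vN[OF that(1)] vN[OF that(2)] that by (simp add: nN_iff sg_lin L.sg_lin a_def algebra_simps)
 have a_diff: "a (X - Y) = a X - a Y" if "X:Gq" "Y:Gq" for X Y using a_lin[OF that, of 1 "-1"] by simp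
 define b where "b = chg sg' \<omega>'"
 have b: "b X Y = \<omega>' [X, Y] - \<omega> [X, Y] - (act (sg X) (a Y) - act (sg Y) (a X) - a (brg X Y) + nb (a X) (a Y))" for X Y
  by (simp add: b_def chg_def a_def)
 have sk: "brg (brg X Y) Z = - brg (brg Y X) Z" if "X:Gq" "Y:Gq" "Z:Gq" for X Y Z
  using that brg_skew[of X Y] brg_lin[of "brg Y X" "brg Y X" Z "-1" 0] by simp
 have bN [simp]: "b X Y:Nh" if "X:Gq" "Y:Gq" for X Y using that by (simp add: b)
 have alb: "ac (b X Y) = 0" if "X:Gq" "Y:Gq" for X Y
  by (rule transgression_al[where L = Gq and \<sigma> = sg and \<sigma>' = sg' and bl = brg and a = a, OF _ _ brg_jac sk _ _ _ _ _ _ _ _ _ b that that(1)])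
   (simp_all add: al_\<omega> L.al_\<omega> ala a_diff)
 show bz [simp]: "pz (chg sg' \<omega>' X Y):Zz" and ib: "ic (pz (chg sg' \<omega>' X Y)) = chg sg' \<omega>' X Y" if "X:Gq" "Y:Gq" for X Y
  using inc_pz[OF bN[OF that]] alb[OF that] by (simp_all add: b_def s_zero)
 have b_lin: "b (r*\<^sub>RX + t*\<^sub>RY) Z = r*\<^sub>Rb X Z + t*\<^sub>Rb Y Z" if "X:Gq" "Y:Gq" "Z:Gq" for r t X Y Z
  using that by (simp add: b \<omega>_left L.\<omega>_left sg_lin brg_lin a_lin act_left_simps act_simps nbr_simps algebra_simps)
 have b_skew: "b X Y = - b Y X" if "X:Gq" "Y:Gq" for X Y
  using that \<omega>_skew[of X Y] L.\<omega>_skew[of X Y] nbr_skew[of "a X" "a Y"] brg_skew[of X Y] a_lin[of "brg Y X" "brg Y X" "-1" 0]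
  by (simp add: b)
 show alt: "cochain2 Gq (%X Y. pz (chg sg' \<omega>' X Y)):alt_maps 2 Gq Zz"
 proof (rule alt_maps_2I[OF bz _ _ sub(3)])
  show "pz (chg sg' \<omega>' X Y) = - pz (chg sg' \<omega>' Y X)" if "X:Gq" "Y:Gq" for X Y
   using b_skew[OF that] pz_skew[OF bN[OF that(2,1)]] by (simp add: b_def)
 qed (simp_all add: b_def[symmetric] pz_lin b_lin)
 show "xm_lift.Dz C sg' \<omega>' - Dz = ce_d 2 Gq brg ga (cochain2 Gq (%X Y. pz (chg sg' \<omega>' X Y)))" (is "_ = ?d")
 proof (rule ce_d_2_eqI[OF alt_maps_diff[OF sub(4) L.Dz_alt Dz_alt]], rule inc_inj)
  fix X Y Z assume X: "X:Gq" "Y:Gq" "Z:Gq"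
  have n: "b (brg Z X) Y = - b (brg X Z) Y" "b Z X = - b X Z"
   using X brg_skew[of Z X] b_skew[of Z X] b_lin[of "brg X Z" "brg X Z" Y "-1" 0] by simp_all
  have "L.D X Y Z = D X Y Z + (act (sg X) (b Y Z) - b (brg X Y) Z + (act (sg Y) (b Z X) - b (brg Y Z) X) + (act (sg Z) (b X Y) - b (brg Z X) Y))"
   unfolding D_def L.D_def cov_d_def
   by (rule transgression_d[where L = Gq and \<sigma> = sg and \<sigma>' = sg' and bl = brg and a = a, OF _ _ brg_jac sk _ _ _ _ _ _ _ _ _ b X])
    (simp_all add: al_\<omega> L.al_\<omega> ala a_diff)
  then show "ic ((L.Dz - Dz) [X, Y, Z]) = ic (ce_d 2 Gq brg ga (cochain2 Gq (%X Y. pz (chg sg' \<omega>' X Y))) [X, Y, Z])"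
   using X n by (simp add: inc_simps Dz_at(1,2) L.Dz_at(1,2) ce_d_2 inc_ga ib[folded b_def] b_def[symmetric] act_simps)
 qed
qed

end

section \<open>The crossed module of a bundle\<close>

text \<open>Horizontality of the curvature is an assumption: in the theorem it is read off from the
  horizontal form \<Omega> that lifts the curvature, instead of being derived from the structure
  equation. It is used for the equivariance of \<alpha> (\<open>al_equiv\<close>).\<close>

locale geo = pconn B \<theta> + pext B E + fin_coords Bs cf
 for B :: "('m::t2_space, 'a::lcs, 'p::t2_space, 'c::lcs, 'k::t2_space, 'b::lcs) pbundle" and \<theta>
  and E :: "('z::t2_space, 'y::lcs, 'h::t2_space, 'd::lcs, 'k) cext" and Bs :: "'a set" and cf +
 fixes s0 :: "'b=>'d"
 assumes s0: "linear s0" "continuous_on UNIV s0" "Lhom (hgrp E) (sgrp B) (hquot E) (s0 x) = x"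
  and par: "paracompact_space (euclidean :: 'm topology)"
  and horizontal: "c:total B==>p:cdom c==>d:base B==>proj B p:cdom d==>tang c d (proj B) p v = 0 ==>
   curvature B \<theta> c p v w = 0"
begin

abbreviation "CC \<equiv> assoc_xmod B E"
abbreviation "GHT \<equiv> cinf_top PP (aut B) (%X. X)"
abbreviation "NHT \<equiv> cinf_top PP HS (%\<xi> _. \<xi>)"
abbreviation "GGT \<equiv> cinf_top MM (vfields MM) (%X. X)"
abbreviation "ZZT \<equiv> cinf_top MM ZF (%f _. f)"

lemma CC_simps [simp]: "gh_top CC = GHT" "gh_br CC = vf_bracket PP" "nh_top CC = NHT"
 "nh_br CC = (%\<xi> \<eta> p. brH (\<xi> p) (\<eta> p))" "gh_act CC = vf_deriv PP" "alpha CC = al" "g_top CC = GGT"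
 "g_br CC = vf_bracket MM" "qt CC = qg B" "z_top CC = ZZT" "inc CC = incl" "g_act CC = vf_deriv MM"
 by (simp_all add: assoc_xmod_def incl_def[abs_def])

lemma top_simps [simp]: "topspace GHT = aut B" "topspace NHT = HS" "topspace GGT = vfields MM" "topspace ZZT = ZF"
 by (simp_all add: topspace_cinf_top atlas_nonempty[OF manM] atlas_nonempty[OF manP])

section \<open>Continuity of the operations on fields and sections\<close>

lemma eventually_atin_in: "t:topspace T==>continuous_map T (cinf_top A S ev) f==>A \<noteq> {}==>eventually (%t. f t:S) (atin T t)"
 using continuous_map_funspace[of T "cinf_top A S ev" f] topspace_cinf_top[of A S ev] by (auto simp: eventually_atin intro!: exI[of _ "topspace T"])

lemma ghD:
 assumes "continuous_map T GHT f" "t:topspace T" "c:PP" "p:cdom c" shows "lmcv PP (atin T t) p (%t. f t c) (f t c)"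
 by (rule lmcvI[OF continuous_map_cinf_vfD[OF manP assms(1,2) _ assms(3)] open_cdom[OF manP assms(3)] assms(4)])
  (use autD in blast)

lemma gD:
 assumes "continuous_map T GGT f" "t:topspace T" "c:MM" "p:cdom c" shows "lmcv MM (atin T t) p (%t. f t c) (f t c)"
 by (rule lmcvI[OF continuous_map_cinf_vfD[OF manM assms(1,2) _ assms(3)] open_cdom[OF manM assms(3)] assms(4)]) simp

lemma nhD:
 assumes "continuous_map T NHT f" "t:topspace T" shows "lmcv PP (atin T t) p f (f t)"
 by (rule lmcvI[OF continuous_map_cinf_funD[OF manP assms HS_msm] open_UNIV]) simp_all

lemma zD:
 assumes "continuous_map T ZZT f" "t:topspace T" shows "lmcv MM (atin T t) p f (f t)"
 by (rule lmcvI[OF continuous_map_cinf_funD[OF manM assms] open_UNIV]) (simp_all add: ZF_iff)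

lemma ghI:
 assumes "!!t. t:topspace T==>f t:aut B"
  "!!t c p. t:topspace T==>c:PP==>p:cdom c==>lmcv PP (atin T t) p (%t. f t c) (f t c)" shows "continuous_map T GHT f"
 by (rule continuous_map_cinf_vfI[OF manP assms(1) _ assms(2)[unfolded lmcv_def]]) (use autD in blast)+

lemma gI:
 assumes "!!t. t:topspace T==>f t:vfields MM"
  "!!t c p. t:topspace T==>c:MM==>p:cdom c==>lmcv MM (atin T t) p (%t. f t c) (f t c)" shows "continuous_map T GGT f"
 by (rule continuous_map_cinf_vfI[OF manM assms(1) order_refl assms(2)[unfolded lmcv_def]])

lemma nhI:
 assumes "!!t. t:topspace T==>f t:HS" "!!t p. t:topspace T==>lmcv PP (atin T t) p f (f t)" shows "continuous_map T NHT f"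
 by (rule continuous_map_cinf_funI[OF manP assms(1) HS_msm assms(2)[unfolded lmcv_def]])

lemma zI:
 assumes "!!t. t:topspace T==>f t:ZF" "!!t p. t:topspace T==>lmcv MM (atin T t) p f (f t)" shows "continuous_map T ZZT f"
 by (rule continuous_map_cinf_funI[OF manM assms(1) iffD1[OF ZF_iff] assms(2)[unfolded lmcv_def]])

text \<open>As \<open>TM\<close> has finite rank, only finitely many derivatives of \<open>\<xi>\<close> enter in the action of a field \<open>X\<close>:
  the vertical part of \<open>X\<close> acts algebraically.\<close>

lemma deriv_decompose:
 assumes X: "X:aut B" and \<xi>: "\<xi>:HS" and c: "c:PP" "p:cdom c" and d: "d:MM" "pr p:cdom d"
 shows "vf_deriv PP X \<xi> p = (\<Sum>b\<in>Bs. cf b (tang c d pr p (X c p))*\<^sub>Rtang c lchart \<xi> p (hv c d p b))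
  - brH (s0 (\<theta> c p (X c p))) (\<xi> p)"
proof -
 let ?w = "tang c d pr p (X c p)" and ?x = "\<theta> c p (X c p)"
 have lin: "linear (tang c lchart \<xi> p)" by (rule tang_lchart_linear[OF manP HS_at[OF \<xi>] c])
 have "X c p = hv c d p ?w + fundv B ?x c p" by (rule tangent_eqI[OF c d])
   (simp_all add: linear_add[OF tang_proj_linear[OF c d]] linear_add[OF th_linear[OF c]] tang_hv[OF c d] th_hv[OF c d]
    tang_proj_fundv[OF c d] th_fundv[OF c])
 then have "vf_deriv PP X \<xi> p = tang c lchart \<xi> p (hv c d p ?w) + tang c lchart \<xi> p (fundv B (Lq (s0 ?x)) c p)"
  using vf_deriv_at[OF autD[OF X] \<xi> c] linear_add[OF lin] s0(3) by metis
 moreover have "tang c lchart \<xi> p (hv c d p ?w) = (\<Sum>b\<in>Bs. cf b ?w*\<^sub>Rtang c lchart \<xi> p (hv c d p b))"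
  using linear_expand[OF fin_coords_axioms linear_compose[OF hv_linear[OF c d] lin], of ?w] by (simp only: o_def)
 ultimately show ?thesis using tang_HS_fundv[OF \<xi> c] by simp
qed

text \<open>After the decomposition the varying X enters only through scalar coefficients and an
  algebraic bracket, while \<xi> is differentiated along fixed horizontal fields. Each summand is
  then a continuous operation.\<close>

lemma cm_deriv: "continuous_map (prod_topology GHT NHT) NHT (%(X, \<xi>). vf_deriv PP X \<xi>)" unfolding case_prod_unfold
proof (rule nhI)
 let ?T = "prod_topology GHT NHT"
 fix t assume t: "t:topspace ?T"
 then have st: "fst t:aut B" "snd t:HS" by auto
 show "vf_deriv PP (fst t) (snd t):HS" by (rule HS_deriv[OF st])
 fix p
 obtain c where c: "c:PP" "p:cdom c" using ex_chart[OF manP] by blast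
 obtain d where d: "d:MM" "pr p:cdom d" using ex_chart[OF manM] by blast
 let ?W = "cdom c\<inter>pr -` cdom d"
 have W: "open ?W" "p:?W" using c d open_cdom[OF manP c(1)] open_over[OF open_cdom[OF manM d(1)]] by auto
 have X: "lmcv PP (atin ?T t) p (%t. fst t c) (fst t c)" by (rule ghD[OF continuous_map_fst t c])
 have \<xi>: "lmcv PP (atin ?T t) p snd (snd t)" by (rule nhD[OF continuous_map_snd t])
 have w: "lmcv PP (atin ?T t) p (%t q. tang c d pr q (fst t c q)) (%q. tang c d pr q (fst t c q))"
  by (rule lmcv_tang_along[OF manP manP manM proj_at smooth_at_id[OF manP] c d X])
 have h: "smooth_at PP lin_atlas (%q. hv c d q b) p" for b
  by (rule lmcv_smooth_at[OF manP lmcv_hv[OF c d lmcv_const[OF manP smooth_at_const, where F = "bot :: unit filter"]]])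
 have "lmcv PP (atin ?T t) p (%t q. (\<Sum>b\<in>Bs. cf b (tang c d pr q (fst t c q))*\<^sub>Rtang c lchart (snd t) q (hv c d q b))
   - brH (s0 (\<theta> c q (fst t c q))) (snd t q))
  (%q. (\<Sum>b\<in>Bs. cf b (tang c d pr q (fst t c q))*\<^sub>Rtang c lchart (snd t) q (hv c d q b)) - brH (s0 (\<theta> c q (fst t c q))) (snd t q))"
  by (intro lmcv_diff[OF manP] lmcv_sum[OF manP] lmcv_scaleR[OF manP] lmcv_linear[OF manP w] cf_linear cf_cont lmcv_tang[OF manP c \<xi> h]
    lmcv_bilinear[OF manP _ \<xi> H.lie_br_bilinear H.lie_br_continuous] lmcv_linear[OF manP lmcv_theta[OF c X] s0(1,2)])
 then show "lmcv PP (atin ?T t) p (%t. vf_deriv PP (fst t) (snd t)) (vf_deriv PP (fst t) (snd t))"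
 proof (rule lmcv_cong_ev[OF manP _ W])
  \<comment> \<open>The decomposition holds for invariant fields and equivariant functions only, and
    the filter is eventually concentrated on these.\<close>
  have "eventually (%t. fst t:aut B\<and>snd t:HS) (atin ?T t)" by (intro eventually_conj eventually_atin_in[OF t continuous_map_fst]
     eventually_atin_in[OF t continuous_map_snd] atlas_nonempty[OF manP])
  then show "eventually (%i. \<forall>q\<in>?W. (\<Sum>b\<in>Bs. cf b (tang c d pr q (fst i c q))*\<^sub>Rtang c lchart (snd i) q (hv c d q b))
   - brH (s0 (\<theta> c q (fst i c q))) (snd i q) = vf_deriv PP (fst i) (snd i) q) (atin ?T t)"
  proof (rule eventually_mono, intro ballI)
   fix i q assume "fst i:aut B\<and>snd i:HS" "q:?W"
   then show "(\<Sum>b\<in>Bs. cf b (tang c d pr q (fst i c q))*\<^sub>Rtang c lchart (snd i) q (hv c d q b))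
    - brH (s0 (\<theta> c q (fst i c q))) (snd i q) = vf_deriv PP (fst i) (snd i) q" by (intro deriv_decompose[symmetric] c d) auto
  qed
 next
  fix q assume "q:?W"
  then show "(\<Sum>b\<in>Bs. cf b (tang c d pr q (fst t c q))*\<^sub>Rtang c lchart (snd t) q (hv c d q b))
    - brH (s0 (\<theta> c q (fst t c q))) (snd t q) = vf_deriv PP (fst t) (snd t) q" by (intro deriv_decompose[symmetric] c d st) auto
 qed
qed

text \<open>The same device on M, with the constant fields of a chart in the role of the fixed
  directions.\<close>

lemma bracket_decompose:
 assumes X: "X:vfields MM" "Y:vfields MM" and c: "c:MM" "p:cdom c"
 shows "vf_bracket MM X Y c p = (\<Sum>b\<in>Bs. cf b (X c p)*\<^sub>Rtang c lchart (Y c) p b) - (\<Sum>b\<in>Bs. cf b (Y c p)*\<^sub>Rtang c lchart (X c) p b)"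
proof -
 have l: "linear (tang c lchart (X c) p)" if "X:vfields MM" for X
  by (rule tang_lchart_linear[OF manM msm_smooth_at[OF manM vf_msm[OF manM that c(1)] open_cdom[OF manM c(1)] c(2)] c])
 show ?thesis using linear_expand[OF fin_coords_axioms l[OF X(1)], of "Y c p"] linear_expand[OF fin_coords_axioms l[OF X(2)], of "X c p"] c
  by (simp add: vf_bracket_def tang_lchart)
qed

lemma cm_bracket: "continuous_map (prod_topology GGT GGT) GGT (%(X, Y). vf_bracket MM X Y)" unfolding case_prod_unfold
proof (rule gI)
 let ?T = "prod_topology GGT GGT"
 fix t assume t: "t:topspace ?T"
 then have st: "fst t:vfields MM" "snd t:vfields MM" by auto
 show "vf_bracket MM (fst t) (snd t):vfields MM" by (rule vf_bracket_in[OF manM st])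
 fix c p assume c: "c:MM" "p:cdom c"
 have X: "lmcv MM (atin ?T t) p (%t. fst t c) (fst t c)" by (rule gD[OF continuous_map_fst t c])
 have Y: "lmcv MM (atin ?T t) p (%t. snd t c) (snd t c)" by (rule gD[OF continuous_map_snd t c])
 have "lmcv MM (atin ?T t) p (%t q. (\<Sum>b\<in>Bs. cf b (fst t c q)*\<^sub>Rtang c lchart (snd t c) q b) - (\<Sum>b\<in>Bs. cf b (snd t c q)*\<^sub>Rtang c lchart (fst t c) q b))
  (%q. (\<Sum>b\<in>Bs. cf b (fst t c q)*\<^sub>Rtang c lchart (snd t c) q b) - (\<Sum>b\<in>Bs. cf b (snd t c q)*\<^sub>Rtang c lchart (fst t c) q b))"
  by (intro lmcv_diff[OF manM] lmcv_sum[OF manM] lmcv_scaleR[OF manM] lmcv_linear[OF manM X] lmcv_linear[OF manM Y] cf_linear cf_cont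
    lmcv_tang[OF manM c X smooth_at_const] lmcv_tang[OF manM c Y smooth_at_const])
 then show "lmcv MM (atin ?T t) p (%t. vf_bracket MM (fst t) (snd t) c) (vf_bracket MM (fst t) (snd t) c)"
 proof (rule lmcv_cong_ev[OF manM _ open_cdom[OF manM c(1)] c(2)])
  have "eventually (%t. fst t:vfields MM\<and>snd t:vfields MM) (atin ?T t)" by (intro eventually_conj eventually_atin_in[OF t continuous_map_fst]
     eventually_atin_in[OF t continuous_map_snd] atlas_nonempty[OF manM])
  then show "eventually (%i. \<forall>q\<in>cdom c. (\<Sum>b\<in>Bs. cf b (fst i c q)*\<^sub>Rtang c lchart (snd i c) q b) - (\<Sum>b\<in>Bs. cf b (snd i c q)*\<^sub>Rtang c lchart (fst i c) q b)
   = vf_bracket MM (fst i) (snd i) c q) (atin ?T t)" by (rule eventually_mono) (intro ballI bracket_decompose[symmetric] c(1); simp)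
 qed (rule bracket_decompose[symmetric, OF st c(1)])
qed

lemma cm_gh_minus: "continuous_map (prod_topology GHT GHT) GHT (%(X, Y). X - Y)" unfolding case_prod_unfold
proof (rule ghI)
 let ?T = "prod_topology GHT GHT"
 fix t assume t: "t:topspace ?T"
 then show "fst t - snd t:aut B" by (auto intro: subspace_diff[OF subspace_aut])
 fix c p assume c: "c:PP" "p:cdom c"
 show "lmcv PP (atin ?T t) p (%t. (fst t - snd t) c) ((fst t - snd t) c)"
  using lmcv_diff[OF manP ghD[OF continuous_map_fst t c] ghD[OF continuous_map_snd t c]] by (simp add: fun_diff_def)
qed

lemma cm_nh_lin: "continuous_map (prod_topology NHT NHT) NHT (%(x, y). x - y)" "continuous_map (prod_topology NHT NHT) NHT (%(x, y). x + y)"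
proof -
 let ?T = "prod_topology NHT NHT"
 have d: "lmcv PP (atin ?T t) p (%t. fst t - snd t) (fst t - snd t)" "lmcv PP (atin ?T t) p (%t. fst t + snd t) (fst t + snd t)"
  if t: "t:topspace ?T" for t p
  using lmcv_diff[OF manP nhD[OF continuous_map_fst t] nhD[OF continuous_map_snd t]] lmcv_add[OF manP nhD[OF continuous_map_fst t] nhD[OF continuous_map_snd t]]
  by (simp_all add: fun_diff_def plus_fun_def)
 show "continuous_map ?T NHT (%(x, y). x - y)" unfolding case_prod_unfold by (rule nhI[OF _ d(1)]) (auto intro: subspace_diff[OF subspace_HS])
 show "continuous_map ?T NHT (%(x, y). x + y)" unfolding case_prod_unfold by (rule nhI[OF _ d(2)]) (auto intro: subspace_add[OF subspace_HS])
qed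

lemma cm_z_lin: "continuous_map (prod_topology ZZT ZZT) ZZT (%(x, y). x - y)" "continuous_map (prod_topology ZZT ZZT) ZZT (%(x, y). x + y)"
proof -
 let ?T = "prod_topology ZZT ZZT"
 have d: "lmcv MM (atin ?T t) p (%t. fst t - snd t) (fst t - snd t)" "lmcv MM (atin ?T t) p (%t. fst t + snd t) (fst t + snd t)"
  if t: "t:topspace ?T" for t p
  using lmcv_diff[OF manM zD[OF continuous_map_fst t] zD[OF continuous_map_snd t]] lmcv_add[OF manM zD[OF continuous_map_fst t] zD[OF continuous_map_snd t]]
  by (simp_all add: fun_diff_def plus_fun_def)
 show "continuous_map ?T ZZT (%(x, y). x - y)" unfolding case_prod_unfold by (rule zI[OF _ d(1)]) (auto intro: subspace_diff[OF subspace_ZF])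
 show "continuous_map ?T ZZT (%(x, y). x + y)" unfolding case_prod_unfold by (rule zI[OF _ d(2)]) (auto intro: subspace_add[OF subspace_ZF])
qed

lemma cm_alpha: "continuous_map NHT GHT al" by (rule ghI[OF al_in lmcv_alpha[OF _ _ nhD[OF continuous_map_id, unfolded id_def]]]) simp_all

lemma cm_qg: "continuous_map GHT GGT (qg B)"
proof (rule gI)
 fix X assume X: "X:topspace GHT"
 then show "qg B X:vfields MM" by (simp add: qg_in)
 fix d m assume d: "d:MM" "m:cdom d"
 show "lmcv MM (atin GHT X) m (%X. qg B X d) (qg B X d)"
 proof (rule lmcv_push[OF d])
  show "lmcv PP (atin GHT X) p (%X. X c) (X c)" if "pr p = m" "c:PP" "p:cdom c" for p c
   by (rule ghD[OF continuous_map_id, unfolded id_def, OF X that(2,3)])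
  show "eventually (%X. related X (qg B X)) (atin GHT X)"
   by (rule eventually_mono[OF eventually_atin_in[OF X continuous_map_id atlas_nonempty[OF manP]]]) (simp add: related_qg)
  show "related X (qg B X)" using X by (simp add: related_qg)
 qed
qed

lemma cm_incl: "continuous_map ZZT NHT incl" by (rule nhI[OF incl_in lmcv_incl[OF zD[OF continuous_map_id, unfolded id_def]]]) simp_all

lemma cm_incl_inverse: "continuous_map (subtopology NHT (incl ` ZF)) ZZT (inv_into ZF incl)"
proof (rule zI)
 let ?T = "subtopology NHT (incl ` ZF)"
 fix \<xi> assume \<xi>: "\<xi>:topspace ?T"
 then have r: "\<xi>:incl ` ZF" by auto
 show "inv_into ZF incl \<xi>:ZF" by (rule inv_into_into[OF r])
 have c: "continuous_map ?T NHT (%\<xi>. \<xi>)" by (rule continuous_map_from_subtopology[OF continuous_map_id, unfolded id_def])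
 fix m
 show "lmcv MM (atin ?T \<xi>) m (inv_into ZF incl) (inv_into ZF incl \<xi>)"
 proof (rule lmcv_incl_inverse)
  fix p
  have "eventually (%\<xi>. \<forall>q\<in>UNIV. \<xi> q = incl (inv_into ZF incl \<xi>) q) (atin ?T \<xi>)" unfolding eventually_atin
  proof (intro disjI2 exI[of _ "topspace ?T"] conjI openin_topspace \<xi> ballI)
   fix \<eta> q assume "\<eta>:topspace ?T - {\<xi>}"
   then have "\<eta>:incl ` ZF" by simp
   then show "\<eta> q = incl (inv_into ZF incl \<eta>) q" by (simp only: f_inv_into_f)
  qed
  then show "lmcv PP (atin ?T \<xi>) p (%\<xi>. incl (inv_into ZF incl \<xi>)) (incl (inv_into ZF incl \<xi>))"
   by (rule lmcv_cong_ev[OF manP nhD[OF c \<xi>] open_UNIV UNIV_I]) (simp add: f_inv_into_f[OF r])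
 qed
qed

text \<open>The connection is arbitrary because the last claim of the theorem compares two
  connections within one crossed module.\<close>

lemma cm_hlift:
 assumes "pconn B \<theta>'" shows "continuous_map GGT GHT (hlift B \<theta>')"
proof -
 interpret L: pconn B \<theta>' by (rule assms)
 show ?thesis
 proof (rule ghI)
  fix X assume X: "X:topspace GGT"
  then show "hlift B \<theta>' X:aut B" by (simp add: L.hlift_in)
  fix c p assume c: "c:PP" "p:cdom c"
  show "lmcv PP (atin GGT X) p (%X. hlift B \<theta>' X c) (hlift B \<theta>' X c)"
  proof (rule L.lmcv_is_hlift[OF c])
   show "lmcv MM (atin GGT X) (pr p) (%X. X d) (X d)" if "d:MM" "pr p:cdom d" for d by (rule gD[OF continuous_map_id, unfolded id_def, OF X that])
   show "eventually (%X. L.is_hlift X (hlift B \<theta>' X)) (atin GGT X)"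
    by (rule eventually_mono[OF eventually_atin_in[OF X continuous_map_id atlas_nonempty[OF manM]]]) (simp add: L.is_hlift_hlift)
   show "L.is_hlift X (hlift B \<theta>' X)" using X by (simp add: L.is_hlift_hlift)
  qed
 qed
qed

text \<open>Both sides project to 0 on M, so \<theta> decides. The curvature vanishes on the
  vertical field \<alpha>(\<xi>); in Cartan's formula the bracket of \<theta>-values cancels the
  derivative of \<theta>(X) along the fibre, and what is left equates \<theta>([\<alpha>(\<xi>), X])
  with \<open>Lq\<close> of X.\<xi>.\<close>

lemma al_equiv:
 assumes X: "X:aut B" and \<xi>: "\<xi>:HS" shows "al (vf_deriv PP X \<xi>) = vf_bracket PP X (al \<xi>)"
proof (rule aut_eqI[OF al_in[OF HS_deriv[OF X \<xi>]] aut_bracket[OF X al_in[OF \<xi>]]])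
 note V = al_in[OF \<xi>]
 have "vf_bracket MM (qg B X) 0 = 0" using vf_bracket_scale_left[OF manM vf_zero[OF manM] qg_in[OF X], of 0] vf_bracket_skew[OF manM, of _ 0] by simp
 then show "qg B (al (vf_deriv PP X \<xi>)) = qg B (vf_bracket PP X (al \<xi>))" by (simp add: qg_al HS_deriv X \<xi> qg_bracket V)
 fix c p assume c: "c:PP" "p:cdom c"
 obtain d where d: "d:MM" "pr p:cdom d" using ex_chart[OF manM] by blast
 have Lm: "linear (%y. - Lq y)" "continuous_on UNIV (%y. - Lq y)"
  using q.Lhom_linear q.Lhom_continuous by (auto intro: linear_compose_neg continuous_on_minus)
 have "tang c lchart (%q. \<theta> c q (al \<xi> c q)) p (X c p) = tang c lchart (%q. - Lq (\<xi> q)) p (X c p)" unfolding tang_lchart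
  by (rule ddir_cong[OF open_cimg[OF manP c(1)] cmap_cimg[OF c(2)]]) (simp add: al_at c(1) th_fundv cinv_cdom)
 also have "\<dots> = - Lq (vf_deriv PP X \<xi> p)"
  using tang_linear_fun[OF manP HS_at[OF \<xi>] c Lm] by (simp add: vf_deriv_at[OF autD[OF X] \<xi> c])
 finally have 1: "tang c lchart (%q. \<theta> c q (al \<xi> c q)) p (X c p) = - Lq (vf_deriv PP X \<xi> p)" .
 have "curvature B \<theta> c p (al \<xi> c p) (X c p) = 0" by (rule horizontal[OF c d]) (simp add: al_at[OF c] tang_proj_fundv[OF c d])
 then have "\<theta> c p (vf_bracket PP (al \<xi>) X c p) = Lq (vf_deriv PP X \<xi> p)"
  unfolding curvature_fields[OF autD[OF V] autD[OF X] c] 1 by (simp add: tang_thv_fundv[OF X c] al_at[OF c] th_fundv[OF c])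
 then show "\<theta> c p (al (vf_deriv PP X \<xi>) c p) = \<theta> c p (vf_bracket PP X (al \<xi>) c p)"
  using vf_bracket_skew[OF manP, of X "al \<xi>"] by (simp add: al_at[OF c] th_fundv[OF c] linear_neg[OF th_linear[OF c]])
qed

sublocale X: xm CC
proof (rule xm.intro; unfold CC_simps top_simps)
 show "subspace (aut B)" "subspace HS" "subspace (vfields MM)" "subspace ZF"
  by (rule subspace_aut subspace_HS subspace_vfields[OF manM] subspace_ZF)+
 fix x y x' assume *: "x:aut B" "y:aut B" "x':aut B"
 show "vf_bracket PP x (y + x') = vf_bracket PP x y + vf_bracket PP x x'" by (rule vf_bracket_add_right[OF manP autD autD autD]) (use * in simp_all)
 show "vf_bracket PP x (vf_bracket PP y x') + vf_bracket PP y (vf_bracket PP x' x) + vf_bracket PP x' (vf_bracket PP x y) = 0"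
  by (rule vf_jacobi[OF manP autD autD autD]) (use * in simp_all)
next
 fix x y assume *: "x:aut B" "y:aut B"
 show "vf_bracket PP x y:aut B" by (rule aut_bracket[OF *])
 show "vf_bracket PP (a*\<^sub>Rx) y = a*\<^sub>Rvf_bracket PP x y" for a by (rule vf_bracket_scale_left[OF manP autD[OF *(1)] autD[OF *(2)]])
 show "qg B (vf_bracket PP x y) = vf_bracket MM (qg B x) (qg B y)" by (rule qg_bracket[OF *])
 show "qg B (a*\<^sub>Rx + b*\<^sub>Ry) = a*\<^sub>Rqg B x + b*\<^sub>Rqg B y" for a b using * by (simp add: qg_add qg_scale aut_scale)
 fix n assume n: "n:HS"
 show "vf_deriv PP (a*\<^sub>Rx + b*\<^sub>Ry) n = a*\<^sub>Rvf_deriv PP x n + b*\<^sub>Rvf_deriv PP y n" for a b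
  using vf_deriv_add_field[OF manP autD[OF *(1)] autD[OF *(2)] HS_msm[OF n]] by (simp add: fun_eq_iff scaleR_fun_def)
 show "vf_deriv PP (vf_bracket PP x y) n = vf_deriv PP x (vf_deriv PP y n) - vf_deriv PP y (vf_deriv PP x n)"
  using vf_deriv_bracket[OF manP autD[OF *(1)] autD[OF *(2)] HS_msm[OF n]] by (simp add: fun_eq_iff)
next
 fix x n n' a b assume x: "x:aut B" and n: "n:HS" "n':HS"
 show "vf_deriv PP x (a*\<^sub>Rn + b*\<^sub>Rn') = a*\<^sub>Rvf_deriv PP x n + b*\<^sub>Rvf_deriv PP x n'"
 proof
  fix p
  have m: "msm PP UNIV (%p. r*\<^sub>R\<xi> p)" if "\<xi>:HS" for r \<xi> using HS_msm[OF HS_scale[OF that, of r]] by (simp add: scaleR_fun_def)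
  have s: "vf_deriv PP x (%p. r*\<^sub>R\<xi> p) p = r*\<^sub>Rvf_deriv PP x \<xi> p" if "\<xi>:HS" for r \<xi>
   by (rule vf_deriv_linear_fun[OF manP autD[OF x] HS_msm[OF that]]) (simp_all add: linear_scale_self continuous_on_scaleR' continuous_on_id continuous_on_const)
  show "vf_deriv PP x (a*\<^sub>Rn + b*\<^sub>Rn') p = (a*\<^sub>Rvf_deriv PP x n + b*\<^sub>Rvf_deriv PP x n') p"
   using vf_deriv_add_fun[OF manP autD[OF x] m[OF n(1), of a] m[OF n(2), of b], of p] s n by (simp add: scaleR_fun_def plus_fun_def)
 qed
next
 fix x y show "vf_bracket PP x y = - vf_bracket PP y x" by (rule vf_bracket_skew[OF manP])
next
 fix n n' show "(%p. brH (n p) (n' p)) = - (%p. brH (n' p) (n p))" by (simp add: fun_eq_iff) (intro allI H.lie_br_skew)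
next
 fix n n' assume "n:HS" "n':HS"
 then show "vf_deriv PP (al n) n' = (%p. brH (n p) (n' p))" by (simp add: fun_eq_iff deriv_al)
next
 fix n assume n: "n:HS" "al n = 0"
 show "n:incl ` ZF"
 proof (rule al_zero_Lq[OF n])
  fix c p x assume "c:PP" "p:cdom c" "fundv B x c p = 0"
  then show "x = 0" using th_fundv[of c p x] linear_0[OF th_linear] by metis
 qed
qed (simp_all add: HS_deriv al_in al_lin al_equiv qg_in qg_al incl_in incl_lin incl_inj al_incl deriv_incl)

end

context geo
begin

text \<open>In a local trivialization the section of \<open>\<alpha>\<close> is given by the linear splitting of \<open>q\<^sub>k\<close>;
  a partition of unity patches these.\<close>

lemma section_exists:
 obtains sec where "!!V. V:aut B==>sec V:HS"
  "!!V. V:aut B==>qg B V = 0==>al (sec V) = V"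
  "!!V W a b. V:aut B==>W:aut B==>sec (a*\<^sub>RV + b*\<^sub>RW) = a*\<^sub>Rsec V + b*\<^sub>Rsec W"
  "!!V g. V:aut B==>msm MM UNIV (g :: 'm=>real)==>sec (%c p. g (pr p)*\<^sub>RV c p) = (%p. g (pr p)*\<^sub>Rsec V p)"
  "continuous_map GHT NHT sec"
proof -
 have "\<exists>U \<kappa>. open U\<and>m:U\<and>smooth_map_on (pr -` U) PP KA \<kappa>\<and>(\<forall>p k. pr p:U-->\<kappa> (ra p k) = mul KK (\<kappa> p) k)" for m
 proof -
  obtain U \<tau> \<kappa> where U: "open U" "m:U" "smooth_map_on (pr -` U) PP KA \<kappa>"
   "!!p. pr p:U==>ra (\<tau> (pr p)) (\<kappa> p) = p" "!!u k. u:U==>\<kappa> (ra (\<tau> u) k) = k" by (rule local_section[of m]) blast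
  have "\<kappa> (ra p k) = mul KK (\<kappa> p) k" if "pr p:U" for p k
   using U(4)[OF that] U(5)[OF that, of "mul KK (\<kappa> p) k"] ract_mul by metis
  then show ?thesis using U(1-3) by blast
 qed
 then have "\<forall>m. \<exists>U \<kappa>. open U\<and>m:U\<and>smooth_map_on (pr -` U) PP KA \<kappa>\<and>(\<forall>p k. pr p:U-->\<kappa> (ra p k) = mul KK (\<kappa> p) k)" by blast
 from choice[OF this] obtain N where "\<forall>m. \<exists>\<kappa>. open (N m)\<and>m:N m\<and>smooth_map_on (pr -` N m) PP KA \<kappa>\<and>(\<forall>p k. pr p:N m-->\<kappa> (ra p k) = mul KK (\<kappa> p) k)"
  by blast
 from choice[OF this] obtain \<kappa> where N: "!!m. open (N m)" "!!m. m:N m" "!!m. smooth_map_on (pr -` N m) PP KA (\<kappa> m)"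
  "!!m p k. pr p:N m==>\<kappa> m (ra p k) = mul KK (\<kappa> m p) k" by blast
 obtain J :: "'m set set" and \<psi> :: "'m set=>'m=>real" and x C where J: "!!j. j:J==>msm MM UNIV (\<psi> j)" "!!j. j:J==>closed (C j)"
  "!!j. j:J==>C j\<subseteq>N (x j)" "!!j u. j:J==>u\<notin>C j==>\<psi> j u = 0"
  "!!m. \<exists>U. open U\<and>m:U\<and>finite {j:J. \<exists>u\<in>U. \<psi> j u \<noteq> 0}" "!!m. (\<Sum>j | j:J\<and>\<psi> j m \<noteq> 0. \<psi> j m) = 1"
  by (rule partition_of_unity[OF manM par N(1,2)]) (rule that)
 \<comment> \<open>The value is transported by Ad to the section of the trivialization, split there
   by s0, and transported back. This makes the result equivariant although s0 is not; the minus sign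
   matches that of \<open>sec_alpha\<close>.\<close>
 define t where "t j q v = \<psi> j (pr q)*\<^sub>RAdh E (ginv KK (\<kappa> (x j) q)) (s0 (Ad KK (\<kappa> (x j) q) (- v)))" for j q v
 \<comment> \<open>Through \<open>thv\<close> the formula makes sense for every invariant field; on
   vertical fields it is a right inverse of \<alpha>. Only nonzero weights are summed, since the
   index set may be infinite.\<close>
 define sec where "sec V q = (\<Sum>j | j:J\<and>\<psi> j (pr q) \<noteq> 0. t j q (thv V q))" for V q
 have tlin: "linear (t j q)" for j q unfolding t_def
  by (intro linearI) (simp_all add: linear_add[OF Adh_linear] linear_scale[OF Adh_linear] linear_add[OF s0(1)] linear_scale[OF s0(1)]
    linear_diff[OF K.Ad_linear] linear_scale[OF K.Ad_linear] linear_neg[OF K.Ad_linear] linear_diff[OF s0(1)] linear_diff[OF Adh_linear]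
    linear_neg[OF s0(1)] linear_neg[OF Adh_linear] scaleR_add_right scaleR_diff_right)
 \<comment> \<open>One statement for two purposes: the trivial filter yields smoothness of
   \<open>sec V\<close>, the filters \<open>atin GHT V\<close> yield continuity of
   \<open>sec\<close>.\<close>
 have lm: "lmcv PP F p (%i. sec (X i)) (sec X')"
  if X: "eventually (%i. X i:aut B) F" "X':aut B" and c: "c:PP" "p:cdom c" and l: "lmcv PP F p (%i. X i c) (X' c)" for F :: "'i filter" and p c X X'
 proof -
  have tl: "lmcv PP F p (%i q. \<theta> c q (X i c q)) (%q. \<theta> c q (X' c q))" by (rule lmcv_theta[OF c l])
  have tj: "lmcv PP F p (%i q. t j q (\<theta> c q (X i c q))) (%q. t j q (\<theta> c q (X' c q)))" if j: "j:J" for j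
  proof (cases "pr p:N (x j)")
   case True
   have sk: "smooth_at PP KA (\<kappa> (x j)) p" by (rule smooth_atI[OF N(3) open_over[OF N(1)]]) (use True in simp)
   have si: "smooth_at PP KA (%q. ginv KK (\<kappa> (x j) q)) p" by (rule smooth_at_comp[OF manP K.manG K.manG sk K.smooth_at_ginv])
   have sp: "smooth_at PP lin_atlas (%q. \<psi> j (pr q)) p"
    by (rule smooth_at_comp[OF manP manM manifold_lin proj_at msm_smooth_at[OF manM J(1)[OF j] open_UNIV UNIV_I]])
   have m: "linear (%v :: 'b. - v)" "continuous_on UNIV (%v :: 'b. - v)" by (auto intro!: linearI continuous_on_minus continuous_on_id)
   show ?thesis unfolding t_def by (intro lmcv_scaleR[OF manP lmcv_const[OF manP sp]] lmcv_Adh[OF manP si] lmcv_linear[OF manP _ s0(1,2)]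
      K.lmcv_Ad[OF manP sk] lmcv_linear[OF manP tl m])
  next
   case False
   \<comment> \<open>Outside N the group coordinate is arbitrary, but there the weight vanishes near
     p, because it is zero off the closed set C, which lies inside N.\<close>
   have W: "open (pr -` (- C j))" "p:pr -` (- C j)" using J(2,3)[OF j] False open_over open_Compl by auto
   show ?thesis by (rule lmcv_cong[OF manP lmcv_const[OF manP smooth_at_const[of _ _ 0]] W]) (simp_all add: t_def J(4)[OF j])
  qed
  obtain U where U: "open U" "pr p:U" "finite {j:J. \<exists>u\<in>U. \<psi> j u \<noteq> 0}" using J(5) by blast
  let ?J = "{j:J. \<exists>u\<in>U. \<psi> j u \<noteq> 0}" and ?W = "cdom c\<inter>pr -` U"
  have W: "open ?W" "p:?W" using open_cdom[OF manP c(1)] open_over[OF U(1)] c(2) U(2) by auto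
  have e: "(\<Sum>j\<in>?J. t j q (\<theta> c q (V c q))) = sec V q" if V: "V:aut B" and q: "q:?W" for V q
  proof -
   have "sec V q = (\<Sum>j | j:J\<and>\<psi> j (pr q) \<noteq> 0. t j q (\<theta> c q (V c q)))"
    unfolding sec_def using thv_at[OF V c(1)] q by simp
   also have "\<dots> = (\<Sum>j\<in>?J. t j q (\<theta> c q (V c q)))"
    by (rule sum.mono_neutral_left[OF U(3)]) (use q in \<open>auto simp: t_def\<close>)
   finally show ?thesis by simp
  qed
  show ?thesis
  proof (rule lmcv_cong_ev[OF manP lmcv_sum[OF manP tj] W])
   show "eventually (%i. \<forall>q\<in>?W. (\<Sum>j\<in>?J. t j q (\<theta> c q (X i c q))) = sec (X i) q) F"
    by (rule eventually_mono[OF X(1)]) (intro ballI e)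
   show "(\<Sum>j\<in>?J. t j q (\<theta> c q (X' c q))) = sec X' q" if "q:?W" for q by (rule e[OF X(2) that])
  qed simp
 qed
 have equiv: "sec V (ra p k) = Adh E (ginv KK k) (sec V p)" if V: "V:aut B" for V p k
 proof -
  have "t j (ra p k) (thv V (ra p k)) = Adh E (ginv KK k) (t j p (thv V p))" if j: "j:J" "\<psi> j (pr p) \<noteq> 0" for j
  proof -
   have "pr p:N (x j)" using J(3)[OF j(1)] J(4)[OF j(1)] j(2) by blast
   then have \<kappa>: "\<kappa> (x j) (ra p k) = mul KK (\<kappa> (x j) p) k" by (rule N(4))
   have "Ad KK (mul KK (\<kappa> (x j) p) k) (- Ad KK (ginv KK k) (thv V p)) = Ad KK (\<kappa> (x j) p) (- thv V p)"
    by (simp add: linear_neg[OF K.Ad_linear] flip: K.Ad_mul) (simp add: K.grp.assoc)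
   moreover have "Adh E (ginv KK (mul KK (\<kappa> (x j) p) k)) w = Adh E (ginv KK k) (Adh E (ginv KK (\<kappa> (x j) p)) w)" for w
    by (simp add: K.grp.inverse_distrib_swap Adh_mul)
   ultimately show ?thesis by (simp add: t_def thv_ract[OF V] \<kappa> linear_scale[OF Adh_linear])
  qed
  then show ?thesis unfolding sec_def proj_ract linear_sum[OF Adh_linear] by (intro sum.cong) auto
 qed
 have inHS: "sec V:HS" if V: "V:aut B" for V unfolding HS_iff
 proof (intro conjI allI)
  have "smooth_at PP lin_atlas (sec V) p" for p
  proof -
   obtain c where c: "c:PP" "p:cdom c" using ex_chart[OF manP] by blast
   have "lmcv PP (bot :: unit filter) p (%_. sec V) (sec V)" by (rule lm[OF _ V c]) (simp_all add: lmcv_const[OF manP lmcv_vf[OF autD[OF V] c]])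
   then show ?thesis by (rule smooth_at_via_lmcv[OF manP])
  qed
  then show "msm PP UNIV (sec V)" using smooth_at_msm_iff[OF open_UNIV manP] by blast
  show "sec V (ra p k) = Adh E (ginv KK k) (sec V p)" for p k by (rule equiv[OF V])
 qed
 have Lq: "Lq (sec V p) = - thv V p" for V p
 proof -
  have "Lq (t j p v) = \<psi> j (pr p)*\<^sub>R(- v)" for j v
   by (simp add: t_def linear_scale[OF q.Lhom_linear] Lq_Adh s0(3) linear_neg[OF K.Ad_linear] flip: K.Ad_mul) (simp add: K.Ad_one)
  then have "Lq (sec V p) = (\<Sum>j | j:J\<and>\<psi> j (pr p) \<noteq> 0. \<psi> j (pr p)*\<^sub>R(- thv V p))"
   by (simp only: sec_def linear_sum[OF q.Lhom_linear])
  also have "\<dots> = (\<Sum>j | j:J\<and>\<psi> j (pr p) \<noteq> 0. \<psi> j (pr p))*\<^sub>R(- thv V p)" by (rule scaleR_sum_left[symmetric])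
  finally show ?thesis by (simp only: J(6) scaleR_one)
 qed
 show thesis
 proof (rule that[of sec, OF inHS])
  show "al (sec V) = V" if V: "V:aut B" "qg B V = 0" for V
  proof (rule aut_eqI[OF al_in[OF inHS[OF V(1)]] V(1)])
   show "qg B (al (sec V)) = qg B V" using V qg_al inHS by simp
   show "\<theta> c p (al (sec V) c p) = \<theta> c p (V c p)" if c: "c:PP" "p:cdom c" for c p
    using thv_at[OF V(1) c] by (simp add: al_at[OF c] th_fundv[OF c] Lq)
  qed
  show "sec (a*\<^sub>RV + b*\<^sub>RW) = a*\<^sub>Rsec V + b*\<^sub>Rsec W" if "V:aut B" "W:aut B" for V W a b
  proof
   fix q
   have "sec (a*\<^sub>RV + b*\<^sub>RW) q = a*\<^sub>Rsec V q + b*\<^sub>Rsec W q"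
    by (simp only: sec_def thv_lin[OF that] linear_add[OF tlin] linear_scale[OF tlin] sum.distrib scaleR_sum_right)
   then show "sec (a*\<^sub>RV + b*\<^sub>RW) q = (a*\<^sub>Rsec V + b*\<^sub>Rsec W) q" by (simp add: scaleR_fun_def)
  qed
  show "sec (%c p. g (pr p)*\<^sub>RV c p) = (%p. g (pr p)*\<^sub>Rsec V p)" if "V:aut B" "msm MM UNIV g" for V and g :: "'m=>real"
   by (simp add: fun_eq_iff sec_def thv_gmult[OF that(2,1)] linear_scale[OF tlin] scaleR_sum_right)
  show "continuous_map GHT NHT sec"
  proof (rule nhI)
   fix V p assume V: "V:topspace GHT"
   show "sec V:HS" using V by (simp add: inHS)
   obtain c where c: "c:PP" "p:cdom c" using ex_chart[OF manP] by blast
   show "lmcv PP (atin GHT V) p sec (sec V)"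
    using eventually_atin_in[OF V continuous_map_id atlas_nonempty[OF manP]] ghD[OF continuous_map_id V c] V
    by (intro lm[OF _ _ c]) (simp_all add: id_def)
  qed
 qed simp_all
qed

end

section \<open>Tensoriality and the conclusions for differential forms\<close>

locale geo_sec = geo B \<theta> E Bs cf s0 for B :: "('m::t2_space, 'a::lcs, 'p::t2_space, 'c::lcs, 'k::t2_space, 'b::lcs) pbundle" and \<theta>
  and E :: "('z::t2_space, 'y::lcs, 'h::t2_space, 'd::lcs, 'k) cext" and Bs :: "'a set" and cf and s0 :: "'b=>'d" +
 fixes sec :: "('p, 'c) vf=>'p=>'d"
 assumes sec_in: "V:aut B==>sec V:hsections B E" and al_sec: "V:aut B==>qg B V = 0==>sec_alpha B E (sec V) = V"
  and sec_lin: "V:aut B==>W:aut B==>sec (a*\<^sub>RV + b*\<^sub>RW) = a*\<^sub>Rsec V + b*\<^sub>Rsec W"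
  and sec_gmult: "V:aut B==>msm (base B) UNIV (g :: 'm=>real) ==>
   sec (%c p. g (proj B p)*\<^sub>RV c p) = (%p. g (proj B p)*\<^sub>Rsec V p)"
  and cm_sec: "continuous_map (cinf_top (total B) (aut B) (%X. X)) (cinf_top (total B) (hsections B E) (%\<xi> _. \<xi>)) sec"
begin

sublocale X: xm_top CC sec by (unfold_locales; unfold CC_simps top_simps)
  (simp_all add: sec_in al_sec sec_lin cm_gh_minus cm_nh_lin cm_z_lin cm_deriv cm_alpha cm_qg cm_incl cm_incl_inverse
   continuous_map_from_subtopology[OF cm_sec] cm_bracket)

text \<open>The connection is a parameter of its own, as two connections have to be compared over
  one fixed section \<open>sec\<close>.\<close>

definition lifts :: "(('p, 'c) chart=>'p=>'c=>'b)=>(('m, 'a) vf list=>'p=>'d)=>bool" where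
 "lifts \<theta>' \<omega>\<longleftrightarrow>connection B \<theta>'\<and>(\<exists>\<Omega>. basic_2form B E \<Omega>\<and>lifts_curvature B E \<theta>' \<Omega>\<and>corresponding_cochain B E \<Omega> \<omega>)"

text \<open>\<alpha>(\<omega>) and the curvature of the horizontal lift are compared under q, where
  both vanish, and under the connection form, where both give minus its curvature.\<close>

lemma lifts_xm:
 assumes "lifts \<theta>' \<omega>" shows "xm_lift CC sec (hlift B \<theta>') \<omega>"
proof -
 obtain \<Omega> where \<Omega>: "connection B \<theta>'" "basic_2form B E \<Omega>" "lifts_curvature B E \<theta>' \<Omega>" "corresponding_cochain B E \<Omega> \<omega>"
  using assms by (auto simp: lifts_def)
 interpret L: pconn B \<theta>' by unfold_locales (rule \<Omega>(1))
 show ?thesis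
 proof (unfold_locales; unfold CC_simps top_simps)
  fix X Y assume X: "X:vfields MM" and Y: "Y:vfields MM"
  show "hlift B \<theta>' (a*\<^sub>RX + b*\<^sub>RY) = a*\<^sub>Rhlift B \<theta>' X + b*\<^sub>Rhlift B \<theta>' Y" for a b
   using X Y by (simp add: L.hlift_add L.hlift_scale vf_scale[OF manM])
  note * = L.hlift_in[OF X] L.hlift_in[OF Y]
  have b: "hlift B \<theta>' (vf_bracket MM X Y):aut B" by (rule L.hlift_in[OF vf_bracket_in[OF manM X Y]])
  have w: "\<omega> [X, Y]:HS"
   using alt_maps_2_in[of \<omega> "vfields MM" HS X Y] \<Omega>(4) X Y by (simp add: corresponding_cochain_def cochains_def)
  show "al (\<omega> [X, Y]) = vf_bracket PP (hlift B \<theta>' X) (hlift B \<theta>' Y) - hlift B \<theta>' (vf_bracket MM X Y)"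
  proof (rule L.aut_eqI[OF al_in[OF w] subspace_diff[OF subspace_aut aut_bracket[OF *] b]])
   show "qg B (al (\<omega> [X, Y])) = qg B (vf_bracket PP (hlift B \<theta>' X) (hlift B \<theta>' Y) - hlift B \<theta>' (vf_bracket MM X Y))"
    using X Y vf_bracket_in[OF manM X Y] by (simp add: qg_al[OF w] X.q_simps[unfolded CC_simps top_simps] aut_bracket * b qg_bracket L.qg_hlift)
   fix c p assume c: "c:PP" "p:cdom c"
   have "\<omega> [X, Y] p = \<Omega> c p (hlift B \<theta>' X c p) (hlift B \<theta>' Y c p)"
    using \<Omega>(4) * c L.qg_hlift[OF X] L.qg_hlift[OF Y] unfolding corresponding_cochain_def by metis
   then have "Lq (\<omega> [X, Y] p) = - \<theta>' c p (vf_bracket PP (hlift B \<theta>' X) (hlift B \<theta>' Y) c p)"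
    using \<Omega>(3) c L.curvature_hlift[OF X Y c] by (simp add: lifts_curvature_def)
   then show "\<theta>' c p (al (\<omega> [X, Y]) c p) = \<theta>' c p ((vf_bracket PP (hlift B \<theta>' X) (hlift B \<theta>' Y) - hlift B \<theta>' (vf_bracket MM X Y)) c p)"
    using L.th_hlift[OF vf_bracket_in[OF manM X Y] c] by (simp add: al_at[OF c] L.th_fundv[OF c] linear_diff[OF L.th_linear[OF c]])
  qed
 qed (use \<Omega>(4) in \<open>simp_all add: L.hlift_in L.qg_hlift corresponding_cochain_def cm_hlift[OF L.pconn_axioms]\<close>)
qed

definition gm :: "('m=>real)=>('p=>'d)=>'p=>'d" where "gm g \<xi> = (%p. g (pr p)*\<^sub>R\<xi> p)"

definition gv :: "('m=>real)=>('m, 'a) vf=>('m, 'a) vf" where "gv g X = (%c m. g m*\<^sub>RX c m)"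

lemma gv_in: "msm MM UNIV g==>X:vfields MM==>gv g X:vfields MM" unfolding gv_def by (rule vf_gmult[OF manM])

lemma gm_in: "msm MM UNIV g==>\<xi>:HS==>gm g \<xi>:HS" unfolding gm_def by (rule HS_gmult)

lemma gm_simps: "gm g (\<xi> + \<eta>) = gm g \<xi> + gm g \<eta>" "gm g (\<xi> - \<eta>) = gm g \<xi> - gm g \<eta>"
 by (simp_all add: gm_def fun_eq_iff algebra_simps)

lemma vf_deriv_lift:
 assumes X: "X:aut B" and g: "msm MM UNIV (g :: 'm=>real)" shows "vf_deriv PP X (%q. g (pr q)) p = vf_deriv MM (qg B X) g (pr p)"
proof -
 obtain c where c: "c:PP" "p:cdom c" using ex_chart[OF manP] by blast
 obtain d where d: "d:MM" "pr p:cdom d" using ex_chart[OF manM] by blast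
 have sg: "smooth_at MM lin_atlas g m" for m by (rule msm_smooth_at[OF manM g open_UNIV UNIV_I])
 have "vf_deriv PP X (%q. g (pr q)) p = tang c lchart (%q. g (pr q)) p (X c p)"
  by (rule vf_deriv_eq[OF manP autD[OF X] smooth_at_comp[OF manP manM manifold_lin proj_at sg] c])
 also have "\<dots> = tang d lchart g (pr p) (tang c d pr p (X c p))" by (rule tang_comp[OF manP manM manifold_lin proj_at sg c d lchart_in]) simp
 finally show ?thesis using vf_deriv_eq[OF manM qg_in[OF X] sg d] qg_at[OF X c d] by simp
qed

lemma act_gm:
 assumes X: "X:aut B" and g: "msm MM UNIV g" and \<xi>: "\<xi>:HS"
 shows "vf_deriv PP X (gm g \<xi>) = gm g (vf_deriv PP X \<xi>) + gm (vf_deriv MM (qg B X) g) \<xi>"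
 using vf_deriv_bilinear_fun[OF manP autD[OF X] msm_lift[OF g] HS_msm[OF \<xi>] bilinear_scaleR continuous_on_scaleR_pair]
 by (simp add: gm_def fun_eq_iff vf_deriv_lift[OF X g] add.commute)

lemma act_gmult:
 assumes X: "X:aut B" and g: "msm MM UNIV (g :: 'm=>real)" and \<xi>: "\<xi>:HS"
 shows "vf_deriv PP (%c p. g (pr p)*\<^sub>RX c p) \<xi> = gm g (vf_deriv PP X \<xi>)"
 using vf_deriv_gmult_field[OF manP autD[OF X] msm_lift[OF g] HS_msm[OF \<xi>]] by (simp add: gm_def fun_eq_iff)

lemma bracket_gv:
 assumes X: "X:vfields MM" and Y: "Y:vfields MM" and g: "msm MM UNIV g"
 shows "vf_bracket MM (gv g X) Y = gv g (vf_bracket MM X Y) - gv (vf_deriv MM Y g) X"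
proof (intro ext)
 fix c m
 show "vf_bracket MM (gv g X) Y c m = (gv g (vf_bracket MM X Y) - gv (vf_deriv MM Y g) X) c m"
 proof (cases "c:MM\<and>m:cdom c")
  case True
  then show ?thesis using vf_bracket_gmult_left[OF manM X Y g, of c m] vf_deriv_eq[OF manM Y msm_smooth_at[OF manM g open_UNIV UNIV_I], of c m]
   by (simp add: gv_def)
 next
  case False
  then show ?thesis using vf_outside[OF manM X, of c m] by (auto simp: vf_bracket_def gv_def)
 qed
qed

lemma incl_gm: "incl (%m. g m*\<^sub>Rf m) = gm g (incl f)" by (simp add: fun_eq_iff incl_def gm_def linear_scale[OF z.Lhom_linear])

lemma lifts_gmult:
 assumes l: "lifts \<theta>' \<omega>" and g: "msm MM UNIV g" and X: "X:vfields MM"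
 shows "!!\<xi>. \<xi>:HS==>vf_deriv PP (hlift B \<theta>' (gv g X)) \<xi> = gm g (vf_deriv PP (hlift B \<theta>' X) \<xi>)"
  and "!!\<xi>. \<xi>:HS==>vf_deriv PP (hlift B \<theta>' X) (gm g \<xi>) = gm g (vf_deriv PP (hlift B \<theta>' X) \<xi>) + gm (vf_deriv MM X g) \<xi>"
  and "!!Y. Y:vfields MM==>\<omega> [gv g X, Y] = gm g (\<omega> [X, Y])"
  and "hlift B \<theta>' (gv g X) = (%c p. g (pr p)*\<^sub>Rhlift B \<theta>' X c p)"
proof -
 obtain \<Omega> where \<Omega>: "connection B \<theta>'" "basic_2form B E \<Omega>" "corresponding_cochain B E \<Omega> \<omega>"
  using l by (auto simp: lifts_def)
 interpret L: pconn B \<theta>' by unfold_locales (rule \<Omega>(1))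
 note hX = L.hlift_in[OF X]
 have h: "hlift B \<theta>' (gv g X) = (%c p. g (pr p)*\<^sub>Rhlift B \<theta>' X c p)" unfolding gv_def by (rule L.hlift_gmult[OF g X])
 show "hlift B \<theta>' (gv g X) = (%c p. g (pr p)*\<^sub>Rhlift B \<theta>' X c p)" by (rule h)
 show "vf_deriv PP (hlift B \<theta>' (gv g X)) \<xi> = gm g (vf_deriv PP (hlift B \<theta>' X) \<xi>)" if "\<xi>:HS" for \<xi>
  unfolding h by (rule act_gmult[OF hX g that])
 show "vf_deriv PP (hlift B \<theta>' X) (gm g \<xi>) = gm g (vf_deriv PP (hlift B \<theta>' X) \<xi>) + gm (vf_deriv MM X g) \<xi>" if "\<xi>:HS" for \<xi>
  using act_gm[OF hX g that] by (simp add: L.qg_hlift[OF X])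
 show "\<omega> [gv g X, Y] = gm g (\<omega> [X, Y])" if Y: "Y:vfields MM" for Y
 proof
  fix p
  obtain c where c: "c:PP" "p:cdom c" using ex_chart[OF manP] by blast
  have w: "\<omega> [X, Y] p = \<Omega> c p (hlift B \<theta>' X c p) (hlift B \<theta>' Y c p)" if X: "X:vfields MM" for X
   using \<Omega>(3) c L.qg_hlift[OF X] L.qg_hlift[OF Y] L.hlift_in[OF X] L.hlift_in[OF Y] unfolding corresponding_cochain_def by metis
  have lin: "linear (%v. \<Omega> c p v w)" for w using \<Omega>(2) c unfolding basic_2form_def by blast
  show "\<omega> [gv g X, Y] p = gm g (\<omega> [X, Y]) p" using w[OF X] w[OF gv_in[OF g X]] linear_scale[OF lin] by (simp add: h gm_def)
 qed
qed

lemma zformsI: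
 assumes "\<eta>:alt_maps r (vfields MM) ZF"
  and "!!g xs i. msm MM UNIV g==>xs:tuples r (vfields MM)==>i < r==>\<eta> (xs[i := gv g (xs ! i)]) = (%m. g m*\<^sub>R\<eta> xs m)"
 shows "\<eta>:zforms r B E" using assms unfolding zforms_def gv_def by (simp add: msm_iff[OF manM open_UNIV])

lemma vf_deriv_msm_g: "X:vfields MM==>msm MM UNIV (g :: 'm=>real)==>msm MM UNIV (vf_deriv MM X g)" by (rule vf_deriv_msm[OF manM])

text \<open>In the first slot the derivatives of g cancel: those from the brackets [g X, Y] and
  [Z, g X] against those from the Leibniz rule for \<sigma>(Y) and \<sigma>(Z). Cyclic symmetry
  carries this to the other slots.\<close>

lemma Dz_form:
 assumes l: "lifts \<theta>' \<omega>" shows "xm_lift.Dz CC (hlift B \<theta>') \<omega>:zforms 3 B E"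
proof -
 interpret L: xm_lift CC sec "hlift B \<theta>'" \<omega> by (rule lifts_xm[OF l])
 note S [simp] = L.\<omega>_in[unfolded CC_simps top_simps] L.brg_in[unfolded CC_simps top_simps] L.sg_in[unfolded CC_simps top_simps]
  X.act_in[unfolded CC_simps top_simps] gv_in gm_in vf_deriv_msm_g X.Nh_sub[unfolded CC_simps top_simps] X.Gq_sub[unfolded CC_simps top_simps]
 note at = L.Dz_at(1,2)[unfolded CC_simps top_simps]
 have w_right: "\<omega> [Y, gv g X] = gm g (\<omega> [Y, X])" if "msm MM UNIV g" "X:vfields MM" "Y:vfields MM" for g :: "'m=>real" and X Y
  using that lifts_gmult(3)[OF l that] L.\<omega>_skew[unfolded CC_simps top_simps, of Y "gv g X"] L.\<omega>_skew[unfolded CC_simps top_simps, of Y X]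
  by (simp add: gm_def fun_eq_iff)
 have w_diff: "\<omega> [X - Y, Z] = \<omega> [X, Z] - \<omega> [Y, Z]" if "X:vfields MM" "Y:vfields MM" "Z:vfields MM" for X Y Z
  using L.\<omega>_left[unfolded CC_simps top_simps, of X Y Z 1 "-1"] that by simp
 have sl: "L.Dz [gv g X, Y, Z] = (%m. g m*\<^sub>RL.Dz [X, Y, Z] m)"
  if g: "msm MM UNIV g" and X: "X:vfields MM" "Y:vfields MM" "Z:vfields MM" for g :: "'m=>real" and X Y Z
 proof (rule incl_inj)
  have b: "vf_bracket MM Z (gv g X) = gv g (vf_bracket MM Z X) + gv (vf_deriv MM Z g) X"
   using bracket_gv[OF X(1,3) g] vf_bracket_skew[OF manM, of Z "gv g X"] vf_bracket_skew[OF manM, of Z X] by (simp add: gv_def fun_eq_iff)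
  have w_add: "\<omega> [X + Y, Z] = \<omega> [X, Z] + \<omega> [Y, Z]" if "X:vfields MM" "Y:vfields MM" "Z:vfields MM" for X Y Z
   using L.\<omega>_left[unfolded CC_simps top_simps, of X Y Z 1 1] that by simp
  have s: "gm (vf_deriv MM Y g) (\<omega> [X, Z]) = - gm (vf_deriv MM Y g) (\<omega> [Z, X])"
   using L.\<omega>_skew[unfolded CC_simps top_simps, of X Z] X by (simp add: gm_def fun_eq_iff)
  show "incl (L.Dz [gv g X, Y, Z]) = incl (%m. g m*\<^sub>RL.Dz [X, Y, Z] m)" using X g
   by (simp add: incl_gm at L.D_def[unfolded CC_simps] cov_d_def lifts_gmult(1-3)[OF l] w_right bracket_gv b w_diff w_add gm_simps s)
 qed
 have cyc: "L.Dz [X, Y, Z] = L.Dz [Y, Z, X]" if "X:vfields MM" "Y:vfields MM" "Z:vfields MM" for X Y Z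
  by (rule incl_inj) (use that L.D_cyc in \<open>simp add: at\<close>)
 show ?thesis
 proof (rule zformsI)
  show "L.Dz:alt_maps 3 (vfields MM) ZF" using L.Dz_alt by simp
  fix g :: "'m=>real" and xs and i :: nat assume g: "msm MM UNIV g" and "xs:tuples 3 (vfields MM)" and i: "i < 3"
  then obtain X Y Z where X: "X:vfields MM" "Y:vfields MM" "Z:vfields MM" "xs = [X, Y, Z]" by (auto simp: tuples3_iff)
  have "i = 0 \<or> i = Suc 0 \<or> i = Suc (Suc 0)" using i by auto
  then show "L.Dz (xs[i := gv g (xs ! i)]) = (%m. g m*\<^sub>RL.Dz xs m)"
  proof (elim disjE)
   assume "i = 0" then show ?thesis using X sl[OF g] by simp
  next
   assume "i = Suc 0"
   then show ?thesis using X g sl[OF g X(2,3,1)] cyc[OF X(1) gv_in[OF g X(2)] X(3)] cyc[OF X(1-3)] by simp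
  next
   assume "i = Suc (Suc 0)"
   then show ?thesis using X g sl[OF g X(3,1,2)] cyc[OF gv_in[OF g X(3)] X(1,2)] cyc[OF X(3,1,2)] by simp
  qed
 qed
qed

text \<open>The derivative of g in \<sigma>(Y).a(g X) cancels against the one in a([g X, Y]). This
  is where the section has to be linear over the functions on M; a merely continuous linear
  splitting would give a primitive that is a cochain but not a form.\<close>

lemma chg_form:
 assumes l: "lifts \<theta>1 \<omega>1" and l': "lifts \<theta>2 \<omega>2"
 shows "cochain2 (vfields MM) (%X Y. X.pz (xm_lift.chg CC sec (hlift B \<theta>1) \<omega>1 (hlift B \<theta>2) \<omega>2 X Y)):zforms 2 B E"
proof -
 interpret L: xm_lift CC sec "hlift B \<theta>1" \<omega>1 by (rule lifts_xm[OF l])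
 interpret L': xm_lift CC sec "hlift B \<theta>2" \<omega>2 by (rule lifts_xm[OF l'])
 note S [simp] = L.\<omega>_in[unfolded CC_simps top_simps] L'.\<omega>_in[unfolded CC_simps top_simps] L.brg_in[unfolded CC_simps top_simps]
  L.sg_in[unfolded CC_simps top_simps] L'.sg_in[unfolded CC_simps top_simps] X.Gh_sub[unfolded CC_simps top_simps]
  X.act_in[unfolded CC_simps top_simps] gv_in gm_in vf_deriv_msm_g sec_in
 let ?c = "L.chg (hlift B \<theta>2) \<omega>2"
 note alt = L.chg_alt[OF L'.xm_lift_axioms, unfolded CC_simps top_simps] and ic = L.inc_chg[OF L'.xm_lift_axioms, unfolded CC_simps top_simps]
 define a where "a X = sec (hlift B \<theta>2 X - hlift B \<theta>1 X)" for X
 have aN [simp]: "a X:HS" if "X:vfields MM" for X using that by (simp add: a_def)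
 have ag: "a (gv g X) = gm g (a X)" if "msm MM UNIV g" "X:vfields MM" for g :: "'m=>real" and X
 proof -
  have "hlift B \<theta>2 (gv g X) - hlift B \<theta>1 (gv g X) = (%c p. g (pr p)*\<^sub>R(hlift B \<theta>2 X - hlift B \<theta>1 X) c p)"
   by (simp add: lifts_gmult(4)[OF l that] lifts_gmult(4)[OF l' that] fun_eq_iff scaleR_diff_right)
  then show ?thesis using that sec_gmult[of "hlift B \<theta>2 X - hlift B \<theta>1 X" g] by (simp add: a_def gm_def)
 qed
 have ad: "a (X - Y) = a X - a Y" if "X:vfields MM" "Y:vfields MM" for X Y
 proof -
  have "hlift B \<theta>2 (X - Y) - hlift B \<theta>1 (X - Y)
   = 1*\<^sub>R(hlift B \<theta>2 X - hlift B \<theta>1 X) + (-1)*\<^sub>R(hlift B \<theta>2 Y - hlift B \<theta>1 Y)"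
   using L.sg_simps(2)[unfolded CC_simps top_simps, OF that] L'.sg_simps(2)[unfolded CC_simps top_simps, OF that] by simp
  then show ?thesis unfolding a_def using that by (simp only: sec_lin S) simp
 qed
 have nbg: "(%p. brH (gm g \<xi> p) (\<eta> p)) = gm g (%p. brH (\<xi> p) (\<eta> p))" for g \<xi> \<eta>
  using bilinear_lmul[OF H.lie_br_bilinear] by (simp add: gm_def)
 have c: "?c X Y = \<omega>2 [X, Y] - \<omega>1 [X, Y] - (vf_deriv PP (hlift B \<theta>1 X) (a Y) - vf_deriv PP (hlift B \<theta>1 Y) (a X)
   - a (vf_bracket MM X Y) + (%p. brH (a X p) (a Y p)))" for X Y by (simp add: L.chg_def a_def)
 have sl: "X.pz (?c (gv g X) Y) = (%m. g m*\<^sub>RX.pz (?c X Y) m)"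
  if g: "msm MM UNIV g" and X: "X:vfields MM" "Y:vfields MM" for g :: "'m=>real" and X Y
 proof (rule incl_inj)
  have "?c (gv g X) Y = gm g (?c X Y)" using X g by (simp add: c lifts_gmult(1-3)[OF l] lifts_gmult(3)[OF l'] ag ad bracket_gv nbg gm_simps)
  then show "incl (X.pz (?c (gv g X) Y)) = incl (%m. g m*\<^sub>RX.pz (?c X Y) m)"
   using ic[OF gv_in[OF g X(1)] X(2)] ic[OF X] by (simp only: incl_gm)
 qed
 let ?w = "cochain2 (vfields MM) (%X Y. X.pz (?c X Y))"
 show ?thesis
 proof (rule zformsI[OF alt])
  fix g :: "'m=>real" and xs and i :: nat assume g: "msm MM UNIV g" and "xs:tuples 2 (vfields MM)" and i: "i < 2"
  then obtain X Y where X: "X:vfields MM" "Y:vfields MM" "xs = [X, Y]" by (auto simp: tuples2_iff)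
  have sk: "?w [U, V] = - ?w [V, U]" if "U:vfields MM" "V:vfields MM" for U V by (rule alt_maps_2_skew[OF alt subspace_vfields[OF manM] that])
  have "i = 0 \<or> i = Suc 0" using i by auto
  then show "?w (xs[i := gv g (xs ! i)]) = (%m. g m*\<^sub>R?w xs m)"
  proof (elim disjE)
   assume "i = 0" then show ?thesis using X g sl[OF g] by simp
  next
   assume "i = Suc 0"
   then show ?thesis using X g sl[OF g X(2,1)] sk[OF X(1) gv_in[OF g X(2)]] sk[OF X(1,2)] by (simp add: fun_eq_iff)
  qed
 qed
qed

lemma zforms_2_diff: "\<eta>:zforms 2 B E==>\<eta>':zforms 2 B E==>\<eta> - \<eta>':zforms 2 B E"
 using alt_maps_diff[OF subspace_ZF] unfolding zforms_def by (auto simp: fun_eq_iff algebra_simps)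

text \<open>\<open>Dz_change\<close> writes the difference of the two cocycles as a differential,
  and \<open>chg_form\<close> says that its primitive is a form.\<close>

lemma derham_class_eq:
 assumes l: "lifts \<theta>1 \<omega>1" and l': "lifts \<theta>2 \<omega>2"
 shows "derham_class 3 B E (xm_lift.Dz CC (hlift B \<theta>2) \<omega>2) = derham_class 3 B E (xm_lift.Dz CC (hlift B \<theta>1) \<omega>1)"
proof -
 interpret L: xm_lift CC sec "hlift B \<theta>1" \<omega>1 by (rule lifts_xm[OF l])
 interpret L': xm_lift CC sec "hlift B \<theta>2" \<omega>2 by (rule lifts_xm[OF l'])
 show ?thesis unfolding derham_class_def
 proof (rule class_eq)
  show "u - v:ext_d (3 - 1) B ` zforms (3 - 1) B E" if "u:ext_d (3 - 1) B ` zforms (3 - 1) B E" "v:ext_d (3 - 1) B ` zforms (3 - 1) B E" for u v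
  proof -
   from that obtain \<eta> \<eta>' where e: "\<eta>:zforms 2 B E" "\<eta>':zforms 2 B E" "u = ext_d 2 B \<eta>" "v = ext_d 2 B \<eta>'" by auto
   have "ext_d 2 B (\<eta> - \<eta>') = u - v"
    using L.ce_d_diff[unfolded CC_simps top_simps, of \<eta> \<eta>'] e by (simp add: ext_d_def zforms_def)
   then show ?thesis using zforms_2_diff[OF e(1,2)] by (metis diff_Suc_1 image_eqI numeral_3_eq_3 numeral_2_eq_2)
  qed
  show "L'.Dz - L.Dz:ext_d (3 - 1) B ` zforms (3 - 1) B E" using chg_form[OF l l'] L.Dz_change[OF L'.xm_lift_axioms] by (simp add: ext_d_def)
 qed
qed

lemma dS_D:
 assumes "lifts \<theta>' \<omega>"
 shows "dS B \<theta>' \<omega> = xm_lift.D CC (hlift B \<theta>') \<omega>" "dSz B E \<theta>' \<omega> = xm_lift.Dz CC (hlift B \<theta>') \<omega>"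
proof -
 interpret L: xm_lift CC sec "hlift B \<theta>'" \<omega> by (rule lifts_xm[OF assms])
 show "dS B \<theta>' \<omega> = L.D" by (simp add: dS_def L.D_def fun_eq_iff)
 then show "dSz B E \<theta>' \<omega> = L.Dz" by (intro ext) (simp add: dSz_def L.Dz_def cochain3_def)
qed

lemma lifts_conclusion:
 assumes l: "lifts \<theta>' \<omega>" shows "!!X Y Z. X:vfields MM==>Y:vfields MM==>Z:vfields MM==>dS B \<theta>' \<omega> X Y Z:inc CC ` ZF"
  and "dSz B E \<theta>' \<omega>:cocycles 3 (g_top CC) (g_br CC) (g_act CC) (z_top CC)"
  and "char_class CC = coh_class 3 (g_top CC) (g_br CC) (g_act CC) (z_top CC) (dSz B E \<theta>' \<omega>)"
  and "dSz B E \<theta>' \<omega>:closed_zforms 3 B E"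
proof -
 interpret L: xm_lift CC sec "hlift B \<theta>'" \<omega> by (rule lifts_xm[OF l])
 note e = dS_D[OF l]
 show "dS B \<theta>' \<omega> X Y Z:inc CC ` ZF" if "X:vfields MM" "Y:vfields MM" "Z:vfields MM" for X Y Z
  unfolding e using L.D_image[of X Y Z] that by simp
 show c: "dSz B E \<theta>' \<omega>:cocycles 3 (g_top CC) (g_br CC) (g_act CC) (z_top CC)" unfolding e by (rule L.Dz_cocycle)
 show "char_class CC = coh_class 3 (g_top CC) (g_br CC) (g_act CC) (z_top CC) (dSz B E \<theta>' \<omega>)" unfolding e by (rule L.char_class_eq)
 show "dSz B E \<theta>' \<omega>:closed_zforms 3 B E" using c Dz_form[OF l] unfolding e by (simp add: closed_zforms_def ext_d_def cocycles_def)
qed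

end

theorem mainTheorem6:
  fixes B :: "('m::t2_space, 'a::lcs, 'p::t2_space, 'c::lcs, 'k::t2_space, 'b::lcs) pbundle"
    and E :: "('z::t2_space, 'y::lcs, 'h::t2_space, 'd::lcs, 'k) cext"
    and \<theta> :: "('p, 'c) chart \<Rightarrow> 'p \<Rightarrow> 'c \<Rightarrow> 'b"
    and \<Omega> :: "('p, 'c) chart \<Rightarrow> 'p \<Rightarrow> 'c \<Rightarrow> 'c \<Rightarrow> 'd"
    and \<omega> :: "('m, 'a) vf list \<Rightarrow> 'p \<Rightarrow> 'd"
  assumes "\<exists>F::'a set. finite F \<and> span F = UNIV"
    and "paracompact_space (euclidean :: 'm topology)"
    and "principal_bundle B"
    and "central_extension E (sgrp B)"
    and "top_split_ext E (sgrp B)"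
    and "connection B \<theta>"
    and "basic_2form B E \<Omega>"
    and "lifts_curvature B E \<theta> \<Omega>"
    and "corresponding_cochain B E \<Omega> \<omega>"
  shows "let C = assoc_xmod B E in
      (\<forall>X0\<in>vfields (base B). \<forall>X1\<in>vfields (base B). \<forall>X2\<in>vfields (base B).
            dS B \<theta> \<omega> X0 X1 X2 \<in> inc C ` zfuns B E)
    \<and> dSz B E \<theta> \<omega> \<in> cocycles 3 (g_top C) (g_br C) (g_act C) (z_top C)
    \<and> char_class C = coh_class 3 (g_top C) (g_br C) (g_act C) (z_top C) (dSz B E \<theta> \<omega>)
    \<and> dSz B E \<theta> \<omega> \<in> closed_zforms 3 B E
    \<and> (\<forall>\<theta>' \<Omega>' \<omega>'. connection B \<theta>' \<and> basic_2form B E \<Omega>' \<and> lifts_curvature B E \<theta>' \<Omega>'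
          \<and> corresponding_cochain B E \<Omega>' \<omega>'
          \<longrightarrow> derham_class 3 B E (dSz B E \<theta>' \<omega>') = derham_class 3 B E (dSz B E \<theta> \<omega>))"
proof -
 obtain Bs and cf :: "'a=>'a=>real" where fc: "fin_coords Bs cf" by (rule fin_coords_exist[OF assms(1)])
 obtain s0 where s0: "linear s0" "continuous_on UNIV s0" "!!x. Lhom (hgrp E) (sgrp B) (hquot E) (s0 x) = x"
  using assms(5) unfolding top_split_ext_def by blast
 \<comment> \<open>\<Omega> is horizontal, hence vanishes on a vertical v, and the curvature is
   \<open>Lq\<close> of \<Omega>. This is the horizontality that \<open>geo\<close> asks
   for.\<close>
 have "curvature B \<theta> c p v w = 0" if "c:total B" "p:cdom c" "d:base B" "proj B p:cdom d" "tang c d (proj B) p v = 0" for c p d v w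
 proof -
  interpret pext B E by (intro pext.intro pbun.intro pext_axioms.intro assms)
  have "\<Omega> c p v w = 0" using assms(7) that unfolding basic_2form_def by blast
  then show ?thesis using assms(8) that linear_0[OF q.Lhom_linear] unfolding lifts_curvature_def by metis
 qed
 then interpret geo B \<theta> E Bs cf s0
  by (intro geo.intro pconn.intro pbun.intro pext.intro pconn_axioms.intro pext_axioms.intro geo_axioms.intro assms fc s0)
 obtain sec where "geo_sec B \<theta> E Bs cf s0 sec"
  by (rule section_exists) (rule that, intro geo_sec.intro geo_axioms geo_sec_axioms.intro; assumption)
 then interpret geo_sec B \<theta> E Bs cf s0 sec .
 have l: "lifts \<theta> \<omega>" using assms by (auto simp: lifts_def)
 \<comment> \<open>The crossed module and the section \<open>sec\<close>, although built with
   \<theta>, serve the second connection as well.\<close>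
 have "derham_class 3 B E (dSz B E \<theta>' \<omega>') = derham_class 3 B E (dSz B E \<theta> \<omega>)" if "lifts \<theta>' \<omega>'" for \<theta>' \<omega>'
  using derham_class_eq[OF l that] dS_D(2)[OF l] dS_D(2)[OF that] by simp
 then show ?thesis unfolding Let_def using lifts_conclusion[OF l] by (auto simp: lifts_def)
qed

end
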